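(* Let $v$ be a weak solution (in the sense recalled in the context) to the three-dimensional primitive equations on $\mathbb{T}^3$ with $v(0)=v_0\in\mathcal{H}$, and suppose that $$v\in L^\beta\big(0,T;\dot{B}^{-1/p}_{p,\infty,z}L^\infty_{\mathrm{H}}\big)\cap L^\gamma\big(0,T;\dot{B}^{2/\gamma}_{2,\infty,z}L^\infty_{\mathrm{H}}\big)$$ for some $T=T_v>0$, where $$\frac{2}{\beta}+\frac{2}{p}=1\qquad(2<p,\beta<\infty),$$ and for some $2<\gamma<\infty$. Then $v$ satisfies the energy equality $$\frac12\|v(t)\|_{L^2}^2+\int_0^t\|\nabla v(\tau)\|_{L^2}^2\,d\tau=\frac12\|v_0\|_{L^2}^2$$ for $0<t\le T$, where $L^2=L^2(\mathbb{T}^3)$.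
   Context: Torus and coordinates. $\mathbb{T}=\mathbb{R}/(2\pi\mathbb{Z})$; points of $\mathbb{T}^3$ are written $x=(x_{\mathrm{H}},z)$ with $x_{\mathrm{H}}=(x_1,x_2)\in\mathbb{T}^2$, $z\in\mathbb{T}$. $\nabla=(\partial_{x_1},\partial_{x_2},\partial_z)$, $\nabla_{\mathrm{H}}=(\partial_{x_1},\partial_{x_2})$, and $\mathrm{div}_{\mathrm{H}}$ is the two-dimensional horizontal divergence. Three-dimensional primitive equations: $\partial_t v+(u\cdot\nabla)v-\Delta v+\nabla_{\mathrm{H}}\Pi=0$, $\partial_z\Pi=0$, $\mathrm{div}\,u=0$ on $\mathbb{T}^3\times(0,\infty)$, where $v$ is the $\mathbb{R}^2$-valued horizontal velocity, $w$ the scalar vertical velocity, $u=(v,w)$, $\Pi$ the scalar pressure. The vertical velocity is determined by $w(x_{\mathrm{H}},z)=\int_z^\pi\mathrm{div}_{\mathrm{H}}v(x_{\mathrm{H}},\zeta)\,d\zeta$. Hydrostatic solenoidal space: $\mathcal{H}=\{v\in L^2(\mathbb{T}^3;\mathbb{R}^2): v \text{ is even in } z \text{ and } \mathrm{div}_{\mathrm{H}}\int_{-\pi}^{\pi}v(x_{\mathrm{H}},z)\,dz=0\}$. Weak solution. An $\mathbb{R}^2$-valued $v$ on $\mathbb{T}^3\times(0,\infty)$ is a weak solution with initial value $v(0)=v_0$ if (i) $v\in C_w([0,\infty);\mathcal{H})\cap L^2_{\mathrm{loc}}([0,\infty);H^1(\mathbb{T}^3)\cap\mathcal{H})$, where $C_w$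 denotes weak continuity in time; and (ii) for every $\phi\in C([0,\infty);C^1(\mathbb{T}^3)\cap\mathcal{H})\cap C^1([0,\infty);C(\mathbb{T}^3))$ compactly supported in time, $$-\int_0^\infty\!\!\int_{\mathbb{T}^3}v\cdot\partial_\tau\phi\,dx\,d\tau+\int_0^\infty\!\!\int_{\mathbb{T}^3}\nabla v:\nabla\phi\,dx\,d\tau-\int_0^\infty\!\!\int_{\mathbb{T}^3}(u\otimes v):\nabla\phi\,dx\,d\tau=(v_0,\phi(0)),$$ where $A:B$ is the entrywise inner product of $3\times2$ matrices (so $(u\otimes v):\nabla\phi=\sum_{i,k}u_i v^k\partial_i\phi^k$), and $(\cdot,\cdot)$ is the $L^2(\mathbb{T}^3)$ inner product. Anisotropic toroidal Besov spaces. Fix a smooth radially symmetric $\chi\in C_0^\infty(\mathbb{R})$ with $\chi(\xi)=1$ for $|\xi|\le1/2$ and $\chi(\xi)=0$ for $|\xi|\ge1$, and set $\rho(\xi)=\chi(\xi/2)-\chi(\xi)$, $\rho_j(\xi)=\rho(2^{-j}\xi)$ and $\varphi_j(z)=\sum_{k\in\mathbb{Z}}\rho_j(k)e^{ikz}$ for $j\in\mathbb{Z}$. Let $(\varphi_j*f)(x_{\mathrm{H}},z)=\int_{-\pi}^{\pi}\varphi_j(z-\zeta)f(x_{\mathrm{H}},\zeta)\,d\zeta$ be the convolution in $z$. For $s\in\mathbb{R}$, $1\le p,q\le\infty$, the space $\dot{B}^{s}_{p,q,z}L^\infty_{\mathrm{H}}$ is given by the norm $$\|f\|_{\dot{B}^{s}_{p,q,z}L^\infty_{\mathrm{H}}}=\Big(\sum_{j\in\mathbb{Z}}\big(2^{sj}\|\varphi_j*f\|_{L^p_zL^\infty_{\mathrm{H}}}\big)^q\Big)^{1/q}$$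 (supremum over $j$ if $q=\infty$), where $\|g\|_{L^p_zL^\infty_{\mathrm{H}}}=\big\|\,\|g(\cdot,z)\|_{L^\infty(\mathbb{T}^{2})}\big\|_{L^p_z(\mathbb{T})}$. Since $\rho_j(0)=0$, the $z$-mean of $f$ does not enter this norm. *)

theory Defs
  imports "HOL-Analysis.Analysis" "HOL-Probability.Essential_Supremum"
begin

section \<open>Function spaces on the torus\<close>

text \<open>
  Functions on the torus of an arbitrary Euclidean space (period \<open>2 * pi\<close> in each coordinate) are
  periodic functions on the whole space, integrated over the fundamental cube. Elements of Lebesgue
  spaces are Borel representatives, so conditions on them are imposed almost everywhere or under
  an integral. The three-dimensional torus has coordinates \<open>(xH, z)\<close> in \<open>(real^2) \<times> real\<close>; its
  basis vectors are \<open>(axis k 1, 0)\<close> and \<open>(0, 1)\<close>.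
\<close>

type_synonym R2 = "real^2"
type_synonym R3 = "(real^2) \<times> real"

definition torus :: "'a::euclidean_space measure" where
  "torus = restrict_space lborel (cbox (- (pi *\<^sub>R One)) (pi *\<^sub>R One))"

definition periodic :: "('a::euclidean_space \<Rightarrow> 'b) \<Rightarrow> bool" where
  "periodic f \<longleftrightarrow> (\<forall>x. \<forall>b\<in>Basis. f (x + (2 * pi) *\<^sub>R b) = f x)"

definition pd :: "'a \<Rightarrow> ('a::euclidean_space \<Rightarrow> 'b::real_normed_vector) \<Rightarrow> 'a \<Rightarrow> 'b" where
  "pd b f x = frechet_derivative f (at x) b"

definition C1_torus :: "('a::euclidean_space \<Rightarrow> 'b::real_normed_vector) set" where
  "C1_torus = {f. periodic f \<and> (\<forall>x. f differentiable (at x)) \<and>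
     (\<forall>b\<in>Basis. continuous_on UNIV (pd b f))}"

text \<open>Smoothness: every iterated partial derivative exists and is again Frechet differentiable.\<close>

definition smooth :: "('a::euclidean_space \<Rightarrow> 'b::real_normed_vector) \<Rightarrow> bool" where
  "smooth f \<longleftrightarrow> (\<forall>bs. set bs \<subseteq> Basis \<longrightarrow> (\<forall>x. foldr pd bs f differentiable (at x)))"

definition L2 :: "('a::euclidean_space \<Rightarrow> 'b::euclidean_space) set" where
  "L2 = {f. periodic f \<and> f \<in> borel_measurable borel \<and> integrable torus (\<lambda>x. (norm (f x))\<^sup>2)}"

definition L2_inner :: "('a::euclidean_space \<Rightarrow> 'b::euclidean_space) \<Rightarrow> ('a \<Rightarrow> 'b) \<Rightarrow> real" where
  "L2_inner f g = (LINT x|torus. f x \<bullet> g x)"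

definition L2_norm :: "('a::euclidean_space \<Rightarrow> 'b::euclidean_space) \<Rightarrow> real" where
  "L2_norm f = sqrt (LINT x|torus. (norm (f x))\<^sup>2)"

definition is_weak_pd ::
  "'a \<Rightarrow> ('a::euclidean_space \<Rightarrow> 'b::euclidean_space) \<Rightarrow> ('a \<Rightarrow> 'b) \<Rightarrow> bool" where
  "is_weak_pd b f g \<longleftrightarrow> (\<forall>\<psi>::'a \<Rightarrow> real. smooth \<psi> \<and> periodic \<psi> \<longrightarrow>
     (LINT x|torus. pd b \<psi> x *\<^sub>R f x) = - (LINT x|torus. \<psi> x *\<^sub>R g x))"

definition H1 :: "('a::euclidean_space \<Rightarrow> 'b::euclidean_space) set" where
  "H1 = {f \<in> L2. \<forall>b\<in>Basis. \<exists>g\<in>L2. is_weak_pd b f g}"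

text \<open>A representative of the weak derivative; meaningful for functions in \<^term>\<open>H1\<close>, and then
  unique up to null sets.\<close>

definition weak_pd ::
  "'a \<Rightarrow> ('a::euclidean_space \<Rightarrow> 'b::euclidean_space) \<Rightarrow> 'a \<Rightarrow> 'b" where
  "weak_pd b f = (SOME g. g \<in> L2 \<and> is_weak_pd b f g)"

definition grad_L2_norm :: "('a::euclidean_space \<Rightarrow> 'b::euclidean_space) \<Rightarrow> real" where
  "grad_L2_norm f = sqrt (\<Sum>b\<in>Basis. (L2_norm (weak_pd b f))\<^sup>2)"

definition H1_norm :: "('a::euclidean_space \<Rightarrow> 'b::euclidean_space) \<Rightarrow> real" where
  "H1_norm f = sqrt ((L2_norm f)\<^sup>2 + (grad_L2_norm f)\<^sup>2)"

section \<open>Weak solutions of the primitive equations\<close>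

definition weak_div_free :: "('a::euclidean_space \<Rightarrow> 'a) \<Rightarrow> bool" where
  "weak_div_free F \<longleftrightarrow> (\<forall>\<psi>::'a \<Rightarrow> real. smooth \<psi> \<and> periodic \<psi> \<longrightarrow>
     (LINT x|torus. (\<Sum>b\<in>Basis. (F x \<bullet> b) * pd b \<psi> x)) = 0)"

definition hydro_sol :: "(R3 \<Rightarrow> R2) set" where
  "hydro_sol = {v \<in> L2. (AE x in torus. v (fst x, - snd x) = v x) \<and>
     weak_div_free (\<lambda>xH. LINT z|torus. v (xH, z))}"

definition div_H :: "(R3 \<Rightarrow> R2) \<Rightarrow> R3 \<Rightarrow> real" where
  "div_H v x = (\<Sum>k\<in>UNIV. weak_pd (axis k 1, 0) v x $ k)"

text \<open>Only evaluated for \<open>x\<close> in the fundamental cube, that is for \<open>- pi \<le> snd x \<le> pi\<close>.\<close>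

definition vertical_velocity :: "(R3 \<Rightarrow> R2) \<Rightarrow> R3 \<Rightarrow> real" where
  "vertical_velocity v x = (LINT \<zeta>:{snd x..pi}|lborel. div_H v (fst x, \<zeta>))"

definition velocity :: "(R3 \<Rightarrow> R2) \<Rightarrow> R3 \<Rightarrow> R3" where
  "velocity v x = (v x, vertical_velocity v x)"

definition sup_continuous_curve ::
  "(real \<Rightarrow> 'a::topological_space \<Rightarrow> 'b::real_normed_vector) \<Rightarrow> bool" where
  "sup_continuous_curve \<phi> \<longleftrightarrow> (\<forall>t\<ge>0. continuous_on UNIV (\<phi> t) \<and>
     uniform_limit UNIV \<phi> (\<phi> t) (at t within {0..}))"

definition time_deriv :: "(real \<Rightarrow> 'a \<Rightarrow> 'b::real_normed_vector) \<Rightarrow> real \<Rightarrow> 'a \<Rightarrow> 'b" where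
  "time_deriv \<phi> t x = vector_derivative (\<lambda>s. \<phi> s x) (at t within {0..})"

definition test_function :: "(real \<Rightarrow> R3 \<Rightarrow> R2) \<Rightarrow> bool" where
  "test_function \<phi> \<longleftrightarrow>
     (\<forall>t\<ge>0. \<phi> t \<in> C1_torus \<inter> hydro_sol) \<and>
     sup_continuous_curve \<phi> \<and>
     (\<forall>b\<in>Basis. sup_continuous_curve (\<lambda>t. pd b (\<phi> t))) \<and>
     (\<forall>t\<ge>0. uniform_limit UNIV (\<lambda>s x. (\<phi> s x - \<phi> t x) /\<^sub>R (s - t)) (time_deriv \<phi> t)
        (at t within {0..})) \<and>
     sup_continuous_curve (time_deriv \<phi>) \<and>
     (\<exists>R. \<forall>t\<ge>R. \<forall>x. \<phi> t x = 0)"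

text \<open>
  Time integrals use the complete measure \<^term>\<open>lebesgue\<close>, since \<open>v t\<close> lies in \<^term>\<open>H1\<close> (and hence
  \<^term>\<open>weak_pd\<close> is meaningful) only for almost every \<open>t\<close>. Joint Borel measurability is no
  restriction on the weakly continuous curve of classes: mollifying each \<open>v t\<close> in space and passing
  to the (upper) limit gives such representatives for every \<open>t\<close>.
\<close>

definition weak_solution :: "(real \<Rightarrow> R3 \<Rightarrow> R2) \<Rightarrow> (R3 \<Rightarrow> R2) \<Rightarrow> bool" where
  "weak_solution v v0 \<longleftrightarrow>
     (\<lambda>(t, x). v t x) \<in> borel_measurable (restrict_space borel ({0..} \<times> UNIV)) \<and>
     (\<forall>t\<ge>0. v t \<in> hydro_sol) \<and>
     (\<forall>g\<in>hydro_sol. continuous_on {0..} (\<lambda>t. L2_inner (v t) g)) \<and>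
     (AE t in lebesgue_on {0..}. v t \<in> H1) \<and>
     (\<forall>T. set_integrable lebesgue {0..T} (\<lambda>t. (H1_norm (v t))\<^sup>2)) \<and>
     (AE x in torus. v 0 x = v0 x) \<and>
     (\<forall>\<phi>. test_function \<phi> \<longrightarrow>
        - (LINT \<tau>:{0..}|lebesgue. LINT x|torus. v \<tau> x \<bullet> time_deriv \<phi> \<tau> x)
        + (LINT \<tau>:{0..}|lebesgue. LINT x|torus.
             (\<Sum>b\<in>Basis. weak_pd b (v \<tau>) x \<bullet> pd b (\<phi> \<tau>) x))
        - (LINT \<tau>:{0..}|lebesgue. LINT x|torus.
             (\<Sum>b\<in>Basis. \<Sum>k\<in>UNIV. (velocity (v \<tau>) x \<bullet> b) * v \<tau> x $ k * pd b (\<phi> \<tau>) x $ k))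
        = L2_inner v0 (\<phi> 0))"

section \<open>Anisotropic Besov norms\<close>

definition ennpowr :: "ennreal \<Rightarrow> real \<Rightarrow> ennreal" where
  "ennpowr x a = (if x = \<infinity> then \<infinity> else ennreal (enn2real x powr a))"

text \<open>Lebesgue norms of non-negative functions for exponents in \<open>[1, \<infinity>]\<close>; as for \<^const>\<open>esssup\<close>,
  the value is infinite for non-measurable functions. Over a counting measure these are the
  sequence norms.\<close>

definition Lp_norm :: "ennreal \<Rightarrow> 'a measure \<Rightarrow> ('a \<Rightarrow> ennreal) \<Rightarrow> ennreal" where
  "Lp_norm p M f =
     (if f \<notin> borel_measurable M then \<infinity>
      else if p = \<infinity> then esssup M f
      else ennpowr (\<integral>\<^sup>+x. ennpowr (f x) (enn2real p) \<partial>M) (1 / enn2real p))"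

definition LP_cutoff :: "(real \<Rightarrow> real) \<Rightarrow> bool" where
  "LP_cutoff chi \<longleftrightarrow> smooth chi \<and> (\<forall>\<xi>. chi (- \<xi>) = chi \<xi>) \<and>
     (\<forall>\<xi>. \<bar>\<xi>\<bar> \<le> 1/2 \<longrightarrow> chi \<xi> = 1) \<and> (\<forall>\<xi>. \<bar>\<xi>\<bar> \<ge> 1 \<longrightarrow> chi \<xi> = 0)"

definition LP_rho :: "(real \<Rightarrow> real) \<Rightarrow> int \<Rightarrow> real \<Rightarrow> real" where
  "LP_rho chi j \<xi> = (let \<rho> = (\<lambda>\<eta>. chi (\<eta> / 2) - chi \<eta>) in \<rho> (2 powi (- j) * \<xi>))"

text \<open>For an even cut-off the series (with finitely many non-zero terms) is real-valued, so taking
  the real part only changes the type.\<close>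

definition LP_kernel :: "(real \<Rightarrow> real) \<Rightarrow> int \<Rightarrow> real \<Rightarrow> real" where
  "LP_kernel chi j z =
     Re (\<Sum>\<^sub>\<infinity>k\<in>(UNIV::int set). of_real (LP_rho chi j (of_int k)) * exp (\<i> * of_int k * of_real z))"

definition conv_z :: "(real \<Rightarrow> real) \<Rightarrow> (R3 \<Rightarrow> R2) \<Rightarrow> R3 \<Rightarrow> R2" where
  "conv_z h f x = (LINT \<zeta>|torus. h (snd x - \<zeta>) *\<^sub>R f (fst x, \<zeta>))"

definition Lpz_LinfH_norm :: "ennreal \<Rightarrow> (R3 \<Rightarrow> R2) \<Rightarrow> ennreal" where
  "Lpz_LinfH_norm p g =
     Lp_norm p torus (\<lambda>z. Lp_norm \<infinity> torus (\<lambda>xH. ennreal (norm (g (xH, z)))))"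

definition besov_norm ::
  "(real \<Rightarrow> real) \<Rightarrow> real \<Rightarrow> ennreal \<Rightarrow> ennreal \<Rightarrow> (R3 \<Rightarrow> R2) \<Rightarrow> ennreal" where
  "besov_norm chi s p q f = Lp_norm q (count_space (UNIV::int set))
     (\<lambda>j. ennreal (2 powr (s * of_int j)) * Lpz_LinfH_norm p (conv_z (LP_kernel chi j) f))"

definition in_L_besov ::
  "(real \<Rightarrow> real) \<Rightarrow> real \<Rightarrow> real \<Rightarrow> real \<Rightarrow> ennreal \<Rightarrow> ennreal \<Rightarrow> (real \<Rightarrow> R3 \<Rightarrow> R2) \<Rightarrow> bool" where
  "in_L_besov chi \<beta> T s p q v \<longleftrightarrow>
     Lp_norm (ennreal \<beta>) (lebesgue_on {0<..<T}) (\<lambda>t. besov_norm chi s p q (v t)) < \<infinity>"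

end

theory Submission
  imports Defs "HOL-Probability.Probability_Measure"
begin

text \<open>
  The equation is tested with the solution itself, regularised in space only: by a trigonometric
  mollifier, whose range is finite-dimensional, so that the energy balance in time reduces to
  finitely many continuous coefficients, and by an average over vertical segments of half-length \<open>h\<close>.
  When the mollification is removed, the vertical derivative of the segment average is a symmetric
  difference quotient, and integrating by parts in \<open>z\<close> turns the vertical flux into the average of
  the horizontal divergence against \<open>v(x) v(x + h e)\<close>. Hence the total flux is bounded uniformly
  in \<open>h\<close> by the fourth power of the \<open>L4\<close> norm plus the dissipation, and it vanishes as \<open>h\<close> tends to \<open>0\<close>.

  The \<open>L4\<close> norm is integrable in time: Littlewood--Paley blocks in \<open>z\<close> are interpolated between the
  Besov and the \<open>H1\<close> bound, the vertical mean obeys Ladyzhenskaya's inequality on the two-dimensional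
  torus, and the remaining powers of the energy are bounded by the uniform boundedness principle.
\<close>

text \<open>The vertical velocity w costs a full horizontal derivative and is only square
  integrable, like the vertical derivative of v; with v merely in L4 the product of w, v and that
  derivative is in general not integrable. The segment average replaces the derivative by (v(x + he)
  - v(x - he)) / (2h). Translating one of the two terms moves the difference onto w, and w(x) - w(x
  + he) is h times a mean of the horizontal divergence, which cancels 1/h. This fixes the order of
  the limits: the trigonometric mollifier goes first, at fixed h, where a bound like 1/h is
  harmless. In the limit the horizontal flux cancels against half the integral of the divergence
  times |v|^2, by the product rule. The mollifier has a kernel of the form sum of F_i(x) F_i(y).
  Single fields F_i e_k need not be solenoidal, so the equation says nothing about their
  coefficients; continuity in time is drawn from the combinations that occur in the mollified
  solution. Vertical frequency zero does not enter the Besov norm; hence the separate treatment of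
  the mean.\<close>

lemmas LB_integral_sum = Bochner_Integration.integral_sum
  and LB_integral_add = Bochner_Integration.integral_add
  and LB_integral_diff = Bochner_Integration.integral_diff
  and LB_integral_cong = Bochner_Integration.integral_cong
  and LB_integrable_sum = Bochner_Integration.integrable_sum
  and LB_integrable_add = Bochner_Integration.integrable_add
  and LB_integrable_diff = Bochner_Integration.integrable_diff
  and LB_integrable_bound = Bochner_Integration.integrable_bound

notation scaleR (infixr "*R" 75)

abbreviation Borel :: "('a::topological_space => 'b::topological_space) set" where
"Borel == borel_measurable borel"

abbreviation nn_torus :: "('a::euclidean_space => ennreal) => ennreal" (binder "\<oint>" 10) where
"nn_torus f == nn_integral torus f"

abbreviation seq_lim :: "(nat => 'a::topological_space) => 'a => bool" ("((_)/ ----> (_))" [60, 60] 60) where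
"f ----> l == (f \<longlongrightarrow> l) sequentially"

section \<open>Integration of periodic functions over the torus\<close>

definition cell :: "'a::euclidean_space set" where
 "cell = cbox (- (pi *R One)) (pi *R One)"

lemma mem_cell: "x : cell \<longleftrightarrow> (ALL b:Basis. - pi <= x \<bullet> b & x \<bullet> b <= pi)"
 by (simp add: cell_def mem_box)

lemma cell_borel [measurable]: "cell : sets borel"
 by (simp add: cell_def)

lemma torus_cell: "torus = restrict_space lborel cell"
 by (simp add: torus_def cell_def)

lemma space_torus [simp]: "space torus = cell"
 by (simp add: torus_cell space_restrict_space)

lemma cell_sets_torus [simp]: "cell : sets torus"
 using sets.top[of torus] by simp

lemma measurable_torus [measurable (raw)]: "f : measurable borel N ==> f : measurable torus N"
 unfolding torus_cell by (rule measurable_restrict_space1) simp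

lemma measurable_torus_fst [measurable]: "fst : measurable (torus \<Otimes>\<^sub>M N) borel"
 using measurable_compose[OF measurable_fst, of "%x. x" torus borel N] by (simp add: measurable_torus)

lemma measurable_torus_snd [measurable]: "snd : measurable (N \<Otimes>\<^sub>M torus) borel"
 using measurable_compose[OF measurable_snd, of "%x. x" torus borel N] by (simp add: measurable_torus)

lemma borel_measurable_fst_borel [measurable]:
 "(fst :: 'a::euclidean_space \<times> 'b::euclidean_space => 'a) : Borel"
 by (intro borel_measurable_continuous_onI continuous_intros)

lemma borel_measurable_snd_borel [measurable]:
 "(snd :: 'a::euclidean_space \<times> 'b::euclidean_space => 'b) : Borel"
 by (intro borel_measurable_continuous_onI continuous_intros)

lemma emeasure_cell_less_top: "emeasure lborel cell < \<infinity>"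
 by (intro emeasure_bounded_finite) (simp add: cell_def)

lemma finite_measure_torus: "finite_measure torus"
 unfolding torus_cell
 using emeasure_cell_less_top
 by (intro finite_measureI) (simp add: emeasure_restrict_space space_restrict_space less_top[symmetric])

lemma nn_integral_torus:
 "(\<oint>x. f x) = (\<integral>\<^sup>+x. f x * indicator cell x \<partial>lborel)"
 unfolding torus_cell by (subst nn_integral_restrict_space) simp_all

lemma integral_torus:
 fixes f :: "'a::euclidean_space => 'b::euclidean_space"
 shows "(LINT x|torus. f x) = (LINT x|lborel. indicator cell x *R f x)"
 unfolding torus_cell by (subst integral_restrict_space) simp_all

lemma integrable_torus:
 fixes f :: "'a::euclidean_space => 'b::euclidean_space"
 shows "integrable torus f \<longleftrightarrow> integrable lborel (%x. indicator cell x *R f x)"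
 unfolding torus_cell by (subst integrable_restrict_space) simp_all

lemma integrable_torus_const [simp, intro]: "integrable torus (%_::'a::euclidean_space. c::'b::euclidean_space)"
 using finite_measure.integrable_const[OF finite_measure_torus] .

lemma periodicD: "periodic f ==> b : Basis ==> f (x + (2 * pi) *R b) = f x"
 by (simp add: periodic_def)

lemma periodic_nat:
 assumes "periodic f" "b : Basis"
 shows "f (x + (2 * pi * real m) *R b) = f x"
proof (induction m arbitrary: x)
 case (Suc m)
 have "x + (2 * pi * real (Suc m)) *R b = (x + (2 * pi * real m) *R b) + (2 * pi) *R b"
  by (simp add: algebra_simps)
 then show ?case using periodicD[OF assms] Suc by metis
qed simp

lemma periodic_int:
 assumes "periodic f" "b : Basis"
 shows "f (x + (2 * pi * of_int m) *R b) = f x"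
proof (cases "m >= 0")
 case True
 then show ?thesis using periodic_nat[OF assms, of x "nat m"] by simp
next
 case False
 then show ?thesis
  using periodic_nat[OF assms, of "x + (2 * pi * of_int m) *R b" "nat (- m)"] by simp
qed

lemma periodic_translate: "periodic f ==> periodic (%x. f (x + y))"
 unfolding periodic_def by (metis (no_types, lifting) add.assoc add.commute)

lemma periodic_compose: "periodic f ==> periodic (%x. g (f x))"
 by (simp add: periodic_def)

lemma periodic_compose2: "periodic f ==> periodic h ==> periodic (%x. g (f x) (h x))"
 by (simp add: periodic_def)

lemma periodic_const: "periodic (%x. c)"
 by (simp add: periodic_def)

lemma nn_integral_lborel_translate:
 assumes [measurable]: "f : Borel"
 shows "(\<integral>\<^sup>+x. f (x + y) \<partial>lborel) = (\<integral>\<^sup>+x. f x \<partial>(lborel::'a::euclidean_space measure))"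
 by (subst (2) lborel_distr_plus[symmetric, of y], subst nn_integral_distr)
  (simp_all add: add.commute)

lemma AE_lborel_inner_neq:
 fixes b :: "'a::euclidean_space"
 assumes "b : Basis"
 shows "AE x in lborel. x \<bullet> b ~= c"
proof -
 have "negligible {x::'a. b \<bullet> x = c}"
  using assms by (intro negligible_hyperplane) auto
 then have "{x::'a. b \<bullet> x = c} : null_sets lborel"
  by (subst (asm) negligible_iff_null_sets) (simp add: null_sets_completion_iff closed_hyperplane)
 then have "AE x in lborel. x \<notin> {x::'a. b \<bullet> x = c}"
  by (rule AE_not_in)
 then show ?thesis by (auto simp: inner_commute)
qed

text \<open>Modulo full periods the shift is some r in [0, 2 pi]. The shifted cube then overlaps
  \<open>cell\<close> except for a slab beyond the face at pi, and moving this slab back by one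
  period fills exactly the missing slab at - pi. The faces are null sets, so the rearrangement is
  claimed almost everywhere.\<close>

lemma nn_integral_torus_translate_Basis:
 fixes f :: "'a::euclidean_space => ennreal"
 assumes [measurable]: "f : Borel" and per: "periodic f" and b: "b : Basis"
 shows "(\<oint>x. f (x + s *R b)) = (\<oint>x. f x)"
proof -
 define m where "m = \<lfloor>s / (2 * pi)\<rfloor>"
 define r where "r = s - 2 * pi * of_int m"
 have "of_int m <= s / (2 * pi)" "s / (2 * pi) < of_int m + 1"
  unfolding m_def by (simp_all add: of_int_floor_le)
 then have r: "0 <= r" "r <= 2 * pi"
  unfolding r_def by (simp_all add: field_simps)
 have shift: "f (x + s *R b) = f (x + r *R b)" for x
 proof -
  have "x + s *R b = (x + r *R b) + (2 * pi * of_int m) *R b"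
   by (simp add: r_def algebra_simps)
  then show ?thesis using periodic_int[OF per b] by metis
 qed
 define H where "H = {x::'a. ALL b':Basis - {b}. - pi <= x \<bullet> b' & x \<bullet> b' <= pi}"
 have "closed H"
  unfolding H_def Ball_def
  by (intro closed_Collect_all closed_Collect_imp closed_Collect_conj closed_Collect_le continuous_intros) auto
 then have [measurable]: "H : sets borel" by simp
 have Hs: "x + c *R b : H \<longleftrightarrow> x : H" for x c
  using b by (auto simp: H_def inner_simps inner_Basis)
 have cellH: "x : cell \<longleftrightarrow> x : H & - pi <= x \<bullet> b & x \<bullet> b <= pi" for x
  using b by (auto simp: mem_cell H_def)
 \<comment> \<open>\<open>A\<close> is the overlap of the two cubes, \<open>B\<close> the protruding
   slab, \<open>C\<close> that slab moved back by one period.\<close>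
 define A where "A = {x. x : H & - pi + r < x \<bullet> b & x \<bullet> b <= pi}"
 define B where "B = {x. x : H & pi < x \<bullet> b & x \<bullet> b <= pi + r}"
 define C where "C = {x. x : H & - pi < x \<bullet> b & x \<bullet> b <= - pi + r}"
 have [measurable]: "A : sets borel" "B : sets borel" "C : sets borel"
  unfolding A_def B_def C_def by measurable
 have bb: "b \<bullet> b = 1" using b by simp
 have "(\<oint>x. f (x + s *R b)) = (\<integral>\<^sup>+x. f (x + r *R b) * indicator cell (x + r *R b - r *R b) \<partial>lborel)"
  unfolding nn_integral_torus shift by simp
 also have "... = (\<integral>\<^sup>+x. f x * indicator cell (x - r *R b) \<partial>lborel)"
  by (rule nn_integral_lborel_translate[where f="%x. f x * indicator cell (x - r *R b)"]) measurable
 also have "... = (\<integral>\<^sup>+x. f x * indicator A x + f x * indicator B x \<partial>lborel)"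
 proof (rule nn_integral_cong_AE)
  show "AE x in lborel. f x * indicator cell (x - r *R b) = f x * indicator A x + f x * indicator B x"
   using AE_lborel_inner_neq[OF b, of "- pi + r"]
  proof eventually_elim
   case (elim x)
   have *: "x - r *R b : cell \<longleftrightarrow> x : H & - pi + r <= x \<bullet> b & x \<bullet> b <= pi + r"
    using Hs[of x "- r"] bb by (auto simp: cellH inner_simps)
   show ?case
    using elim r by (auto simp: * A_def B_def indicator_def)
  qed
 qed
 also have "... = (\<integral>\<^sup>+x. f x * indicator A x \<partial>lborel) + (\<integral>\<^sup>+x. f x * indicator B x \<partial>lborel)"
  by (rule nn_integral_add) auto
 also have "(\<integral>\<^sup>+x. f x * indicator B x \<partial>lborel) = (\<integral>\<^sup>+x. f (x + (2 * pi) *R b) * indicator B (x + (2 * pi) *R b) \<partial>lborel)"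
  by (rule nn_integral_lborel_translate[symmetric, where f="%x. f x * indicator B x"]) measurable
 also have "... = (\<integral>\<^sup>+x. f x * indicator C x \<partial>lborel)"
  using Hs bb by (auto simp: periodicD[OF per b] B_def C_def inner_simps indicator_def intro!: nn_integral_cong)
 also have "(\<integral>\<^sup>+x. f x * indicator A x \<partial>lborel) + ... = (\<integral>\<^sup>+x. f x * indicator A x + f x * indicator C x \<partial>lborel)"
  by (rule nn_integral_add[symmetric]) auto
 also have "... = (\<integral>\<^sup>+x. f x * indicator cell x \<partial>lborel)"
 proof (rule nn_integral_cong_AE)
  show "AE x in lborel. f x * indicator A x + f x * indicator C x = f x * indicator cell x"
   using AE_lborel_inner_neq[OF b, of "- pi"]
  proof eventually_elim
   case (elim x)
   then show ?case
    using r by (auto simp: cellH A_def C_def indicator_def)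
  qed
 qed
 finally show ?thesis unfolding nn_integral_torus .
qed

lemma nn_integral_torus_translate:
 fixes f :: "'a::euclidean_space => ennreal"
 assumes m: "f : Borel" and per: "periodic f"
 shows "(\<oint>x. f (x + y)) = (\<oint>x. f x)"
proof -
 have "(\<oint>x. f (x + (\<Sum>b\<in>F. (y \<bullet> b) *R b))) = (\<oint>x. f x)"
  if "finite F" "F \<subseteq> Basis" for F
  using that
 proof (induction F)
  case (insert b F)
  let ?g = "%x. f (x + (\<Sum>b\<in>F. (y \<bullet> b) *R b))"
  have "(\<oint>x. f (x + (\<Sum>b\<in>insert b F. (y \<bullet> b) *R b))) = (\<oint>x. ?g (x + (y \<bullet> b) *R b))"
   using insert by (simp add: add_ac)
  also have "... = (\<oint>x. ?g x)"
   using insert m per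
   by (intro nn_integral_torus_translate_Basis periodic_translate) (auto intro!: measurable_compose[OF _ m])
  finally show ?case using insert by simp
 qed simp
 from this[of Basis] show ?thesis by (simp add: euclidean_representation)
qed

lemma integrable_torus_translate:
 fixes f :: "'a::euclidean_space => 'b::euclidean_space"
 assumes m[measurable]: "f : Borel" and per: "periodic f" and "integrable torus f"
 shows "integrable torus (%x. f (x + y))"
proof -
 have "(\<oint>x. norm (f (x + y))) = (\<oint>x. norm (f x))"
  by (rule nn_integral_torus_translate) (auto intro: periodic_compose per)
 then show ?thesis
  using assms(3) by (auto simp: integrable_iff_bounded)
qed

lemma integral_torus_translate_real:
 fixes f :: "'a::euclidean_space => real"
 assumes m[measurable]: "f : Borel" and per: "periodic f" and i: "integrable torus f"
 shows "(LINT x|torus. f (x + y)) = (LINT x|torus. f x)"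
proof -
 have "(\<oint>x. ennreal (f (x + y))) = (\<oint>x. ennreal (f x))"
  by (rule nn_integral_torus_translate) (auto intro: periodic_compose per)
 moreover have "(\<oint>x. ennreal (- f (x + y))) = (\<oint>x. ennreal (- f x))"
  by (rule nn_integral_torus_translate) (auto intro: periodic_compose per)
 ultimately show ?thesis
  using real_lebesgue_integral_def[OF i] real_lebesgue_integral_def[OF integrable_torus_translate[OF m per i]]
  by simp
qed

lemma integral_torus_translate:
 fixes f :: "'a::euclidean_space => 'b::euclidean_space"
 assumes m[measurable]: "f : Borel" and per: "periodic f" and i: "integrable torus f"
 shows "(LINT x|torus. f (x + y)) = (LINT x|torus. f x)"
proof (rule euclidean_eqI)
 fix b :: 'b assume "b : Basis"
 have "(LINT x|torus. f (x + y)) \<bullet> b = (LINT x|torus. f (x + y) \<bullet> b)"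
  by (rule integral_inner_left[symmetric]) (rule integrable_torus_translate[OF m per i])
 also have "... = (LINT x|torus. f x \<bullet> b)"
  by (rule integral_torus_translate_real[where f="%x. f x \<bullet> b"]) (auto intro!: periodic_compose[where g="%u. u \<bullet> b"] per i)
 also have "... = (LINT x|torus. f x) \<bullet> b"
  by (rule integral_inner_left) (rule i)
 finally show "(LINT x|torus. f (x + y)) \<bullet> b = (LINT x|torus. f x) \<bullet> b" .
qed

lemma cell_Times: "(cell :: ('a::euclidean_space \<times> 'b::euclidean_space) set) = cell \<times> cell"
 by (auto simp: mem_cell Basis_prod_def inner_simps ball_Un)

lemma sigma_finite_torus: "sigma_finite_measure torus"
 by (rule finite_measure.axioms(1)[OF finite_measure_torus])

text \<open>Both sides carry the trace of the product Borel algebra and agree on rectangles. Every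
  Fubini argument below uses this to split the torus into horizontal and vertical variables.\<close>

lemma torus_prod:
 "(torus :: ('a::euclidean_space \<times> 'b::euclidean_space) measure) = torus \<Otimes>\<^sub>M torus"
proof -
 interpret t1: sigma_finite_measure "torus :: 'a measure" by (rule sigma_finite_torus)
 interpret t2: sigma_finite_measure "torus :: 'b measure" by (rule sigma_finite_torus)
 have "(torus :: 'a measure) \<Otimes>\<^sub>M (torus :: 'b measure) = (torus :: ('a \<times> 'b) measure)"
 proof (rule pair_measure_eqI)
  show "sets ((torus :: 'a measure) \<Otimes>\<^sub>M (torus :: 'b measure)) = sets (torus :: ('a \<times> 'b) measure)"
  proof -
   have "sets ((torus :: 'a measure) \<Otimes>\<^sub>M (torus :: 'b measure)) =
      sets (restrict_space borel cell \<Otimes>\<^sub>M restrict_space borel cell)"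
    unfolding torus_cell by (intro sets_pair_measure_cong sets_restrict_space_cong) auto
   also have "... = sets (restrict_space (borel \<Otimes>\<^sub>M borel) (cell \<times> cell :: ('a \<times> 'b) set))"
   proof -
    have e1: "{a \<times> b | a b. a : (\<inter>) cell ` sets (borel :: 'a measure) & b : (\<inter>) cell ` sets (borel :: 'b measure)} =
     (\<inter>) (cell \<times> cell) ` {a \<times> b |a b. a : sets (borel :: 'a measure) & b : sets (borel :: 'b measure)}" (is "?L = ?R")
    proof (intro subset_antisym subsetI)
     fix S assume "S : ?L"
     then obtain a b where "a : sets borel" "b : sets borel" "S = (cell \<inter> a) \<times> (cell \<inter> b)" by auto
     then show "S : ?R" by (auto simp: Times_Int_Times intro!: image_eqI[of _ _ "a \<times> b"])
    next
     fix S assume "S : ?R"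
     then obtain a b where "a : sets borel" "b : sets borel" "S = (cell \<times> cell) \<inter> (a \<times> b)" by auto
     then show "S : ?L" by (auto simp: Times_Int_Times)
    qed
    have e2: "(\<inter>) (cell \<times> cell) ` sigma_sets UNIV {a \<times> b |a b. a : sets (borel :: 'a measure) & b : sets (borel :: 'b measure)} =
     sigma_sets (cell \<times> cell :: ('a \<times> 'b) set)
      ((\<inter>) (cell \<times> cell) ` {a \<times> b |a b. a : sets (borel :: 'a measure) & b : sets (borel :: 'b measure)})"
     by (rule sigma_sets_Int) (auto intro!: sigma_sets.Basic exI[of _ cell])
    show ?thesis
     unfolding sets_pair_measure sets_restrict_space space_restrict_space
     by (simp only: space_pair_measure space_borel Int_UNIV_right UNIV_Times_UNIV e1 e2)
   qed
   also have "... = sets (torus :: ('a \<times> 'b) measure)"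
    unfolding torus_cell cell_Times borel_prod by (intro sets_restrict_space_cong) simp
   finally show ?thesis .
  qed
 next
  fix A :: "'a set" and B :: "'b set"
  assume AB: "A : sets torus" "B : sets torus"
  then have A: "A : sets borel" "A \<subseteq> cell" and B: "B : sets borel" "B \<subseteq> cell"
   by (auto simp: torus_cell sets_restrict_space)
  show "emeasure torus A * emeasure torus B = emeasure torus (A \<times> B)"
   using A B unfolding torus_cell cell_Times
   by (simp add: emeasure_restrict_space Times_Int_Times lborel_prod[symmetric] lborel.emeasure_pair_measure_Times
     Sigma_mono borel_prod)
 qed (unfold_locales)
 then show ?thesis by simp
qed

section \<open>Partial derivatives and trigonometric polynomials\<close>

lemma pd_eqI: "(f has_derivative F) (at x) ==> pd b f x = F b"
 unfolding pd_def by (metis frechet_derivative_at)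

lemma pd_has_derivative: "f differentiable (at x) ==> (f has_derivative (%h. pd h f x)) (at x)"
 unfolding pd_def by (simp add: frechet_derivative_works)

lemma has_derivative_translate_iff:
 "((%x. f (x + y)) has_derivative F) (at x) \<longleftrightarrow> (f has_derivative F) (at (x + y :: 'a::real_normed_vector))"
proof
 assume "((%x. f (x + y)) has_derivative F) (at x)"
 then have *: "((%x. f (x + y)) has_derivative F) (at ((x + y) - y))" by simp
 have "((%u. (%x. f (x + y)) (u - y)) has_derivative (%h. F h)) (at (x + y))"
  by (rule has_derivative_compose[of "%u. u - y" "%h. h" "x + y" UNIV "%x. f (x + y)" F])
   (use * in \<open>auto intro!: derivative_eq_intros\<close>)
 then show "(f has_derivative F) (at (x + y))" by simp
next
 assume *: "(f has_derivative F) (at (x + y))"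
 show "((%x. f (x + y)) has_derivative F) (at x)"
  by (rule has_derivative_compose[of "%u. u + y" "%h. h" x UNIV f F])
   (use * in \<open>auto intro!: derivative_eq_intros\<close>)
qed

lemma pd_translate: "pd b (%x. f (x + y)) = (%x. pd b f (x + y))"
 by (simp add: fun_eq_iff pd_def frechet_derivative_def has_derivative_translate_iff)

lemma smooth_translate: "smooth f ==> smooth (%x. f (x + y))"
proof -
 have "foldr pd bs (%x. f (x + y)) = (%x. foldr pd bs f (x + y))" for bs
  by (induction bs) (simp_all add: pd_translate)
 then show "smooth f ==> smooth (%x. f (x + y))"
  by (auto simp: smooth_def differentiable_def has_derivative_translate_iff)
qed

lemma smooth_differentiable: "smooth f ==> f differentiable (at x)"
 unfolding smooth_def by (drule spec[of _ "[]"]) simp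

lemma smooth_pd_differentiable: "smooth f ==> b : Basis ==> pd b f differentiable (at x)"
 unfolding smooth_def by (drule spec[of _ "[b]"]) simp

lemma smooth_continuous: "smooth f ==> continuous_on A f"
 by (meson continuous_at_imp_continuous_on differentiable_imp_continuous_within smooth_differentiable)

lemma smooth_pd_continuous: "smooth f ==> b : Basis ==> continuous_on A (pd b f)"
 by (meson continuous_at_imp_continuous_on differentiable_imp_continuous_within smooth_pd_differentiable)

lemma periodic_pd: "periodic f ==> periodic (pd b f)"
 unfolding periodic_def
proof (intro allI ballI)
 fix x b' assume *: "ALL x. ALL b:Basis. f (x + (2 * pi) *R b) = f x" and b': "b' : (Basis :: 'a set)"
 then have "(%x. f (x + (2 * pi) *R b')) = f" by auto
 then show "pd b f (x + (2 * pi) *R b') = pd b f x"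
  by (metis pd_translate)
qed

lemma pd_add: "f differentiable (at x) ==> g differentiable (at x) ==> pd b (%x. f x + g x) x = pd b f x + pd b g x"
 by (rule pd_eqI) (intro has_derivative_add pd_has_derivative)

lemma pd_sum:
 "(!!i. i : I ==> f i differentiable (at x)) ==> pd b (%x. \<Sum>i\<in>I. f i x) x = (\<Sum>i\<in>I. pd b (f i) x)"
 by (rule pd_eqI) (intro has_derivative_sum pd_has_derivative)

lemma pd_scaleR_left:
 "f differentiable (at x) ==> pd b (%x. f x *R c) x = pd b f x *R c"
 by (rule pd_eqI) (auto intro!: derivative_eq_intros pd_has_derivative)

lemma pd_scaleR_right:
 "f differentiable (at x) ==> pd b (%x. r *R f x) x = r *R pd b f x"
 by (rule pd_eqI) (auto intro!: derivative_eq_intros pd_has_derivative)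

lemma pd_mult:
 fixes f g :: "'a::euclidean_space => real"
 shows "f differentiable (at x) ==> g differentiable (at x) ==>
  pd b (%x. f x * g x) x = pd b f x * g x + f x * pd b g x"
 by (rule pd_eqI) (auto intro!: derivative_eq_intros pd_has_derivative simp: fun_eq_iff)

text \<open>Real trigonometric polynomials. The free phase \<open>c\<close> makes one kind of atom
  suffice: sines, translates, derivatives and products of atoms are again sums of atoms, so closure
  under these operations is an induction on the sum.\<close>

inductive tp :: "('a::euclidean_space => real) => bool" where
 tp_atom: "ALL b:Basis. k \<bullet> b : \<int> ==> tp (%x. a * cos (k \<bullet> x + c))"
| tp_add: "tp f ==> tp g ==> tp (%x. f x + g x)"

lemma tp_const: "tp (%x. a)"
 using tp_atom[of 0 a 0] by simp

lemma tp_scale: "tp f ==> tp (%x. r * f x)"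
proof (induction rule: tp.induct)
 case (tp_atom k a c)
 then show ?case using tp.tp_atom[of k "r * a" c] by (simp add: mult.assoc)
qed (simp add: distrib_left tp_add)

lemma tp_minus: "tp f ==> tp (%x. - f x)"
 using tp_scale[of f "-1"] by simp

lemma tp_diff: "tp f ==> tp g ==> tp (%x. f x - g x)"
 using tp_add[OF _ tp_minus, of f g] by simp

lemma tp_sum: "(!!i. i : I ==> tp (f i)) ==> tp (%x. \<Sum>i\<in>I. f i x)"
 by (induction I rule: infinite_finite_induct) (simp_all add: tp_const tp_add)

lemma tp_mult_atom:
 assumes "tp f" "ALL b:Basis. k \<bullet> b : \<int>"
 shows "tp (%x. a * cos (k \<bullet> x + c) * f x)"
 using assms(1)
proof (induction rule: tp.induct)
 case (tp_atom k' a' c')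
 have "(%x. a * cos (k \<bullet> x + c) * (a' * cos (k' \<bullet> x + c'))) =
   (%x. (a * a' / 2) * cos ((k - k') \<bullet> x + (c - c')) + (a * a' / 2) * cos ((k + k') \<bullet> x + (c + c')))"
 proof
  fix x
  have "(k - k') \<bullet> x + (c - c') = (k \<bullet> x + c) - (k' \<bullet> x + c')" "(k + k') \<bullet> x + (c + c') = (k \<bullet> x + c) + (k' \<bullet> x + c')"
   by (simp_all add: inner_simps)
  then show "a * cos (k \<bullet> x + c) * (a' * cos (k' \<bullet> x + c')) =
   (a * a' / 2) * cos ((k - k') \<bullet> x + (c - c')) + (a * a' / 2) * cos ((k + k') \<bullet> x + (c + c'))"
   by (simp only: cos_diff[of "k \<bullet> x + c"] cos_add[of "k \<bullet> x + c"]) (simp add: algebra_simps)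
 qed
 moreover have "ALL b:Basis. (k - k') \<bullet> b : \<int>" "ALL b:Basis. (k + k') \<bullet> b : \<int>"
  using tp_atom assms(2) by (auto simp: inner_simps)
 ultimately show ?case by (simp only: tp_add tp.tp_atom)
qed (simp add: distrib_left tp_add)

lemma tp_mult: "tp f ==> tp g ==> tp (%x. f x * g x)"
 by (induction rule: tp.induct) (simp_all add: tp_mult_atom tp_add distrib_right)

lemma tp_power: "tp f ==> tp (%x. f x ^ n)"
 by (induction n) (simp_all add: tp_const tp_mult)

lemma tp_translate: "tp f ==> tp (%x. f (x + y))"
proof (induction rule: tp.induct)
 case (tp_atom k a c)
 then show ?case using tp.tp_atom[of k a "k \<bullet> y + c"] by (simp add: inner_simps add.assoc)
qed (simp add: tp_add)

lemma Basis_int_inner: "b : Basis ==> ALL b':Basis. (of_int m *R b) \<bullet> b' : \<int>"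
 by (auto simp: inner_Basis)

lemma tp_cos: "b : Basis ==> tp (%x. cos (of_int m * (x \<bullet> b)))"
 using tp_atom[OF Basis_int_inner[of b m], where a=1 and c=0] by (simp add: inner_commute)

lemma tp_sin: "b : Basis ==> tp (%x. sin (of_int m * (x \<bullet> b)))"
 using tp_atom[OF Basis_int_inner[of b m], where a=1 and c="- (pi / 2)"] by (simp add: inner_commute cos_diff)

lemma tp_fst: "tp f ==> tp (%x::'a::euclidean_space \<times> 'b::euclidean_space. f (fst x))"
proof (induction rule: tp.induct)
 case (tp_atom k a c)
 then show ?case using tp.tp_atom[of "(k, 0)" a c] by (simp add: inner_prod_def Basis_prod_def ball_Un)
qed (simp add: tp_add)

lemma tp_snd: "tp f ==> tp (%x::'a::euclidean_space \<times> 'b::euclidean_space. f (snd x))"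
proof (induction rule: tp.induct)
 case (tp_atom k a c)
 then show ?case using tp.tp_atom[of "(0, k)" a c] by (simp add: inner_prod_def Basis_prod_def ball_Un)
qed (simp add: tp_add)

lemma tp_slice_fst: "tp f ==> tp (%x. f (x, z))"
proof (induction rule: tp.induct)
 case (tp_atom k a c)
 then have "tp (%x. a * cos (fst k \<bullet> x + (snd k \<bullet> z + c)))"
  by (intro tp.tp_atom) (simp add: inner_prod_def Basis_prod_def ball_Un)
 moreover have "fst k \<bullet> x + (snd k \<bullet> z + c) = k \<bullet> (x, z) + c" for x
  by (simp add: inner_prod_def)
 ultimately show ?case by simp
qed (simp add: tp_add)

lemma tp_slice_snd: "tp f ==> tp (%z. f (x, z))"
proof (induction rule: tp.induct)
 case (tp_atom k a c)
 then have "tp (%z. a * cos (snd k \<bullet> z + (fst k \<bullet> x + c)))"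
  by (intro tp.tp_atom) (simp add: inner_prod_def Basis_prod_def ball_Un)
 moreover have "snd k \<bullet> z + (fst k \<bullet> x + c) = k \<bullet> (x, z) + c" for z
  by (simp add: inner_prod_def)
 ultimately show ?case by simp
qed (simp add: tp_add)

lemma tp_differentiable: "tp f ==> f differentiable (at x)"
proof (induction rule: tp.induct)
 case (tp_atom k a c)
 have "((%x. a * cos (k \<bullet> x + c)) has_derivative (%h. - (a * (k \<bullet> h)) * sin (k \<bullet> x + c))) (at x)"
  by (auto intro!: derivative_eq_intros)
 then show ?case by (auto simp: differentiable_def)
qed simp

lemma pd_atom: "pd b (%x. a * cos (k \<bullet> x + c)) = (%x. (a * (k \<bullet> b)) * cos (k \<bullet> x + (c + pi / 2)))"
proof
 fix x
 have "((%x. a * cos (k \<bullet> x + c)) has_derivative (%h. - (a * (k \<bullet> h)) * sin (k \<bullet> x + c))) (at x)"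
  by (auto intro!: derivative_eq_intros)
 from pd_eqI[OF this, of b] show "pd b (%x. a * cos (k \<bullet> x + c)) x = (a * (k \<bullet> b)) * cos (k \<bullet> x + (c + pi / 2))"
  by (simp add: cos_add sin_add algebra_simps)
qed

lemma tp_pd: "tp f ==> tp (pd b f)"
proof (induction rule: tp.induct)
 case (tp_atom k a c)
 then show ?case unfolding pd_atom by (rule tp.tp_atom)
next
 case (tp_add f g)
 then have "pd b (%x. f x + g x) = (%x. pd b f x + pd b g x)"
  by (simp add: fun_eq_iff pd_add tp_differentiable)
 then show ?case using tp_add by (simp add: tp.tp_add)
qed

lemma tp_smooth: "tp f ==> smooth f"
proof -
 assume "tp f"
 then have "tp (foldr pd bs f)" for bs
  by (induction bs) (simp_all add: tp_pd)
 then show ?thesis by (simp add: smooth_def tp_differentiable)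
qed

lemma tp_periodic: "tp f ==> periodic f"
proof (induction rule: tp.induct)
 case (tp_atom k a c)
 show ?case unfolding periodic_def
 proof (intro allI ballI)
  fix x b assume "b : (Basis :: 'a set)"
  then obtain m :: int where m: "k \<bullet> b = of_int m" using tp_atom by (auto elim: Ints_cases)
  have "cos (k \<bullet> (x + (2 * pi) *R b) + c) = cos ((k \<bullet> x + c) + 2 * pi * of_int m)"
   by (simp add: inner_simps m algebra_simps)
  also have "... = cos (k \<bullet> x + c)"
   by (simp add: cos_add)
  finally show "a * cos (k \<bullet> (x + (2 * pi) *R b) + c) = a * cos (k \<bullet> x + c)" by simp
 qed
qed (simp add: periodic_def)

lemma tp_bounded: "tp f ==> EX C>=0. ALL x. \<bar>f x\<bar> <= C"
proof (induction rule: tp.induct)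
 case (tp_atom k a c)
 have "\<bar>a * cos (k \<bullet> x + c)\<bar> <= \<bar>a\<bar>" for x
  by (simp add: abs_mult mult_left_le)
 then show ?case by (intro exI[of _ "\<bar>a\<bar>"]) auto
next
 case (tp_add f g)
 then obtain C D where "C >= 0" "D >= 0" "!!x. \<bar>f x\<bar> <= C" "!!x. \<bar>g x\<bar> <= D" by auto
 then have "\<bar>f x + g x\<bar> <= C + D" for x
  by (meson abs_triangle_ineq add_mono order_trans)
 then show ?case using \<open>C >= 0\<close> \<open>D >= 0\<close> by (intro exI[of _ "C + D"]) auto
qed

lemma tp_continuous: "tp f ==> continuous_on A f"
 using tp_smooth smooth_continuous by blast

lemma tp_borel: "tp f ==> f : Borel"
 by (rule borel_measurable_continuous_onI) (rule tp_continuous)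

lemma integrable_torus_bounded:
 fixes f :: "'a::euclidean_space => 'b::euclidean_space"
 assumes "f : Borel" "!!x. norm (f x) <= C"
 shows "integrable torus f"
 by (rule LB_integrable_bound[where f="%_. C"])
  (use assms order_trans[OF norm_ge_zero assms(2)] in auto)

lemma tp_integrable: "tp f ==> integrable torus f"
 using tp_bounded[of f] tp_borel[of f] by (metis integrable_torus_bounded real_norm_def)

text \<open>Translation by half a wave length along a coordinate with nonzero frequency changes the
  sign of the cosine but not its integral.\<close>

lemma integral_atom_zero:
 assumes "ALL b:Basis. k \<bullet> b : \<int>" "k ~= 0"
 shows "(LINT x|torus. cos (k \<bullet> x + c)) = 0"
proof -
 obtain b where b: "b : Basis" "k \<bullet> b ~= 0"
  using assms(2) by (metis euclidean_all_zero_iff)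
 let ?f = "%x. 1 * cos (k \<bullet> x + c)"
 have tp: "tp ?f" by (rule tp_atom) fact
 have "(LINT x|torus. ?f (x + (pi / (k \<bullet> b)) *R b)) = (LINT x|torus. ?f x)"
  using tp by (intro integral_torus_translate tp_borel tp_periodic tp_integrable)
 moreover have "?f (x + (pi / (k \<bullet> b)) *R b) = - ?f x" for x
  using b by (simp add: inner_simps cos_add)
 ultimately show ?thesis by simp
qed

lemma tp_integral_pd: "tp f ==> (LINT x|torus. pd b f x) = 0"
proof (induction rule: tp.induct)
 case (tp_atom k a c)
 show ?case
 proof (cases "k \<bullet> b = 0")
  case False
  then have "k ~= 0" by auto
  from integral_atom_zero[OF tp_atom this] show ?thesis by (simp add: pd_atom)
 qed (simp add: pd_atom)
next
 case (tp_add f g)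
 then show ?case
  by (simp add: pd_add tp_differentiable tp_integrable tp_pd)
qed

lemma has_derivative_along:
 assumes "f differentiable (at (x + s *R b))"
 shows "((%s. f (x + s *R b)) has_vector_derivative pd b f (x + s *R b)) (at s)"
 unfolding has_vector_derivative_def
proof -
 have lin: "linear (%h. pd h f (x + s *R b))"
  using pd_has_derivative[OF assms] has_derivative_linear by blast
 have "((%s. f (x + s *R b)) has_derivative (%h. pd (h *R b) f (x + s *R b))) (at s)"
  by (rule has_derivative_compose[of "%s. x + s *R b" "%h. h *R b" s UNIV f "%h. pd h f (x + s *R b)"])
   (use pd_has_derivative[OF assms] in \<open>auto intro!: derivative_eq_intros\<close>)
 then show "((%s. f (x + s *R b)) has_derivative (%h. h *R pd b f (x + s *R b))) (at s)"
  using linear_cmul[OF lin] by simp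
qed

lemma tp_ftc:
 assumes "tp f" "a <= b"
 shows "h * (LINT s:{a..b}|lborel. pd e f (x + (h * s) *R e)) = f (x + (h * b) *R e) - f (x + (h * a) *R e)"
proof -
 have "(LBINT s. (h * pd e f (x + (h * s) *R e)) * indicator {a..b} s) = f (x + (h * b) *R e) - f (x + (h * a) *R e)"
 proof (rule integral_FTC_Icc_real[OF \<open>a <= b\<close>])
  fix s
  have "((%r. f (x + r *R e)) has_real_derivative pd e f (x + (h * s) *R e)) (at (h * s))"
   using has_derivative_along[where x=x and s="h * s" and b=e, OF tp_differentiable[OF assms(1)]]
   by (simp add: has_real_derivative_iff_has_vector_derivative)
  moreover have "((%s. h * s) has_real_derivative h) (at s)"
   by (auto intro!: derivative_eq_intros)
  ultimately show "DERIV (%s. f (x + (h * s) *R e)) s :> h * pd e f (x + (h * s) *R e)"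
   using DERIV_chain[of "%r. f (x + r *R e)" _ "%s. h * s" s h UNIV] by (simp add: o_def mult.commute[of _ h])
  have "continuous_on UNIV (%s. h * pd e f (x + (h * s) *R e))"
   by (intro continuous_on_mult continuous_on_const
     continuous_on_compose2[OF tp_continuous[OF tp_pd[OF assms(1)]], where t=UNIV])
    (auto intro!: continuous_intros)
  then show "isCont (%s. h * pd e f (x + (h * s) *R e)) s"
   by (simp add: continuous_on_eq_continuous_at)
 qed
 moreover have "(LBINT s. (h * pd e f (x + (h * s) *R e)) * indicator {a..b} s) = h * (LINT s:{a..b}|lborel. pd e f (x + (h * s) *R e))"
  by (simp add: set_lebesgue_integral_def mult.commute mult.left_commute flip: integral_mult_right_zero)
 ultimately show ?thesis by simp
qed

lemma pd_slice_snd: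
 assumes "f differentiable (at (x, z))"
 shows "pd (1::real) (%z. f (x, z)) z = pd (0, 1) f (x, z)"
proof (rule pd_eqI)
 show "((%z. f (x, z)) has_derivative (%h. pd (0, h) f (x, z))) (at z)"
  by (rule has_derivative_compose[of "%z. (x, z)" "%h. (0, h)" z UNIV f "%h. pd h f (x, z)"])
   (use pd_has_derivative[OF assms] in \<open>auto intro!: derivative_eq_intros\<close>)
qed

text \<open>Atoms with vertical frequency zero go to \<open>B\<close>; for the others the derivative
  is undone by dividing by the frequency and turning the phase back by a quarter period. The
  antiderivative is again a trigonometric polynomial, hence periodic.\<close>

lemma tp_antiderivative_snd:
 assumes "tp (G :: 'a::euclidean_space \<times> real => real)"
 shows "EX A B. tp A & tp B & (ALL x. G x = B (fst x) + pd (0, 1) A x)"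
 using assms
proof (induction rule: tp.induct)
 case (tp_atom k a c)
 show ?case
 proof (cases "snd k = 0")
  case True
  have "tp (%x. a * cos (fst k \<bullet> x + c))"
   using tp_atom by (intro tp.tp_atom) (auto simp: Basis_prod_def inner_prod_def ball_Un)
  moreover have "tp (%x::'a \<times> real. 0)" by (rule tp_const)
  moreover have "pd (0, 1) (%x::'a \<times> real. 0::real) x = 0" for x
   by (rule pd_eqI[where F="%_. 0"]) simp
  ultimately show ?thesis
   using True by (intro exI[of _ "%x. 0"] exI[of _ "%x. a * cos (fst k \<bullet> x + c)"])
    (auto simp: inner_prod_def)
 next
  case False
  have "tp (%x. a / snd k * cos (k \<bullet> x + (c - pi / 2)))"
   by (rule tp.tp_atom) fact
  then show ?thesis
   using False by (intro exI[of _ "%x. a / snd k * cos (k \<bullet> x + (c - pi / 2))"] exI[of _ "%x. 0"] conjI tp_const)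
   (simp_all only: pd_atom, simp add: inner_prod_def)
 qed
next
 case (tp_add f g)
 then obtain A B A' B' where *: "tp A" "tp B" "!!x. f x = B (fst x) + pd (0, 1) A x"
  "tp A'" "tp B'" "!!x. g x = B' (fst x) + pd (0, 1) A' x" by blast
 then show ?case
  by (intro exI[of _ "%x. A x + A' x"] exI[of _ "%x. B x + B' x"])
   (auto simp: pd_add tp_differentiable tp.tp_add)
qed

lemma measure_torus_real: "measure (torus :: real measure) cell = 2 * pi"
 unfolding torus_cell by (subst measure_restrict_space) (simp_all add: cell_def)

text \<open>\<open>B\<close> is the vertical mean of \<open>G\<close>. Applied to the mollified
  horizontal divergence, this yields a vertical velocity that is periodic in z.\<close>

lemma tp_antiderivative_zero_mean:
 assumes "tp (G :: 'a::euclidean_space \<times> real => real)" "!!x. (LINT z|torus. G (x, z)) = 0"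
 shows "EX A. tp A & (ALL x. G x = pd (0, 1) A x)"
proof -
 obtain A B where AB: "tp A" "tp B" "!!x. G x = B (fst x) + pd (0, 1) A x"
  using tp_antiderivative_snd[OF assms(1)] by blast
 have "B x = 0" for x
 proof -
  have "pd (0, 1) A (x, z) = pd 1 (%z. A (x, z)) z" for z
   by (simp add: pd_slice_snd tp_differentiable AB)
  then have "(LINT z|torus. G (x, z)) = (LINT z|torus. B x + pd 1 (%z. A (x, z)) (z::real))"
   by (simp add: AB)
  also have "... = (LINT z|(torus :: real measure). B x) + (LINT z|torus. pd 1 (%z. A (x, z)) (z::real))"
   by (rule LB_integral_add) (auto intro!: tp_integrable tp_pd tp_slice_snd AB)
  also have "... = 2 * pi * B x"
   by (simp add: tp_integral_pd tp_slice_snd AB measure_torus_real)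
  finally show ?thesis using assms(2)[of x] by simp
 qed
 with AB show ?thesis by auto
qed

section \<open>Continuity of translations in Lebesgue spaces\<close>

text \<open>The p-th power of the Lebesgue norm, without the root and with infinity allowed: for the
  exponents 2 and 4 the estimates become polynomial inequalities between extended reals.\<close>

definition pmass :: "nat => ('a::euclidean_space => 'b::euclidean_space) => ennreal" where
 "pmass p f = (\<oint>x. ennreal (norm (f x) ^ p))"

definition Lp_torus :: "nat => ('a::euclidean_space => 'b::euclidean_space) set" where
 "Lp_torus p = {f. periodic f & f : Borel & pmass p f < \<infinity>}"

lemma L2_eq_Lp_torus: "L2 = Lp_torus 2"
 unfolding L2_def Lp_torus_def pmass_def
 by (auto simp: integrable_iff_bounded)

lemma Lp_torusD:
 assumes "f : Lp_torus p"
 shows "periodic f" "f : Borel" "pmass p f < \<infinity>"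
 using assms by (auto simp: Lp_torus_def)

lemma pmass_cong_AE: "AE x in torus. f x = g x ==> pmass p f = pmass p g"
 unfolding pmass_def by (rule nn_integral_cong_AE) auto

lemma pmass_mono_AE:
 "AE x in torus. norm (f x) <= norm (g x) ==> pmass p f <= pmass p g"
 unfolding pmass_def by (rule nn_integral_mono_AE) (auto elim!: eventually_mono simp: power_mono)

lemma norm_add_power:
 fixes a b :: "'b::real_normed_vector"
 shows "norm (a + b) ^ p <= 2 ^ p * (norm a ^ p + norm b ^ p)"
proof -
 define m where "m = max (norm a) (norm b)"
 have "norm (a + b) <= 2 * m"
  using norm_triangle_ineq[of a b] unfolding m_def by linarith
 then have "norm (a + b) ^ p <= (2 * m) ^ p" by (intro power_mono) auto
 also have "... = 2 ^ p * m ^ p" by (simp add: power_mult_distrib)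
 also have "m ^ p <= norm a ^ p + norm b ^ p" by (auto simp: m_def max_def)
 finally show ?thesis by simp
qed

lemma pmass_add:
 assumes [measurable]: "f : Borel" "g : Borel"
 shows "pmass p (%x. f x + g x) <= 2 ^ p * (pmass p f + pmass p g)"
proof -
 have "pmass p (%x. f x + g x) <= (\<oint>x. 2 ^ p * (ennreal (norm (f x) ^ p) + ennreal (norm (g x) ^ p)))"
  unfolding pmass_def
 proof (rule nn_integral_mono)
  fix x
  have "ennreal (norm (f x + g x) ^ p) <= ennreal (2 ^ p * (norm (f x) ^ p + norm (g x) ^ p))"
   by (intro ennreal_leI norm_add_power)
  then show "ennreal (norm (f x + g x) ^ p) <= 2 ^ p * (ennreal (norm (f x) ^ p) + ennreal (norm (g x) ^ p))"
   by (simp add: ennreal_mult ennreal_power[symmetric])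
 qed
 also have "... = 2 ^ p * (pmass p f + pmass p g)"
  unfolding pmass_def by (simp add: nn_integral_cmult nn_integral_add)
 finally show ?thesis .
qed

lemma pmass_minus: "pmass p (%x. - f x) = pmass p f"
 by (simp add: pmass_def)

lemma pmass_diff:
 assumes "f : Borel" "g : Borel"
 shows "pmass p (%x. f x - g x) <= 2 ^ p * (pmass p f + pmass p g)"
 using pmass_add[of f "%x. - g x" p] assms by (simp add: pmass_minus)

lemma pmass_translate:
 assumes [measurable]: "f : Borel" and "periodic f"
 shows "pmass p (%x. f (x + y)) = pmass p f"
 unfolding pmass_def
 by (rule nn_integral_torus_translate) (auto intro: periodic_compose assms)

lemma pmass_scaleR: "pmass p (%x. r *R f x) = ennreal (\<bar>r\<bar> ^ p) * pmass p f" if [measurable]: "f : Borel"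
 unfolding pmass_def by (subst nn_integral_cmult[symmetric]) (auto simp: power_mult_distrib ennreal_mult)

lemma Lp_torus_translate: "f : Lp_torus p ==> (%x. f (x + y)) : Lp_torus p"
 unfolding Lp_torus_def using pmass_translate[of f p y] by (auto intro: periodic_translate)

lemma Lp_torus_translate_minus: "f : Lp_torus p ==> (%x. f (x - y)) : Lp_torus p"
 using Lp_torus_translate[of f p "- y"] by simp

lemma Lp_torus_add: "f : Lp_torus p ==> g : Lp_torus p ==> (%x. f x + g x) : Lp_torus p"
 unfolding Lp_torus_def
 by (auto intro: periodic_compose2 le_less_trans[OF pmass_add] simp: ennreal_mult_less_top power_less_top_ennreal)

lemma Lp_torus_scaleR: "f : Lp_torus p ==> (%x. r *R f x) : Lp_torus p"
 unfolding Lp_torus_def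
 by (auto intro: periodic_compose simp: pmass_scaleR ennreal_mult_less_top)

lemma Lp_torus_minus: "f : Lp_torus p ==> (%x. - f x) : Lp_torus p"
 using Lp_torus_scaleR[of f p "-1"] by simp

lemma Lp_torus_diff: "f : Lp_torus p ==> g : Lp_torus p ==> (%x. f x - g x) : Lp_torus p"
 using Lp_torus_add[OF _ Lp_torus_minus, of f p g] by simp

lemma Lp_torus_sum: "(!!i. i : I ==> f i : Lp_torus p) ==> p > 0 ==> (%x. \<Sum>i\<in>I. f i x) : Lp_torus p"
proof (induction I rule: infinite_finite_induct)
 case (insert i I)
 then show ?case by (simp add: Lp_torus_add)
qed (auto simp: Lp_torus_def pmass_def periodic_def power_0_left)

lemma Lp_torus_bounded:
 assumes "periodic f" "f : Borel" "!!x. norm (f x) <= C"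
 shows "f : Lp_torus p"
proof -
 have "pmass p f <= (\<integral>\<^sup>+x. ennreal (C ^ p) \<partial>(torus :: 'a measure))"
  unfolding pmass_def by (intro nn_integral_mono ennreal_leI power_mono assms) simp
 also have "... < \<infinity>"
  using finite_measure.emeasure_finite[OF finite_measure_torus, of "cell :: 'a set"]
  by (simp add: ennreal_mult_eq_top_iff less_top[symmetric])
 finally show ?thesis using assms by (auto simp: Lp_torus_def)
qed

lemma tp_Lp_torus: "tp f ==> f : Lp_torus p"
 using tp_bounded[of f] by (metis Lp_torus_bounded real_norm_def tp_borel tp_periodic)

section \<open>Null sequences of extended nonnegative reals\<close>

lemma ennreal_tendsto_0_iff:
 "((a :: 'i => ennreal) \<longlongrightarrow> 0) F \<longleftrightarrow> (ALL r>0. \<forall>\<^sub>F n in F. a n < ennreal r)"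
proof safe
 fix r :: real assume "(a \<longlongrightarrow> 0) F" "0 < r"
 then show "\<forall>\<^sub>F n in F. a n < ennreal r"
  by (intro order_tendstoD(2)) auto
next
 assume *: "ALL r>0. \<forall>\<^sub>F n in F. a n < ennreal r"
 show "(a \<longlongrightarrow> 0) F"
 proof (rule order_tendstoI)
  fix e :: ennreal assume "0 < e"
  then obtain r where r: "0 < r" "ennreal r <= e"
   by (cases e) (auto intro: that[of 1])
  from *[rule_format, OF r(1)] show "\<forall>\<^sub>F n in F. a n < e"
   by eventually_elim (use r in auto)
 qed auto
qed

lemma ennreal_tendsto_0_ex:
 "((a :: nat => ennreal) \<longlongrightarrow> 0) sequentially ==> 0 < r ==> EX n. a n < ennreal r"
 unfolding ennreal_tendsto_0_iff eventually_sequentially by blast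

lemma ennreal_tendsto_0_approx:
 fixes a :: "'i => ennreal"
 assumes "!!e. 0 < e ==> EX b. (b \<longlongrightarrow> 0) F & (ALL n. a n <= b n + ennreal e)"
 shows "(a \<longlongrightarrow> 0) F"
 unfolding ennreal_tendsto_0_iff
proof safe
 fix r :: real assume r: "0 < r"
 obtain b where b: "(b \<longlongrightarrow> 0) F" "!!n. a n <= b n + ennreal (r / 2)"
  using assms[of "r / 2"] r by auto
 then have "\<forall>\<^sub>F n in F. b n < ennreal (r / 2)"
  using r half_gt_zero[OF r] unfolding ennreal_tendsto_0_iff by blast
 then show "\<forall>\<^sub>F n in F. a n < ennreal r"
 proof eventually_elim
  case (elim n)
  have "b n + ennreal (r / 2) < ennreal (r / 2) + ennreal (r / 2)"
   using elim by (simp add: ennreal_add_left_cancel_less add.commute)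
  also have "... = ennreal r" using r by (simp add: ennreal_plus[symmetric] del: ennreal_plus)
  finally show ?case using b(2)[of n] by (rule le_less_trans[rotated])
 qed
qed

lemma ennreal_tendsto_0_cmult:
 fixes a :: "'i => ennreal"
 assumes "(a \<longlongrightarrow> 0) F" "c < \<infinity>"
 shows "((%n. c * a n) \<longlongrightarrow> 0) F"
 using ennreal_tendsto_cmult[of c a 0 F] assms by auto

lemma ennreal_tendsto_0_add:
 fixes a b :: "'i => ennreal"
 assumes "(a \<longlongrightarrow> 0) F" "(b \<longlongrightarrow> 0) F"
 shows "((%n. a n + b n) \<longlongrightarrow> 0) F"
 using tendsto_add[OF assms] by simp

lemma ennreal_tendsto_0_le:
 fixes a b :: "'i => ennreal"
 assumes "(b \<longlongrightarrow> 0) F" "!!n. a n <= b n"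
 shows "(a \<longlongrightarrow> 0) F"
 by (rule tendsto_sandwich[OF _ _ tendsto_const assms(1)]) (use assms in auto)

text \<open>For an open set the convergence is pointwise: a point of \<open>U\<close> stays in
  \<open>U\<close> under small shifts, and points outside contribute nothing. Only the part that
  leaves \<open>U\<close> is measured.\<close>

lemma indicator_open_translation:
 fixes U :: "'a::euclidean_space set"
 assumes U: "open U" "emeasure lborel U < \<infinity>" and y: "y ----> 0"
 shows "(%n. \<integral>\<^sup>+x. ennreal (indicator U x * (1 - indicator U (x + y n))) \<partial>lborel) ----> 0"
proof -
 have [measurable]: "U : sets borel" using U by simp
 have "(%n. \<integral>\<^sup>+x. ennreal (indicator U x * (1 - indicator U (x + y n))) \<partial>lborel) ----> (\<integral>\<^sup>+x. 0 \<partial>(lborel :: 'a measure))"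
 proof (rule nn_integral_dominated_convergence[where w="indicator U"])
  show "(\<integral>\<^sup>+ x. indicator U x \<partial>lborel) < \<infinity>" using U by simp
  show "AE x in lborel. (%i. ennreal (indicator U x * (1 - indicator U (x + y i)))) ----> 0"
  proof (rule AE_I2)
   fix x
   show "(%i. ennreal (indicator U x * (1 - indicator U (x + y i)))) ----> 0"
   proof (cases "x : U")
    case True
    have "(%i. x + y i) ----> x + 0" by (intro tendsto_intros y)
    then have "\<forall>\<^sub>F i in sequentially. x + y i : U"
     using topological_tendstoD[OF _ U(1)] True by auto
    then have "\<forall>\<^sub>F i in sequentially. ennreal (indicator U x * (1 - indicator U (x + y i))) = 0"
     by eventually_elim (use True in auto)
    then show ?thesis by (simp add: tendsto_eventually)
   qed simp
  qed
 qed (auto simp: indicator_def)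
 then show ?thesis by simp
qed

lemma indicator_translation_open:
 fixes U :: "'a::euclidean_space set"
 assumes U: "open U" "emeasure lborel U < \<infinity>" and y: "y ----> 0"
 shows "(%n. \<integral>\<^sup>+x. ennreal \<bar>indicator U (x + y n) - indicator U x\<bar> \<partial>lborel) ----> 0"
proof -
 have [measurable]: "U : sets borel" using U by simp
 have y': "(%n. - y n) ----> 0" using tendsto_minus[OF y] by simp
 \<comment> \<open>The points that enter \<open>U\<close> under the shift are, after translation,
   those that leave it under the opposite shift.\<close>
 have eq: "(\<integral>\<^sup>+x. ennreal \<bar>indicator U (x + y n) - indicator U x\<bar> \<partial>lborel) =
  (\<integral>\<^sup>+x. ennreal (indicator U x * (1 - indicator U (x + y n))) \<partial>lborel) +
  (\<integral>\<^sup>+x. ennreal (indicator U x * (1 - indicator U (x + - y n))) \<partial>lborel)" for n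
 proof -
  have "(\<integral>\<^sup>+x. ennreal \<bar>indicator U (x + y n) - indicator U x\<bar> \<partial>lborel) =
   (\<integral>\<^sup>+x. ennreal (indicator U x * (1 - indicator U (x + y n))) +
    ennreal (indicator U (x + y n) * (1 - indicator U (x + y n + - y n))) \<partial>lborel)"
   by (intro nn_integral_cong) (auto simp: indicator_def)
  also have "... = (\<integral>\<^sup>+x. ennreal (indicator U x * (1 - indicator U (x + y n))) \<partial>lborel) +
   (\<integral>\<^sup>+x. ennreal (indicator U (x + y n) * (1 - indicator U (x + y n + - y n))) \<partial>lborel)"
   by (rule nn_integral_add) auto
  also have "(\<integral>\<^sup>+x. ennreal (indicator U (x + y n) * (1 - indicator U (x + y n + - y n))) \<partial>lborel) =
   (\<integral>\<^sup>+x. ennreal (indicator U x * (1 - indicator U (x + - y n))) \<partial>lborel)"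
   by (rule nn_integral_lborel_translate[where f="%x. ennreal (indicator U x * (1 - indicator U (x + - y n)))"]) auto
  finally show ?thesis .
 qed
 show ?thesis unfolding eq
  by (intro ennreal_tendsto_0_add indicator_open_translation U y y')
qed

text \<open>Outer regularity reduces a Borel set to an open one. The excess \<open>U - A\<close>
  enters twice, shifted and unshifted, so it is chosen of measure below e / 2.\<close>

lemma indicator_translation:
 fixes A :: "'a::euclidean_space set"
 assumes A[measurable]: "A : sets borel" and fin: "emeasure lborel A < \<infinity>" and y: "y ----> 0"
 shows "(%n. \<integral>\<^sup>+x. ennreal \<bar>indicator A (x + y n) - indicator A x\<bar> \<partial>lborel) ----> 0"
proof (rule ennreal_tendsto_0_approx)
 fix e :: real assume e: "0 < e"
 obtain U where U: "open U" "A \<subseteq> U" "emeasure lborel (U - A) < ennreal (e / 2)"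
  using outer_regular_lborel[OF A, of "e / 2"] e by auto
 then have [measurable]: "U : sets borel" by simp
 have "emeasure lborel U = emeasure lborel A + emeasure lborel (U - A)"
  using U by (subst plus_emeasure) (auto intro!: arg_cong[where f="emeasure lborel"])
 also have "... < \<infinity>" using fin U(3) by (auto simp: less_top[symmetric])
 finally have Ufin: "emeasure lborel U < \<infinity>" .
 let ?w = "%n. \<integral>\<^sup>+x. ennreal \<bar>indicator U (x + y n) - indicator U x\<bar> \<partial>lborel"
 have "(\<integral>\<^sup>+x. ennreal \<bar>indicator A (x + y n) - indicator A x\<bar> \<partial>lborel) <= ?w n + ennreal e" for n
 proof -
  have "(\<integral>\<^sup>+x. ennreal \<bar>indicator A (x + y n) - indicator A x\<bar> \<partial>lborel) <=
   (\<integral>\<^sup>+x. ennreal \<bar>indicator U (x + y n) - indicator U x\<bar> +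
    (indicator (U - A) (x + y n) + indicator (U - A) x) \<partial>lborel)"
   using U(2) by (intro nn_integral_mono) (auto simp: indicator_def split: if_splits)
  also have "... = ?w n + ((\<integral>\<^sup>+x. indicator (U - A) (x + y n) \<partial>lborel) + (\<integral>\<^sup>+x. indicator (U - A) x \<partial>lborel))"
   by (subst nn_integral_add, simp, simp)+ simp
  also have "(\<integral>\<^sup>+x. indicator (U - A) (x + y n) \<partial>lborel) = (\<integral>\<^sup>+x. indicator (U - A) x \<partial>lborel)"
   by (rule nn_integral_lborel_translate) simp
  also have "(\<integral>\<^sup>+x. indicator (U - A) x \<partial>lborel) = emeasure lborel (U - A)" by simp
  also have "emeasure lborel (U - A) + emeasure lborel (U - A) <= ennreal (e / 2) + ennreal (e / 2)"
   using U(3) by (intro add_mono) auto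
  also have "... = ennreal e" using e by (simp add: ennreal_plus[symmetric] del: ennreal_plus)
  finally show ?thesis by (simp add: add_left_mono)
 qed
 with indicator_translation_open[OF U(1) Ufin y]
 show "EX b. b ----> 0 & (ALL n. (\<integral>\<^sup>+x. ennreal \<bar>indicator A (x + y n) - indicator A x\<bar> \<partial>lborel) <= b n + ennreal e)"
  by blast
qed

lemma lborel_L1_translation:
 fixes f :: "'a::euclidean_space => 'b::euclidean_space"
 assumes "integrable lborel f" and y: "y ----> 0"
 shows "(%n. \<integral>\<^sup>+x. ennreal (norm (f (x + y n) - f x)) \<partial>lborel) ----> 0"
 using assms(1)
proof (induction rule: integrable_induct)
 case (base A c)
 then have [measurable]: "A : sets borel" by simp
 have "(\<integral>\<^sup>+x. ennreal (norm (indicator A (x + y n) *R c - indicator A x *R c)) \<partial>lborel) =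
  ennreal (norm c) * (\<integral>\<^sup>+x. ennreal \<bar>indicator A (x + y n) - indicator A x\<bar> \<partial>lborel)" for n
  by (subst nn_integral_cmult[symmetric])
   (auto simp: scaleR_diff_left[symmetric] ennreal_mult[symmetric] mult.commute intro!: nn_integral_cong)
 then show ?case
  using base y by (simp add: ennreal_tendsto_0_cmult indicator_translation)
next
 case (add f g)
 then have [measurable]: "f : Borel" "g : Borel" by auto
 show ?case
 proof (rule ennreal_tendsto_0_le[OF ennreal_tendsto_0_add[OF add(3,4)]])
  fix n
  have "(\<integral>\<^sup>+x. ennreal (norm (f (x + y n) + g (x + y n) - (f x + g x))) \<partial>lborel) <=
   (\<integral>\<^sup>+x. ennreal (norm (f (x + y n) - f x)) + ennreal (norm (g (x + y n) - g x)) \<partial>lborel)"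
  proof (rule nn_integral_mono)
   fix x
   show "ennreal (norm (f (x + y n) + g (x + y n) - (f x + g x))) <=
    ennreal (norm (f (x + y n) - f x)) + ennreal (norm (g (x + y n) - g x))"
    by (simp add: ennreal_plus[symmetric] norm_diff_triangle_ineq del: ennreal_plus)
  qed
  also have "... = (\<integral>\<^sup>+x. ennreal (norm (f (x + y n) - f x)) \<partial>lborel) + (\<integral>\<^sup>+x. ennreal (norm (g (x + y n) - g x)) \<partial>lborel)"
   by (rule nn_integral_add) auto
  finally show "(\<integral>\<^sup>+x. ennreal (norm (f (x + y n) + g (x + y n) - (f x + g x))) \<partial>lborel) <= ..." .
 qed
next
 case (lim f s)
 then have [measurable]: "f : Borel" "!!i. s i : Borel" by auto
 have conv: "(%i. \<integral>\<^sup>+x. ennreal (norm (f x - s i x)) \<partial>lborel) ----> 0"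
  using lim by (intro nn_integral_dominated_convergence_norm[where w="%x. 2 * norm (f x)"])
   (auto simp: integrable_iff_bounded ennreal_mult nn_integral_cmult ennreal_mult_less_top)
 show ?case
 proof (rule ennreal_tendsto_0_approx)
  fix e :: real assume e: "0 < e"
  then obtain i where i: "(\<integral>\<^sup>+x. ennreal (norm (f x - s i x)) \<partial>lborel) < ennreal (e / 2)"
   using ennreal_tendsto_0_ex[OF conv, of "e / 2"] by auto
  have "(\<integral>\<^sup>+x. ennreal (norm (f (x + y n) - f x)) \<partial>lborel) <=
   (\<integral>\<^sup>+x. ennreal (norm (s i (x + y n) - s i x)) \<partial>lborel) + ennreal e" for n
  proof -
   have "(\<integral>\<^sup>+x. ennreal (norm (f (x + y n) - f x)) \<partial>lborel) <=
    (\<integral>\<^sup>+x. ennreal (norm (s i (x + y n) - s i x)) + (ennreal (norm (f (x + y n) - s i (x + y n))) +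
     ennreal (norm (f x - s i x))) \<partial>lborel)"
   proof (rule nn_integral_mono)
    fix x
    have "norm (f (x + y n) - f x) <= norm (s i (x + y n) - s i x) + (norm (f (x + y n) - s i (x + y n)) + norm (f x - s i x))"
     using norm_triangle_ineq[of "s i (x + y n) - s i x" "(f (x + y n) - s i (x + y n)) - (f x - s i x)"]
      norm_triangle_ineq4[of "f (x + y n) - s i (x + y n)" "f x - s i x"] by (simp add: algebra_simps)
    then show "ennreal (norm (f (x + y n) - f x)) <= ennreal (norm (s i (x + y n) - s i x)) +
     (ennreal (norm (f (x + y n) - s i (x + y n))) + ennreal (norm (f x - s i x)))"
     by (simp add: ennreal_plus[symmetric] del: ennreal_plus)
   qed
   also have "... = (\<integral>\<^sup>+x. ennreal (norm (s i (x + y n) - s i x)) \<partial>lborel) +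
    ((\<integral>\<^sup>+x. ennreal (norm (f (x + y n) - s i (x + y n))) \<partial>lborel) + (\<integral>\<^sup>+x. ennreal (norm (f x - s i x)) \<partial>lborel))"
    by (subst nn_integral_add, simp, simp)+ simp
   also have "(\<integral>\<^sup>+x. ennreal (norm (f (x + y n) - s i (x + y n))) \<partial>lborel) = (\<integral>\<^sup>+x. ennreal (norm (f x - s i x)) \<partial>lborel)"
    by (rule nn_integral_lborel_translate[where f="%x. ennreal (norm (f x - s i x))"]) simp
   also have "(\<integral>\<^sup>+x. ennreal (norm (f x - s i x)) \<partial>lborel) + (\<integral>\<^sup>+x. ennreal (norm (f x - s i x)) \<partial>lborel) <=
    ennreal (e / 2) + ennreal (e / 2)"
    using i by (intro add_mono) auto
   also have "... = ennreal e" using e by (simp add: ennreal_plus[symmetric] del: ennreal_plus)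
   finally show ?thesis by (simp add: add_left_mono)
  qed
  with lim.IH[of i] show "EX b. b ----> 0 & (ALL n. (\<integral>\<^sup>+x. ennreal (norm (f (x + y n) - f x)) \<partial>lborel) <= b n + ennreal e)"
   by blast
 qed
qed

text \<open>Cutting \<open>f\<close> off outside \<open>cell\<close> brings the problem to the whole
  space, at the price of points whose shift leaves \<open>cell\<close>. Their contribution
  \<open>D n\<close> lives near the faces and vanishes by dominated convergence, because the faces
  are null.\<close>

lemma torus_L1_translation:
 fixes f :: "'a::euclidean_space => 'b::euclidean_space"
 assumes f: "f : Lp_torus 1" and y: "y ----> 0"
 shows "(%n. pmass 1 (%x. f (x + y n) - f x)) ----> 0"
proof -
 note [measurable] = Lp_torusD(2)[OF f]
 define F where "F x = indicator cell x *R f x" for x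
 have [measurable]: "F : Borel" unfolding F_def by measurable
 have "integrable torus f"
  using Lp_torusD[OF f] by (auto simp: pmass_def integrable_iff_bounded)
 then have F: "integrable lborel F"
  unfolding F_def by (simp add: integrable_torus)
 define h where "h x = ennreal (norm (f x))" for x
 have [measurable]: "h : Borel" unfolding h_def by measurable
 have hfin: "(\<oint>x. h x) < \<infinity>"
  using Lp_torusD[OF f] by (simp add: pmass_def h_def)
 define D where "D n = (\<integral>\<^sup>+u. h u * indicator cell u * (1 - indicator cell (u - y n)) \<partial>lborel)" for n
 have D: "D ----> 0"
 proof -
  have "D ----> (\<integral>\<^sup>+u. 0 \<partial>(lborel :: 'a measure))"
   unfolding D_def
  proof (rule nn_integral_dominated_convergence[where w="%u. h u * indicator cell u"])
   show "(\<integral>\<^sup>+u. h u * indicator cell u \<partial>lborel) < \<infinity>"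
    using hfin by (simp add: nn_integral_torus)
   have "AE u in lborel. ALL b:Basis. u \<bullet> b ~= pi & u \<bullet> b ~= - (pi :: real)"
    by (intro AE_finite_allI AE_conjI AE_lborel_inner_neq) auto
   then show "AE u in lborel. (%n. h u * indicator cell u * (1 - indicator cell (u - y n))) ----> 0"
   proof eventually_elim
    case (elim u)
    show ?case
    proof (cases "u : cell")
     case True
     then have "u : box (- (pi *R One)) (pi *R One)"
      using elim by (force simp: mem_cell mem_box)
     moreover have "(%n. u - y n) ----> u - 0" by (intro tendsto_intros y)
     ultimately have "\<forall>\<^sub>F n in sequentially. u - y n : box (- (pi *R One)) (pi *R One)"
      using topological_tendstoD[OF _ open_box] by auto
     then have "\<forall>\<^sub>F n in sequentially. h u * indicator cell u * (1 - indicator cell (u - y n)) = 0"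
     proof eventually_elim
      case (elim n)
      then have "u - y n : cell" unfolding cell_def using box_subset_cbox by blast
      then show ?case by simp
     qed
     then show ?thesis by (simp add: tendsto_eventually)
    qed simp
   qed
  qed (auto simp: indicator_def)
  then show ?thesis by simp
 qed
 \<comment> \<open>The mass that shifted points of \<open>cell\<close> see outside equals the mass
   inside that they no longer see: adding the common part \<open>E\<close> gives the integral over
   one period in both cases, and \<open>E\<close> is finite.\<close>
 have *: "(\<integral>\<^sup>+x. h (x + y n) * indicator cell x * (1 - indicator cell (x + y n)) \<partial>lborel) = D n" for n
 proof -
  define E where "E = (\<integral>\<^sup>+u. h u * indicator cell u * indicator cell (u - y n) \<partial>lborel)"
  have "(\<oint>x. h x) = (\<integral>\<^sup>+u. h u * indicator cell u * indicator cell (u - y n) +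
    h u * indicator cell u * (1 - indicator cell (u - y n)) \<partial>lborel)"
   unfolding nn_integral_torus by (intro nn_integral_cong) (auto simp: indicator_def)
  also have "... = E + D n" unfolding E_def D_def by (rule nn_integral_add) auto
  finally have 1: "(\<oint>x. h x) = E + D n" .
  have "(\<oint>x. h x) = (\<oint>x. h (x + y n))"
   by (rule nn_integral_torus_translate[symmetric])
    (auto simp: h_def intro: periodic_compose[OF Lp_torusD(1)[OF f]])
  also have "... = (\<integral>\<^sup>+x. h (x + y n) * indicator cell (x + y n) * indicator cell (x + y n - y n) +
    h (x + y n) * indicator cell x * (1 - indicator cell (x + y n)) \<partial>lborel)"
   unfolding nn_integral_torus by (intro nn_integral_cong) (auto simp: indicator_def)
  also have "... = (\<integral>\<^sup>+x. h (x + y n) * indicator cell (x + y n) * indicator cell (x + y n - y n) \<partial>lborel) +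
    (\<integral>\<^sup>+x. h (x + y n) * indicator cell x * (1 - indicator cell (x + y n)) \<partial>lborel)"
   by (rule nn_integral_add) auto
  also have "(\<integral>\<^sup>+x. h (x + y n) * indicator cell (x + y n) * indicator cell (x + y n - y n) \<partial>lborel) = E"
   unfolding E_def
   by (rule nn_integral_lborel_translate[where f="%u. h u * indicator cell u * indicator cell (u - y n)"]) auto
  finally have 2: "(\<oint>x. h x) = E + (\<integral>\<^sup>+x. h (x + y n) * indicator cell x * (1 - indicator cell (x + y n)) \<partial>lborel)" .
  have "E ~= top" using 1 hfin by (auto simp: less_top[symmetric])
  then show ?thesis using 1 2 by (simp add: ennreal_add_left_cancel)
 qed
 show ?thesis
 proof (rule ennreal_tendsto_0_le[OF ennreal_tendsto_0_add[OF lborel_L1_translation[OF F y] D]])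
  fix n
  have "pmass 1 (%x. f (x + y n) - f x) <= (\<integral>\<^sup>+x. ennreal (norm (F (x + y n) - F x)) +
    h (x + y n) * indicator cell x * (1 - indicator cell (x + y n)) \<partial>lborel)"
   unfolding pmass_def nn_integral_torus
  proof (rule nn_integral_mono)
   fix x
   have "ennreal (norm (f (x + y n) - f x)) <= ennreal (norm (f x)) + ennreal (norm (f (x + y n)))"
    using norm_triangle_ineq4[of "f (x + y n)" "f x"]
    by (simp add: ennreal_plus[symmetric] add.commute del: ennreal_plus)
   then show "ennreal (norm (f (x + y n) - f x) ^ 1) * indicator cell x
    <= ennreal (norm (F (x + y n) - F x)) + h (x + y n) * indicator cell x * (1 - indicator cell (x + y n))"
    by (auto simp: F_def h_def indicator_def)
  qed
  also have "... = (\<integral>\<^sup>+x. ennreal (norm (F (x + y n) - F x)) \<partial>lborel) + D n"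
   unfolding *[symmetric] by (rule nn_integral_add) auto
  finally show "pmass 1 (%x. f (x + y n) - f x) <= ..." .
 qed
qed

text \<open>Truncation at height \<open>R\<close>. The bounded part reduces to exponent 1 because
  its differences are at most 2 R; the remainder is small, uniformly in the shift, by translation
  invariance.\<close>

lemma torus_Lp_translation:
 fixes f :: "'a::euclidean_space => 'b::euclidean_space"
 assumes f: "f : Lp_torus p" and p: "0 < p" and y: "y ----> 0"
 shows "(%n. pmass p (%x. f (x + y n) - f x)) ----> 0"
proof (rule ennreal_tendsto_0_approx)
 fix e :: real assume e: "0 < e"
 note [measurable] = Lp_torusD(2)[OF f]
 note per = Lp_torusD(1)[OF f]
 define g where "g R x = (if norm (f x) <= real R then f x else 0)" for R x
 define r where "r R x = (if norm (f x) <= real R then 0 else f x)" for R x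
 have [measurable]: "g R : Borel" "r R : Borel" for R
  unfolding g_def r_def by measurable
 have pg: "periodic (g R)" "periodic (r R)" for R
  unfolding g_def r_def by (auto intro: periodic_compose[OF per])
 have "(%R. pmass p (r R)) ----> (\<integral>\<^sup>+x. 0 \<partial>(torus :: 'a measure))"
  unfolding pmass_def
 proof (rule nn_integral_dominated_convergence[where w="%x. ennreal (norm (f x) ^ p)"])
  show "(\<oint>x. ennreal (norm (f x) ^ p)) < \<infinity>" using Lp_torusD(3)[OF f] by (simp add: pmass_def)
  show "AE x in torus. (%R. ennreal (norm (r R x) ^ p)) ----> 0"
  proof (rule AE_I2)
   fix x
   obtain N where "norm (f x) <= real N" using real_arch_simple by blast
   then have "\<forall>\<^sub>F R in sequentially. ennreal (norm (r R x) ^ p) = 0"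
    using p by (intro eventually_sequentiallyI[of N]) (auto simp: r_def)
   then show "(%R. ennreal (norm (r R x) ^ p)) ----> 0" by (simp add: tendsto_eventually)
  qed
 qed (use p in \<open>auto simp: r_def\<close>)
 then have "(%R. 2 ^ p * (2 ^ p * (2 * pmass p (r R)))) ----> 0"
  by (intro ennreal_tendsto_0_cmult) (auto simp: power_less_top_ennreal)
 \<comment> \<open>The factors anticipate \<open>pmass_add\<close> and \<open>pmass_diff\<close>
   below, each of which costs 2 ^ p, and the two copies of the remainder.\<close>
 then obtain R where R: "2 ^ p * (2 ^ p * (2 * pmass p (r R))) < ennreal e"
  using ennreal_tendsto_0_ex[OF _ e] by blast
 have g1: "g R : Lp_torus 1"
  by (rule Lp_torus_bounded[where C="real R"]) (auto simp: g_def pg intro: periodic_compose[OF per])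
 define c where "c = ennreal ((2 * real R) ^ (p - 1))"
 have bnd: "pmass p (%x. f (x + y n) - f x) <= 2 ^ p * (c * pmass 1 (%x. g R (x + y n) - g R x)) + ennreal e" for n
 proof -
  have "pmass p (%x. f (x + y n) - f x) = pmass p (%x. (g R (x + y n) - g R x) + (r R (x + y n) - r R x))"
   by (rule arg_cong[where f="pmass p"]) (auto simp: g_def r_def fun_eq_iff)
  also have "... <= 2 ^ p * (pmass p (%x. g R (x + y n) - g R x) + pmass p (%x. r R (x + y n) - r R x))"
   by (rule pmass_add) auto
  also have "pmass p (%x. r R (x + y n) - r R x) <= 2 ^ p * (pmass p (%x. r R (x + y n)) + pmass p (r R))"
   by (rule pmass_diff) auto
  also have "pmass p (%x. r R (x + y n)) = pmass p (r R)"
   by (rule pmass_translate) (auto simp: pg)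
  also have "pmass p (%x. g R (x + y n) - g R x) <= c * pmass 1 (%x. g R (x + y n) - g R x)"
  proof -
   have "pmass p (%x. g R (x + y n) - g R x) <= (\<oint>x. c * ennreal (norm (g R (x + y n) - g R x) ^ 1))"
    unfolding pmass_def
   proof (rule nn_integral_mono)
    fix x
    let ?d = "norm (g R (x + y n) - g R x)"
    have "norm (g R u) <= real R" for u by (simp add: g_def)
    then have "?d <= 2 * real R"
     using norm_triangle_ineq4[of "g R (x + y n)" "g R x"] by (smt (verit))
    then have "?d ^ (p - 1) * ?d <= (2 * real R) ^ (p - 1) * ?d"
     by (intro mult_right_mono power_mono) auto
    moreover have "?d ^ (p - 1) * ?d = ?d ^ p"
     using p by (metis power_minus_mult)
    ultimately show "ennreal (?d ^ p) <= c * ennreal (?d ^ 1)"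
     unfolding c_def by (simp add: ennreal_mult[symmetric])
   qed
   then show ?thesis unfolding pmass_def by (simp add: nn_integral_cmult)
  qed
  finally have "pmass p (%x. f (x + y n) - f x) <= 2 ^ p * (c * pmass 1 (%x. g R (x + y n) - g R x) + 2 ^ p * (pmass p (r R) + pmass p (r R)))"
   by (simp add: add_mono mult_left_mono)
  also have "... = 2 ^ p * (c * pmass 1 (%x. g R (x + y n) - g R x)) + 2 ^ p * (2 ^ p * (2 * pmass p (r R)))"
   by (simp add: distrib_left mult_2)
  also have "... <= 2 ^ p * (c * pmass 1 (%x. g R (x + y n) - g R x)) + ennreal e"
   using R by (intro add_left_mono) auto
  finally show ?thesis .
 qed
 have "(%n. 2 ^ p * (c * pmass 1 (%x. g R (x + y n) - g R x))) ----> 0"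
  by (intro ennreal_tendsto_0_cmult torus_L1_translation g1 y) (auto simp: c_def power_less_top_ennreal)
 with bnd show "EX b. b ----> 0 & (ALL n. pmass p (%x. f (x + y n) - f x) <= b n + ennreal e)" by blast
qed

section \<open>Averages of translates\<close>

text \<open>The trigonometric mollifier and the segment average are both averages over random
  shifts; contraction and convergence are proved once for all such laws.\<close>

locale shift_measure = prob_space \<mu> for \<mu> :: "'a::euclidean_space measure" +
 assumes sets_eq [measurable_cong]: "sets \<mu> = sets borel"

definition avg :: "'a measure => ('a::euclidean_space => 'b::euclidean_space) => 'a => 'b" where
 "avg \<mu> f x = (LINT y|\<mu>. f (x + y))"

lemma periodic_avg: "periodic f ==> periodic (avg \<mu> f)"
 unfolding avg_def periodic_def
proof (intro allI ballI)
 fix x b assume *: "ALL x. ALL b:Basis. f (x + (2 * pi) *R b) = f x" and b: "b : (Basis :: 'a set)"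
 have "f (x + (2 * pi) *R b + y) = f (x + y)" for y
 proof -
  have "x + (2 * pi) *R b + y = (x + y) + (2 * pi) *R b" by simp
  then show ?thesis using * b by metis
 qed
 then show "(LINT y|\<mu>. f (x + (2 * pi) *R b + y)) = (LINT y|\<mu>. f (x + y))" by simp
qed

context shift_measure
begin

lemma space_eq [simp]: "space \<mu> = UNIV"
 using sets_eq_imp_space_eq[OF sets_eq] by simp

lemma borel_measurable_avg [measurable (raw)]:
 assumes [measurable]: "f : Borel"
 shows "avg \<mu> f : Borel"
 unfolding avg_def by measurable

lemma pair_torus: "pair_sigma_finite torus \<mu>"
 by (intro pair_sigma_finite.intro sigma_finite_torus) unfold_locales

lemma nn_integral_square_le:
 assumes [measurable]: "g : Borel"
 shows "(\<integral>\<^sup>+y. g y \<partial>\<mu>)\<^sup>2 <= (\<integral>\<^sup>+y. (g y)\<^sup>2 \<partial>\<mu>)"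
 using Cauchy_Schwarz_nn_integral[of g \<mu> "%_. 1"] emeasure_space_1 by simp

text \<open>Jensen's inequality, obtained from Cauchy-Schwarz against the constant 1: one
  application for the square, two for the fourth power.\<close>

lemma nn_integral_power_le:
 assumes [measurable]: "g : Borel" and p: "p : {2, 4}"
 shows "(\<integral>\<^sup>+y. g y \<partial>\<mu>) ^ p <= (\<integral>\<^sup>+y. g y ^ p \<partial>\<mu>)"
proof (cases "p = 2")
 case False
 then have p: "p = 4" using p by simp
 have "(\<integral>\<^sup>+y. g y \<partial>\<mu>) ^ 4 = ((\<integral>\<^sup>+y. g y \<partial>\<mu>)\<^sup>2)\<^sup>2"
  by (simp flip: power_mult)
 also have "... <= (\<integral>\<^sup>+y. (g y)\<^sup>2 \<partial>\<mu>)\<^sup>2"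
  by (intro power_mono nn_integral_square_le) auto
 also have "... <= (\<integral>\<^sup>+y. ((g y)\<^sup>2)\<^sup>2 \<partial>\<mu>)"
  by (intro nn_integral_square_le) auto
 also have "... = (\<integral>\<^sup>+y. g y ^ 4 \<partial>\<mu>)"
  by (simp flip: power_mult)
 finally show ?thesis by (simp add: p)
qed (simp add: nn_integral_square_le)

lemma norm_integral_power_le:
 fixes g :: "'a => 'b::euclidean_space"
 assumes [measurable]: "g : Borel" and p: "p : {2, 4}"
 shows "ennreal (norm (LINT y|\<mu>. g y) ^ p) <= (\<integral>\<^sup>+y. ennreal (norm (g y) ^ p) \<partial>\<mu>)"
proof -
 have "ennreal (norm (LINT y|\<mu>. g y)) <= (\<integral>\<^sup>+y. ennreal (norm (g y)) \<partial>\<mu>)"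
  by (cases "integrable \<mu> g") (auto intro: integral_norm_bound_ennreal simp: not_integrable_integral_eq)
 then have "ennreal (norm (LINT y|\<mu>. g y)) ^ p <= (\<integral>\<^sup>+y. ennreal (norm (g y)) \<partial>\<mu>) ^ p"
  by (intro power_mono) auto
 also have "... <= (\<integral>\<^sup>+y. ennreal (norm (g y)) ^ p \<partial>\<mu>)"
  by (rule nn_integral_power_le[OF _ p]) auto
 finally show ?thesis by (simp add: ennreal_power)
qed

lemma nn_integral_torus_swap:
 fixes g :: "'a => 'a => ennreal"
 assumes [measurable]: "case_prod g : borel_measurable (borel \<Otimes>\<^sub>M borel)"
 shows "(\<oint>x. (\<integral>\<^sup>+y. g x y \<partial>\<mu>)) = (\<integral>\<^sup>+y. (\<oint>x. g x y) \<partial>\<mu>)"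
proof -
 interpret P: pair_sigma_finite torus \<mu> by (rule pair_torus)
 have "(%z. (fst z, snd z)) : measurable (torus \<Otimes>\<^sub>M \<mu>) (borel \<Otimes>\<^sub>M borel)"
  by measurable
 then have [measurable]: "case_prod g : borel_measurable (torus \<Otimes>\<^sub>M \<mu>)"
  using measurable_comp[OF _ assms, of "%z. (fst z, snd z)" "torus \<Otimes>\<^sub>M \<mu>"] by (simp add: comp_def)
 show ?thesis using P.Fubini'[of g] by simp
qed

lemma pmass_avg_le:
 assumes [measurable]: "f : Borel" and per: "periodic f" and p: "p : {2, 4}"
 shows "pmass p (avg \<mu> f) <= pmass p f"
proof -
 have "pmass p (avg \<mu> f) <= (\<oint>x. (\<integral>\<^sup>+y. ennreal (norm (f (x + y)) ^ p) \<partial>\<mu>))"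
  unfolding pmass_def avg_def by (intro nn_integral_mono norm_integral_power_le p) auto
 also have "... = (\<integral>\<^sup>+y. (\<oint>x. ennreal (norm (f (x + y)) ^ p)) \<partial>\<mu>)"
  by (rule nn_integral_torus_swap) measurable
 also have "... = (\<integral>\<^sup>+y. pmass p f \<partial>\<mu>)"
  using pmass_translate[of f p] per by (simp add: pmass_def)
 also have "... = pmass p f"
  using emeasure_space_1 by simp
 finally show ?thesis .
qed

lemma avg_Lp_torus: "f : Lp_torus p ==> p : {2, 4} ==> avg \<mu> f : Lp_torus p"
 unfolding Lp_torus_def using pmass_avg_le[of f p] by (auto intro: periodic_avg borel_measurable_avg)

lemma AE_integrable_avg:
 assumes [measurable]: "f : Borel" and per: "periodic f" and fin: "pmass 2 f < \<infinity>"
 shows "AE x in torus. integrable \<mu> (%y. f (x + y))"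
proof -
 have "(\<oint>x. (\<integral>\<^sup>+y. ennreal (norm (f (x + y)) ^ 2) \<partial>\<mu>)) = (\<integral>\<^sup>+y. (\<oint>x. ennreal (norm (f (x + y)) ^ 2)) \<partial>\<mu>)"
  by (rule nn_integral_torus_swap) measurable
 also have "... = pmass 2 f"
  using pmass_translate[of f 2] per emeasure_space_1 by (simp add: pmass_def)
 finally have "AE x in torus. (\<integral>\<^sup>+y. ennreal (norm (f (x + y)) ^ 2) \<partial>\<mu>) ~= \<infinity>"
  using fin by (intro nn_integral_PInf_AE) auto
 then show ?thesis
 proof eventually_elim
  case (elim x)
  have "(\<integral>\<^sup>+y. ennreal (norm (f (x + y))) \<partial>\<mu>)\<^sup>2 <= (\<integral>\<^sup>+y. ennreal (norm (f (x + y)) ^ 2) \<partial>\<mu>)"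
   using nn_integral_square_le[of "%y. ennreal (norm (f (x + y)))"] by (simp add: ennreal_power)
  also have "... < \<infinity>" using elim by (simp add: less_top)
  finally show ?case by (simp add: integrable_iff_bounded power_less_top_ennreal)
 qed
qed

lemma avg_diff_AE:
 assumes "f : Lp_torus 2" "g : Lp_torus 2"
 shows "AE x in torus. avg \<mu> (%x. f x - g x) x = avg \<mu> f x - avg \<mu> g x"
proof -
 have "AE x in torus. integrable \<mu> (%y. f (x + y))" "AE x in torus. integrable \<mu> (%y. g (x + y))"
  using assms by (auto simp: Lp_torus_def intro: AE_integrable_avg)
 then show ?thesis by eventually_elim (simp add: avg_def)
qed

lemma pmass_avg_diff2:
 assumes f: "f : Lp_torus 2" and g: "g : Lp_torus 2"
 shows "pmass 2 (%x. avg \<mu> f x - avg \<mu> g x) <= pmass 2 (%x. f x - g x)"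
proof -
 have "pmass 2 (%x. avg \<mu> f x - avg \<mu> g x) = pmass 2 (avg \<mu> (%x. f x - g x))"
  by (rule pmass_cong_AE) (use avg_diff_AE[OF f g] in auto)
 also have "... <= pmass 2 (%x. f x - g x)"
  using Lp_torus_diff[OF f g] by (intro pmass_avg_le) (auto simp: Lp_torus_def)
 finally show ?thesis .
qed

lemma pmass_avg_diff_le:
 assumes [measurable]: "f : Borel" and p: "p : {2, 4}"
 shows "pmass p (%x. avg \<mu> f x - f x) <= (\<integral>\<^sup>+y. pmass p (%x. f (x + y) - f x) \<partial>\<mu>)"
proof -
 have "ennreal (norm (avg \<mu> f x - f x) ^ p) <= (\<integral>\<^sup>+y. ennreal (norm (f (x + y) - f x) ^ p) \<partial>\<mu>)" for x
 proof (cases "integrable \<mu> (%y. f (x + y))")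
  case True
  then have "avg \<mu> f x - f x = (LINT y|\<mu>. f (x + y) - f x)"
   unfolding avg_def using prob_space by simp
  then show ?thesis
   using norm_integral_power_le[of "%y. f (x + y) - f x" p] p by simp
 next
  case False
  \<comment> \<open>Here \<open>avg\<close> takes the default value 0 of the Bochner integral; the
    estimate survives because the right-hand side is infinite.\<close>
  have "\<not> integrable \<mu> (%y. f (x + y) - f x)"
   using False LB_integrable_add[of \<mu> "%y. f (x + y) - f x" "%_. f x"] by auto
  then have *: "(\<integral>\<^sup>+y. ennreal (norm (f (x + y) - f x)) \<partial>\<mu>) = \<infinity>"
   by (subst (asm) integrable_iff_bounded) (auto simp: not_less top_unique)
  have "(\<integral>\<^sup>+y. ennreal (norm (f (x + y) - f x)) ^ p \<partial>\<mu>) >= \<infinity> ^ p"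
   unfolding *[symmetric] by (rule nn_integral_power_le[OF _ p]) measurable
  moreover have "(\<infinity> :: ennreal) ^ p = \<infinity>" using p by auto
  ultimately show ?thesis by (simp add: ennreal_power top_unique)
 qed
 then have "pmass p (%x. avg \<mu> f x - f x) <= (\<oint>x. (\<integral>\<^sup>+y. ennreal (norm (f (x + y) - f x) ^ p) \<partial>\<mu>))"
  unfolding pmass_def by (intro nn_integral_mono) auto
 also have "... = (\<integral>\<^sup>+y. (\<oint>x. ennreal (norm (f (x + y) - f x) ^ p)) \<partial>\<mu>)"
  by (rule nn_integral_torus_swap) measurable
 finally show ?thesis by (simp add: pmass_def)
qed

end

text \<open>The modulus of translation \<open>\<omega>\<close> is bounded everywhere and small near
  0, so averaging it against a law that concentrates at 0 leaves \<open>C\<close> times the outer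
  mass plus \<open>e\<close>. The limit in n and the limit in h are both instances.\<close>

lemma pmass_avg_tendsto:
 assumes f: "f : Lp_torus p" and p: "p : {2, 4}"
  and \<mu>: "!!n. shift_measure (\<mu> n)"
  and conc: "!!\<delta>. 0 < \<delta> ==> (%n. emeasure (\<mu> n) {y. \<delta> <= norm y}) ----> 0"
 shows "(%n. pmass p (%x. avg (\<mu> n) f x - f x)) ----> 0"
proof (rule ennreal_tendsto_0_approx)
 fix e :: real assume e: "0 < e"
 note [measurable] = Lp_torusD(2)[OF f]
 define \<omega> where "\<omega> y = pmass p (%x. f (x + y) - f x)" for y
 have [measurable]: "\<omega> : Borel"
  unfolding \<omega>_def pmass_def
  by (rule sigma_finite_measure.borel_measurable_nn_integral[OF sigma_finite_torus]) measurable
 define C where "C = 2 ^ p * (pmass p f + pmass p f)"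
 have C: "\<omega> y <= C" for y
  unfolding \<omega>_def C_def
  using pmass_diff[of "%x. f (x + y)" f p] pmass_translate[of f p y] Lp_torusD[OF f] by simp
 have Cfin: "C < \<infinity>"
  using Lp_torusD[OF f] by (auto simp: C_def ennreal_mult_less_top power_less_top_ennreal)
 have "EX \<delta>>0. ALL y. norm y < \<delta> --> \<omega> y < ennreal e"
 proof (rule ccontr)
  assume "\<not> ?thesis"
  then have "ALL k::nat. EX y. norm y < 1 / Suc k & \<not> \<omega> y < ennreal e"
   by (metis of_nat_0_less_iff zero_less_Suc zero_less_divide_1_iff)
  then obtain y where y: "!!k::nat. norm (y k) < 1 / Suc k" "!!k. \<not> \<omega> (y k) < ennreal e" by metis
  have "y ----> 0"
  proof (rule Lim_null_comparison)
   show "\<forall>\<^sub>F k in sequentially. norm (y k) <= 1 / Suc k"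
    using y(1) by (auto intro!: always_eventually less_imp_le)
   show "(%k. 1 / real (Suc k)) ----> 0"
    using LIMSEQ_inverse_real_of_nat by (simp add: inverse_eq_divide)
  qed
  from torus_Lp_translation[OF f _ this] p have "(%k. \<omega> (y k)) ----> 0"
   by (auto simp: \<omega>_def)
  from ennreal_tendsto_0_ex[OF this e] y(2) show False by blast
 qed
 then obtain \<delta> where \<delta>: "0 < \<delta>" "!!y. norm y < \<delta> ==> \<omega> y < ennreal e" by blast
 have "pmass p (%x. avg (\<mu> n) f x - f x) <= C * emeasure (\<mu> n) {y. \<delta> <= norm y} + ennreal e" for n
 proof -
  interpret shift_measure "\<mu> n" by (rule \<mu>)
  have "pmass p (%x. avg (\<mu> n) f x - f x) <= (\<integral>\<^sup>+y. \<omega> y \<partial>\<mu> n)"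
   unfolding \<omega>_def by (rule pmass_avg_diff_le[OF _ p]) measurable
  also have "... <= (\<integral>\<^sup>+y. C * indicator {y. \<delta> <= norm y} y + ennreal e \<partial>\<mu> n)"
  proof (rule nn_integral_mono)
   fix y
   show "\<omega> y <= C * indicator {y. \<delta> <= norm y} y + ennreal e"
   proof (cases "\<delta> <= norm y")
    case True
    then show ?thesis using C[of y] add_increasing2[of "ennreal e" "\<omega> y" C] by simp
   next
    case False
    then show ?thesis using \<delta>(2)[of y] by (simp add: less_imp_le)
   qed
  qed
  also have "... = (\<integral>\<^sup>+y. C * indicator {y. \<delta> <= norm y} y \<partial>\<mu> n) + (\<integral>\<^sup>+y. ennreal e \<partial>\<mu> n)"
   by (rule nn_integral_add) auto
  also have "... = C * emeasure (\<mu> n) {y. \<delta> <= norm y} + ennreal e"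
   using emeasure_space_1 by (simp add: nn_integral_cmult_indicator)
  finally show ?thesis .
 qed
 moreover have "(%n. C * emeasure (\<mu> n) {y. \<delta> <= norm y}) ----> 0"
  by (intro ennreal_tendsto_0_cmult conc \<delta> Cfin)
 ultimately show "EX b. b ----> 0 & (ALL n. pmass p (%x. avg (\<mu> n) f x - f x) <= b n + ennreal e)" by blast
qed

text \<open>The uniform law on the segment from h a e to h b e. The symmetric choice (-1, 1)
  regularises the solution; the one-sided choice (0, 1) appears on the divergence once a shift has
  been moved onto the vertical velocity.\<close>

definition segm :: "real => real => real => 'a::euclidean_space => 'a measure" where
 "segm a b h e = distr (uniform_measure lborel {a..b}) borel (%s. (h * s) *R e)"

lemma shift_measure_segm: "a < b ==> shift_measure (segm a b h e)"
 unfolding segm_def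
 by (intro shift_measure.intro prob_space.prob_space_distr prob_space_uniform_measure shift_measure_axioms.intro) auto

lemma avg_segm:
 fixes f :: "'a::euclidean_space => 'b::euclidean_space"
 assumes [measurable]: "f : Borel" and "a < b"
 shows "avg (segm a b h e) f x = (LINT s:{a..b}|lborel. f (x + (h * s) *R e)) /\<^sub>R (b - a)"
proof -
 have "avg (segm a b h e) f x = (LINT s|uniform_measure lborel {a..b}. f (x + (h * s) *R e))"
  unfolding avg_def segm_def by (subst integral_distr) auto
 also have "... = (LINT s:{a..b}|lborel. f (x + (h * s) *R e)) /\<^sub>R measure lborel {a..b}"
 proof -
  have "uniform_measure lborel {a..b} = density lborel (%x. ennreal (indicator {a..b} x / (b - a)))"
   unfolding uniform_measure_def using \<open>a < b\<close>
   by (intro density_cong) (auto simp: indicator_def divide_ennreal[symmetric] ennreal_1[symmetric] simp del: ennreal_1)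
  then have "(LINT s|uniform_measure lborel {a..b}. f (x + (h * s) *R e)) =
   (LINT s|lborel. (indicator {a..b} s / (b - a)) *R f (x + (h * s) *R e))"
   using \<open>a < b\<close> by (simp, subst integral_density) auto
  also have "... = (LINT s|lborel. inverse (b - a) *R (indicator {a..b} s *R f (x + (h * s) *R e)))"
   by (simp add: divide_inverse mult.commute)
  also have "... = (LINT s:{a..b}|lborel. f (x + (h * s) *R e)) /\<^sub>R (b - a)"
   unfolding set_lebesgue_integral_def by (rule integral_scaleR_right)
  finally show ?thesis using \<open>a < b\<close> by simp
 qed
 finally show ?thesis using \<open>a < b\<close> by simp
qed

lemma emeasure_segm_far:
 assumes "a < b" "h * max \<bar>a\<bar> \<bar>b\<bar> * norm e < \<delta>" "0 <= h"
 shows "emeasure (segm a b h e) {y. \<delta> <= norm y} = 0"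
proof -
 have "emeasure (segm a b h e) {y. \<delta> <= norm y} = emeasure (uniform_measure lborel {a..b}) {s. \<delta> <= norm ((h * s) *R e)}"
  unfolding segm_def by (subst emeasure_distr) (auto intro!: arg_cong2[where f=emeasure])
 also have "... = emeasure lborel ({a..b} \<inter> {s. \<delta> <= norm ((h * s) *R e)}) / emeasure lborel {a..b}"
  by (subst emeasure_uniform_measure) auto
 also have "{a..b} \<inter> {s. \<delta> <= norm ((h * s) *R e)} = {}"
 proof -
  have "norm ((h * s) *R e) < \<delta>" if "s : {a..b}" for s
  proof -
   have "\<bar>s\<bar> <= max \<bar>a\<bar> \<bar>b\<bar>" using that by auto
   then have "h * \<bar>s\<bar> * norm e <= h * max \<bar>a\<bar> \<bar>b\<bar> * norm e"
    using \<open>0 <= h\<close> by (intro mult_right_mono mult_left_mono) auto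
   then show ?thesis using assms by (simp add: abs_mult)
  qed
  then show ?thesis by (fastforce simp: not_le)
 qed
 finally show ?thesis by simp
qed

lemma segm_tendsto:
 assumes "a < b" "h ----> 0" "!!n. 0 <= h n" "0 < \<delta>"
 shows "(%n. emeasure (segm a b (h n) e) {y. \<delta> <= norm y}) ----> 0"
proof -
 have "(%n. h n * max \<bar>a\<bar> \<bar>b\<bar> * norm e) ----> 0 * max \<bar>a\<bar> \<bar>b\<bar> * norm e"
  by (intro tendsto_intros assms)
 then have "\<forall>\<^sub>F n in sequentially. h n * max \<bar>a\<bar> \<bar>b\<bar> * norm e < \<delta>"
  using assms by (intro order_tendstoD) auto
 then have "\<forall>\<^sub>F n in sequentially. emeasure (segm a b (h n) e) {y. \<delta> <= norm y} = 0"
  by eventually_elim (intro emeasure_segm_far assms)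
 then show ?thesis by (simp add: tendsto_eventually)
qed

section \<open>A polynomial approximate identity\<close>

text \<open>The mean of (1 + cos) / 2 over the coordinates: a trigonometric polynomial with values
  in [0, 1] that reaches 1 in \<open>cell\<close> only at 0. Its normalised powers form an
  approximate identity made of trigonometric polynomials.\<close>

definition bump :: "'a::euclidean_space => real" where
 "bump y = (\<Sum>b\<in>Basis. (1 + cos (y \<bullet> b)) / (2 * real DIM('a)))"

lemma tp_bump: "tp bump"
 unfolding bump_def
proof (rule tp_sum)
 fix b :: 'a assume "b : Basis"
 then have "tp (%y. cos (y \<bullet> b))" using tp_cos[of b 1] by simp
 then have "tp (%y. 1 / (2 * real DIM('a)) * (1 + cos (y \<bullet> b)))"
  by (intro tp_scale tp_add tp_const)
 then show "tp (%y. (1 + cos (y \<bullet> b)) / (2 * real DIM('a)))" by simp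
qed

lemma bump_nonneg: "0 <= bump y"
proof -
 have "0 <= 1 + cos (y \<bullet> b)" for b
  using cos_ge_minus_one[of "y \<bullet> b"] by linarith
 then show ?thesis unfolding bump_def by (intro sum_nonneg divide_nonneg_nonneg) auto
qed

lemma bump_term_le: "(1 + cos (y \<bullet> b)) / (2 * real DIM('a::euclidean_space)) <= 1 / real DIM('a)"
 using cos_le_one[of "y \<bullet> b"] by (simp add: divide_simps)

lemma bump_0 [simp]: "bump 0 = 1"
 by (simp add: bump_def)

lemma bump_minus [simp]: "bump (- y) = bump y"
 by (simp add: bump_def)

lemma bump_lt_1:
 assumes "y : cell" "y ~= (0 :: 'a::euclidean_space)"
 shows "bump y < 1"
proof -
 obtain b where b: "b : (Basis :: 'a set)" "y \<bullet> b ~= 0"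
  using assms by (metis euclidean_all_zero_iff)
 have "- pi <= y \<bullet> b" "y \<bullet> b <= pi" using assms b by (auto simp: mem_cell)
 have "cos (y \<bullet> b) = cos \<bar>y \<bullet> b\<bar>" by simp
 also have "... < cos 0"
  using b \<open>- pi <= y \<bullet> b\<close> \<open>y \<bullet> b <= pi\<close> by (intro cos_monotone_0_pi) auto
 finally have *: "cos (y \<bullet> b) < 1" by simp
 have "bump y < (\<Sum>b\<in>(Basis :: 'a set). 1 / real DIM('a))"
  unfolding bump_def
 proof (rule sum_strict_mono_ex1)
  show "EX a:Basis. (1 + cos (y \<bullet> a)) / (2 * real DIM('a)) < 1 / real DIM('a)"
   using * b by (intro bexI[of _ b]) (auto simp: divide_simps)
 qed (auto intro: bump_term_le)
 then show ?thesis by simp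
qed

lemma bump_continuous: "continuous_on A bump"
 by (rule tp_continuous[OF tp_bump])

lemma bump_borel [measurable]: "bump : Borel"
 by (rule tp_borel[OF tp_bump])

definition kern :: "nat => 'a::euclidean_space => real" where
 "kern n y = bump y ^ n / (LINT u|torus. bump (u :: 'a) ^ n)"

lemma integrable_bump_power: "integrable torus (%y. bump y ^ n)"
 by (intro tp_integrable tp_power tp_bump)

lemma zero_interior_cell: "0 : interior (cell :: 'a::euclidean_space set)"
proof -
 have "(0 :: 'a) : box (- (pi *R One)) (pi *R One)"
  by (auto simp: mem_box)
 then show ?thesis unfolding cell_def interior_cbox .
qed

text \<open>Near 0 the bump exceeds any q below 1, so the integral of its n-th power decays no
  faster than q ^ n; \<open>v\<close> is the volume of such a neighbourhood.\<close>

lemma integral_bump_power_ge: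
 assumes q: "q < 1" "0 <= q"
 shows "EX v>0. ALL n. v * q ^ n <= (LINT u|torus. bump (u :: 'a::euclidean_space) ^ n)"
proof -
 have "EX d>0. ALL u::'a. dist u 0 < d --> dist (bump u) (bump 0) < 1 - q"
  using bump_continuous[of UNIV, unfolded continuous_on_iff, rule_format, of 0 "1 - q"] q by auto
 then obtain d where d0: "0 < d" "!!u::'a. dist u 0 < d ==> dist (bump u) (bump 0) < 1 - q" by blast
 have d: "0 < d" "!!u::'a. norm u < d ==> q < bump u"
 proof -
  fix u :: 'a assume "norm u < d"
  then have "\<bar>bump u - 1\<bar> < 1 - q" using d0(2)[of u] by (simp add: dist_real_def)
  then show "q < bump u" by linarith
 qed (rule d0)
 obtain r where r: "0 < r" "ball 0 r \<subseteq> (cell :: 'a set)"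
  using zero_interior_cell by (auto simp: mem_interior)
 define B where "B = ball (0 :: 'a) (min d r)"
 have BQ: "B \<subseteq> cell" using r by (auto simp: B_def)
 have [measurable]: "B : sets borel" by (simp add: B_def)
 define v where "v = measure torus B"
 have v: "0 < v"
 proof -
  have "v = measure lborel B"
   unfolding v_def torus_cell using BQ by (subst measure_restrict_space) auto
  also have "... > 0"
   using content_ball_pos[of "min d r" "0 :: 'a"] d r by (simp add: B_def)
  finally show ?thesis .
 qed
 have "v * q ^ n <= (LINT u|torus. bump (u :: 'a) ^ n)" for n
 proof -
  have B': "B : sets torus" using BQ by (auto simp: torus_cell sets_restrict_space)
  have "(LINT u|torus. q ^ n * indicator B u) <= (LINT u|torus. bump (u :: 'a) ^ n)"
  proof (rule integral_mono)
   show "integrable torus (%u. q ^ n * indicator B u)"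
    by (rule integrable_torus_bounded[where C="q ^ n"]) (use q in \<open>auto simp: indicator_def\<close>)
   fix u show "q ^ n * indicator B u <= bump u ^ n"
    using less_imp_le[OF d(2)[of u]] q bump_nonneg[of u] power_mono[of q "bump u" n]
    by (auto simp: B_def indicator_def dist_norm)
  qed (rule integrable_bump_power)
  also have "(LINT u|torus. q ^ n * indicator B u) = v * q ^ n"
   using B' BQ by (simp add: v_def Int_absorb2)
  finally show ?thesis .
 qed
 with v show ?thesis by blast
qed

lemma integral_bump_power_pos: "0 < (LINT u|torus. bump (u :: 'a::euclidean_space) ^ n)"
proof -
 obtain v where v: "v > 0" "!!n. v * (1/2) ^ n <= (LINT u|torus. bump (u :: 'a) ^ n)"
  using integral_bump_power_ge[of "1/2", where 'a='a] by auto
 have "0 < v * (1/2) ^ n" using v by simp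
 then show ?thesis using v(2)[of n] by linarith
qed

lemma kern_nonneg: "0 <= kern n y"
 unfolding kern_def by (intro divide_nonneg_nonneg zero_le_power bump_nonneg less_imp_le[OF integral_bump_power_pos])

lemma kern_minus [simp]: "kern n (- y) = kern n y"
 by (simp add: kern_def)

lemma tp_kern: "tp (kern n)"
 using tp_scale[OF tp_power[OF tp_bump], of "1 / (LINT u|torus. bump (u :: 'a) ^ n)" n]
 by (simp add: kern_def[abs_def])

lemma kern_borel [measurable]: "kern n : Borel"
 by (rule tp_borel[OF tp_kern])

lemma integral_kern: "(LINT y|torus. kern n (y :: 'a::euclidean_space)) = 1"
 using integral_bump_power_pos[of n, where 'a='a] by (simp add: kern_def)

definition kernm :: "nat => 'a::euclidean_space measure" where
 "kernm n = density lborel (%y. ennreal (kern n y * indicator cell y))"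

lemma kernm_emeasure:
 assumes [measurable]: "A : sets borel"
 shows "emeasure (kernm n) A = ennreal (LINT y|torus. kern n y * indicator A y)"
proof -
 have "emeasure (kernm n) A = (\<oint>y. ennreal (kern n y * indicator A y))"
  unfolding kernm_def nn_integral_torus
  by (subst emeasure_density) (auto intro!: nn_integral_cong simp: indicator_def)
 also have "... = ennreal (LINT y|torus. kern n y * indicator A y)"
 proof (rule nn_integral_eq_integral)
  obtain C where "!!y. \<bar>kern n (y :: 'a)\<bar> <= C" using tp_bounded[OF tp_kern] by metis
  then show "integrable torus (%y. kern n y * indicator A y)"
   by (intro integrable_torus_bounded[where C=C])
   (auto simp: indicator_def intro: order_trans[OF abs_ge_zero])
 qed (simp add: kern_nonneg)
 finally show ?thesis .
qed

lemma shift_measure_kernm: "shift_measure (kernm n)"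
proof -
 have "emeasure (kernm n) UNIV = 1"
  by (subst kernm_emeasure) (simp_all add: integral_kern)
 then show ?thesis
  by (intro shift_measure.intro shift_measure_axioms.intro prob_spaceI) (simp_all add: kernm_def)
qed

lemma kernm_tendsto:
 assumes \<delta>: "0 < \<delta>"
 shows "(%n. emeasure (kernm n :: 'a::euclidean_space measure) {y. \<delta> <= norm y}) ----> 0"
proof -
 define K where "K = (cell :: 'a set) \<inter> {y. \<delta> <= norm y}"
 have "compact K"
  unfolding K_def cell_def by (intro compact_Int_closed compact_cbox closed_Collect_le continuous_intros)
 obtain q0 where q0: "q0 < 1" "0 <= q0" "!!y. y : K ==> bump y <= q0"
 proof (cases "K = {}")
  case True
  then show ?thesis using that[of 0] by auto
 next
  case False
  then obtain z where "z : K" "!!y. y : K ==> bump y <= bump z"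
   using continuous_attains_sup[OF \<open>compact K\<close> _ bump_continuous] by blast
  moreover have "bump z < 1" using \<open>z : K\<close> \<delta> by (intro bump_lt_1) (auto simp: K_def)
  ultimately show ?thesis using that[of "bump z"] bump_nonneg by blast
 qed
 \<comment> \<open>Any value strictly between \<open>q0\<close> and 1 works: away from 0 the
   numerator of the kernel is at most q0 ^ n, while its normalisation is at least v q ^ n.\<close>
 define q where "q = (q0 + 1) / 2"
 have q: "q0 < q" "q < 1" "0 < q" using q0 by (auto simp: q_def)
 obtain v where v: "v > 0" "!!n. v * q ^ n <= (LINT u|torus. bump (u :: 'a) ^ n)"
  using integral_bump_power_ge[of q, where 'a='a] q by auto
 define c where "c = measure (torus :: 'a measure) cell"
 have bound: "(LINT y|torus. kern n y * indicator {y::'a. \<delta> <= norm y} y) <= c / v * (q0 / q) ^ n" for n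
 proof -
  have "(LINT y|torus. kern n y * indicator {y::'a. \<delta> <= norm y} y) <= (LINT y|(torus :: 'a measure). (q0 / q) ^ n / v)"
  proof (rule integral_mono)
   obtain C where "!!y. \<bar>kern n (y :: 'a)\<bar> <= C" using tp_bounded[OF tp_kern] by metis
   then show "integrable torus (%y::'a. kern n y * indicator {y. \<delta> <= norm y} y)"
    by (intro integrable_torus_bounded[where C=C])
    (auto simp: indicator_def intro: order_trans[OF abs_ge_zero])
   fix y :: 'a assume "y : space torus"
   show "kern n y * indicator {y. \<delta> <= norm y} y <= (q0 / q) ^ n / v"
   proof (cases "\<delta> <= norm y")
    case True
    then have "y : K" using \<open>y : space torus\<close> by (simp add: K_def)
    have "kern n y <= q0 ^ n / (v * q ^ n)"
     unfolding kern_def using q0 \<open>y : K\<close> v q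
     by (intro frac_le power_mono bump_nonneg) auto
    then show ?thesis using True by (simp add: power_divide field_simps)
   qed (use q0 q v in simp)
  qed simp
  then show ?thesis by (simp add: c_def mult.commute)
 qed
 have "(%n. ennreal (c / v * (q0 / q) ^ n)) ----> ennreal 0"
  using q q0 by (intro tendsto_ennrealI tendsto_mult_right_zero LIMSEQ_power_zero) auto
 then have lim: "(%n. ennreal (c / v * (q0 / q) ^ n)) ----> 0" by simp
 show ?thesis
 proof (rule ennreal_tendsto_0_le[OF lim])
  fix n
  have "{y::'a. \<delta> <= norm y} : sets borel" by measurable
  from kernm_emeasure[OF this]
  show "emeasure (kernm n) {y::'a. \<delta> <= norm y} <= ennreal (c / v * (q0 / q) ^ n)"
   using ennreal_leI[OF bound[of n]] by (simp only:)
 qed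
qed

section \<open>Trigonometric mollification and its separated kernel\<close>

definition moll :: "nat => ('a::euclidean_space => 'b::euclidean_space) => 'a => 'b" where
 "moll n f = avg (kernm n) f"

lemma pmass_moll_tendsto:
 "f : Lp_torus p ==> p : {2, 4} ==> (%n. pmass p (%x. moll n f x - f x)) ----> 0"
 unfolding moll_def by (rule pmass_avg_tendsto) (auto intro: shift_measure_kernm kernm_tendsto)

lemma moll_Lp_torus: "f : Lp_torus p ==> p : {2, 4} ==> moll n f : Lp_torus p"
 unfolding moll_def by (rule shift_measure.avg_Lp_torus[OF shift_measure_kernm])

lemma pmass_moll_le: "f : Lp_torus p ==> p : {2, 4} ==> pmass p (moll n f) <= pmass p f"
 unfolding moll_def by (rule shift_measure.pmass_avg_le[OF shift_measure_kernm]) (auto simp: Lp_torus_def)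

lemma integrable_torus_mult_tp:
 fixes f :: "'a::euclidean_space => 'b::euclidean_space"
 assumes "integrable torus f" "tp F"
 shows "integrable torus (%x. F x *R f x)"
proof -
 obtain C where C: "C >= 0" "!!x. \<bar>F x\<bar> <= C" using tp_bounded[OF assms(2)] by auto
 note [measurable] = tp_borel[OF assms(2)]
 show ?thesis
  by (rule LB_integrable_bound[where f="%x. C *R f x"])
   (use assms C in \<open>auto intro!: mult_right_mono borel_measurable_integrable\<close>)
qed

text \<open>Moves the shift from \<open>f\<close> to the kernel, where it can be expanded.
  Periodicity makes this a change of variables over one period.\<close>

lemma moll_eq:
 fixes f :: "'a::euclidean_space => 'b::euclidean_space"
 assumes [measurable]: "f : Borel" and per: "periodic f" and int: "integrable torus f"
 shows "moll n f x = (LINT y|torus. kern n (y - x) *R f y)"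
proof -
 have "moll n f x = (LINT y|lborel. (kern n y * indicator cell y) *R f (x + y))"
  unfolding moll_def avg_def kernm_def
  by (subst integral_density) (auto intro!: AE_I2 mult_nonneg_nonneg simp: kern_nonneg)
 also have "... = (LINT y|torus. kern n (y + x - x) *R f (y + x))"
  unfolding integral_torus by (simp add: mult.commute add.commute)
 also have "... = (LINT y|torus. kern n (y - x) *R f y)"
 proof (rule integral_torus_translate[where f="%y. kern n (y - x) *R f y"])
  have tp: "tp (%y. kern n (y - x))" using tp_translate[OF tp_kern, of n "- x"] by simp
  show "(%y. kern n (y - x) *R f y) : Borel" by measurable
  show "periodic (%y. kern n (y - x) *R f y)" by (rule periodic_compose2[OF tp_periodic[OF tp] per])
  show "integrable torus (%y. kern n (y - x) *R f y)" by (rule integrable_torus_mult_tp[OF int tp])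
 qed
 finally show ?thesis .
qed

text \<open>Kernels that are finite sums of F(x) F(y), with the same function in both variables.
  Scaling is by nonnegative factors, absorbed as a square root on each side. Finite rank and
  symmetry of the smoothed energy both rest on this shape.\<close>

inductive deg :: "('a::euclidean_space => 'a => real) => bool" where
 deg_base: "tp F ==> deg (%x y. F x * F y)"
| deg_add: "deg k ==> deg l ==> deg (%x y. k x y + l x y)"

lemma deg_scale: "deg k ==> 0 <= r ==> deg (%x y. r * k x y)"
proof (induction rule: deg.induct)
 case (deg_base F)
 have "deg (%x y. (sqrt r * F x) * (sqrt r * F y))"
  by (intro deg.deg_base tp_scale deg_base)
 moreover have "sqrt r * F x * (sqrt r * F y) = r * (F x * F y)" for x y
  using deg_base by (simp add: mult.left_commute mult.assoc[symmetric])
 ultimately show ?case by simp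
qed (simp add: distrib_left deg.deg_add)

lemma deg_mult_base: "deg k ==> tp G ==> deg (%x y. G x * G y * k x y)"
proof (induction rule: deg.induct)
 case (deg_base F)
 then have "deg (%x y. (G x * F x) * (G y * F y))"
  by (intro deg.deg_base tp_mult)
 then show ?case by (simp add: ac_simps)
qed (simp add: distrib_left deg.deg_add)

lemma deg_mult: "deg k ==> deg l ==> deg (%x y. k x y * l x y)"
 by (induction rule: deg.induct) (simp_all add: distrib_right deg_add deg_mult_base)

lemma deg_1: "deg (%x y. 1)"
 using deg_base[OF tp_const[of 1]] by simp

lemma deg_0: "deg (%x y. 0)"
 using deg_base[OF tp_const[of 0]] by simp

lemma deg_power: "deg k ==> deg (%x y. k x y ^ n)"
 by (induction n) (simp_all add: deg_1 deg_mult)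

lemma deg_sum: "finite I ==> (!!i. i : I ==> deg (k i)) ==> deg (%x y. \<Sum>i\<in>I. k i x y)"
 by (induction I rule: finite_induct) (simp_all add: deg_0 deg_add)

lemma deg_finite: "deg k ==> EX (m::nat) F. (ALL i<m. tp (F i)) & (ALL x y. k x y = (\<Sum>i<m. F i x * F i y))"
proof (induction rule: deg.induct)
 case (deg_base F)
 then show ?case by (intro exI[of _ 1] exI[of _ "%_. F"]) simp
next
 case (deg_add k l)
 from deg_add(3) obtain m :: nat and F where 1: "ALL i<m. tp (F i)" "ALL x y. k x y = (\<Sum>i<m. F i x * F i y)" by blast
 from deg_add(4) obtain m' :: nat and F' where 2: "ALL i<m'. tp (F' i)" "ALL x y. l x y = (\<Sum>i<m'. F' i x * F' i y)" by blast
 note * = 1 2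
 define G where "G i = (if i < m then F i else F' (i - m))" for i
 have "(\<Sum>i<m + m'. G i x * G i y) = k x y + l x y" for x y
 proof -
  have "(\<Sum>i<m + m'. G i x * G i y) = (\<Sum>i<m. G i x * G i y) + (\<Sum>i<m'. G (m + i) x * G (m + i) y)"
   using sum.atLeastLessThan_concat[of 0 m "m + m'" "%i. G i x * G i y"]
    sum.shift_bounds_nat_ivl[of "%i. G i x * G i y" 0 m m']
   by (simp add: lessThan_atLeast0 add.commute)
  then show ?thesis by (simp add: G_def *)
 qed
 moreover have "tp (G i)" if "i < m + m'" for i
  using that by (simp add: G_def *)
 ultimately show ?case by (intro exI[of _ "m + m'"] exI[of _ G]) auto
qed

text \<open>The addition theorem separates cos(y - x) in each coordinate; sums, powers and the
  normalisation preserve the separated form.\<close>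

lemma deg_kern: "deg (%x y. kern n (y - x :: 'a::euclidean_space))"
proof -
 have "deg (%x y. \<Sum>b\<in>(Basis :: 'a set). 1 / (2 * real DIM('a)) * (1 + (cos (x \<bullet> b) * cos (y \<bullet> b) + sin (x \<bullet> b) * sin (y \<bullet> b))))"
 proof (intro deg_sum deg_scale)
  fix b :: 'a assume "b : Basis"
  then have "tp (%x. cos (x \<bullet> b))" "tp (%x. sin (x \<bullet> b))"
   using tp_cos[of b 1] tp_sin[of b 1] by simp_all
  then show "deg (%x y. 1 + (cos (x \<bullet> b) * cos (y \<bullet> b) + sin (x \<bullet> b) * sin (y \<bullet> b)))"
   by (intro deg_add deg_1 deg_base)
 qed auto
 moreover have "(%x y. \<Sum>b\<in>(Basis :: 'a set). 1 / (2 * real DIM('a)) * (1 + (cos (x \<bullet> b) * cos (y \<bullet> b) + sin (x \<bullet> b) * sin (y \<bullet> b))))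
  = (%x y. bump (y - x))"
  by (auto simp: bump_def fun_eq_iff inner_diff_left cos_diff mult.commute intro!: sum.cong)
 ultimately have "deg (%x y. bump (y - x :: 'a))" by simp
 from deg_scale[OF deg_power[OF this], of "1 / (LINT u|torus. bump (u :: 'a) ^ n)" n]
 show ?thesis using integral_bump_power_pos[of n, where 'a='a] by (simp add: kern_def)
qed

lemma kern_expand:
 obtains m :: nat and F where "!!i. i < m ==> tp (F i)"
  "!!x y. kern n (y - x :: 'a::euclidean_space) = (\<Sum>i<m. F i x * F i y)"
 using deg_finite[OF deg_kern] by blast

section \<open>Bilinear and trilinear forms\<close>

lemma ennreal_tendsto_0_power:
 fixes a :: "'i => ennreal"
 assumes "((%n. a n ^ k) \<longlongrightarrow> 0) F" "0 < k"
 shows "(a \<longlongrightarrow> 0) F"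
 unfolding ennreal_tendsto_0_iff
proof safe
 fix r :: real assume r: "0 < r"
 then have "\<forall>\<^sub>F n in F. a n ^ k < ennreal (r ^ k)"
  using assms(1) unfolding ennreal_tendsto_0_iff by simp
 then show "\<forall>\<^sub>F n in F. a n < ennreal r"
 proof eventually_elim
  case (elim n)
  show ?case
  proof (rule ccontr)
   assume "\<not> a n < ennreal r"
   then have "ennreal r ^ k <= a n ^ k" by (intro power_mono) auto
   then show False using elim r by (simp add: ennreal_power)
  qed
 qed
qed

lemma ennreal_tendsto_0_mult_bounded:
 fixes a b :: "'i => ennreal"
 assumes "(a \<longlongrightarrow> 0) F" "(b \<longlongrightarrow> B) F" "B < \<infinity>"
 shows "((%n. a n * b n) \<longlongrightarrow> 0) F"
 using tendsto_mult_ennreal[OF assms(1,2)] assms(3) by auto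

lemma pmass_bound_tendsto:
 assumes "((%n. pmass p (%x. f n x - g x)) \<longlongrightarrow> 0) F"
 shows "((%n. 2 ^ p * (pmass p (%x. f n x - g x) + pmass p g)) \<longlongrightarrow> 2 ^ p * pmass p g) F"
proof -
 have "((%n. 2 ^ p * (pmass p (%x. f n x - g x) + pmass p g)) \<longlongrightarrow> 2 ^ p * (0 + pmass p g)) F"
  by (intro ennreal_tendsto_cmult tendsto_add assms tendsto_const) (simp add: power_less_top_ennreal)
 then show ?thesis by simp
qed

lemma pmass_le_diff:
 assumes "f : Borel" "g : Borel"
 shows "pmass p f <= 2 ^ p * (pmass p (%x. f x - g x) + pmass p g)"
 using pmass_add[of "%x. f x - g x" g p] assms by simp

lemma norm_add3: "norm (a + (b + c)) <= norm a + (norm b + norm c)"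
 using norm_triangle_ineq[of a "b + c"] norm_triangle_ineq[of b c] by linarith

text \<open>Like \<open>Lp_torus\<close> but without periodicity: the vertical velocity is an
  integral from z up to pi and is only meaningful on \<open>cell\<close>.\<close>

definition Lmeas :: "nat => ('a::euclidean_space => 'b::euclidean_space) set" where
 "Lmeas p = {f. f : Borel & pmass p f < \<infinity>}"

lemma Lp_torus_Lmeas: "f : Lp_torus p ==> f : Lmeas p"
 by (simp add: Lp_torus_def Lmeas_def)

lemma LmeasD: "f : Lmeas p ==> f : Borel" "f : Lmeas p ==> pmass p f < \<infinity>"
 by (auto simp: Lmeas_def)

definition tri :: "('a::euclidean_space => 'd::euclidean_space) => ('a => 'b::euclidean_space) => ('a => 'c::euclidean_space) => ennreal" where
 "tri a b c = (\<oint>x. ennreal (norm (a x) * (norm (b x) * norm (c x))))"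

lemma nn_integral_norm_mult_le:
 assumes [measurable]: "a : Borel" "b : Borel"
 shows "(\<oint>x. ennreal (norm (a x) * norm (b x)))\<^sup>2 <= pmass 2 a * pmass 2 b"
 using Cauchy_Schwarz_nn_integral[of "%x. ennreal (norm (a x))" torus "%x. ennreal (norm (b x))"]
 by (simp add: ennreal_mult ennreal_power pmass_def)

text \<open>Hoelder's inequality with exponents 2, 4, 4, raised to the fourth power so that two
  applications of Cauchy-Schwarz give it without roots.\<close>

lemma tri_le:
 assumes [measurable]: "a : Borel" "b : Borel" "c : Borel"
 shows "tri a b c ^ 4 <= (pmass 2 a)\<^sup>2 * (pmass 4 b * pmass 4 c)"
proof -
 have "(tri a b c)\<^sup>2 <= pmass 2 a * (\<oint>x. (ennreal (norm (b x) * norm (c x)))\<^sup>2)"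
  using Cauchy_Schwarz_nn_integral[of "%x. ennreal (norm (a x))" torus "%x. ennreal (norm (b x) * norm (c x))"]
  by (simp add: ennreal_mult' ennreal_power pmass_def tri_def)
 then have "((tri a b c)\<^sup>2)\<^sup>2 <= (pmass 2 a * (\<oint>x. (ennreal (norm (b x) * norm (c x)))\<^sup>2))\<^sup>2"
  by (intro power_mono) auto
 also have "... = (pmass 2 a)\<^sup>2 * (\<oint>x. (ennreal (norm (b x) * norm (c x)))\<^sup>2)\<^sup>2"
  by (simp add: power_mult_distrib)
 also have "(\<oint>x. (ennreal (norm (b x) * norm (c x)))\<^sup>2)\<^sup>2 <= pmass 4 b * pmass 4 c"
  using Cauchy_Schwarz_nn_integral[of "%x. ennreal ((norm (b x))\<^sup>2)" torus "%x. ennreal ((norm (c x))\<^sup>2)"]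
  by (simp add: ennreal_mult' ennreal_power pmass_def power_mult_distrib flip: power_mult)
 finally show ?thesis by (simp add: mult_left_mono flip: power_mult)
qed

lemma tri_finite:
 assumes "a : Lmeas 2" "b : Lp_torus 4" "c : Lp_torus 4"
 shows "tri a b c < \<infinity>"
proof -
 have "tri a b c ^ 4 <= (pmass 2 a)\<^sup>2 * (pmass 4 b * pmass 4 c)"
  using assms by (intro tri_le) (auto simp: Lp_torus_def Lmeas_def)
 also have "... < \<infinity>"
  using assms by (auto simp: Lp_torus_def Lmeas_def ennreal_mult_less_top power_less_top_ennreal)
 finally show ?thesis by (simp add: power_less_top_ennreal)
qed

lemma integrable_tri:
 fixes a :: "'a::euclidean_space => real" and b c :: "'a => 'b::euclidean_space"
 assumes "a : Lmeas 2" "b : Lp_torus 4" "c : Lp_torus 4"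
 shows "integrable torus (%x. a x * (b x \<bullet> c x))"
proof -
 note [measurable] = LmeasD(1)[OF assms(1)] Lp_torusD(2)[OF assms(2)] Lp_torusD(2)[OF assms(3)]
 have "(\<oint>x. ennreal (norm (a x * (b x \<bullet> c x)))) <= tri a b c"
  unfolding tri_def
  by (intro nn_integral_mono ennreal_leI) (auto simp: abs_mult intro!: mult_left_mono Cauchy_Schwarz_ineq2)
 then show ?thesis
  using tri_finite[OF assms] by (auto simp: integrable_iff_bounded)
qed

lemma integrable_inner_L2:
 fixes b c :: "'a::euclidean_space => 'b::euclidean_space"
 assumes "b : Lp_torus 2" "c : Lp_torus 2"
 shows "integrable torus (%x. b x \<bullet> c x)"
proof -
 note [measurable] = Lp_torusD(2)[OF assms(1)] Lp_torusD(2)[OF assms(2)]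
 have "(\<oint>x. ennreal (norm (b x \<bullet> c x))) <= (\<oint>x. ennreal (norm (b x) * norm (c x)))"
  by (intro nn_integral_mono ennreal_leI) (auto intro!: Cauchy_Schwarz_ineq2)
 moreover have "(\<oint>x. ennreal (norm (b x) * norm (c x)))\<^sup>2 < \<infinity>"
  using assms by (intro le_less_trans[OF nn_integral_norm_mult_le])
   (auto simp: Lp_torus_def ennreal_mult_less_top)
 ultimately show ?thesis
  by (auto simp: integrable_iff_bounded power_less_top_ennreal intro: le_less_trans)
qed

lemma integrable_mult_L2:
 fixes a :: "'a::euclidean_space => real" and b :: "'a::euclidean_space => 'b::euclidean_space"
 assumes "a : Lp_torus 2" "b : Lp_torus 2"
 shows "integrable torus (%x. a x *R b x)"
proof -
 note [measurable] = Lp_torusD(2)[OF assms(1)] Lp_torusD(2)[OF assms(2)]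
 have "(\<oint>x. ennreal (norm (a x) * norm (b x)))\<^sup>2 < \<infinity>"
  using assms by (intro le_less_trans[OF nn_integral_norm_mult_le])
   (auto simp: Lp_torus_def ennreal_mult_less_top)
 then show ?thesis
  by (auto simp: integrable_iff_bounded power_less_top_ennreal)
qed

lemma Lp_torus_const: "(%_. c) : Lp_torus p"
 by (rule Lp_torus_bounded[where C="norm c"]) (auto simp: periodic_const)

lemma L2_integrable: "(f :: 'a::euclidean_space => 'b::euclidean_space) : Lp_torus 2 ==> integrable torus f"
 using integrable_mult_L2[of "%_. 1" f] by (simp add: Lp_torus_const)

text \<open>The factors are exchanged one at a time. In each difference exactly one factor tends to
  0 in its norm while the others stay bounded, the perturbed ones by their limit plus a null
  sequence.\<close>

lemma integral_tri_tendsto: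
 fixes a :: "'a::euclidean_space => real" and b c :: "'a => 'b::euclidean_space"
 assumes L: "a : Lmeas 2" "b : Lp_torus 4" "c : Lp_torus 4"
  "!!n. a' n : Lmeas 2" "!!n. b' n : Lp_torus 4" "!!n. c' n : Lp_torus 4"
  and lim: "((%n. pmass 2 (%x. a' n x - a x)) \<longlongrightarrow> 0) F" "((%n. pmass 4 (%x. b' n x - b x)) \<longlongrightarrow> 0) F"
  "((%n. pmass 4 (%x. c' n x - c x)) \<longlongrightarrow> 0) F"
 shows "((%n. LINT x|torus. a' n x * (b' n x \<bullet> c' n x)) \<longlongrightarrow> (LINT x|torus. a x * (b x \<bullet> c x))) F"
proof (rule tendsto_L1_int)
 note [measurable] = LmeasD(1)[OF L(1)] Lp_torusD(2)[OF L(2)] Lp_torusD(2)[OF L(3)]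
  LmeasD(1)[OF L(4)] Lp_torusD(2)[OF L(5)] Lp_torusD(2)[OF L(6)]
 show "integrable torus (%x. a' n x * (b' n x \<bullet> c' n x))" for n by (intro integrable_tri L)
 show "integrable torus (%x. a x * (b x \<bullet> c x))" by (intro integrable_tri L)
 let ?a = "%n x. a' n x - a x" and ?b = "%n x. b' n x - b x" and ?c = "%n x. c' n x - c x"
 have fin: "(pmass 2 a)\<^sup>2 < \<infinity>" "2 ^ 4 * pmass 4 b < \<infinity>" "2 ^ 4 * pmass 4 c < \<infinity>" "pmass 4 b < \<infinity>"
  using L(1-3) by (auto simp: Lp_torus_def Lmeas_def power_less_top_ennreal ennreal_mult_less_top)
 have bnd: "pmass 4 (b' n) <= 2 ^ 4 * (pmass 4 (?b n) + pmass 4 b)" "pmass 4 (c' n) <= 2 ^ 4 * (pmass 4 (?c n) + pmass 4 c)" for n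
  by (intro pmass_le_diff, simp, simp)+
 have A: "((%n. tri (?a n) (b' n) (c' n)) \<longlongrightarrow> 0) F"
 proof (rule ennreal_tendsto_0_power[where k=4])
  have "((%n. pmass 2 (?a n)) \<longlongrightarrow> 0) F" by (rule lim)
  from ennreal_tendsto_0_mult_bounded[OF this this]
  have "((%n. (pmass 2 (?a n))\<^sup>2) \<longlongrightarrow> 0) F" by (simp add: power2_eq_square)
  from ennreal_tendsto_0_mult_bounded[OF ennreal_tendsto_0_mult_bounded[OF this pmass_bound_tendsto[OF lim(2)] fin(2)] pmass_bound_tendsto[OF lim(3)] fin(3)]
  show "((%n. tri (?a n) (b' n) (c' n) ^ 4) \<longlongrightarrow> 0) F"
  proof (rule ennreal_tendsto_0_le)
   fix n
   have "tri (?a n) (b' n) (c' n) ^ 4 <= (pmass 2 (?a n))\<^sup>2 * (pmass 4 (b' n) * pmass 4 (c' n))"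
    by (intro tri_le) auto
   also have "... <= (pmass 2 (?a n))\<^sup>2 * ((2 ^ 4 * (pmass 4 (?b n) + pmass 4 b)) * (2 ^ 4 * (pmass 4 (?c n) + pmass 4 c)))"
    by (intro mult_left_mono mult_mono bnd) auto
   finally show "tri (?a n) (b' n) (c' n) ^ 4 <= (pmass 2 (?a n))\<^sup>2 * (2 ^ 4 * (pmass 4 (?b n) + pmass 4 b)) * (2 ^ 4 * (pmass 4 (?c n) + pmass 4 c))"
    by (simp add: mult.assoc)
  qed
 qed simp
 have B: "((%n. tri a (?b n) (c' n)) \<longlongrightarrow> 0) F"
 proof (rule ennreal_tendsto_0_power[where k=4])
  from ennreal_tendsto_0_cmult[OF ennreal_tendsto_0_mult_bounded[OF lim(2) pmass_bound_tendsto[OF lim(3)] fin(3)] fin(1)]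
  show "((%n. tri a (?b n) (c' n) ^ 4) \<longlongrightarrow> 0) F"
  proof (rule ennreal_tendsto_0_le)
   fix n
   have "tri a (?b n) (c' n) ^ 4 <= (pmass 2 a)\<^sup>2 * (pmass 4 (?b n) * pmass 4 (c' n))"
    by (intro tri_le) auto
   also have "... <= (pmass 2 a)\<^sup>2 * (pmass 4 (?b n) * (2 ^ 4 * (pmass 4 (?c n) + pmass 4 c)))"
    by (intro mult_left_mono bnd) auto
   finally show "tri a (?b n) (c' n) ^ 4 <= (pmass 2 a)\<^sup>2 * (pmass 4 (?b n) * (2 ^ 4 * (pmass 4 (?c n) + pmass 4 c)))" .
  qed
 qed simp
 have C: "((%n. tri a b (?c n)) \<longlongrightarrow> 0) F"
 proof (rule ennreal_tendsto_0_power[where k=4])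
  from ennreal_tendsto_0_cmult[OF ennreal_tendsto_0_cmult[OF lim(3) fin(4)] fin(1)]
  show "((%n. tri a b (?c n) ^ 4) \<longlongrightarrow> 0) F"
   by (rule ennreal_tendsto_0_le) (intro tri_le, auto)
 qed simp
 from ennreal_tendsto_0_add[OF A ennreal_tendsto_0_add[OF B C]]
 show "((%n. \<integral>\<^sup>+x. ennreal (norm (a' n x * (b' n x \<bullet> c' n x) - a x * (b x \<bullet> c x))) \<partial>torus) \<longlongrightarrow> 0) F"
 proof (rule ennreal_tendsto_0_le)
  fix n
  have "(\<oint>x. ennreal (norm (a' n x * (b' n x \<bullet> c' n x) - a x * (b x \<bullet> c x)))) <=
   (\<oint>x. ennreal (norm (?a n x) * (norm (b' n x) * norm (c' n x))) +
    (ennreal (norm (a x) * (norm (?b n x) * norm (c' n x))) + ennreal (norm (a x) * (norm (b x) * norm (?c n x)))))"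
  proof (rule nn_integral_mono)
   fix x
   have "a' n x * (b' n x \<bullet> c' n x) - a x * (b x \<bullet> c x) =
    ?a n x * (b' n x \<bullet> c' n x) + (a x * (?b n x \<bullet> c' n x) + a x * (b x \<bullet> ?c n x))"
    by (simp add: algebra_simps inner_simps)
   then have "norm (a' n x * (b' n x \<bullet> c' n x) - a x * (b x \<bullet> c x)) <= norm (?a n x * (b' n x \<bullet> c' n x)) + (norm (a x * (?b n x \<bullet> c' n x)) + norm (a x * (b x \<bullet> ?c n x)))"
    by (simp only: norm_add3)
   also have "... <= norm (?a n x) * (norm (b' n x) * norm (c' n x)) +
    (norm (a x) * (norm (?b n x) * norm (c' n x)) + norm (a x) * (norm (b x) * norm (?c n x)))"
    unfolding norm_mult by (intro add_mono mult_left_mono) (auto intro: Cauchy_Schwarz_ineq2)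
   finally show "ennreal (norm (a' n x * (b' n x \<bullet> c' n x) - a x * (b x \<bullet> c x))) <=
    ennreal (norm (?a n x) * (norm (b' n x) * norm (c' n x))) +
    (ennreal (norm (a x) * (norm (?b n x) * norm (c' n x))) + ennreal (norm (a x) * (norm (b x) * norm (?c n x))))"
    by (simp add: ennreal_plus[symmetric] del: ennreal_plus)
  qed
  also have "... = tri (?a n) (b' n) (c' n) + (tri a (?b n) (c' n) + tri a b (?c n))"
   unfolding tri_def by (subst nn_integral_add, simp, simp)+ simp
  finally show "(\<oint>x. ennreal (norm (a' n x * (b' n x \<bullet> c' n x) - a x * (b x \<bullet> c x)))) <= ..." .
 qed
qed

lemma integral_inner_tendsto:
 fixes b c :: "'a::euclidean_space => 'b::euclidean_space"
 assumes L: "b : Lp_torus 2" "c : Lp_torus 2" "!!n. b' n : Lp_torus 2" "!!n. c' n : Lp_torus 2"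
  and lim: "((%n. pmass 2 (%x. b' n x - b x)) \<longlongrightarrow> 0) F" "((%n. pmass 2 (%x. c' n x - c x)) \<longlongrightarrow> 0) F"
 shows "((%n. LINT x|torus. b' n x \<bullet> c' n x) \<longlongrightarrow> (LINT x|torus. b x \<bullet> c x)) F"
proof (rule tendsto_L1_int)
 note [measurable] = Lp_torusD(2)[OF L(1)] Lp_torusD(2)[OF L(2)] Lp_torusD(2)[OF L(3)] Lp_torusD(2)[OF L(4)]
 show "integrable torus (%x. b' n x \<bullet> c' n x)" for n by (intro integrable_inner_L2 L)
 show "integrable torus (%x. b x \<bullet> c x)" by (intro integrable_inner_L2 L)
 let ?b = "%n x. b' n x - b x" and ?c = "%n x. c' n x - c x"
 let ?bi = "%b c. \<integral>\<^sup>+x. ennreal (norm (b x) * norm (c x)) \<partial>torus"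
 have fin: "2 ^ 2 * pmass 2 c < \<infinity>" "pmass 2 b < \<infinity>"
  using L(1-2) by (auto simp: Lp_torus_def power_less_top_ennreal ennreal_mult_less_top)
 have bnd: "pmass 2 (c' n) <= 2 ^ 2 * (pmass 2 (?c n) + pmass 2 c)" for n
  by (intro pmass_le_diff) auto
 have B: "((%n. ?bi (?b n) (c' n)) \<longlongrightarrow> 0) F"
 proof (rule ennreal_tendsto_0_power[where k=2])
  from ennreal_tendsto_0_mult_bounded[OF lim(1) pmass_bound_tendsto[OF lim(2)] fin(1)]
  show "((%n. (?bi (?b n) (c' n))\<^sup>2) \<longlongrightarrow> 0) F"
  proof (rule ennreal_tendsto_0_le)
   fix n
   have "(?bi (?b n) (c' n))\<^sup>2 <= (pmass 2 (?b n) * pmass 2 (c' n))"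
    by (intro nn_integral_norm_mult_le) auto
   also have "... <= (pmass 2 (?b n) * (2 ^ 2 * (pmass 2 (?c n) + pmass 2 c)))"
    by (intro mult_left_mono bnd) auto
   finally show "(?bi (?b n) (c' n))\<^sup>2 <= (pmass 2 (?b n) * (2 ^ 2 * (pmass 2 (?c n) + pmass 2 c)))" .
  qed
 qed simp
 have C: "((%n. ?bi b (?c n)) \<longlongrightarrow> 0) F"
 proof (rule ennreal_tendsto_0_power[where k=2])
  from ennreal_tendsto_0_cmult[OF lim(2) fin(2)]
  show "((%n. (?bi b (?c n))\<^sup>2) \<longlongrightarrow> 0) F"
   by (rule ennreal_tendsto_0_le) (intro nn_integral_norm_mult_le, auto)
 qed simp
 from ennreal_tendsto_0_add[OF B C]
 show "((%n. \<integral>\<^sup>+x. ennreal (norm (b' n x \<bullet> c' n x - b x \<bullet> c x)) \<partial>torus) \<longlongrightarrow> 0) F"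
 proof (rule ennreal_tendsto_0_le)
  fix n
  have "(\<oint>x. ennreal (norm (b' n x \<bullet> c' n x - b x \<bullet> c x))) <=
   (\<oint>x. ennreal (norm (?b n x) * norm (c' n x)) + ennreal (norm (b x) * norm (?c n x)))"
  proof (rule nn_integral_mono)
   fix x
   have "b' n x \<bullet> c' n x - b x \<bullet> c x = ?b n x \<bullet> c' n x + b x \<bullet> ?c n x"
    by (simp add: inner_simps)
   also have "norm ... <= norm (?b n x) * norm (c' n x) + norm (b x) * norm (?c n x)"
    using norm_triangle_ineq[of "?b n x \<bullet> c' n x" "b x \<bullet> ?c n x"]
     Cauchy_Schwarz_ineq2[of "?b n x" "c' n x"] Cauchy_Schwarz_ineq2[of "b x" "?c n x"] by simp
   finally show "ennreal (norm (b' n x \<bullet> c' n x - b x \<bullet> c x)) <=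
    ennreal (norm (?b n x) * norm (c' n x)) + ennreal (norm (b x) * norm (?c n x))"
    by (simp add: ennreal_plus[symmetric] del: ennreal_plus)
  qed
  also have "... = ?bi (?b n) (c' n) + ?bi b (?c n)"
   by (subst nn_integral_add) auto
  finally show "(\<oint>x. ennreal (norm (b' n x \<bullet> c' n x - b x \<bullet> c x))) <= ..." .
 qed
qed

section \<open>The Hilbert space of square integrable fields\<close>

lemma pmass_2_eq:
 assumes "f : Lp_torus 2"
 shows "pmass 2 f = ennreal ((L2_norm f)\<^sup>2)"
proof -
 have int: "integrable torus (%x. (norm (f x))\<^sup>2)"
  using assms by (auto simp: L2_eq_Lp_torus[symmetric] L2_def)
 have "pmass 2 f = ennreal (LINT x|torus. (norm (f x))\<^sup>2)"
  unfolding pmass_def by (rule nn_integral_eq_integral[OF int]) simp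
 then show ?thesis by (simp add: L2_norm_def integral_nonneg)
qed

lemma L2_norm_sq: "(L2_norm f)\<^sup>2 = (LINT x|torus. f x \<bullet> f x)"
 by (simp add: L2_norm_def integral_nonneg power2_norm_eq_inner)

lemma L2_norm_nonneg: "0 <= L2_norm f"
 by (simp add: L2_norm_def integral_nonneg)

lemma integral_inner_le:
 fixes f g :: "'a::euclidean_space => 'b::euclidean_space"
 assumes "f : Lp_torus 2" "g : Lp_torus 2"
 shows "\<bar>LINT x|torus. f x \<bullet> g x\<bar> <= L2_norm f * L2_norm g"
proof -
 note [measurable] = Lp_torusD(2)[OF assms(1)] Lp_torusD(2)[OF assms(2)]
 have "ennreal \<bar>LINT x|torus. f x \<bullet> g x\<bar> <= (\<oint>x. ennreal (norm (f x \<bullet> g x)))"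
  using integral_norm_bound_ennreal[OF integrable_inner_L2[OF assms]] by simp
 also have "... <= (\<oint>x. ennreal (norm (f x) * norm (g x)))"
  by (intro nn_integral_mono ennreal_leI) (auto intro!: Cauchy_Schwarz_ineq2)
 finally have "(ennreal \<bar>LINT x|torus. f x \<bullet> g x\<bar>)\<^sup>2 <= (\<oint>x. ennreal (norm (f x) * norm (g x)))\<^sup>2"
  by (rule power_mono) simp
 also have "... <= pmass 2 f * pmass 2 g"
  by (rule nn_integral_norm_mult_le) auto
 also have "... = ennreal ((L2_norm f * L2_norm g)\<^sup>2)"
  by (simp add: pmass_2_eq assms ennreal_mult power_mult_distrib)
 finally have "\<bar>LINT x|torus. f x \<bullet> g x\<bar>\<^sup>2 <= (L2_norm f * L2_norm g)\<^sup>2"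
  by (simp add: ennreal_power)
 then show ?thesis
  by (rule power2_le_imp_le) (simp add: L2_norm_nonneg)
qed

lemma pmass_zero_AE:
 assumes [measurable]: "f : Borel" and "pmass p f = 0" "0 < p"
 shows "AE x in torus. f x = 0"
 using assms(2,3) unfolding pmass_def by (subst (asm) nn_integral_0_iff_AE) auto

text \<open>The mollification at a point is a pairing with a trigonometric polynomial, so all
  mollifications vanish, and with them their limit.\<close>

lemma L2_orthogonal_tp_zero:
 fixes q :: "'a::euclidean_space => 'b::euclidean_space"
 assumes q: "q : Lp_torus 2" and orth: "!!\<psi>. tp \<psi> ==> (LINT x|torus. \<psi> x *R q x) = 0"
 shows "AE x in torus. q x = 0"
proof -
 have "moll n q x = 0" for n x
  using orth[OF tp_translate[OF tp_kern], of n "- x"] Lp_torusD[OF q] L2_integrable[OF q]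
  by (simp add: moll_eq)
 with pmass_moll_tendsto[OF q] have "(%n. pmass 2 (%x. - q x)) ----> 0" by simp
 then have "pmass 2 q = 0" by (simp add: pmass_minus LIMSEQ_const_iff)
 with Lp_torusD[OF q] show ?thesis by (intro pmass_zero_AE) auto
qed

section \<open>Weak derivatives and mollification\<close>

lemma H1_L2: "f : H1 ==> f : Lp_torus 2"
 by (simp add: H1_def L2_eq_Lp_torus)

lemma weak_pd_H1:
 assumes "f : H1" "b : Basis"
 shows "weak_pd b f : Lp_torus 2" "is_weak_pd b f (weak_pd b f)"
proof -
 have "EX g. g : L2 & is_weak_pd b f g" using assms by (auto simp: H1_def)
 from someI_ex[OF this] show "weak_pd b f : Lp_torus 2" "is_weak_pd b f (weak_pd b f)"
  by (simp_all add: weak_pd_def L2_eq_Lp_torus)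
qed

lemma is_weak_pd_tp:
 "is_weak_pd b f g ==> tp \<psi> ==> (LINT x|torus. pd b \<psi> x *R f x) = - (LINT x|torus. \<psi> x *R g x)"
 by (simp add: is_weak_pd_def tp_smooth tp_periodic)

lemma integral_sum_scaleR:
 fixes g :: "'i => 'a => 'b::euclidean_space"
 assumes "!!i. i : I ==> integrable M (g i)"
 shows "(LINT y|M. (\<Sum>i\<in>I. c i *R g i y)) = (\<Sum>i\<in>I. c i *R (LINT y|M. g i y))"
 by (subst LB_integral_sum) (use assms in auto)

lemma moll_expand:
 fixes f :: "'a::euclidean_space => 'b::euclidean_space"
 assumes F: "!!i. i < m ==> tp (F i)" "!!x y. kern n (y - x) = (\<Sum>i<m. F i x * F i y)"
  and f: "f : Lp_torus 2"
 shows "moll n f x = (\<Sum>i<m. F i x *R (LINT y|torus. F i y *R f y))"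
proof -
 have int: "integrable torus (%y. F i y *R f y)" if "i < m" for i
  using that by (intro integrable_torus_mult_tp L2_integrable f F)
 have "moll n f x = (LINT y|torus. (\<Sum>i<m. F i x *R (F i y *R f y)))"
  using Lp_torusD[OF f] L2_integrable[OF f] by (simp add: moll_eq F scaleR_sum_left)
 also have "... = (\<Sum>i<m. F i x *R (LINT y|torus. F i y *R f y))"
  by (rule integral_sum_scaleR) (use int in auto)
 finally show ?thesis .
qed

lemma pd_reflect:
 fixes f :: "'a::euclidean_space => real"
 assumes "!!u. f (- u) = f u" "f differentiable (at u)"
 shows "pd b f (- u) = - pd b f u"
proof (rule pd_eqI[where F="%h. - pd h f u"])
 have "((%x. f (- x)) has_derivative (%h. pd (- h) f u)) (at (- u))"
  by (rule has_derivative_compose[of "%x. - x" "%h. - h" "- u" UNIV f "%h. pd h f u"])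
   (use pd_has_derivative[OF assms(2)] in \<open>auto intro!: derivative_eq_intros\<close>)
 moreover have "pd (- h) f u = - pd h f u" for h
  using has_derivative_linear[OF pd_has_derivative[OF assms(2)]] by (rule linear_neg)
 ultimately show "(f has_derivative (%h. - pd h f u)) (at (- u))" by (simp add: assms(1))
qed

lemma differentiable_scaleR_const: "f differentiable (at x) ==> (%x. f x *R c) differentiable (at x)"
 by (intro differentiable_scaleR differentiable_const)

lemma pd_moll:
 fixes f :: "'a::euclidean_space => 'b::euclidean_space"
 assumes F: "!!i. i < m ==> tp (F i)" "!!x y. kern n (y - x) = (\<Sum>i<m. F i x * F i y)"
  and f: "f : Lp_torus 2"
 shows "pd b (moll n f) x = (\<Sum>i<m. pd b (F i) x *R (LINT y|torus. F i y *R f y))"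
proof -
 have "moll n f = (%x. \<Sum>i<m. F i x *R (LINT y|torus. F i y *R f y))"
  using moll_expand[OF F f] by auto
 then show ?thesis
  using F(1) by (subst \<open>moll n f = _\<close>, subst pd_sum) (auto simp: pd_scaleR_left tp_differentiable intro!: differentiable_scaleR_const)
qed

text \<open>An even kernel of y - x turns a derivative in y into minus a derivative in x, which
  cancels the sign of the weak formulation. The hypothesis involves trigonometric tests only, which
  is what is at hand for vertical means.\<close>

lemma moll_tp_weak_pd:
 fixes f :: "'a::euclidean_space => 'b::euclidean_space"
 assumes f: "f : Lp_torus 2" and g: "g : Lp_torus 2"
  "!!\<psi>. tp \<psi> ==> (LINT x|torus. pd b \<psi> x *R f x) = - (LINT x|torus. \<psi> x *R g x)"
 shows "moll n g x = pd b (moll n f) x"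
proof -
 obtain m and F :: "nat => 'a => real" where F: "!!i. i < m ==> tp (F i)" "!!x y. kern n (y - x :: 'a) = (\<Sum>i<m. F i x * F i y)"
  using kern_expand by blast
 have tpK: "tp (%y. kern n (y - x))" using tp_translate[OF tp_kern, of n "- x"] by simp
 have "(\<Sum>i<m. pd b (F i) x * F i y) = - pd b (kern n) (y - x)" for y
 proof -
  have "(\<Sum>i<m. pd b (F i) x * F i y) = pd b (%x. \<Sum>i<m. F i x * F i y) x"
   using F(1) pd_scaleR_left[of "F _" x b "F _ y"] by (subst pd_sum) (auto simp: tp_differentiable)
  also have "... = pd b (%x. kern n (x + - y)) x"
   using F(2) kern_minus[of n "_ - y"] by (simp add: F(2)[symmetric] flip: kern_minus[of n "y - _"])
  also have "... = pd b (kern n) (- (y - x))"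
   by (subst pd_translate) simp
  also have "... = - pd b (kern n) (y - x)"
   by (rule pd_reflect) (auto intro: tp_differentiable tp_kern)
  finally show ?thesis .
 qed
 note * = this
 have "moll n g x = (LINT y|torus. kern n (y - x) *R g y)"
  using Lp_torusD[OF g(1)] L2_integrable[OF g(1)] by (simp add: moll_eq)
 also have "... = - (LINT y|torus. pd b (%y. kern n (y - x)) y *R f y)"
  using g(2)[OF tpK] by simp
 also have "(%y. pd b (%y. kern n (y - x)) y *R f y) = (%y. - (\<Sum>i<m. pd b (F i) x *R (F i y *R f y)))"
 proof
  fix y
  have "pd b (%y. kern n (y + - x)) y = pd b (kern n) (y + - x)"
   by (subst pd_translate) simp
  then have "pd b (%y. kern n (y - x)) y = - (\<Sum>i<m. pd b (F i) x * F i y)"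
   by (simp add: *)
  then show "pd b (%y. kern n (y - x)) y *R f y = - (\<Sum>i<m. pd b (F i) x *R (F i y *R f y))"
   by (simp add: scaleR_sum_left)
 qed
 also have "- (LINT y|torus. - (\<Sum>i<m. pd b (F i) x *R (F i y *R f y))) = (\<Sum>i<m. pd b (F i) x *R (LINT y|torus. F i y *R f y))"
 proof -
  have int: "integrable torus (%y. F i y *R f y)" if "i < m" for i
   using that by (intro integrable_torus_mult_tp L2_integrable f F)
  have "(LINT y|torus. (\<Sum>i<m. pd b (F i) x *R (F i y *R f y))) = (\<Sum>i<m. pd b (F i) x *R (LINT y|torus. F i y *R f y))"
   by (rule integral_sum_scaleR) (use int in auto)
  then show ?thesis by (simp only: Bochner_Integration.integral_minus minus_minus)
 qed
 also have "... = pd b (moll n f) x" using pd_moll[OF F f] by simp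
 finally show ?thesis .
qed

lemma moll_weak_pd:
 fixes f :: "'a::euclidean_space => 'b::euclidean_space"
 assumes "f : Lp_torus 2" "g : Lp_torus 2" "is_weak_pd b f g"
 shows "moll n g x = pd b (moll n f) x"
 using assms by (intro moll_tp_weak_pd is_weak_pd_tp)

section \<open>Fubini on the torus\<close>

lemma pair_torus_torus: "pair_sigma_finite (torus :: 'a::euclidean_space measure) (torus :: 'b::euclidean_space measure)"
 by (intro pair_sigma_finite.intro sigma_finite_torus)

lemma nn_integral_torus_fst:
 fixes f :: "'a::euclidean_space \<times> 'b::euclidean_space => ennreal"
 assumes [measurable]: "f : Borel"
 shows "(\<oint>x. f x) = (\<oint>x. (\<oint>z. f (x, z)))"
 unfolding torus_prod
 by (rule sigma_finite_measure.nn_integral_fst[symmetric, OF sigma_finite_torus])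
  (unfold torus_prod[symmetric], measurable)

lemma nn_integral_torus_snd:
 fixes f :: "'a::euclidean_space \<times> 'b::euclidean_space => ennreal"
 assumes [measurable]: "f : Borel"
 shows "(\<oint>x. f x) = (\<oint>z. (\<oint>x. f (x, z)))"
 unfolding torus_prod
 by (rule pair_sigma_finite.nn_integral_snd[symmetric, OF pair_torus_torus])
  (unfold torus_prod[symmetric], measurable)

lemma integral_torus_fst:
 fixes f :: "'a::euclidean_space \<times> 'b::euclidean_space => 'c::euclidean_space"
 assumes "integrable torus f"
 shows "(LINT x|torus. LINT z|torus. f (x, z)) = (LINT x|torus. f x)"
  and "AE x in torus. integrable torus (%z. f (x, z))"
  and "integrable torus (%x. LINT z|torus. f (x, z))"
proof -
 interpret pair_sigma_finite "torus :: 'a measure" "torus :: 'b measure" by (rule pair_torus_torus)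
 note * = assms[unfolded torus_prod]
 show "(LINT x|torus. LINT z|torus. f (x, z)) = (LINT x|torus. f x)"
  using integral_fst'[OF *] by (simp add: torus_prod)
 show "AE x in torus. integrable torus (%z. f (x, z))"
  using AE_integrable_fst'[OF *] .
 show "integrable torus (%x. LINT z|torus. f (x, z))"
  using integrable_fst'[OF *] .
qed

lemma periodic_fst: "periodic f ==> periodic (%x::'a::euclidean_space \<times> 'b::euclidean_space. f (fst x))"
 by (auto simp: periodic_def Basis_prod_def)

lemma periodic_slice: "periodic f ==> periodic (%x::'a::euclidean_space. f (x, z::'b::euclidean_space))"
 unfolding periodic_def
proof (intro allI ballI)
 fix x b assume *: "ALL x. ALL b:Basis. f (x + (2 * pi) *R b) = f x" and b: "b : (Basis :: 'a set)"
 then have "(b, 0) : (Basis :: ('a \<times> 'b) set)" by (auto simp: Basis_prod_def)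
 then have "f ((x, z) + (2 * pi) *R (b, 0)) = f (x, z)" using * by blast
 then show "f (x + (2 * pi) *R b, z) = f (x, z)" by simp
qed

lemma periodic_slice_snd: "periodic f ==> periodic (%z::'b::euclidean_space. f (x::'a::euclidean_space, z))"
 unfolding periodic_def
proof (intro allI ballI)
 fix z b assume *: "ALL x. ALL b:Basis. f (x + (2 * pi) *R b) = f x" and b: "b : (Basis :: 'b set)"
 then have "(0, b) : (Basis :: ('a \<times> 'b) set)" by (auto simp: Basis_prod_def)
 then have "f ((x, z) + (2 * pi) *R (0, b)) = f (x, z)" using * by blast
 then show "f (x, z + (2 * pi) *R b) = f (x, z)" by simp
qed

section \<open>Components and vector-valued trigonometric polynomials\<close>

lemma Lp_torus_inner:
 fixes f :: "'a::euclidean_space => 'b::euclidean_space"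
 assumes f: "f : Lp_torus p" and c: "norm c <= 1" shows "(%x. f x \<bullet> c) : Lp_torus p"
proof -
 note [measurable] = Lp_torusD(2)[OF f]
 have "\<bar>f x \<bullet> c\<bar> <= norm (f x)" for x
  using Cauchy_Schwarz_ineq2[of "f x" c] mult_left_le[OF c norm_ge_zero[of "f x"]] by linarith
 then have "pmass p (%x. f x \<bullet> c) <= pmass p f"
  by (intro pmass_mono_AE) auto
 then show ?thesis
  using Lp_torusD[OF f] by (auto simp: Lp_torus_def intro: periodic_compose)
qed

lemma moll_inner:
 fixes f :: "'a::euclidean_space => 'b::euclidean_space"
 assumes f: "f : Lp_torus 2" and c: "norm c <= 1"
 shows "moll n f x \<bullet> c = moll n (%x. f x \<bullet> c) x"
proof -
 have tp: "tp (%y. kern n (y - x))" using tp_translate[OF tp_kern, of n "- x"] by simp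
 have "moll n f x \<bullet> c = (LINT y|torus. kern n (y - x) *R f y) \<bullet> c"
  using Lp_torusD[OF f] L2_integrable[OF f] by (simp add: moll_eq)
 also have "... = (LINT y|torus. (kern n (y - x) *R f y) \<bullet> c)"
  by (rule integral_inner_left[symmetric]) (intro integrable_torus_mult_tp tp L2_integrable f)
 also have "... = moll n (%x. f x \<bullet> c) x"
  using Lp_torusD[OF Lp_torus_inner[OF f c]] L2_integrable[OF Lp_torus_inner[OF f c]] by (simp add: moll_eq)
 finally show ?thesis .
qed

lemma tp_moll:
 fixes f :: "'a::euclidean_space => real"
 assumes f: "f : Lp_torus 2"
 shows "tp (moll n f)"
proof -
 obtain m and F :: "nat => 'a => real" where F: "!!i. i < m ==> tp (F i)" "!!x y. kern n (y - x :: 'a) = (\<Sum>i<m. F i x * F i y)"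
  using kern_expand by blast
 have "moll n f = (%x. \<Sum>i<m. (LINT y|torus. F i y *R f y) * F i x)"
  using moll_expand[OF F f] by (auto simp: mult.commute)
 moreover have "tp (%x. \<Sum>i<m. (LINT y|torus. F i y *R f y) * F i x)"
  by (intro tp_sum tp_scale F) auto
 ultimately show ?thesis by simp
qed

definition tpv :: "('a::euclidean_space => 'b::euclidean_space) => bool" where
 "tpv g \<longleftrightarrow> (ALL c:Basis. tp (%x. g x \<bullet> c))"

lemma tpvD: "tpv g ==> c : Basis ==> tp (%x. g x \<bullet> c)"
 by (simp add: tpv_def)

lemma tpv_moll: "f : Lp_torus 2 ==> tpv (moll n f)"
 by (simp add: tpv_def moll_inner tp_moll Lp_torus_inner)

lemma tpv_rep: "g = (%x. \<Sum>c\<in>Basis. (g x \<bullet> c) *R c)"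
 by (simp add: euclidean_representation)

lemma tpv_differentiable: "tpv g ==> g differentiable (at x)"
 by (subst tpv_rep) (intro differentiable_sum finite_Basis ballI differentiable_scaleR_const tp_differentiable tpvD)

lemma pd_inner: "g differentiable (at x) ==> pd b (%x. g x \<bullet> c) x = pd b g x \<bullet> c"
 by (rule pd_eqI) (auto intro!: derivative_eq_intros pd_has_derivative)

lemma tpv_pd: "tpv g ==> tpv (pd b g)"
 using tp_pd[OF tpvD, of g _ b] by (auto simp: tpv_def pd_inner[symmetric] tpv_differentiable)

lemma tpv_periodic: "tpv g ==> periodic g"
 unfolding periodic_def
proof (intro allI ballI, rule euclidean_eqI)
 fix x b c assume "tpv g" "b : (Basis :: 'a set)" "c : (Basis :: 'b set)"
 then show "g (x + (2 * pi) *R b) \<bullet> c = g x \<bullet> c"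
  using tp_periodic[OF tpvD, of g c] by (auto simp: periodic_def)
qed

lemma tpv_continuous: "tpv g ==> continuous_on A g"
 by (subst tpv_rep) (intro continuous_intros tp_continuous tpvD)

lemma tpv_borel: "tpv g ==> g : Borel"
 by (intro borel_measurable_continuous_onI tpv_continuous)

lemma tpv_bounded: "tpv (g :: 'a::euclidean_space => 'b::euclidean_space) ==> EX C>=0. ALL x. norm (g x) <= C"
proof -
 assume g: "tpv g"
 then have "ALL c:(Basis::'b set). EX C>=0. ALL x. \<bar>g x \<bullet> c\<bar> <= C"
  using tp_bounded[OF tpvD] by blast
 then obtain C where C: "!!c. c : (Basis::'b set) ==> C c >= 0 & (ALL x. \<bar>g x \<bullet> c\<bar> <= C c)" by metis
 have "norm (g x) <= (\<Sum>c\<in>Basis. C c)" for x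
  using norm_le_l1[of "g x"] C sum_mono[of Basis "%c. \<bar>g x \<bullet> c\<bar>" C] by fastforce
 moreover have "0 <= (\<Sum>c\<in>(Basis::'b set). C c)" using C by (intro sum_nonneg) auto
 ultimately show ?thesis by blast
qed

lemma tpv_Lp_torus: "tpv g ==> g : Lp_torus p"
 using tpv_bounded[of g] by (metis Lp_torus_bounded tpv_borel tpv_periodic)

lemma tpv_scaleR_sum: "(!!i. i : I ==> tp (F i)) ==> tpv (%x. \<Sum>i\<in>I. F i x *R c i)"
 unfolding tpv_def
proof
 fix d assume *: "!!i. i : I ==> tp (F i)"
 have "tp (%x. \<Sum>i\<in>I. (c i \<bullet> d) * F i x)" by (intro tp_sum tp_scale *)
 then show "tp (%x. (\<Sum>i\<in>I. F i x *R c i) \<bullet> d)" by (simp add: inner_sum_left mult.commute)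
qed

section \<open>Symmetric difference quotients as averaged derivatives\<close>

lemma integrable_segm_bounded:
 fixes f :: "'a::euclidean_space => 'b::euclidean_space"
 assumes [measurable]: "f : Borel" and "!!x. norm (f x) <= C" "a < b"
 shows "integrable (segm a b h e) (%y. f (x + y))"
proof -
 interpret shift_measure "segm a b h e" by (rule shift_measure_segm) fact
 show ?thesis
  by (rule integrable_const_bound[where B=C]) (use assms in auto)
qed

lemma avg_segm_inner:
 fixes f :: "'a::euclidean_space => 'b::euclidean_space"
 assumes "f : Borel" and "!!x. norm (f x) <= C" "a < b"
 shows "avg (segm a b h e) f x \<bullet> c = avg (segm a b h e) (%x. f x \<bullet> c) x"
 unfolding avg_def using integrable_segm_bounded[OF assms]
 by (rule integral_inner_left[symmetric])

text \<open>Averaging over a symmetric segment keeps the cosine part of the shift and kills the odd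
  sine part, hence acts as a scalar multiplier. The scalar is the same for all amplitudes and
  phases, in particular for an atom and its derivative; therefore the average commutes with
  differentiation.\<close>

lemma avg_segm_atom:
 "EX \<sigma>. ALL a c. avg (segm (-1) 1 h e) (%x. a * cos (k \<bullet> x + c)) = (%x. (\<sigma> * a) * cos (k \<bullet> x + c))"
proof (intro exI allI ext)
 fix a c x
 define t where "t = h * (k \<bullet> e)"
 have [measurable]: "(%x. a * cos (k \<bullet> x + c)) : Borel" by measurable
 have i1: "set_integrable lborel {-1..1} (%s. cos (t * s))" "set_integrable lborel {-1..1} (%s. sin (t * s))"
  by (intro borel_integrable_atLeastAtMost' continuous_intros)+
 have lin: "(LINT s:{-1..1}|lborel. p * cos (t * s) + q * sin (t * s)) =
  p * (LINT s:{-1..1}|lborel. cos (t * s)) + q * (LINT s:{-1..1}|lborel. sin (t * s))" for p q :: real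
  using i1 by (subst set_integral_add) auto
 have odd: "(LINT s:{-1..1}|lborel. sin (t * s)) = 0"
 proof -
  have "(LINT s:{-1..1}|lborel. sin (t * s)) = (LINT s|lborel. indicator {-1..1} (0 + -1 * s) *R sin (t * (0 + -1 * s)))"
   unfolding set_lebesgue_integral_def
   by (subst lborel_integral_real_affine[where c="-1" and t=0]) auto
  also have "... = - (LINT s:{-1..1}|lborel. sin (t * s))"
   unfolding set_lebesgue_integral_def
   by (subst Bochner_Integration.integral_minus[symmetric]) (auto intro!: LB_integral_cong simp: indicator_def)
  finally show ?thesis by simp
 qed
 have "avg (segm (-1) 1 h e) (%x. a * cos (k \<bullet> x + c)) x =
   (LINT s:{-1..1}|lborel. a * cos (k \<bullet> (x + (h * s) *R e) + c)) / 2"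
  by (subst avg_segm) auto
 also have "(%s. a * cos (k \<bullet> (x + (h * s) *R e) + c)) =
   (%s. (a * cos (k \<bullet> x + c)) * cos (t * s) + (- a * sin (k \<bullet> x + c)) * sin (t * s))"
 proof
  fix s
  have "k \<bullet> (x + (h * s) *R e) + c = (k \<bullet> x + c) + t * s" by (simp add: inner_simps t_def)
  then show "a * cos (k \<bullet> (x + (h * s) *R e) + c) = (a * cos (k \<bullet> x + c)) * cos (t * s) + (- a * sin (k \<bullet> x + c)) * sin (t * s)"
   by (simp only: cos_add) (simp add: algebra_simps)
 qed
 also have "(LINT s:{-1..1}|lborel. (a * cos (k \<bullet> x + c)) * cos (t * s) + (- a * sin (k \<bullet> x + c)) * sin (t * s)) =
  (a * cos (k \<bullet> x + c)) * (LINT s:{-1..1}|lborel. cos (t * s)) + (- a * sin (k \<bullet> x + c)) * (LINT s:{-1..1}|lborel. sin (t * s))"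
  by (rule lin)
 finally show "avg (segm (-1) 1 h e) (%x. a * cos (k \<bullet> x + c)) x =
  (((LINT s:{-1..1}|lborel. cos (h * (k \<bullet> e) * s)) / 2) * a) * cos (k \<bullet> x + c)"
  using odd by (simp add: t_def)
qed

lemma tp_bounded': "tp f ==> EX C. ALL x. norm (f x) <= C"
 using tp_bounded[of f] by auto

lemma avg_segm_add:
 assumes "tp f" "tp g"
 shows "avg (segm (-1) 1 h e) (%x. f x + g x) = (%x. avg (segm (-1) 1 h e) f x + avg (segm (-1) 1 h e) g x)"
proof
 fix x
 obtain C D where "!!x. norm (f x) <= C" "!!x. norm (g x) <= D" using tp_bounded'[OF assms(1)] tp_bounded'[OF assms(2)] by auto
 then have "integrable (segm (-1) 1 h e) (%y. f (x + y))" "integrable (segm (-1) 1 h e) (%y. g (x + y))"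
  using assms by (auto intro!: integrable_segm_bounded tp_borel)
 then show "avg (segm (-1) 1 h e) (%x. f x + g x) x = avg (segm (-1) 1 h e) f x + avg (segm (-1) 1 h e) g x"
  by (simp add: avg_def)
qed

lemma tp_avg_segm:
 "tp f ==> tp (avg (segm (-1) 1 h e) f) & pd b (avg (segm (-1) 1 h e) f) = avg (segm (-1) 1 h e) (pd b f)"
proof (induction rule: tp.induct)
 case (tp_atom k a c)
 obtain \<sigma> where \<sigma>: "!!a c. avg (segm (-1) 1 h e) (%x. a * cos (k \<bullet> x + c)) = (%x. (\<sigma> * a) * cos (k \<bullet> x + c))"
  using avg_segm_atom by blast
 show ?case unfolding pd_atom \<sigma> using tp.tp_atom[OF tp_atom, of "\<sigma> * a" c] by (auto simp: mult.assoc)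
next
 case (tp_add f g)
 then have "pd b (%x. f x + g x) = (%x. pd b f x + pd b g x)" for b
  by (auto simp: pd_add tp_differentiable)
 then show ?case using tp_add
  by (auto simp: avg_segm_add tp_pd tp.tp_add pd_add tp_differentiable fun_eq_iff)
qed

lemma tpv_avg_segm:
 assumes "tpv g"
 shows "tpv (avg (segm (-1) 1 h e) g)" "pd b (avg (segm (-1) 1 h e) g) = avg (segm (-1) 1 h e) (pd b g)"
proof -
 obtain C where C: "!!x. norm (g x) <= C" using tpv_bounded[OF assms] by auto
 have eq: "avg (segm (-1) 1 h e) g x \<bullet> c = avg (segm (-1) 1 h e) (%x. g x \<bullet> c) x" for x c
  by (rule avg_segm_inner[OF tpv_borel[OF assms] C]) simp
 then show *: "tpv (avg (segm (-1) 1 h e) g)"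
  using assms tp_avg_segm[OF tpvD[OF assms]] by (simp add: tpv_def)
 obtain D where D: "!!x. norm (pd b g x) <= D" using tpv_bounded[OF tpv_pd[OF assms]] by metis
 show "pd b (avg (segm (-1) 1 h e) g) = avg (segm (-1) 1 h e) (pd b g)"
 proof (rule ext, rule euclidean_eqI)
  fix x c assume c: "c : (Basis :: 'b set)"
  have "pd b (avg (segm (-1) 1 h e) g) x \<bullet> c = pd b (avg (segm (-1) 1 h e) (%x. g x \<bullet> c)) x"
   using * by (subst pd_inner[symmetric]) (auto simp: eq tpv_differentiable)
  also have "... = avg (segm (-1) 1 h e) (pd b (%x. g x \<bullet> c)) x"
   using tp_avg_segm[OF tpvD[OF assms c]] by simp
  also have "pd b (%x. g x \<bullet> c) = (%x. pd b g x \<bullet> c)"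
   using assms by (auto simp: pd_inner tpv_differentiable)
  also have "avg (segm (-1) 1 h e) (%x. pd b g x \<bullet> c) x = avg (segm (-1) 1 h e) (pd b g) x \<bullet> c"
   by (rule avg_segm_inner[OF tpv_borel[OF tpv_pd[OF assms]] D, symmetric]) simp
  finally show "pd b (avg (segm (-1) 1 h e) g) x \<bullet> c = avg (segm (-1) 1 h e) (pd b g) x \<bullet> c" .
 qed
qed

lemma tp_avg_ftc:
 assumes "tp f" "a < b"
 shows "h * (b - a) * avg (segm a b h e) (pd e f) x = f (x + (h * b) *R e) - f (x + (h * a) *R e)"
proof -
 have *: "h * (b - a) * (inverse (b - a) * I) = h * I" for I using assms(2) by simp
 have "avg (segm a b h e) (pd e f) x = inverse (b - a) * (LINT s:{a..b}|lborel. pd e f (x + (h * s) *R e))"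
  using assms by (simp add: avg_segm tp_borel tp_pd)
 then show ?thesis
  using tp_ftc[OF assms(1), of a b h e x] assms(2) by (simp only: *)
qed

text \<open>The derivative of a segment average along the segment sees only the two end points. This
  is where the vertical derivative is traded for a finite difference.\<close>

lemma tpv_difference_quotient:
 assumes "tpv g" "h ~= 0"
 shows "pd e (avg (segm (-1) 1 h e) g) x = (g (x + h *R e) - g (x - h *R e)) /\<^sub>R (2 * h)"
proof (rule euclidean_eqI)
 fix c assume c: "c : (Basis :: 'b set)"
 obtain D where D: "!!x. norm (pd e g x) <= D" using tpv_bounded[OF tpv_pd[OF assms(1)]] by metis
 have "pd e (avg (segm (-1) 1 h e) g) x \<bullet> c = avg (segm (-1) 1 h e) (%x. pd e g x \<bullet> c) x"
  unfolding tpv_avg_segm(2)[OF assms(1)] by (rule avg_segm_inner[OF tpv_borel[OF tpv_pd[OF assms(1)]] D]) simp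
 also have "(%x. pd e g x \<bullet> c) = pd e (%x. g x \<bullet> c)"
  using assms by (auto simp: pd_inner tpv_differentiable)
 also have "avg (segm (-1) 1 h e) (pd e (%x. g x \<bullet> c)) x = (g (x + h *R e) \<bullet> c - g (x - h *R e) \<bullet> c) / (2 * h)"
  using tp_avg_ftc[OF tpvD[OF assms(1) c], of "-1" 1 h e x] assms(2) by (simp add: field_simps)
 finally have eq: "pd e (avg (segm (-1) 1 h e) g) x \<bullet> c = (g (x + h *R e) \<bullet> c - g (x - h *R e) \<bullet> c) / (2 * h)" .
 show "pd e (avg (segm (-1) 1 h e) g) x \<bullet> c = ((g (x + h *R e) - g (x - h *R e)) /\<^sub>R (2 * h)) \<bullet> c"
  unfolding eq inner_scaleR_left inner_diff_left divide_inverse by (rule mult.commute)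
qed

section \<open>The vertical velocity\<close>

lemma Basis_R2: "(Basis :: R2 set) = range (%k. axis k 1)"
 by (auto simp: Basis_vec_def)

lemma Basis_R3: "(Basis :: R3 set) = range (%k. (axis k 1, 0)) \<union> {(0, 1)}"
 by (auto simp: Basis_prod_def Basis_R2)

lemma sum_Basis_R2: "(\<Sum>b\<in>(Basis :: R2 set). g b) = (\<Sum>k\<in>UNIV. g (axis k 1))"
 unfolding Basis_R2 by (subst sum.reindex) (auto simp: inj_on_def axis_eq_axis)

lemma sum_Basis_R3: "(\<Sum>b\<in>(Basis :: R3 set). g b) = (\<Sum>k\<in>UNIV. g (axis k 1, 0)) + g (0, 1)"
proof -
 have "(\<Sum>b\<in>(Basis :: R3 set). g b) = (\<Sum>b\<in>range (%k. (axis k 1, 0)). g b) + (\<Sum>b\<in>{(0, 1)}. g b)"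
  unfolding Basis_R3 by (rule sum.union_disjoint) auto
 also have "(\<Sum>b\<in>range (%k. (axis k 1, 0)). g b) = (\<Sum>k\<in>UNIV. g (axis k 1, 0))"
  by (subst sum.reindex) (auto simp: inj_on_def axis_eq_axis)
 finally show ?thesis by simp
qed

lemma Basis_R3_hor [simp]: "(axis k 1, 0) : (Basis :: R3 set)"
 and Basis_R3_ver [simp]: "(0, 1) : (Basis :: R3 set)"
 and Basis_R2_axis [simp]: "axis k 1 : (Basis :: R2 set)"
 by (auto simp: Basis_R3 Basis_R2)

lemma inner_axis_R2: "(u :: R2) \<bullet> axis k 1 = u $ k"
 by (simp add: inner_axis)

lemma borel_measurable_nth_R2 [measurable]: "(%x::R2. x $ k) : Borel"
 by (intro borel_measurable_continuous_onI continuous_intros)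

lemma pmass_zero: "0 < p ==> pmass p (%x. 0) = 0"
 by (simp add: pmass_def power_0_left)

text \<open>The vertical velocity as an operator on divergences. On square integrable functions it
  is continuous, and it can be applied to mollified divergences as well.\<close>

definition vert :: "(R3 => real) => R3 => real" where
 "vert D x = (LINT \<zeta>:{snd x..pi}|lborel. D (fst x, \<zeta>))"

lemma vertical_velocity_vert: "vertical_velocity f = vert (div_H f)"
 by (simp add: fun_eq_iff vertical_velocity_def vert_def)

lemma vert_borel [measurable]:
 assumes [measurable]: "D : Borel"
 shows "vert D : Borel"
proof -
 have eq: "vert D x = (LINT \<zeta>|lborel. (if snd x <= \<zeta> & \<zeta> <= pi then 1 else 0) *R D (fst x, \<zeta>))" for x
  unfolding vert_def set_lebesgue_integral_def
  by (intro LB_integral_cong) (auto simp: indicator_def)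
 show ?thesis unfolding eq[abs_def] by measurable
qed

lemma mem_cell_real: "z : (cell :: real set) \<longleftrightarrow> - pi <= z & z <= pi"
 by (simp add: mem_cell)

lemma emeasure_torus_real: "emeasure (torus :: real measure) cell = ennreal (2 * pi)"
 unfolding torus_cell by (subst emeasure_restrict_space) (simp_all add: cell_def)

lemma pmass_slice_le:
 fixes d :: "R3 => real"
 assumes [measurable]: "d : Borel"
 shows "(\<oint>z. ennreal \<bar>d (xH, z)\<bar>)\<^sup>2 <= ennreal (2 * pi) * (\<oint>z. ennreal ((d (xH, z))\<^sup>2))"
 using Cauchy_Schwarz_nn_integral[of "%z. ennreal \<bar>d (xH, z)\<bar>" torus "%_. 1"]
 by (simp add: emeasure_torus_real ennreal_power mult.commute)

text \<open>Cauchy-Schwarz in z bounds the vertical integral, at every height, by the norm of the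
  whole column. One factor 2 pi is the length of the column, the other comes from integrating this
  height-independent bound over z.\<close>

lemma pmass_vert_diff:
 fixes D1 D2 :: "R3 => real"
 assumes D: "D1 : Lp_torus 2" "D2 : Lp_torus 2"
 shows "pmass 2 (%x. vert D1 x - vert D2 x) <= ennreal (2 * pi) * (ennreal (2 * pi) * pmass 2 (%x. D1 x - D2 x))"
proof -
 note [measurable] = Lp_torusD(2)[OF D(1)] Lp_torusD(2)[OF D(2)]
 define J where "J xH = (\<oint>z. ennreal ((D1 (xH, z) - D2 (xH, z))\<^sup>2))" for xH
 have [measurable]: "J : Borel"
  unfolding J_def by (rule sigma_finite_measure.borel_measurable_nn_integral[OF sigma_finite_torus]) measurable
 have ae: "AE xH in torus. integrable torus (%z. D1 (xH, z)) & integrable torus (%z. D2 (xH, z))"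
  using integral_torus_fst(2)[OF L2_integrable[OF D(1)]] integral_torus_fst(2)[OF L2_integrable[OF D(2)]] by auto
 have "pmass 2 (%x. vert D1 x - vert D2 x) = (\<oint>xH. (\<oint>z. ennreal ((vert D1 (xH, z) - vert D2 (xH, z))\<^sup>2)))"
  unfolding pmass_def by (subst nn_integral_torus_fst) auto
 also have "... <= (\<oint>xH. (\<integral>\<^sup>+z. ennreal (2 * pi) * J xH \<partial>(torus :: real measure)))"
 proof (rule nn_integral_mono_AE)
  show "AE xH in torus. (\<oint>z. ennreal ((vert D1 (xH, z) - vert D2 (xH, z))\<^sup>2)) <= (\<integral>\<^sup>+z. ennreal (2 * pi) * J xH \<partial>(torus :: real measure))"
   using ae
  proof eventually_elim
   case (elim xH)
   show ?case
   proof (rule nn_integral_mono)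
    fix z assume "z : space (torus :: real measure)"
    then have z: "- pi <= z" "z <= pi" by (auto simp: mem_cell_real)
    have si: "set_integrable lborel {z..pi} (%\<zeta>. D1 (xH, \<zeta>))" "set_integrable lborel {z..pi} (%\<zeta>. D2 (xH, \<zeta>))"
    proof -
     have "set_integrable lborel cell (%\<zeta>. D1 (xH, \<zeta>))" "set_integrable lborel cell (%\<zeta>. D2 (xH, \<zeta>))"
      using elim by (auto simp: integrable_torus set_integrable_def)
     then show "set_integrable lborel {z..pi} (%\<zeta>. D1 (xH, \<zeta>))" "set_integrable lborel {z..pi} (%\<zeta>. D2 (xH, \<zeta>))"
      using z by (auto elim!: set_integrable_subset simp: mem_cell_real)
    qed
    have "ennreal \<bar>vert D1 (xH, z) - vert D2 (xH, z)\<bar> = ennreal (norm (LINT \<zeta>:{z..pi}|lborel. D1 (xH, \<zeta>) - D2 (xH, \<zeta>)))"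
     unfolding vert_def using si by (simp add: set_integral_diff)
    also have "... <= (\<integral>\<^sup>+\<zeta>. ennreal (norm (indicator {z..pi} \<zeta> *R (D1 (xH, \<zeta>) - D2 (xH, \<zeta>)))) \<partial>lborel)"
     unfolding set_lebesgue_integral_def
     using set_integral_diff(1)[OF si] by (intro integral_norm_bound_ennreal) (simp add: set_integrable_def)
    also have "... <= (\<oint>\<zeta>. ennreal \<bar>D1 (xH, \<zeta>) - D2 (xH, \<zeta>)\<bar>)"
     unfolding nn_integral_torus using z
     by (intro nn_integral_mono) (auto simp: indicator_def mem_cell_real)
    finally have "(ennreal \<bar>vert D1 (xH, z) - vert D2 (xH, z)\<bar>)\<^sup>2 <= (\<oint>\<zeta>. ennreal \<bar>D1 (xH, \<zeta>) - D2 (xH, \<zeta>)\<bar>)\<^sup>2"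
     by (rule power_mono) simp
    also have "... <= ennreal (2 * pi) * J xH"
     unfolding J_def by (rule pmass_slice_le[of "%x. D1 x - D2 x"]) measurable
    finally show "ennreal ((vert D1 (xH, z) - vert D2 (xH, z))\<^sup>2) <= ennreal (2 * pi) * J xH"
     by (simp add: ennreal_power)
   qed
  qed
 qed
 also have "... = ennreal (2 * pi) * (ennreal (2 * pi) * (\<oint>xH. J xH))"
  by (simp add: emeasure_torus_real nn_integral_cmult mult.commute mult.left_commute nn_integral_multc)
 also have "(\<oint>xH. J xH) = pmass 2 (%x. D1 x - D2 x)"
  unfolding J_def pmass_def by (subst nn_integral_torus_fst) auto
 finally show ?thesis .
qed

lemma vert_zero: "vert (%_. 0) = (%_. 0)"
 by (simp add: vert_def fun_eq_iff)

lemma pmass_vert_le: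
 assumes "D : Lp_torus 2"
 shows "pmass 2 (vert D) <= ennreal (2 * pi) * (ennreal (2 * pi) * pmass 2 D)"
 using pmass_vert_diff[OF assms Lp_torus_const[of 0]] by (simp add: vert_zero)

lemma vert_Lmeas: "D : Lp_torus 2 ==> vert D : Lmeas 2"
 unfolding Lmeas_def using pmass_vert_le[of D]
 by (auto simp: Lp_torus_def ennreal_mult_less_top vert_borel intro: le_less_trans)

lemma vert_pd:
 assumes "tp A" "x : cell"
 shows "vert (pd (0, 1) A) x = A (fst x, pi) - A x"
proof -
 have "snd x <= pi" using assms(2) by (cases x) (auto simp: cell_Times mem_cell_real)
 then show ?thesis
  using tp_ftc[OF assms(1), of "snd x" pi 1 "(0, 1)" "(fst x, 0)"] by (simp add: vert_def)
qed

lemma hydro_sol_L2: "f : hydro_sol ==> f : Lp_torus 2"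
 by (simp add: hydro_sol_def L2_eq_Lp_torus)

lemma div_H_Lp_torus: "f : H1 ==> div_H f : Lp_torus 2"
 unfolding div_H_def[abs_def]
proof (rule Lp_torus_sum)
 fix k :: 2 assume "f : H1"
 then have "(%x. weak_pd (axis k 1, 0) f x \<bullet> axis k 1) : Lp_torus 2"
  by (intro Lp_torus_inner weak_pd_H1) auto
 then show "(%x. weak_pd (axis k 1, 0) f x $ k) : Lp_torus 2" by (simp add: inner_axis_R2)
qed simp

lemma pd_fst:
 assumes "\<psi> differentiable (at (fst x))"
 shows "pd (b, 0) (%x. \<psi> (fst x)) x = pd b \<psi> (fst x)"
proof -
 have "((%x. \<psi> (fst x)) has_derivative (%h. pd (fst h) \<psi> (fst x))) (at x)"
  by (rule has_derivative_compose[of fst fst x UNIV \<psi> "%h. pd h \<psi> (fst x)"])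
  (use pd_has_derivative[OF assms] in \<open>auto intro!: derivative_eq_intros\<close>)
 from pd_eqI[OF this, of "(b, 0)"] show ?thesis by simp
qed

text \<open>For a test function of the horizontal variables the z-integral can be carried out first.
  Testing the divergence then means testing the vertical mean, which is divergence free by the
  definition of \<open>hydro_sol\<close>.\<close>

lemma div_H_test:
 fixes f :: "R3 => R2"
 assumes f: "f : H1" "f : hydro_sol" and \<psi>: "tp \<psi>"
 shows "(LINT x|torus. \<psi> (fst x) * div_H f x) = 0"
proof -
 note fL = H1_L2[OF f(1)]
 let ?\<Psi> = "%x::R3. \<psi> (fst x)"
 have tp\<Psi>: "tp ?\<Psi>" by (rule tp_fst[OF \<psi>])
 let ?D = "%k. weak_pd (axis k 1, 0) f"
 have intD: "integrable torus (%x. ?\<Psi> x *R ?D k x)" for k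
  by (intro integrable_torus_mult_tp tp\<Psi> L2_integrable weak_pd_H1 f) simp
 have intF: "integrable torus (%x. pd (axis k 1, 0) ?\<Psi> x *R f x)" for k
  by (intro integrable_torus_mult_tp tp_pd tp\<Psi> L2_integrable fL)
 have eq: "(LINT x|torus. ?\<Psi> x * ?D k x $ k) = - (LINT x|torus. pd (axis k 1) \<psi> (fst x) * (f x $ k))" for k
 proof -
  have "(LINT x|torus. ?\<Psi> x * ?D k x $ k) = (LINT x|torus. (?\<Psi> x *R ?D k x) \<bullet> axis k 1)"
   by (simp add: inner_axis_R2)
  also have "... = (LINT x|torus. ?\<Psi> x *R ?D k x) \<bullet> axis k 1"
   by (rule integral_inner_left[OF intD])
  also have "... = - ((LINT x|torus. pd (axis k 1, 0) ?\<Psi> x *R f x) \<bullet> axis k 1)"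
   using is_weak_pd_tp[OF weak_pd_H1(2)[OF f(1), of "(axis k 1, 0)"] tp\<Psi>] by simp
  also have "... = - (LINT x|torus. (pd (axis k 1, 0) ?\<Psi> x *R f x) \<bullet> axis k 1)"
   by (subst integral_inner_left[OF intF]) simp
  also have "(%x. (pd (axis k 1, 0) ?\<Psi> x *R f x) \<bullet> axis k 1) = (%x. pd (axis k 1) \<psi> (fst x) * (f x $ k))"
   by (auto simp: pd_fst tp_differentiable \<psi> inner_axis_R2)
  finally show ?thesis .
 qed
 have intD': "integrable torus (%x. ?\<Psi> x * ?D k x $ k)" for k
  using integrable_inner_left[OF intD, where c="axis k 1"] by (simp add: inner_axis_R2)
 have intF': "integrable torus (%x. pd (axis k 1) \<psi> (fst x) * (f x $ k))" for k
  using integrable_inner_left[OF intF, where c="axis k 1"]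
  by (simp add: inner_axis_R2 pd_fst tp_differentiable \<psi>)
 have "(LINT x|torus. \<psi> (fst x) * div_H f x) = (LINT x|torus. (\<Sum>k\<in>UNIV. ?\<Psi> x * ?D k x $ k))"
  by (simp add: div_H_def sum_distrib_left)
 also have "... = (\<Sum>k\<in>UNIV. LINT x|torus. ?\<Psi> x * ?D k x $ k)"
  by (rule LB_integral_sum) (rule intD')
 also have "... = - (\<Sum>k\<in>UNIV. LINT x|torus. pd (axis k 1) \<psi> (fst x) * (f x $ k))"
  by (simp add: eq sum_negf)
 also have "(\<Sum>k\<in>UNIV. LINT x|torus. pd (axis k 1) \<psi> (fst x) * (f x $ k)) = (LINT x|torus. (\<Sum>k\<in>UNIV. pd (axis k 1) \<psi> (fst x) * (f x $ k)))"
  by (rule LB_integral_sum[symmetric]) (rule intF')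
 also have "... = (LINT xH|torus. LINT z|torus. (\<Sum>k\<in>UNIV. pd (axis k 1) \<psi> xH * (f (xH, z) $ k)))"
  by (subst integral_torus_fst(1)[symmetric]) (auto intro!: LB_integrable_sum intF')
 also have "... = (LINT xH|torus. (\<Sum>b\<in>Basis. ((LINT z|torus. f (xH, z)) \<bullet> b) * pd b \<psi> xH))"
 proof (rule integral_cong_AE)
  have [measurable]: "f : Borel" using Lp_torusD(2)[OF fL] .
  have [measurable]: "pd b \<psi> : Borel" for b by (rule tp_borel[OF tp_pd[OF \<psi>]])
  interpret sigma_finite_measure "torus :: real measure" by (rule sigma_finite_torus)
  have "(%x. (fst x, snd x)) : measurable (borel \<Otimes>\<^sub>M torus) (borel :: R3 measure)" by measurable
  show "(%xH. LINT z|torus. (\<Sum>k\<in>UNIV. pd (axis k 1) \<psi> xH * (f (xH, z) $ k))) : borel_measurable torus"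
   by measurable
  show "(%xH. \<Sum>b\<in>Basis. ((LINT z|torus. f (xH, z)) \<bullet> b) * pd b \<psi> xH) : borel_measurable torus"
   by measurable
  show "AE xH in torus. (LINT z|torus. (\<Sum>k\<in>UNIV. pd (axis k 1) \<psi> xH * (f (xH, z) $ k))) =
   (\<Sum>b\<in>Basis. ((LINT z|torus. f (xH, z)) \<bullet> b) * pd b \<psi> xH)"
   using integral_torus_fst(2)[OF L2_integrable[OF fL]]
  proof eventually_elim
   case (elim xH)
   have "(LINT z|torus. (\<Sum>k\<in>UNIV. pd (axis k 1) \<psi> xH * (f (xH, z) $ k))) =
    (\<Sum>k\<in>UNIV. LINT z|torus. pd (axis k 1) \<psi> xH * (f (xH, z) \<bullet> axis k 1))"
    by (subst LB_integral_sum) (use elim in \<open>auto simp: inner_axis_R2[symmetric]\<close>)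
   also have "... = (\<Sum>k\<in>UNIV. pd (axis k 1) \<psi> xH * ((LINT z|torus. f (xH, z)) \<bullet> axis k 1))"
    using elim by simp
   finally show ?case by (simp add: sum_Basis_R2 mult.commute)
  qed
 qed
 also have "... = 0"
  using f(2) tp_smooth[OF \<psi>] tp_periodic[OF \<psi>] by (simp add: hydro_sol_def weak_div_free_def)
 finally show ?thesis by simp
qed

text \<open>The kernel integrated over a vertical line in x no longer depends on the height of y. It
  is therefore a horizontal test function, to which \<open>div_H_test\<close> applies.\<close>

lemma moll_div_H_zero_mean:
 assumes f: "f : H1" "f : hydro_sol"
 shows "(LINT z|torus. moll n (div_H f) (xH, z)) = 0"
proof -
 let ?D = "div_H f"
 have D: "?D : Lp_torus 2" by (rule div_H_Lp_torus[OF f(1)])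
 obtain m and F :: "nat => R3 => real" where F: "!!i. i < m ==> tp (F i)" "!!x y. kern n (y - x :: R3) = (\<Sum>i<m. F i x * F i y)"
  using kern_expand by blast
 define \<kappa> where "\<kappa> y = (LINT z|torus. kern n (y - (xH, z)))" for y :: R3
 define c where "c i = (LINT z|torus. F i (xH, z))" for i
 have intF: "integrable torus (%z. F i (xH, z))" if "i < m" for i
  using that by (intro tp_integrable tp_slice_snd F)
 have \<kappa>: "\<kappa> y = (\<Sum>i<m. c i * F i y)" for y
 proof -
  have "\<kappa> y = (LINT z|torus. (\<Sum>i<m. F i y *R F i (xH, z)))"
   unfolding \<kappa>_def F(2) by (simp add: mult.commute)
  also have "... = (\<Sum>i<m. F i y *R c i)"
   unfolding c_def by (rule integral_sum_scaleR) (use intF in auto)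
  finally show ?thesis by (simp add: mult.commute)
 qed
 have tp\<kappa>: "tp \<kappa>"
  unfolding \<kappa>[abs_def] by (intro tp_sum tp_scale F) auto
 have "\<kappa> (yH, yz) = \<kappa> (yH, 0)" for yH yz
 proof -
  have tp: "tp (%z. kern n ((yH, yz) - (xH, z)))"
  proof -
   have "tp (%z. kern n ((xH - yH, z) + (0, - yz)))"
    by (rule tp_slice_snd[where x="xH - yH", OF tp_translate[OF tp_kern, of n "(0, - yz)"]])
   moreover have "kern n ((xH - yH, z) + (0, - yz)) = kern n ((yH, yz) - (xH, z))" for z
    using kern_minus[of n "(yH, yz) - (xH, z)"] by simp
   ultimately show ?thesis by simp
  qed
  have "\<kappa> (yH, yz) = (LINT z|torus. kern n ((yH, yz) - (xH, z + yz)))"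
   unfolding \<kappa>_def
   by (rule integral_torus_translate[symmetric]) (intro tp_borel tp_periodic tp_integrable tp)+
  then show ?thesis by (simp add: \<kappa>_def)
 qed
 then have \<kappa>': "\<kappa> y = \<kappa> (fst y, 0)" for y by (metis prod.collapse)
 have "(LINT z|torus. moll n ?D (xH, z)) = (LINT z|torus. (\<Sum>i<m. (LINT y|torus. F i y *R ?D y) *R F i (xH, z)))"
  by (simp add: moll_expand[OF F D] mult.commute)
 also have "... = (\<Sum>i<m. (LINT y|torus. F i y *R ?D y) *R c i)"
  unfolding c_def by (rule integral_sum_scaleR) (use intF in auto)
 also have "... = (\<Sum>i<m. c i *R (LINT y|torus. F i y *R ?D y))"
  by (simp add: mult.commute)
 also have "... = (LINT y|torus. (\<Sum>i<m. c i *R (F i y *R ?D y)))"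
  by (rule integral_sum_scaleR[symmetric]) (intro integrable_torus_mult_tp L2_integrable D F, simp)
 also have "... = (LINT y|torus. \<kappa> y * ?D y)"
  by (simp add: \<kappa> sum_distrib_right mult.assoc)
 also have "... = (LINT y|torus. \<kappa> (fst y, 0) * ?D y)"
  by (subst \<kappa>') simp
 also have "... = 0"
  by (rule div_H_test[OF f]) (rule tp_slice_fst[OF tp\<kappa>])
 finally show ?thesis .
qed

text \<open>The identity behind the bound that is uniform in h. With w for
  \<open>vert (div_H f)\<close>, shifting the term with x - h e by h e leaves w(x) - w(x + h e)
  against the product of g(x) and g(x + h e), and this difference is h times a segment average of
  the divergence. It is proved for mollified divergences, whose antiderivatives are periodic, and
  carried over by continuity.\<close>

lemma vert_difference_quotient:
 fixes g :: "R3 => R2"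
 assumes f: "f : H1" "f : hydro_sol" and g: "g : Lp_torus 4"
 shows "(LINT x|torus. vert (div_H f) x * (g x \<bullet> (g (x + h *R (0, 1)) - g (x - h *R (0, 1))))) =
  h * (LINT x|torus. avg (segm 0 1 h (0, 1)) (div_H f) x * (g x \<bullet> g (x + h *R (0, 1))))"
proof -
 let ?D = "div_H f" and ?e = "(0, 1) :: R3"
 let ?G = "%n. moll n ?D"
 let ?g = "%x. g (x + h *R ?e)" and ?g' = "%x. g (x - h *R ?e)"
 note [measurable] = Lp_torusD(2)[OF g]
 interpret S: shift_measure "segm 0 1 h ?e" by (rule shift_measure_segm) simp
 have D: "?D : Lp_torus 2" by (rule div_H_Lp_torus[OF f(1)])
 have G: "?G n : Lp_torus 2" for n by (rule moll_Lp_torus[OF D]) simp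
 have gs: "?g : Lp_torus 4" "?g' : Lp_torus 4"
  by (rule Lp_torus_translate[OF g], rule Lp_torus_translate_minus[OF g])
 then have gd: "(%x. ?g x - ?g' x) : Lp_torus 4" by (rule Lp_torus_diff)
 have step: "(LINT x|torus. vert (?G n) x * (g x \<bullet> (?g x - ?g' x))) = h * (LINT x|torus. avg (segm 0 1 h ?e) (?G n) x * (g x \<bullet> ?g x))" for n
 proof -
  obtain A where A: "tp A" "!!x. ?G n x = pd ?e A x"
   using tp_antiderivative_zero_mean[OF tp_moll[OF D] moll_div_H_zero_mean[OF f], of n] by blast
  then have GA: "?G n = pd ?e A" by auto
  \<comment> \<open>A periodic function that agrees with \<open>vert (?G n)\<close> on
    \<open>cell\<close>; the translation below uses values outside.\<close>
  define w where "w x = A (fst x, pi) - A x" for x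
  have tpw: "tp w" unfolding w_def by (intro tp_diff A tp_fst tp_slice_fst)
  note w = tp_Lp_torus[OF tpw, of 2]
  have i1: "integrable torus (%x. w x * (g x \<bullet> ?g x))" "integrable torus (%x. w x * (g x \<bullet> ?g' x))"
   by (intro integrable_tri Lp_torus_Lmeas w g gs)+
  have per: "periodic (%x. w x * (g x \<bullet> ?g' x))"
   using tp_periodic[OF tpw] Lp_torusD(1)[OF g] Lp_torusD(1)[OF gs(2)] by (auto simp: periodic_def)
  have [measurable]: "w : Borel" by (rule tp_borel[OF tpw])
  have i2: "integrable torus (%x. w (x + h *R ?e) * (?g x \<bullet> g x))"
   using integrable_torus_translate[OF _ per i1(2), of "h *R ?e"] by simp
  have "(LINT x|torus. w x * (g x \<bullet> ?g' x)) = (LINT x|torus. w (x + h *R ?e) * (?g x \<bullet> g x))"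
   using integral_torus_translate[OF _ per i1(2), of "h *R ?e"] by simp
  then have "(LINT x|torus. w x * (g x \<bullet> ?g x)) - (LINT x|torus. w x * (g x \<bullet> ?g' x)) =
   (LINT x|torus. w x * (g x \<bullet> ?g x)) - (LINT x|torus. w (x + h *R ?e) * (?g x \<bullet> g x))" by simp
  also have "... = (LINT x|torus. w x * (g x \<bullet> ?g x) - w (x + h *R ?e) * (?g x \<bullet> g x))"
   using i1 i2 by simp
  also have "... = (LINT x|torus. h * (avg (segm 0 1 h ?e) (?G n) x * (g x \<bullet> ?g x)))"
  proof (rule LB_integral_cong)
   fix x :: R3
   \<comment> \<open>The value of \<open>A\<close> at height pi does not depend on z and drops out
     of the difference.\<close>
   have "w x - w (x + h *R ?e) = h * avg (segm 0 1 h ?e) (?G n) x"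
    using tp_avg_ftc[OF A(1), of 0 1 h ?e x] by (simp add: w_def GA flip: zero_prod_def)
   then show "w x * (g x \<bullet> ?g x) - w (x + h *R ?e) * (?g x \<bullet> g x) = h * (avg (segm 0 1 h ?e) (?G n) x * (g x \<bullet> ?g x))"
    by (simp add: inner_commute algebra_simps flip: left_diff_distrib mult.assoc)
  qed simp
  finally have "(LINT x|torus. w x * (g x \<bullet> ?g x)) - (LINT x|torus. w x * (g x \<bullet> ?g' x)) =
   h * (LINT x|torus. avg (segm 0 1 h ?e) (?G n) x * (g x \<bullet> ?g x))" by simp
  moreover have "(LINT x|torus. vert (?G n) x * (g x \<bullet> (?g x - ?g' x))) = (LINT x|torus. w x * (g x \<bullet> ?g x) - w x * (g x \<bullet> ?g' x))"
  proof (rule LB_integral_cong)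
   fix x assume "x : space (torus :: R3 measure)"
   then have "vert (?G n) x = w x" using vert_pd[OF A(1)] by (simp add: GA w_def)
   then show "vert (?G n) x * (g x \<bullet> (?g x - ?g' x)) = w x * (g x \<bullet> ?g x) - w x * (g x \<bullet> ?g' x)"
    by (simp only: inner_diff_right right_diff_distrib)
  qed simp
  ultimately show ?thesis using i1 by simp
 qed
 have limG: "(%n. pmass 2 (%x. ?G n x - ?D x)) ----> 0" by (rule pmass_moll_tendsto[OF D]) simp
 have "(%n. LINT x|torus. vert (?G n) x * (g x \<bullet> (?g x - ?g' x))) ----> (LINT x|torus. vert ?D x * (g x \<bullet> (?g x - ?g' x)))"
 proof (rule integral_tri_tendsto)
  show "(%n. pmass 2 (%x. vert (?G n) x - vert ?D x)) ----> 0"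
   by (rule ennreal_tendsto_0_le[OF ennreal_tendsto_0_cmult[OF ennreal_tendsto_0_cmult[OF limG]]])
    (use pmass_vert_diff[OF G D] in \<open>auto simp: ennreal_mult_less_top\<close>)
 qed (use gd in \<open>auto intro: vert_Lmeas G D g simp: pmass_zero\<close>)
 moreover have "(%n. h * (LINT x|torus. avg (segm 0 1 h ?e) (?G n) x * (g x \<bullet> ?g x))) ---->
  h * (LINT x|torus. avg (segm 0 1 h ?e) ?D x * (g x \<bullet> ?g x))"
 proof (intro tendsto_mult tendsto_const, rule integral_tri_tendsto)
  show "(%n. pmass 2 (%x. avg (segm 0 1 h ?e) (?G n) x - avg (segm 0 1 h ?e) ?D x)) ----> 0"
   by (rule ennreal_tendsto_0_le[OF limG]) (rule S.pmass_avg_diff2[OF G D])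
 qed (use gs(1) in \<open>auto intro: Lp_torus_Lmeas S.avg_Lp_torus G D g simp: pmass_zero\<close>)
 ultimately show ?thesis
  unfolding step by (rule LIMSEQ_unique)
qed

section \<open>The nonlinear term at a fixed time\<close>

definition rmass :: "nat => ('a::euclidean_space => 'b::euclidean_space) => real" where
 "rmass p f = enn2real (pmass p f)"

lemma rmass_nonneg: "0 <= rmass p f"
 by (simp add: rmass_def)

lemma rmass_mono: "pmass p f <= pmass p g ==> pmass p g < \<infinity> ==> rmass p f <= rmass p g"
 unfolding rmass_def by (rule enn2real_mono) auto

lemma rmass_eq: "f : Lmeas p ==> rmass p f = (LINT x|torus. norm (f x) ^ p)"
 unfolding rmass_def pmass_def
 by (rule integral_eq_nn_integral[symmetric]) (auto simp: Lmeas_def)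

lemma integrable_rmass: "f : Lmeas p ==> integrable torus (%x. norm (f x) ^ p)"
 by (auto simp: Lmeas_def pmass_def integrable_iff_bounded)

lemma young_tri:
 fixes a b c :: real
 assumes "0 <= a" "0 <= b" "0 <= c"
 shows "a * (b * c) <= a ^ 2 + b ^ 4 + c ^ 4"
proof -
 have "2 * (a * (b * c)) <= a\<^sup>2 + (b * c)\<^sup>2"
  using sum_squares_bound[of a "b * c"] by simp
 moreover have "2 * (b * c)\<^sup>2 <= b ^ 4 + c ^ 4"
  using sum_squares_bound[of "b\<^sup>2" "c\<^sup>2"] by (simp add: power_mult_distrib flip: power_mult)
 moreover have "0 <= a * (b * c)" "0 <= (b * c)\<^sup>2" using assms by auto
 ultimately show ?thesis by linarith
qed

text \<open>Young's inequality in place of Hoelder's: a bound that is a sum of masses is integrable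
  in time as soon as each mass is.\<close>

lemma integral_tri_young:
 fixes a :: "'a::euclidean_space => real" and b c :: "'a => 'b::euclidean_space"
 assumes "a : Lmeas 2" "b : Lp_torus 4" "c : Lp_torus 4"
 shows "\<bar>LINT x|torus. a x * (b x \<bullet> c x)\<bar> <= rmass 2 a + rmass 4 b + rmass 4 c"
proof -
 note L = assms(1) Lp_torus_Lmeas[OF assms(2)] Lp_torus_Lmeas[OF assms(3)]
 have "\<bar>LINT x|torus. a x * (b x \<bullet> c x)\<bar> <= (LINT x|torus. \<bar>a x * (b x \<bullet> c x)\<bar>)"
  by (rule integral_abs_bound)
 also have "... <= (LINT x|torus. norm (a x) ^ 2 + norm (b x) ^ 4 + norm (c x) ^ 4)"
 proof (rule integral_mono)
  show "integrable torus (%x. \<bar>a x * (b x \<bullet> c x)\<bar>)"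
   using integrable_tri[OF assms] by (rule integrable_abs)
  show "integrable torus (%x. norm (a x) ^ 2 + norm (b x) ^ 4 + norm (c x) ^ 4)"
   by (intro LB_integrable_add integrable_rmass L)
  fix x
  have "\<bar>a x * (b x \<bullet> c x)\<bar> <= norm (a x) * (norm (b x) * norm (c x))"
   by (simp add: abs_mult mult_left_mono Cauchy_Schwarz_ineq2)
  also have "... <= norm (a x) ^ 2 + norm (b x) ^ 4 + norm (c x) ^ 4"
   by (rule young_tri) auto
  finally show "\<bar>a x * (b x \<bullet> c x)\<bar> <= norm (a x) ^ 2 + norm (b x) ^ 4 + norm (c x) ^ 4" .
 qed
 also have "... = rmass 2 a + rmass 4 b + rmass 4 c"
  using integrable_rmass[OF L(1)] integrable_rmass[OF L(2)] integrable_rmass[OF L(3)]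
  by (simp add: rmass_eq L)
 finally show ?thesis .
qed

text \<open>One horizontal part of the flux, with an arbitrary field \<open>d\<close> in the place
  of the derivative so that averaged weak derivatives can be inserted.\<close>

definition hor :: "2 => (R3 => R2) => (R3 => R2) => real" where
 "hor k f d = (LINT x|torus. f x $ k * (f x \<bullet> d x))"

lemma Lp_torus_nth: "f : Lp_torus p ==> (%x. (f x :: R2) $ k) : Lp_torus p"
 using Lp_torus_inner[of f p "axis k 1"] by (simp add: inner_axis_R2)

lemma rmass_nth_le: "f : Lp_torus p ==> rmass p (%x. (f x :: R2) $ k) <= rmass p f"
 by (intro rmass_mono pmass_mono_AE) (auto simp: Lp_torus_def component_le_norm_cart)

lemma inner_R2: "(u :: R2) \<bullet> v = (\<Sum>j\<in>UNIV. u $ j * v $ j)"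
 by (simp add: inner_vec_def)

lemma hor_eq:
 assumes "f : Lp_torus 4" "d : Lp_torus 2"
 shows "hor k f d = (\<Sum>j\<in>UNIV. LINT x|torus. d x $ j * ((f x $ k) \<bullet> (f x $ j)))"
  and "integrable torus (%x. f x $ k * (f x \<bullet> d x))"
proof -
 have i: "integrable torus (%x. d x $ j * ((f x $ k) \<bullet> (f x $ j)))" for j
  by (intro integrable_tri Lp_torus_Lmeas Lp_torus_nth assms)
 have eq: "(%x. f x $ k * (f x \<bullet> d x)) = (%x. \<Sum>j\<in>UNIV. d x $ j * ((f x $ k) \<bullet> (f x $ j)))"
  by (auto simp: inner_R2 sum_distrib_left algebra_simps)
 show "hor k f d = (\<Sum>j\<in>UNIV. LINT x|torus. d x $ j * ((f x $ k) \<bullet> (f x $ j)))"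
  unfolding hor_def eq by (rule LB_integral_sum) (rule i)
 show "integrable torus (%x. f x $ k * (f x \<bullet> d x))"
  unfolding eq by (rule LB_integrable_sum) (rule i)
qed

lemma pmass_nth_diff_le: "pmass p (%x. (f x :: R2) $ k - g x $ k) <= pmass p (%x. f x - g x)"
 by (rule pmass_mono_AE) (auto simp: component_le_norm_cart simp flip: vector_minus_component)

lemma hor_tendsto:
 assumes L: "f : Lp_torus 4" "d : Lp_torus 2" "!!n. f' n : Lp_torus 4" "!!n. d' n : Lp_torus 2"
  and lim: "((%n. pmass 4 (%x. f' n x - f x)) \<longlongrightarrow> 0) F" "((%n. pmass 2 (%x. d' n x - d x)) \<longlongrightarrow> 0) F"
 shows "((%n. hor k (f' n) (d' n)) \<longlongrightarrow> hor k f d) F"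
 unfolding hor_eq(1)[OF L(1,2)] hor_eq(1)[OF L(3,4)]
 by (intro tendsto_sum integral_tri_tendsto Lp_torus_Lmeas Lp_torus_nth L
   ennreal_tendsto_0_le[OF lim(1)] ennreal_tendsto_0_le[OF lim(2)] pmass_nth_diff_le)

lemma hor_bound:
 assumes L: "f : Lp_torus 4" "d : Lp_torus 2"
 shows "\<bar>hor k f d\<bar> <= 2 * (rmass 2 d + 2 * rmass 4 f)"
proof -
 have "\<bar>hor k f d\<bar> <= (\<Sum>j\<in>UNIV. \<bar>LINT x|torus. d x $ j * ((f x $ k) \<bullet> (f x $ j))\<bar>)"
  unfolding hor_eq(1)[OF L] by (rule sum_abs)
 also have "... <= (\<Sum>j\<in>(UNIV::2 set). rmass 2 d + 2 * rmass 4 f)"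
 proof (rule sum_mono)
  fix j :: 2
  have "\<bar>LINT x|torus. d x $ j * ((f x $ k) \<bullet> (f x $ j))\<bar> <= rmass 2 (%x. d x $ j) + rmass 4 (%x. f x $ k) + rmass 4 (%x. f x $ j)"
   by (intro integral_tri_young Lp_torus_Lmeas Lp_torus_nth L)
  also have "... <= rmass 2 d + rmass 4 f + rmass 4 f"
   by (intro add_mono rmass_nth_le L)
  finally show "\<bar>LINT x|torus. d x $ j * ((f x $ k) \<bullet> (f x $ j))\<bar> <= rmass 2 d + 2 * rmass 4 f" by simp
 qed
 finally show ?thesis by simp
qed

text \<open>The derivative of F_k |F|^2 integrates to zero over the torus.\<close>

lemma hor_product_rule_tpv:
 assumes F: "tpv F"
 shows "(LINT x|torus. pd (axis k 1, 0) F x $ k * (F x \<bullet> F x)) + 2 * hor k F (pd (axis k 1, 0) F) = 0"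
proof -
 let ?b = "(axis k 1, 0) :: R3"
 have tpF: "tp (%x. F x $ j)" for j
  using tpvD[OF F, of "axis j 1"] by (simp add: inner_axis_R2)
 have pdF: "pd ?b (%x. F x $ j) x = pd ?b F x $ j" for j x
  using pd_inner[OF tpv_differentiable[OF F], of ?b "axis j 1" x] by (simp add: inner_axis_R2)
 define P where "P x = F x $ k * (\<Sum>j\<in>UNIV. F x $ j * F x $ j)" for x
 have tpP: "tp P" unfolding P_def by (intro tp_mult tp_sum tpF)
 have pdP: "pd ?b P x = pd ?b F x $ k * (F x \<bullet> F x) + 2 * (F x $ k * (F x \<bullet> pd ?b F x))" for x
 proof -
  have "pd ?b (%x. \<Sum>j\<in>UNIV. F x $ j * F x $ j) x = (\<Sum>j\<in>UNIV. pd ?b (%x. F x $ j * F x $ j) x)"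
   by (rule pd_sum) (intro tp_differentiable tp_mult tpF)
  also have "... = 2 * (F x \<bullet> pd ?b F x)"
   by (simp add: pd_mult tp_differentiable tpF pdF inner_R2 sum_distrib_left)
  finally have 1: "pd ?b (%x. \<Sum>j\<in>UNIV. F x $ j * F x $ j) x = 2 * (F x \<bullet> pd ?b F x)" .
  have "pd ?b P x = pd ?b (%x. F x $ k) x * (\<Sum>j\<in>UNIV. F x $ j * F x $ j) + F x $ k * pd ?b (%x. \<Sum>j\<in>UNIV. F x $ j * F x $ j) x"
   unfolding P_def by (rule pd_mult) (intro tp_differentiable tp_sum tp_mult tpF)+
  then show ?thesis by (simp add: 1 pdF inner_R2)
 qed
 have L: "F : Lp_torus 4" "pd ?b F : Lp_torus 2"
  by (intro tpv_Lp_torus tpv_pd F)+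
 have "0 = (LINT x|torus. pd ?b P x)" using tp_integral_pd[OF tpP] by simp
 also have "... = (LINT x|torus. pd ?b F x $ k * (F x \<bullet> F x)) + (LINT x|torus. 2 * (F x $ k * (F x \<bullet> pd ?b F x)))"
  unfolding pdP
  by (intro LB_integral_add integrable_tri Lp_torus_Lmeas Lp_torus_nth L integrable_mult_right hor_eq(2))
 finally show ?thesis by (simp add: hor_def)
qed

text \<open>Both terms are continuous under convergence of the field in L4 and of its derivative in
  L2, and mollification provides both.\<close>

lemma hor_product_rule:
 assumes f: "f : H1" "f : Lp_torus 4"
 shows "(LINT x|torus. weak_pd (axis k 1, 0) f x $ k * (f x \<bullet> f x)) + 2 * hor k f (weak_pd (axis k 1, 0) f) = 0"
proof -
 let ?b = "(axis k 1, 0) :: R3"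
 let ?D = "weak_pd ?b f"
 note fL = H1_L2[OF f(1)]
 have D: "?D : Lp_torus 2" "is_weak_pd ?b f ?D" using weak_pd_H1[OF f(1)] by auto
 have M: "pd ?b (moll n f) = moll n ?D" for n
  using moll_weak_pd[OF fL D] by auto
 have l4: "(%n. pmass 4 (%x. moll n f x - f x)) ----> 0" by (rule pmass_moll_tendsto) (use f in auto)
 have l2: "(%n. pmass 2 (%x. moll n ?D x - ?D x)) ----> 0" by (rule pmass_moll_tendsto) (use D in auto)
 have m4: "moll n f : Lp_torus 4" and m2: "moll n ?D : Lp_torus 2" for n
  using f D by (auto intro: moll_Lp_torus)
 have "(%n. (LINT x|torus. moll n ?D x $ k * (moll n f x \<bullet> moll n f x)) + 2 * hor k (moll n f) (moll n ?D)) ---->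
  (LINT x|torus. ?D x $ k * (f x \<bullet> f x)) + 2 * hor k f ?D"
  by (intro tendsto_add tendsto_mult tendsto_const hor_tendsto integral_tri_tendsto Lp_torus_Lmeas Lp_torus_nth f(2) D(1)
   m4 m2 l4 l2 ennreal_tendsto_0_le[OF l2] pmass_nth_diff_le)
 moreover have "(LINT x|torus. moll n ?D x $ k * (moll n f x \<bullet> moll n f x)) + 2 * hor k (moll n f) (moll n ?D) = 0" for n
  using hor_product_rule_tpv[OF tpv_moll[OF fL], of k n] by (simp add: M)
 ultimately show ?thesis by (simp add: LIMSEQ_const_iff)
qed

section \<open>The flux against smoothed fields\<close>

definition flux :: "(R3 => R2) => (R3 => R2) => real" where
 "flux f g = (LINT x|torus. (\<Sum>b\<in>Basis. (velocity f x \<bullet> b) * (f x \<bullet> pd b g x)))"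

abbreviation smear :: "real => (R3 => 'b::euclidean_space) => R3 => 'b" where
 "smear h \<equiv> avg (segm (-1) 1 h (0, 1))"

lemma Lp_torus_mult_tp:
 assumes f: "f : Lp_torus p" and F: "tp F"
 shows "(%x. F x *R f x) : Lp_torus p"
proof -
 obtain C where C: "C >= 0" "!!x. \<bar>F x\<bar> <= C" using tp_bounded[OF F] by auto
 note [measurable] = tp_borel[OF F] Lp_torusD(2)[OF f]
 have "pmass p (%x. F x *R f x) <= pmass p (%x. C *R f x)"
  by (intro pmass_mono_AE) (use C in \<open>auto intro!: mult_right_mono\<close>)
 also have "... < \<infinity>" using Lp_torusD(3)[OF f] by (simp add: pmass_scaleR ennreal_mult_less_top)
 finally show ?thesis
  using periodic_compose2[OF tp_periodic[OF F] Lp_torusD(1)[OF f]] by (auto simp: Lp_torus_def)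
qed

lemma integrable_mult_Lmeas:
 fixes a b :: "'a::euclidean_space => real"
 assumes "a : Lmeas 2" "b : Lmeas 2"
 shows "integrable torus (%x. a x * b x)"
proof -
 note [measurable] = LmeasD(1)[OF assms(1)] LmeasD(1)[OF assms(2)]
 have "(\<oint>x. ennreal (norm (a x) * norm (b x)))\<^sup>2 < \<infinity>"
  using assms by (intro le_less_trans[OF nn_integral_norm_mult_le])
   (auto simp: Lmeas_def ennreal_mult_less_top)
 then have "(\<oint>x. ennreal (norm (a x) * norm (b x))) < \<infinity>"
  by (auto simp: power_less_top_ennreal)
 then show ?thesis by (intro integrableI_bounded) (auto simp: abs_mult)
qed

lemma Lp_torus_inner_tpv:
 fixes f :: "'a::euclidean_space => 'b::euclidean_space"
 assumes f: "f : Lp_torus p" "0 < p" and d: "tpv d"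
 shows "(%x. f x \<bullet> d x) : Lp_torus p"
proof -
 have "(%x. f x \<bullet> d x) = (%x. \<Sum>c\<in>Basis. (d x \<bullet> c) *R (f x \<bullet> c))"
  by (intro ext, subst euclidean_inner) (simp add: mult.commute)
 also have "... : Lp_torus p"
  by (intro Lp_torus_sum Lp_torus_mult_tp Lp_torus_inner f tpvD[OF d]) auto
 finally show ?thesis .
qed

lemma flux_terms_integrable:
 assumes f: "f : H1" and d: "tpv d"
 shows "integrable torus (%x. f x $ k * (f x \<bullet> d x))" "integrable torus (%x. vert (div_H f) x * (f x \<bullet> d x))"
 by (intro integrable_mult_Lmeas vert_Lmeas div_H_Lp_torus Lp_torus_Lmeas Lp_torus_nth Lp_torus_inner_tpv H1_L2 f d; simp)+

lemma flux_integrand: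
 "(\<Sum>b\<in>Basis. (velocity f x \<bullet> b) * (f x \<bullet> pd b g x)) = (\<Sum>k\<in>UNIV. f x $ k * (f x \<bullet> pd (axis k 1, 0) g x)) + vert (div_H f) x * (f x \<bullet> pd (0, 1) g x)"
 unfolding sum_Basis_R3 by (simp add: velocity_def inner_axis_R2 vertical_velocity_vert)

lemma flux_eq:
 assumes f: "f : H1" and g: "tpv g"
 shows "flux f g = (\<Sum>k\<in>UNIV. hor k f (pd (axis k 1, 0) g)) + (LINT x|torus. vert (div_H f) x * (f x \<bullet> pd (0, 1) g x))"
proof -
 have "flux f g = (LINT x|torus. (\<Sum>k\<in>UNIV. f x $ k * (f x \<bullet> pd (axis k 1, 0) g x))) + (LINT x|torus. vert (div_H f) x * (f x \<bullet> pd (0, 1) g x))"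
  unfolding flux_def flux_integrand
  by (intro LB_integral_add LB_integrable_sum flux_terms_integrable f tpv_pd g)
 also have "(LINT x|torus. (\<Sum>k\<in>UNIV. f x $ k * (f x \<bullet> pd (axis k 1, 0) g x))) = (\<Sum>k\<in>UNIV. hor k f (pd (axis k 1, 0) g))"
  unfolding hor_def by (intro LB_integral_sum flux_terms_integrable f tpv_pd g)
 finally show ?thesis .
qed

text \<open>The limit of \<open>flux f (smear h (moll n f))\<close> in n: averaged weak derivatives
  in the horizontal directions, a symmetric difference quotient in the vertical one.\<close>

definition rflux :: "real => (R3 => R2) => real" where
 "rflux h f = (\<Sum>k\<in>UNIV. hor k f (smear h (weak_pd (axis k 1, 0) f))) +
  (LINT x|torus. vert (div_H f) x * (f x \<bullet> (f (x + h *R (0, 1)) - f (x - h *R (0, 1))))) / (2 * h)"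

lemma shift_smear: "shift_measure (segm (-1) 1 h e)"
 by (rule shift_measure_segm) simp

lemma pmass_translate_diff:
 assumes "f : Lp_torus p" "g : Lp_torus p"
 shows "pmass p (%x. f (x + y) - g (x + y)) = pmass p (%x. f x - g x)"
 using pmass_translate[of "%x. f x - g x" p y] Lp_torusD[OF Lp_torus_diff[OF assms]] by simp

lemma flux_smear_moll_eq:
 assumes f: "f : H1" "f : Lp_torus 4" and h: "h ~= 0"
 shows "flux f (smear h (moll n f)) = (\<Sum>k\<in>UNIV. hor k f (smear h (moll n (weak_pd (axis k 1, 0) f)))) +
  (LINT x|torus. vert (div_H f) x * (f x \<bullet> (moll n f (x + h *R (0, 1)) - moll n f (x - h *R (0, 1))))) / (2 * h)"
proof -
 note fL = H1_L2[OF f(1)]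
 have tm: "tpv (moll n f)" by (rule tpv_moll[OF fL])
 have 1: "pd (axis k 1, 0) (smear h (moll n f)) = smear h (moll n (weak_pd (axis k 1, 0) f))" for k
 proof -
  have "moll n (weak_pd (axis k 1, 0) f) = pd (axis k 1, 0) (moll n f)"
   using moll_weak_pd[OF fL weak_pd_H1[OF f(1)], of "(axis k 1, 0)"] by auto
  then show ?thesis by (simp add: tpv_avg_segm(2)[OF tm])
 qed
 have 2: "vert (div_H f) x * (f x \<bullet> pd (0, 1) (smear h (moll n f)) x) =
  vert (div_H f) x * (f x \<bullet> (moll n f (x + h *R (0, 1)) - moll n f (x - h *R (0, 1)))) / (2 * h)" for x
  unfolding tpv_difference_quotient[OF tm h] inner_scaleR_right divide_inverse by (simp only: ac_simps)
 show ?thesis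
  unfolding flux_eq[OF f(1) tpv_avg_segm(1)[OF tm]] 1 2 by simp
qed

lemma flux_tendsto:
 assumes f: "f : H1" "f : Lp_torus 4" and h: "h ~= 0"
 shows "(%n. flux f (smear h (moll n f))) ----> rflux h f"
proof -
 interpret S: shift_measure "segm (-1) 1 h ((0, 1) :: R3)" by (rule shift_smear)
 let ?D = "%k. weak_pd (axis k 1, 0) f"
 let ?e = "h *R (0, 1) :: R3"
 have D: "?D k : Lp_torus 2" for k using weak_pd_H1[OF f(1)] by auto
 have l4: "(%n. pmass 4 (%x. moll n f x - f x)) ----> 0" by (rule pmass_moll_tendsto) (use f in auto)
 have m4: "moll n f : Lp_torus 4" for n using f by (auto intro: moll_Lp_torus)
 have m2: "moll n (?D k) : Lp_torus 2" for n k using D by (auto intro: moll_Lp_torus)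
 have A: "(%n. hor k f (smear h (moll n (?D k)))) ----> hor k f (smear h (?D k))" for k
 proof (rule hor_tendsto)
  have "(%n. pmass 2 (%x. moll n (?D k) x - ?D k x)) ----> 0" by (rule pmass_moll_tendsto) (use D in auto)
  then show "(%n. pmass 2 (%x. smear h (moll n (?D k)) x - smear h (?D k) x)) ----> 0"
   by (rule ennreal_tendsto_0_le) (intro S.pmass_avg_diff2 m2 D)
 qed (auto intro: f D m2 S.avg_Lp_torus simp: pmass_zero)
 have B: "(%n. LINT x|torus. vert (div_H f) x * (f x \<bullet> (moll n f (x + ?e) - moll n f (x - ?e)))) ---->
  (LINT x|torus. vert (div_H f) x * (f x \<bullet> (f (x + ?e) - f (x - ?e))))"
 proof (rule integral_tri_tendsto)
  show "vert (div_H f) : Lmeas 2" by (intro vert_Lmeas div_H_Lp_torus f)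
  then show "vert (div_H f) : Lmeas 2" .
  show "f : Lp_torus 4" by (rule f)
  then show "f : Lp_torus 4" .
  show "(%x. f (x + ?e) - f (x - ?e)) : Lp_torus 4"
   by (intro Lp_torus_diff Lp_torus_translate Lp_torus_translate_minus f)
  show "(%x. moll n f (x + ?e) - moll n f (x - ?e)) : Lp_torus 4" for n
   by (intro Lp_torus_diff Lp_torus_translate Lp_torus_translate_minus m4)
  have "(%n. 2 ^ 4 * (pmass 4 (%x. moll n f x - f x) + pmass 4 (%x. moll n f x - f x))) ----> 0"
   by (intro ennreal_tendsto_0_cmult ennreal_tendsto_0_add l4) (simp add: power_less_top_ennreal)
  then show "(%n. pmass 4 (%x. moll n f (x + ?e) - moll n f (x - ?e) - (f (x + ?e) - f (x - ?e)))) ----> 0"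
  proof (rule ennreal_tendsto_0_le)
   fix n
   have [measurable]: "moll n f : Borel" "f : Borel"
    using Lp_torusD(2)[OF m4] Lp_torusD(2)[OF f(2)] by auto
   have "pmass 4 (%x. moll n f (x + ?e) - moll n f (x - ?e) - (f (x + ?e) - f (x - ?e))) =
    pmass 4 (%x. (moll n f (x + ?e) - f (x + ?e)) - (moll n f (x - ?e) - f (x - ?e)))"
    by (rule arg_cong[where f="pmass 4"]) (auto simp: fun_eq_iff)
   also have "... <= 2 ^ 4 * (pmass 4 (%x. moll n f (x + ?e) - f (x + ?e)) + pmass 4 (%x. moll n f (x - ?e) - f (x - ?e)))"
    by (rule pmass_diff) measurable
   also have "pmass 4 (%x. moll n f (x + ?e) - f (x + ?e)) = pmass 4 (%x. moll n f x - f x)"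
    by (rule pmass_translate_diff[OF m4 f(2)])
   also have "pmass 4 (%x. moll n f (x - ?e) - f (x - ?e)) = pmass 4 (%x. moll n f x - f x)"
    using pmass_translate_diff[OF m4 f(2), of n "- ?e"] by (simp only: diff_conv_add_uminus)
   finally show "pmass 4 (%x. moll n f (x + ?e) - moll n f (x - ?e) - (f (x + ?e) - f (x - ?e))) <=
    2 ^ 4 * (pmass 4 (%x. moll n f x - f x) + pmass 4 (%x. moll n f x - f x))" .
  qed
 qed (auto simp: pmass_zero)
 show ?thesis
  unfolding flux_smear_moll_eq[OF f h] rflux_def
  by (intro tendsto_add tendsto_sum A tendsto_divide B tendsto_const) (use h in simp)
qed

text \<open>Dominates all fluxes at a fixed time. Its integrability in time is what the Besov bound
  has to provide.\<close>

definition bulk :: "(R3 => R2) => real" where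
 "bulk f = rmass 4 f + (grad_L2_norm f)\<^sup>2"

lemma rmass_2_eq: "f : Lp_torus 2 ==> rmass 2 f = (L2_norm f)\<^sup>2"
 by (simp add: rmass_def pmass_2_eq)

lemma grad_L2_norm_sq: "(grad_L2_norm f)\<^sup>2 = (\<Sum>b\<in>Basis. (L2_norm (weak_pd b f))\<^sup>2)"
 by (simp add: grad_L2_norm_def sum_nonneg)

lemma rmass_weak_pd_le: "f : H1 ==> b : Basis ==> rmass 2 (weak_pd b f) <= (grad_L2_norm f)\<^sup>2"
 unfolding grad_L2_norm_sq rmass_2_eq[OF weak_pd_H1(1)] by (rule member_le_sum) auto

lemma rmass_avg_le:
 assumes "shift_measure \<mu>" "f : Lp_torus p" "p : {2, 4}"
 shows "rmass p (avg \<mu> f) <= rmass p f"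
 using assms by (intro rmass_mono shift_measure.pmass_avg_le) (auto simp: Lp_torus_def)

lemma rmass_moll_le: "f : Lp_torus p ==> p : {2, 4} ==> rmass p (moll n f) <= rmass p f"
 unfolding moll_def by (rule rmass_avg_le[OF shift_measure_kernm])

lemma rmass_translate: "f : Lp_torus p ==> rmass p (%x. f (x + y)) = rmass p f"
 by (simp add: rmass_def pmass_translate Lp_torusD)

lemma rmass_div_H_le:
 assumes "f : H1" shows "rmass 2 (div_H f) <= 8 * (grad_L2_norm f)\<^sup>2"
proof -
 let ?D = "%k::2. %x. weak_pd (axis k 1, 0) f x $ k"
 have D: "?D k : Lp_torus 2" for k by (intro Lp_torus_nth weak_pd_H1 assms) simp
 note [measurable] = Lp_torusD(2)[OF D]
 have le: "rmass 2 (?D k) <= (grad_L2_norm f)\<^sup>2" for k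
  by (rule order_trans[OF rmass_nth_le rmass_weak_pd_le]) (auto intro: weak_pd_H1 assms)
 have "pmass 2 (div_H f) <= 2 ^ 2 * (pmass 2 (?D 1) + pmass 2 (?D 2))"
  unfolding div_H_def[abs_def] sum_2 by (rule pmass_add) auto
 also have "... = ennreal (4 * (rmass 2 (?D 1) + rmass 2 (?D 2)))"
  using Lp_torusD(3)[OF D] by (simp add: rmass_def ennreal_mult ennreal_plus less_top)
 finally have "rmass 2 (div_H f) <= 4 * (rmass 2 (?D 1) + rmass 2 (?D 2))"
  unfolding rmass_def[of 2 "div_H f"] by (intro enn2real_leI) (auto simp: rmass_nonneg)
 with le[of 1] le[of 2] show ?thesis by simp
qed

text \<open>512 is 8 * 8 * 8: twice the bound 2 pi <= 8 for the vertical length, and the factor 8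
  for the divergence.\<close>

lemma rmass_vert_le:
 assumes "f : H1" shows "rmass 2 (vert (div_H f)) <= 512 * (grad_L2_norm f)\<^sup>2"
proof -
 have D: "div_H f : Lp_torus 2" by (rule div_H_Lp_torus[OF assms])
 have "pmass 2 (vert (div_H f)) <= ennreal (2 * pi) * (ennreal (2 * pi) * ennreal (rmass 2 (div_H f)))"
  using pmass_vert_le[OF D] Lp_torusD(3)[OF D] by (simp add: rmass_def less_top)
 also have "... = ennreal ((2 * pi) * ((2 * pi) * rmass 2 (div_H f)))"
  by (simp only: ennreal_mult pi_ge_zero mult_nonneg_nonneg rmass_nonneg zero_le_numeral)
 finally have "rmass 2 (vert (div_H f)) <= (2 * pi) * ((2 * pi) * rmass 2 (div_H f))"
  unfolding rmass_def[of 2 "vert _"] by (intro enn2real_leI) (auto simp: rmass_nonneg)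
 also have "... <= 8 * (8 * rmass 2 (div_H f))"
  using pi_less_4 by (intro mult_mono) (auto simp: rmass_nonneg)
 also have "... <= 8 * (8 * (8 * (grad_L2_norm f)\<^sup>2))"
  using rmass_div_H_le[OF assms] by simp
 finally show ?thesis by simp
qed

lemma hor_smear_bound:
 assumes f: "f : H1" "f : Lp_torus 4" and d: "d : Lp_torus 2" "rmass 2 d <= (grad_L2_norm f)\<^sup>2"
 shows "\<bar>hor k f (smear h d)\<bar> <= 4 * bulk f"
proof -
 have "\<bar>hor k f (smear h d)\<bar> <= 2 * (rmass 2 (smear h d) + 2 * rmass 4 f)"
  by (intro hor_bound f shift_measure.avg_Lp_torus[OF shift_smear] d) simp
 also have "rmass 2 (smear h d) <= (grad_L2_norm f)\<^sup>2"
  by (rule order_trans[OF rmass_avg_le[OF shift_smear d(1)] d(2)]) simp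
 finally have "\<bar>hor k f (smear h d)\<bar> <= 2 * ((grad_L2_norm f)\<^sup>2 + 2 * rmass 4 f)" by simp
 moreover have "2 * (x + 2 * y) <= 4 * (y + x)" if "0 <= x" for x y :: real using that by simp
 ultimately show ?thesis unfolding bulk_def using zero_le_power2 order_trans by blast
qed

text \<open>At fixed h Young's inequality is applied directly to the difference quotient and the
  factor 1 / h stays. Uniformity in n is what dominated convergence asks for here.\<close>

lemma flux_bound:
 assumes f: "f : H1" "f : Lp_torus 4" and h: "0 < h"
 shows "\<bar>flux f (smear h (moll n f))\<bar> <= (8 + 512 / h) * bulk f"
proof -
 let ?D = "%k. weak_pd (axis k 1, 0) f"
 let ?e = "h *R (0, 1) :: R3"
 let ?m = "moll n f"
 have m4: "?m : Lp_torus 4" using f by (auto intro: moll_Lp_torus)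
 have md: "(%x. ?m (x + ?e) - ?m (x - ?e)) : Lp_torus 4"
  by (intro Lp_torus_diff Lp_torus_translate Lp_torus_translate_minus m4)
 have "pmass 4 (%x. ?m (x + ?e) - ?m (x - ?e)) <= 2 ^ 4 * (pmass 4 (%x. ?m (x + ?e)) + pmass 4 (%x. ?m (x - ?e)))"
  by (intro pmass_diff Lp_torusD[OF Lp_torus_translate[OF m4]] Lp_torusD[OF Lp_torus_translate_minus[OF m4]])
 also have "pmass 4 (%x. ?m (x + ?e)) = pmass 4 ?m"
  by (intro pmass_translate Lp_torusD[OF m4])
 also have "pmass 4 (%x. ?m (x - ?e)) = pmass 4 ?m"
  using pmass_translate[OF Lp_torusD(2,1)[OF m4], of 4 "- ?e"] by (simp only: diff_conv_add_uminus)
 also have "pmass 4 ?m <= pmass 4 f" by (rule pmass_moll_le[OF f(2)]) simp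
 also have "2 ^ 4 * (pmass 4 f + pmass 4 f) = ennreal (32 * rmass 4 f)"
  using Lp_torusD(3)[OF f(2)] by (simp add: rmass_def ennreal_mult less_top distrib_right[symmetric] flip: mult_2)
 finally have *: "rmass 4 (%x. ?m (x + ?e) - ?m (x - ?e)) <= 32 * rmass 4 f"
  unfolding rmass_def[of 4 "%x. ?m (x + ?e) - ?m (x - ?e)"]
  by (intro enn2real_leI) (auto simp: rmass_nonneg add_mono mult_left_mono)
 have "\<bar>LINT x|torus. vert (div_H f) x * (f x \<bullet> (?m (x + ?e) - ?m (x - ?e)))\<bar> <=
  rmass 2 (vert (div_H f)) + rmass 4 f + rmass 4 (%x. ?m (x + ?e) - ?m (x - ?e))"
  by (intro integral_tri_young vert_Lmeas div_H_Lp_torus f md)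
 also have "... <= 512 * (grad_L2_norm f)\<^sup>2 + rmass 4 f + 32 * rmass 4 f"
  by (intro add_mono rmass_vert_le f * order_refl)
 also have "... <= 1024 * bulk f"
  by (simp add: bulk_def rmass_nonneg)
 finally have "\<bar>LINT x|torus. vert (div_H f) x * (f x \<bullet> (?m (x + ?e) - ?m (x - ?e)))\<bar> / (2 * h) <= 1024 * bulk f / (2 * h)"
  using h by (intro divide_right_mono) auto
 then have B: "\<bar>(LINT x|torus. vert (div_H f) x * (f x \<bullet> (?m (x + ?e) - ?m (x - ?e)))) / (2 * h)\<bar> <= 512 / h * bulk f"
  using h by (simp add: abs_divide)
 have A: "\<bar>hor k f (smear h (moll n (?D k)))\<bar> <= 4 * bulk f" for k
 proof (rule hor_smear_bound[OF f])
  have D: "?D k : Lp_torus 2" using weak_pd_H1[OF f(1)] by auto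
  show "moll n (?D k) : Lp_torus 2" using D by (auto intro: moll_Lp_torus)
  show "rmass 2 (moll n (?D k)) <= (grad_L2_norm f)\<^sup>2"
   by (rule order_trans[OF rmass_moll_le[OF D] rmass_weak_pd_le[OF f(1)]]) auto
 qed
 have "\<bar>\<Sum>k\<in>UNIV. hor k f (smear h (moll n (?D k)))\<bar> <= 8 * bulk f"
  using A[of 1] A[of 2] unfolding sum_2 by linarith
 moreover have "flux f (smear h ?m) = (\<Sum>k\<in>UNIV. hor k f (smear h (moll n (?D k)))) + (LINT x|torus. vert (div_H f) x * (f x \<bullet> (?m (x + ?e) - ?m (x - ?e)))) / (2 * h)"
  using h by (intro flux_smear_moll_eq f) simp
 ultimately show ?thesis using B unfolding distrib_right by linarith
qed

lemma rflux_eq: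
 assumes f: "f : H1" "f : hydro_sol" "f : Lp_torus 4" and h: "h ~= 0"
 shows "rflux h f = (\<Sum>k\<in>UNIV. hor k f (smear h (weak_pd (axis k 1, 0) f))) +
  (LINT x|torus. avg (segm 0 1 h (0, 1)) (div_H f) x * (f x \<bullet> f (x + h *R (0, 1)))) / 2"
 unfolding rflux_def vert_difference_quotient[OF f] using h by simp

text \<open>After \<open>rflux_eq\<close> no 1 / h is left. The horizontal terms contribute at most
  \<open>8 * bulk f\<close>, the averaged divergence at most \<open>4 * bulk f\<close>.\<close>

lemma rflux_bound:
 assumes f: "f : H1" "f : hydro_sol" "f : Lp_torus 4" and h: "h ~= 0"
 shows "\<bar>rflux h f\<bar> <= 16 * bulk f"
proof -
 let ?D = "%k. weak_pd (axis k 1, 0) f"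
 interpret S: shift_measure "segm 0 1 h ((0, 1) :: R3)" by (rule shift_measure_segm) simp
 have D: "div_H f : Lp_torus 2" by (rule div_H_Lp_torus[OF f(1)])
 have A: "\<bar>hor k f (smear h (?D k))\<bar> <= 4 * bulk f" for k
  by (rule hor_smear_bound[OF f(1,3)]) (auto intro: weak_pd_H1 f rmass_weak_pd_le)
 have "\<bar>LINT x|torus. avg (segm 0 1 h (0, 1)) (div_H f) x * (f x \<bullet> f (x + h *R (0, 1)))\<bar> <=
  rmass 2 (avg (segm 0 1 h (0, 1)) (div_H f)) + rmass 4 f + rmass 4 (%x. f (x + h *R (0, 1)))"
  by (intro integral_tri_young Lp_torus_Lmeas S.avg_Lp_torus D f Lp_torus_translate) simp
 also have "... <= 8 * (grad_L2_norm f)\<^sup>2 + rmass 4 f + rmass 4 f"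
 proof (intro add_mono order_refl)
  show "rmass 2 (avg (segm 0 1 h (0, 1)) (div_H f)) <= 8 * (grad_L2_norm f)\<^sup>2"
   using rmass_avg_le[OF S.shift_measure_axioms D] rmass_div_H_le[OF f(1)] by simp
  show "rmass 4 (%x. f (x + h *R (0, 1))) <= rmass 4 f" by (simp only: rmass_translate[OF f(3)])
 qed
 also have "... <= 8 * bulk f" by (simp add: bulk_def rmass_nonneg)
 finally have B: "\<bar>LINT x|torus. avg (segm 0 1 h (0, 1)) (div_H f) x * (f x \<bullet> f (x + h *R (0, 1)))\<bar> <= 8 * bulk f" .
 have "0 <= bulk f" by (simp add: bulk_def rmass_nonneg)
 moreover have "\<bar>\<Sum>k\<in>UNIV. hor k f (smear h (?D k))\<bar> <= 8 * bulk f"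
  using A[of 1] A[of 2] unfolding sum_2 by linarith
 ultimately show ?thesis using B unfolding rflux_eq[OF f h] by linarith
qed

text \<open>All averages and shifts tend to the identity; what remains is the horizontal flux plus
  half the integral of the divergence times |f|^2, and this is zero by the product rule.\<close>

lemma rflux_tendsto:
 assumes f: "f : H1" "f : hydro_sol" "f : Lp_torus 4" and h: "h ----> 0" "!!n. 0 < h n"
 shows "(%n. rflux (h n) f) ----> 0"
proof -
 let ?D = "%k. weak_pd (axis k 1, 0) f"
 have D: "?D k : Lp_torus 2" for k using weak_pd_H1[OF f(1)] by auto
 have dv: "div_H f : Lp_torus 2" by (rule div_H_Lp_torus[OF f(1)])
 have h0: "h n ~= 0" "0 <= h n" for n using h(2)[of n] by auto
 have A: "(%n. hor k f (smear (h n) (?D k))) ----> hor k f (?D k)" for k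
 proof (rule hor_tendsto)
  show "(%n. pmass 2 (%x. smear (h n) (?D k) x - ?D k x)) ----> 0"
   by (rule pmass_avg_tendsto[OF D _ shift_smear segm_tendsto]) (auto intro: h h0)
 qed (auto intro: f D shift_measure.avg_Lp_torus[OF shift_smear] simp: pmass_zero)
 have B: "(%n. LINT x|torus. avg (segm 0 1 (h n) (0, 1)) (div_H f) x * (f x \<bullet> f (x + h n *R (0, 1)))) ---->
  (LINT x|torus. div_H f x * (f x \<bullet> f x))"
 proof (rule integral_tri_tendsto)
  have sm: "shift_measure (segm 0 1 (h n) ((0, 1) :: R3))" for n by (rule shift_measure_segm) simp
  show "(%n. pmass 2 (%x. avg (segm 0 1 (h n) (0, 1)) (div_H f) x - div_H f x)) ----> 0"
   by (rule pmass_avg_tendsto[OF dv _ sm segm_tendsto]) (auto intro: h h0)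
  show "avg (segm 0 1 (h n) (0, 1)) (div_H f) : Lmeas 2" for n
   by (intro Lp_torus_Lmeas shift_measure.avg_Lp_torus[OF sm] dv) simp
  have "(%n. h n *R ((0, 1) :: R3)) ----> 0 *R (0, 1)" by (intro tendsto_intros h)
  then have "(%n. h n *R ((0, 1) :: R3)) ----> 0" by (simp only: scaleR_zero_left)
  from torus_Lp_translation[OF f(3) _ this]
  show "(%n. pmass 4 (%x. f (x + h n *R (0, 1)) - f x)) ----> 0" by (simp only: zero_less_numeral)
  show "(%x. f (x + h n *R (0, 1))) : Lp_torus 4" for n by (rule Lp_torus_translate[OF f(3)])
 qed (auto intro: f dv Lp_torus_Lmeas simp: pmass_zero)
 have "(%n. rflux (h n) f) ----> (\<Sum>k\<in>UNIV. hor k f (?D k)) + (LINT x|torus. div_H f x * (f x \<bullet> f x)) / 2"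
  unfolding rflux_eq[OF f h0(1)]
  by (intro tendsto_add tendsto_sum A tendsto_divide B tendsto_const) simp
 also have "(\<Sum>k\<in>UNIV. hor k f (?D k)) + (LINT x|torus. div_H f x * (f x \<bullet> f x)) / 2 = 0"
 proof -
  have "(LINT x|torus. div_H f x * (f x \<bullet> f x)) = (\<Sum>k\<in>UNIV. LINT x|torus. ?D k x $ k * (f x \<bullet> f x))"
   unfolding div_H_def sum_distrib_right
   by (intro LB_integral_sum integrable_tri Lp_torus_Lmeas Lp_torus_nth D f)
  also have "... = (\<Sum>k\<in>UNIV. - 2 * hor k f (?D k))"
   using hor_product_rule[OF f(1,3)] by (intro sum.cong) (auto simp: add_eq_0_iff)
  finally show ?thesis by (simp add: sum_2 field_simps)
 qed
 finally show ?thesis .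
qed

section \<open>The Ladyzhenskaya inequality on the two-dimensional torus\<close>

text \<open>Convergence in L2 yields almost everywhere convergence along a subsequence; Fatou's
  lemma then transports a bound in any other exponent.\<close>

lemma pmass_Fatou:
 fixes f :: "'a::euclidean_space => 'b::euclidean_space"
 assumes f: "f : Lp_torus 2" and f': "!!n. f' n : Lp_torus 2"
  and lim: "(%n. pmass 2 (%x. f' n x - f x)) ----> 0" and bnd: "!!n. pmass p (f' n) <= K"
 shows "pmass p f <= K"
proof -
 note [measurable] = Lp_torusD(2)[OF f] Lp_torusD(2)[OF f']
 let ?u = "%n x. (norm (f' n x - f x))\<^sup>2"
 have "EX r. strict_mono r & (AE x in torus. (%n. ?u (r n) x) ----> 0)"
 proof (rule tendsto_L1_AE_subseq)
  show "integrable torus (?u n)" for n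
   by (intro integrable_rmass Lp_torus_Lmeas Lp_torus_diff f f')
  have "ennreal (LINT x|torus. norm (?u n x)) = pmass 2 (%x. f' n x - f x)" for n
   unfolding pmass_def
   by (subst nn_integral_eq_integral[symmetric]) (auto intro!: integrable_rmass Lp_torus_Lmeas Lp_torus_diff f f')
  then have "(%n. ennreal (LINT x|torus. norm (?u n x))) ----> ennreal 0" using lim by simp
  then show "(%n. LINT x|torus. norm (?u n x)) ----> 0"
   by (subst (asm) tendsto_ennreal_iff) (auto intro: always_eventually integral_nonneg)
 qed
 then obtain r where r: "AE x in torus. (%n. ?u (r n) x) ----> 0" by blast
 have "pmass p f = (\<oint>x. liminf (%n. ennreal (norm (f' (r n) x) ^ p)))"
  unfolding pmass_def
 proof (rule nn_integral_cong_AE)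
  show "AE x in torus. ennreal (norm (f x) ^ p) = liminf (%n. ennreal (norm (f' (r n) x) ^ p))"
   using r
  proof eventually_elim
   case (elim x)
   then have "(%n. norm (f' (r n) x - f x)) ----> 0"
    using tendsto_real_sqrt[of "%n. ?u (r n) x" 0] by simp
   then have "(%n. f' (r n) x) ----> f x"
    by (simp add: tendsto_norm_zero_iff LIM_zero_iff)
   then have "(%n. ennreal (norm (f' (r n) x) ^ p)) ----> ennreal (norm (f x) ^ p)"
    by (intro tendsto_ennrealI tendsto_intros)
   then show ?case by (rule lim_imp_Liminf[OF trivial_limit_sequentially, symmetric])
  qed
 qed
 also have "... <= liminf (%n. pmass p (f' (r n)))"
  unfolding pmass_def by (rule nn_integral_liminf) measurable
 also have "... <= liminf (%n. K)"
  by (rule Liminf_mono) (simp add: bnd)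
 finally show ?thesis by (simp add: Liminf_const)
qed

lemma periodic_line:
 assumes "periodic k" "b : Basis"
 shows "periodic (%s::real. k (x + s *R b))"
 unfolding periodic_def
proof (intro allI ballI)
 fix s c :: real assume "c : Basis"
 then have "x + (s + (2 * pi) *R c) *R b = (x + s *R b) + (2 * pi) *R b" by (simp add: algebra_simps)
 then show "k (x + (s + (2 * pi) *R c) *R b) = k (x + s *R b)"
  using periodicD[OF assms] by metis
qed

lemma nn_integral_line_shift:
 fixes k :: "'a::euclidean_space => ennreal"
 assumes [measurable]: "k : Borel" and k: "periodic k" and b: "b : Basis"
 shows "(\<integral>\<^sup>+s. k (x + r *R b + s *R b) \<partial>(torus :: real measure)) = (\<oint>s. k (x + s *R b))"
proof -
 have "(\<oint>s. k (x + r *R b + s *R b)) = (\<integral>\<^sup>+s. k (x + (s + r) *R b) \<partial>(torus :: real measure))"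
  by (simp add: algebra_simps)
 also have "... = (\<oint>s. k (x + s *R b))"
  by (rule nn_integral_torus_translate[where f="%s. k (x + s *R b)"]) (auto intro: periodic_line k b)
 finally show ?thesis .
qed

lemma nn_integral_swap_line:
 fixes k :: "'a::euclidean_space => real => ennreal"
 assumes [measurable]: "case_prod k : borel_measurable (borel \<Otimes>\<^sub>M borel)"
 shows "(\<oint>x. (\<oint>s. k x s)) = (\<oint>s. (\<oint>x. k x s))"
proof -
 interpret P: pair_sigma_finite "torus :: 'a measure" "torus :: real measure" by (rule pair_torus_torus)
 have "(%z. (fst z, snd z)) : measurable ((torus :: 'a measure) \<Otimes>\<^sub>M (torus :: real measure)) (borel \<Otimes>\<^sub>M borel)"
  by measurable
 then have [measurable]: "case_prod k : borel_measurable ((torus :: 'a measure) \<Otimes>\<^sub>M (torus :: real measure))"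
  using measurable_comp[OF _ assms, of "%z. (fst z, snd z)" "(torus :: 'a measure) \<Otimes>\<^sub>M (torus :: real measure)"] by (simp add: comp_def)
 show ?thesis using P.Fubini'[of k] by simp
qed

lemma R2_rep: "(x :: R2) = (x $ 1) *R axis 1 1 + (x $ 2) *R axis 2 1"
 by (auto simp: vec_eq_iff axis_def forall_2)

text \<open>\<open>G1\<close> depends on the second coordinate only and \<open>G2\<close> on the
  first, so the integral of the product splits. Since \<open>real^2\<close> is not a product type,
  the splitting is done by averaging \<open>G1\<close> over shifts along the second axis; the
  average \<open>H\<close> is constant.\<close>

lemma nn_integral_crossed_product:
 fixes G1 G2 :: "R2 => ennreal"
 assumes [measurable]: "G1 : Borel" "G2 : Borel"
  and per: "periodic G1" "periodic G2"
  and inv: "!!x r. G1 (x + r *R axis 1 1) = G1 x" "!!x r. G2 (x + r *R axis 2 1) = G2 x"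
 shows "emeasure torus (cell :: R2 set) * (\<oint>x. G1 x * G2 x) = (\<oint>x. G1 x) * (\<oint>x. G2 x)"
proof -
 let ?e1 = "axis 1 1 :: R2" and ?e2 = "axis 2 1 :: R2"
 let ?l = "ennreal (2 * pi)"
 define H where "H x = (\<oint>s. G1 (x + s *R ?e2))" for x
 have [measurable]: "H : Borel"
  unfolding H_def by (rule sigma_finite_measure.borel_measurable_nn_integral[OF sigma_finite_torus]) measurable
 have H2: "H (x + r *R ?e2) = H x" for x r
  unfolding H_def by (rule nn_integral_line_shift) (auto intro: per)
 have H1: "H (x + r *R ?e1) = H x" for x r
 proof -
  have "G1 (x + r *R ?e1 + s *R ?e2) = G1 (x + s *R ?e2)" for s
   using inv(1)[of "x + s *R ?e2" r] by (simp add: algebra_simps)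
  then show ?thesis by (simp add: H_def)
 qed
 have Hc: "H x = H 0" for x
  using H1[of 0 "x $ 1"] H2[of "0 + (x $ 1) *R ?e1" "x $ 2"] R2_rep[of x] by simp
 have "?l * (\<oint>x. G1 x) = (\<integral>\<^sup>+s. (\<oint>x. G1 x) \<partial>(torus :: real measure))"
  by (simp add: emeasure_torus_real mult.commute)
 also have "... = (\<integral>\<^sup>+s. (\<oint>x. G1 (x + s *R ?e2)) \<partial>(torus :: real measure))"
  using nn_integral_torus_translate[OF _ per(1)] by simp
 also have "... = (\<oint>x. H x)"
  unfolding H_def by (rule nn_integral_swap_line[symmetric]) measurable
 also have "... = (\<integral>\<^sup>+x. H 0 \<partial>(torus :: R2 measure))"
  by (intro nn_integral_cong) (rule Hc)
 also have "... = H 0 * emeasure torus (cell :: R2 set)" by simp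
 finally have 1: "?l * (\<oint>x. G1 x) = H 0 * emeasure torus (cell :: R2 set)" .
 have per12: "periodic (%x. G1 x * G2 x)" by (rule periodic_compose2[OF per])
 have "?l * (\<oint>x. G1 x * G2 x) = (\<integral>\<^sup>+s. (\<oint>x. G1 x * G2 x) \<partial>(torus :: real measure))"
  by (simp add: emeasure_torus_real mult.commute)
 also have "... = (\<integral>\<^sup>+s. (\<oint>x. G1 (x + s *R ?e2) * G2 (x + s *R ?e2)) \<partial>(torus :: real measure))"
  using nn_integral_torus_translate[OF _ per12] by simp
 also have "... = (\<integral>\<^sup>+s. (\<oint>x. G1 (x + s *R ?e2) * G2 x) \<partial>(torus :: real measure))"
  by (simp add: inv)
 also have "... = (\<oint>x. (\<integral>\<^sup>+s. G1 (x + s *R ?e2) * G2 x \<partial>(torus :: real measure)))"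
  by (rule nn_integral_swap_line[symmetric]) measurable
 also have "... = (\<oint>x. H x * G2 x)"
  by (simp add: H_def nn_integral_multc)
 also have "... = (\<oint>x. H 0 * G2 x)"
 proof (rule nn_integral_cong)
  show "H x * G2 x = H 0 * G2 x" for x
   by (subst Hc[of x]) (rule refl)
 qed
 also have "... = H 0 * (\<oint>x. G2 x)" by (simp add: nn_integral_cmult)
 finally have 2: "?l * (\<oint>x. G1 x * G2 x) = H 0 * (\<oint>x. G2 x)" .
 have "?l * (emeasure torus (cell :: R2 set) * (\<oint>x. G1 x * G2 x)) =
  (H 0 * emeasure torus (cell :: R2 set)) * (\<oint>x. G2 x)"
  using 2 by (simp add: ac_simps)
 also have "... = ?l * ((\<oint>x. G1 x) * (\<oint>x. G2 x))"
  unfolding 1[symmetric] by (simp add: ac_simps)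
 finally show ?thesis
  using pi_gt_zero by (subst (asm) ennreal_mult_cancel_left) (auto simp: ennreal_eq_0_iff)
qed

text \<open>On a circle a function is at most its mean plus its total variation. The factor 1 / (2
  pi) of the mean is estimated by 1.\<close>

lemma tp_le_line_integral:
 fixes h :: "R2 => real"
 assumes h: "tp h" "!!x. 0 <= h x"
 shows "ennreal (h x) <= (\<integral>\<^sup>+s. ennreal (h (x + s *R b) + \<bar>pd b h (x + s *R b)\<bar>) \<partial>(torus :: real measure))"
proof -
 define P where "P = (LINT s|(torus :: real measure). \<bar>pd b h (x + s *R b)\<bar>)"
 have [measurable]: "h : Borel" "pd b h : Borel"
  using h by (auto intro: tp_borel tp_pd)
 obtain C where C: "!!x. \<bar>h x\<bar> <= C" using tp_bounded[OF h(1)] by auto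
 obtain D where D: "!!x. \<bar>pd b h x\<bar> <= D" using tp_bounded[OF tp_pd[OF h(1)]] by metis
 have ih: "integrable torus (%s::real. h (x + s *R b))"
  by (rule integrable_torus_bounded[where C=C]) (use C in auto)
 have ip: "integrable torus (%s::real. \<bar>pd b h (x + s *R b)\<bar>)"
  by (rule integrable_torus_bounded[where C=D]) (use D in auto)
 have step: "h x <= h (x + s *R b) + P" if s: "s : cell" for s
 proof -
  \<comment> \<open>Ordering the end points covers both signs of \<open>s\<close>.\<close>
  define a c where "a = min 0 s" and "c = max 0 s"
  have ac: "a <= c" "- pi <= a" "c <= pi" using s by (auto simp: a_def c_def mem_cell_real)
  have "\<bar>h (x + s *R b) - h x\<bar> = \<bar>h (x + c *R b) - h (x + a *R b)\<bar>"
   by (auto simp: a_def c_def min_def max_def)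
  also have "... = \<bar>LINT r:{a..c}|lborel. pd b h (x + r *R b)\<bar>"
   using tp_ftc[OF h(1) ac(1), of 1 b x] by simp
  also have "... <= (LINT r:{a..c}|lborel. \<bar>pd b h (x + r *R b)\<bar>)"
   unfolding set_lebesgue_integral_def
   by (rule order_trans[OF integral_abs_bound]) (simp add: abs_mult)
  also have "... <= P"
   unfolding P_def integral_torus set_lebesgue_integral_def
  proof (rule integral_mono)
   show "integrable lborel (%r. indicator cell r *R \<bar>pd b h (x + r *R b)\<bar>)"
    using ip by (simp add: integrable_torus)
   then have "set_integrable lborel cell (%r. \<bar>pd b h (x + r *R b)\<bar>)"
    by (simp add: set_integrable_def)
   then have "set_integrable lborel {a..c} (%r. \<bar>pd b h (x + r *R b)\<bar>)"
    by (rule set_integrable_subset) (use ac in \<open>auto simp: mem_cell_real\<close>)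
   then show "integrable lborel (%r. indicator {a..c} r *R \<bar>pd b h (x + r *R b)\<bar>)"
    by (simp add: set_integrable_def)
  qed (use ac in \<open>auto simp: indicator_def mem_cell_real\<close>)
  finally show ?thesis by linarith
 qed
 have "2 * pi * h x = (LINT s|(torus :: real measure). h x)" by (simp add: measure_torus_real)
 also have "... <= (LINT s|(torus :: real measure). h (x + s *R b) + P)"
  using step ih by (intro integral_mono) auto
 also have "... = (LINT s|(torus :: real measure). h (x + s *R b)) + 2 * pi * P"
  using ih by (simp add: measure_torus_real)
 finally have le: "2 * pi * h x <= (LINT s|(torus :: real measure). h (x + s *R b)) + 2 * pi * P" .
 have "(LINT s|(torus :: real measure). h (x + s *R b)) <= 2 * pi * (LINT s|(torus :: real measure). h (x + s *R b))"
 proof -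
  have "1 * I <= 2 * pi * I" if "0 <= I" for I :: real
   using pi_gt3 that by (intro mult_right_mono) auto
  moreover have "0 <= (LINT s|(torus :: real measure). h (x + s *R b))"
   by (intro Bochner_Integration.integral_nonneg h(2))
  ultimately show ?thesis by (simp only: mult_1)
 qed
 with le have "2 * pi * h x <= 2 * pi * ((LINT s|(torus :: real measure). h (x + s *R b)) + P)"
  by (simp add: distrib_left)
 then have "h x <= (LINT s|(torus :: real measure). h (x + s *R b)) + P"
  by (rule mult_left_le_imp_le) simp
 also have "... = (LINT s|(torus :: real measure). h (x + s *R b) + \<bar>pd b h (x + s *R b)\<bar>)"
  unfolding P_def using ih ip by simp
 finally have "ennreal (h x) <= ennreal (LINT s|(torus :: real measure). h (x + s *R b) + \<bar>pd b h (x + s *R b)\<bar>)"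
  by (rule ennreal_leI)
 also have "... = (\<integral>\<^sup>+s. ennreal (h (x + s *R b) + \<bar>pd b h (x + s *R b)\<bar>) \<partial>(torus :: real measure))"
  using ih ip h(2) by (intro nn_integral_eq_integral[symmetric]) auto
 finally show ?thesis .
qed

lemma ennreal_mult_le_squares: "(a :: ennreal) * b <= a\<^sup>2 + b\<^sup>2"
proof (cases "a <= b")
 case True
 then have "a * b <= b * b" by (rule mult_right_mono) simp
 then show ?thesis by (simp add: power2_eq_square add_increasing)
next
 case False
 then have "a * b <= a * a" by (intro mult_left_mono) auto
 then show ?thesis by (simp add: power2_eq_square add_increasing2)
qed

lemma ennreal_add_square_le: "((a :: ennreal) + b)\<^sup>2 <= 4 * (a\<^sup>2 + b\<^sup>2)"
proof -
 have m: "max a b ^ 2 <= a\<^sup>2 + b\<^sup>2" by (auto simp: max_def add_increasing add_increasing2)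
 have "a + b <= 2 * max a b" by (simp add: mult_2 add_mono)
 then have "(a + b)\<^sup>2 <= (2 * max a b)\<^sup>2" by (rule power_mono) simp
 also have "... = 4 * (max a b)\<^sup>2" by (simp add: power_mult_distrib)
 also have "... <= 4 * (a\<^sup>2 + b\<^sup>2)" by (intro mult_left_mono m) simp
 finally show ?thesis .
qed

text \<open>The value of |g|^2 at x is bounded by line integrals through x in either direction, so
  |g|^4 is bounded by a product of two functions of one coordinate each. The integral of the product
  splits, and Cauchy-Schwarz bounds each factor by the norms of \<open>g\<close> and one
  derivative.\<close>

lemma Ladyzhenskaya_tpv:
 fixes g :: "R2 => R2"
 assumes g: "tpv g"
 shows "emeasure torus (cell :: R2 set) * pmass 4 g <= ennreal ((2 * pi)\<^sup>2) *
  (4 * ((pmass 2 g)\<^sup>2 + 4 * (pmass 2 g * pmass 2 (pd (axis 1 1) g))) +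
  4 * ((pmass 2 g)\<^sup>2 + 4 * (pmass 2 g * pmass 2 (pd (axis 2 1) g))))"
proof -
 define h where "h x = g x \<bullet> g x" for x
 have h: "tp h"
 proof -
  have "tp (%x. \<Sum>j\<in>Basis. (g x \<bullet> j) * (g x \<bullet> j))" by (intro tp_sum tp_mult tpvD g)
  then show ?thesis by (simp add: h_def[abs_def] euclidean_inner[of "g _" "g _"])
 qed
 have h0: "0 <= h x" for x by (simp add: h_def)
 have pdh: "pd b h x = 2 * (g x \<bullet> pd b g x)" for b x
 proof -
  have "(h has_derivative (%e. g x \<bullet> pd e g x + pd e g x \<bullet> g x)) (at x)"
   unfolding h_def[abs_def] using pd_has_derivative[OF tpv_differentiable[OF g]]
   by (auto intro!: derivative_eq_intros)
  from pd_eqI[OF this] show ?thesis by (simp add: inner_commute)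
 qed
 have [measurable]: "g : Borel" "pd b g : Borel" "h : Borel" "pd b h : Borel" for b
  by (auto intro: tpv_borel tpv_pd g tp_borel tp_pd h)
 define k where "k b x = ennreal (h x + \<bar>pd b h x\<bar>)" for b x
 have [measurable]: "k b : Borel" for b unfolding k_def by measurable
 have perk: "periodic (k b)" for b
  unfolding k_def using tp_periodic[OF h] tp_periodic[OF tp_pd[OF h]] by (rule periodic_compose2)
 define G where "G b x = (\<integral>\<^sup>+s. k b (x + s *R b) \<partial>(torus :: real measure))" for b x
 have [measurable]: "G b : Borel" for b
  unfolding G_def by (rule sigma_finite_measure.borel_measurable_nn_integral[OF sigma_finite_torus]) measurable
 have perG: "periodic (G b)" for b
  unfolding periodic_def G_def
 proof (intro allI ballI nn_integral_cong)
  fix x c s assume "c : (Basis :: R2 set)"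
  then show "k b (x + (2 * pi) *R c + s *R b) = k b (x + s *R b)"
   using periodicD[OF perk, of c b "x + s *R b"] by (simp add: algebra_simps)
 qed
 have inv: "G b (x + r *R b) = G b x" if "b : Basis" for b x r
  unfolding G_def by (rule nn_integral_line_shift) (auto intro: perk that)
 have hG: "ennreal (h x) <= G b x" for b x
  unfolding G_def k_def by (rule tp_le_line_integral[OF h h0])
 have intG: "(\<oint>x. G b x) = ennreal (2 * pi) * (\<oint>x. k b x)" for b
 proof -
  have "(\<oint>x. G b x) = (\<integral>\<^sup>+s. (\<oint>x. k b (x + s *R b)) \<partial>(torus :: real measure))"
   unfolding G_def by (rule nn_integral_swap_line) measurable
  then show ?thesis
   using nn_integral_torus_translate[OF _ perk] by (simp add: emeasure_torus_real mult.commute)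
 qed
 have intk: "(\<oint>x. k b x)\<^sup>2 <= 4 * ((pmass 2 g)\<^sup>2 + 4 * (pmass 2 g * pmass 2 (pd b g)))" for b
 proof -
  define I where "I = (\<oint>x. ennreal (norm (g x) * norm (pd b g x)))"
  have "(\<oint>x. k b x) <= (\<oint>x. ennreal (norm (g x) ^ 2) + 2 * ennreal (norm (g x) * norm (pd b g x)))"
  proof (rule nn_integral_mono)
   fix x
   have "h x + \<bar>pd b h x\<bar> <= norm (g x) ^ 2 + 2 * (norm (g x) * norm (pd b g x))"
    using Cauchy_Schwarz_ineq2[of "g x" "pd b g x"] by (simp add: h_def pdh abs_mult power2_norm_eq_inner)
   then have "k b x <= ennreal (norm (g x) ^ 2 + 2 * (norm (g x) * norm (pd b g x)))"
    unfolding k_def by (rule ennreal_leI)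
   then show "k b x <= ennreal (norm (g x) ^ 2) + 2 * ennreal (norm (g x) * norm (pd b g x))"
    by (simp add: ennreal_mult)
  qed
  also have "... = pmass 2 g + 2 * I"
   unfolding pmass_def I_def by (simp add: nn_integral_add nn_integral_cmult)
  finally have "(\<oint>x. k b x)\<^sup>2 <= (pmass 2 g + 2 * I)\<^sup>2" by (rule power_mono) simp
  also have "... <= 4 * ((pmass 2 g)\<^sup>2 + (2 * I)\<^sup>2)" by (rule ennreal_add_square_le)
  also have "(2 * I)\<^sup>2 = 4 * I\<^sup>2" by (simp add: power_mult_distrib)
  also have "I\<^sup>2 <= pmass 2 g * pmass 2 (pd b g)"
   unfolding I_def by (rule nn_integral_norm_mult_le) auto
  finally show ?thesis by (simp add: mult_left_mono add_left_mono)
 qed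
 have "pmass 4 g = (\<oint>x. ennreal (h x) * ennreal (h x))"
  unfolding pmass_def h_def
  by (intro nn_integral_cong) (simp add: ennreal_mult[symmetric] power2_norm_eq_inner[symmetric] flip: power_add)
 also have "... <= (\<oint>x. G (axis 1 1) x * G (axis 2 1) x)"
  by (intro nn_integral_mono mult_mono hG) auto
 finally have "emeasure torus (cell :: R2 set) * pmass 4 g <= emeasure torus (cell :: R2 set) * (\<oint>x. G (axis 1 1) x * G (axis 2 1) x)"
  by (rule mult_left_mono) simp
 also have "... = (\<oint>x. G (axis 1 1) x) * (\<oint>x. G (axis 2 1) x)"
  by (rule nn_integral_crossed_product) (auto intro: perG inv)
 also have "... = ennreal ((2 * pi)\<^sup>2) * ((\<oint>x. k (axis 1 1) x) * (\<oint>x. k (axis 2 1) x))"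
  unfolding intG power2_eq_square by (simp only: ennreal_mult pi_ge_zero mult_nonneg_nonneg zero_le_numeral ac_simps)
 also have "... <= ennreal ((2 * pi)\<^sup>2) * ((\<oint>x. k (axis 1 1) x)\<^sup>2 + (\<oint>x. k (axis 2 1) x)\<^sup>2)"
  by (intro mult_left_mono ennreal_mult_le_squares) simp
 also have "... <= ennreal ((2 * pi)\<^sup>2) *
  (4 * ((pmass 2 g)\<^sup>2 + 4 * (pmass 2 g * pmass 2 (pd (axis 1 1) g))) +
  4 * ((pmass 2 g)\<^sup>2 + 4 * (pmass 2 g * pmass 2 (pd (axis 2 1) g))))"
  by (intro mult_left_mono add_mono intk) simp
 finally show ?thesis .
qed

lemma emeasure_cell_pos: "emeasure torus (cell :: R2 set) ~= 0" "emeasure torus (cell :: R2 set) ~= top"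
proof -
 have "0 < measure torus (cell :: R2 set)"
  using integral_bump_power_pos[of 0, where 'a=R2] by simp
 then show "emeasure torus (cell :: R2 set) ~= 0" by (auto simp: measure_def)
 show "emeasure torus (cell :: R2 set) ~= top"
  using finite_measure.emeasure_finite[OF finite_measure_torus, of "cell :: R2 set"] by simp
qed

lemma Ladyzhenskaya:
 fixes g :: "R2 => R2"
 assumes g: "g : Lp_torus 2" and D: "!!k. D k : Lp_torus 2"
  and w: "!!k \<psi>. tp \<psi> ==> (LINT x|torus. pd (axis k 1) \<psi> x *R g x) = - (LINT x|torus. \<psi> x *R D k x)"
 shows "emeasure torus (cell :: R2 set) * pmass 4 g <= ennreal ((2 * pi)\<^sup>2) *
  (4 * ((pmass 2 g)\<^sup>2 + 4 * (pmass 2 g * pmass 2 (D 1))) +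
  4 * ((pmass 2 g)\<^sup>2 + 4 * (pmass 2 g * pmass 2 (D 2))))" (is "?m * _ <= ?K")
proof -
 have "pmass 4 (moll n g) <= ?K / ?m" for n
 proof -
  have pd: "pd (axis k 1) (moll n g) = moll n (D k)" for k
   using moll_tp_weak_pd[OF g D w] by auto
  have le: "pmass 2 (moll n g) <= pmass 2 g" "pmass 2 (moll n (D k)) <= pmass 2 (D k)" for k
   by (intro pmass_moll_le g D; simp)+
  have "?m * pmass 4 (moll n g) <= ennreal ((2 * pi)\<^sup>2) *
   (4 * ((pmass 2 (moll n g))\<^sup>2 + 4 * (pmass 2 (moll n g) * pmass 2 (moll n (D 1)))) +
   4 * ((pmass 2 (moll n g))\<^sup>2 + 4 * (pmass 2 (moll n g) * pmass 2 (moll n (D 2)))))"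
   using Ladyzhenskaya_tpv[OF tpv_moll[OF g], of n] by (simp only: pd)
  also have "... <= ?K"
   by (intro mult_left_mono add_mono mult_mono power_mono le) auto
  finally have "pmass 4 (moll n g) * ?m / ?m <= ?K / ?m"
   by (intro divide_right_mono_ennreal) (simp only: mult.commute)
  then show ?thesis
   by (simp only: ennreal_mult_divide_eq[OF emeasure_cell_pos])
 qed
 from pmass_Fatou[OF g moll_Lp_torus[OF g] pmass_moll_tendsto[OF g] this]
 have "pmass 4 g <= ?K / ?m" by simp
 then have "?m * pmass 4 g <= ?m * (?K / ?m)" by (rule mult_left_mono) simp
 also have "... = ?K"
  by (subst ennreal_times_divide, subst mult.commute) (rule ennreal_mult_divide_eq[OF emeasure_cell_pos])
 finally show ?thesis .
qed

section \<open>Vertical means\<close>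

lemma z_integral_Lp_torus:
 fixes F :: "R3 => R2"
 assumes F: "F : Lp_torus 2"
 shows "(%xH. LINT z|torus. F (xH, z)) : Lp_torus 2"
  and "pmass 2 (%xH. LINT z|torus. F (xH, z)) <= ennreal (2 * pi) * pmass 2 F"
proof -
 note [measurable] = Lp_torusD(2)[OF F]
 have "ennreal ((norm (LINT z|torus. F (xH, z)))\<^sup>2) <= ennreal (2 * pi) * (\<oint>z. ennreal ((norm (F (xH, z)))\<^sup>2))" for xH
 proof -
  have "ennreal (norm (LINT z|torus. F (xH, z))) <= (\<oint>z. ennreal (norm (F (xH, z))))"
   by (cases "integrable torus (%z. F (xH, z))") (auto intro: integral_norm_bound_ennreal simp: not_integrable_integral_eq)
  then have "(ennreal (norm (LINT z|torus. F (xH, z))))\<^sup>2 <= (\<oint>z. ennreal (norm (F (xH, z))))\<^sup>2"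
   by (rule power_mono) simp
  also have "... <= ennreal (2 * pi) * (\<oint>z. ennreal ((norm (F (xH, z)))\<^sup>2))"
   using pmass_slice_le[of "%x. norm (F x)" xH] by simp
  finally show ?thesis by (simp add: ennreal_power)
 qed
 then have "pmass 2 (%xH. LINT z|torus. F (xH, z)) <= (\<oint>xH. ennreal (2 * pi) * (\<oint>z. ennreal ((norm (F (xH, z)))\<^sup>2)))"
  unfolding pmass_def by (intro nn_integral_mono)
 also have "... = ennreal (2 * pi) * pmass 2 F"
  unfolding pmass_def nn_integral_torus_fst[of "%x. ennreal ((norm (F x))\<^sup>2)", simplified]
  by (rule nn_integral_cmult)
   (rule measurable_torus, rule sigma_finite_measure.borel_measurable_nn_integral[OF sigma_finite_torus], measurable)
 finally show le: "pmass 2 (%xH. LINT z|torus. F (xH, z)) <= ennreal (2 * pi) * pmass 2 F" .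
 have "(%xH. LINT z|torus. F (xH, z)) : Borel"
 proof -
  interpret sigma_finite_measure "torus :: real measure" by (rule sigma_finite_torus)
  show ?thesis by measurable
 qed
 moreover have "periodic (%xH. LINT z|torus. F (xH, z))"
  using periodic_slice[OF Lp_torusD(1)[OF F]] by (auto simp: periodic_def)
 moreover have "ennreal (2 * pi) * pmass 2 F < \<infinity>"
  using Lp_torusD(3)[OF F] by (simp add: ennreal_mult_less_top)
 ultimately show "(%xH. LINT z|torus. F (xH, z)) : Lp_torus 2"
  using le by (auto simp: Lp_torus_def intro: le_less_trans)
qed

lemma integral_tp_fst:
 fixes F :: "R3 => R2"
 assumes F: "F : Lp_torus 2" and \<psi>: "tp \<psi>"
 shows "(LINT x|torus. \<psi> (fst x) *R F x) = (LINT xH|torus. \<psi> xH *R (LINT z|torus. F (xH, z)))"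
proof -
 have "(LINT x|torus. \<psi> (fst x) *R F x) = (LINT xH|torus. LINT z|torus. \<psi> xH *R F (xH, z))"
  using integral_torus_fst(1)[OF integrable_torus_mult_tp[OF L2_integrable[OF F] tp_fst[OF \<psi>]]] by simp
 then show ?thesis by simp
qed

lemma z_mean_weak_pd:
 fixes f :: "R3 => R2"
 assumes f: "f : H1" and \<psi>: "tp \<psi>"
 shows "(LINT xH|torus. pd (axis k 1) \<psi> xH *R (LINT z|torus. f (xH, z))) =
  - (LINT xH|torus. \<psi> xH *R (LINT z|torus. weak_pd (axis k 1, 0) f (xH, z)))"
proof -
 have D: "weak_pd (axis k 1, 0) f : Lp_torus 2" by (intro weak_pd_H1 f) simp
 have "pd (axis k 1, 0) (%x. \<psi> (fst x)) x = pd (axis k 1) \<psi> (fst x)" for x :: R3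
  by (intro pd_fst tp_differentiable \<psi>)
 then show ?thesis
  using is_weak_pd_tp[OF weak_pd_H1(2)[OF f, of "(axis k 1, 0)"] tp_fst[OF \<psi>]]
  by (simp add: integral_tp_fst[OF H1_L2[OF f] tp_pd[OF \<psi>]] integral_tp_fst[OF D \<psi>])
qed

text \<open>The mean lives on the two-dimensional torus, where energy and gradient control the
  fourth power. The bound is linear in the squared gradient, hence integrable in time once the
  energy is bounded.\<close>

lemma pmass_4_z_mean_le:
 "EX C>=0. ALL f:(H1 :: (R3 => R2) set). pmass 4 (%xH. LINT z|torus. f (xH, z)) <= ennreal (C * (rmass 2 f * (rmass 2 f + (grad_L2_norm f)\<^sup>2)))"
proof -
 define m where "m = enn2real (emeasure torus (cell :: R2 set))"
 have m: "emeasure torus (cell :: R2 set) = ennreal m" "0 < m"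
  using emeasure_cell_pos unfolding m_def by (auto simp: less_top enn2real_positive_iff zero_less_iff_neq_zero)
 define L where "L = 2 * pi"
 have L: "0 < L" by (simp add: L_def)
 \<comment> \<open>The outer square of \<open>L\<close> is the prefactor in
   \<open>Ladyzhenskaya\<close>, the inner squares are the vertical lengths in two masses, and 8 +
   32 collects the two terms 4 (a^2 + 4 a b).\<close>
 define C where "C = L\<^sup>2 * (8 * L\<^sup>2 + 32 * L\<^sup>2) / m"
 have C0: "0 <= C" using L m by (simp add: C_def)
 have "pmass 4 (%xH. LINT z|torus. f (xH, z)) <= ennreal (C * (rmass 2 f * (rmass 2 f + (grad_L2_norm f)\<^sup>2)))" if f: "f : H1" for f :: "R3 => R2"
 proof -
  let ?g = "%xH. LINT z|torus. f (xH, z)"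
  let ?D = "%k. %xH. LINT z|torus. weak_pd (axis k 1, 0) f (xH, z)"
  define X where "X = rmass 2 f"
  define Y where "Y = (grad_L2_norm f)\<^sup>2"
  have XY: "0 <= X" "0 <= Y" by (simp_all add: X_def Y_def rmass_nonneg)
  have fL: "f : Lp_torus 2" by (rule H1_L2[OF f])
  have DL: "weak_pd (axis k 1, 0) f : Lp_torus 2" for k by (intro weak_pd_H1 f) simp
  have g: "?g : Lp_torus 2" and gX: "pmass 2 ?g <= ennreal (L * X)"
   using z_integral_Lp_torus[OF fL] Lp_torusD(3)[OF fL] by (auto simp: X_def L_def rmass_def ennreal_mult less_top)
  have D: "?D k : Lp_torus 2" and DY: "pmass 2 (?D k) <= ennreal (L * Y)" for k
  proof -
   show "?D k : Lp_torus 2" by (rule z_integral_Lp_torus[OF DL])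
   have "pmass 2 (?D k) <= ennreal L * ennreal (rmass 2 (weak_pd (axis k 1, 0) f))"
    using z_integral_Lp_torus(2)[OF DL, of k] Lp_torusD(3)[OF DL, of k] by (simp add: L_def rmass_def less_top)
   also have "... <= ennreal L * ennreal Y"
    unfolding Y_def by (intro mult_left_mono ennreal_leI rmass_weak_pd_le f) auto
   finally show "pmass 2 (?D k) <= ennreal (L * Y)" using L XY by (simp add: ennreal_mult)
  qed
  let ?g2 = "pmass 2 ?g"
  have "ennreal m * pmass 4 ?g <= ennreal (L\<^sup>2) * (4 * (?g2\<^sup>2 + 4 * (?g2 * pmass 2 (?D 1))) + 4 * (?g2\<^sup>2 + 4 * (?g2 * pmass 2 (?D 2))))"
   unfolding m(1)[symmetric] L_def by (rule Ladyzhenskaya[OF g D z_mean_weak_pd[OF f]])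
  also have "... <= ennreal (L\<^sup>2) * (4 * ((ennreal (L * X))\<^sup>2 + 4 * (ennreal (L * X) * ennreal (L * Y))) + 4 * ((ennreal (L * X))\<^sup>2 + 4 * (ennreal (L * X) * ennreal (L * Y))))"
   by (intro mult_left_mono add_mono mult_mono power_mono gX DY) auto
  also have "... = ennreal (L\<^sup>2 * (4 * ((L * X)\<^sup>2 + 4 * ((L * X) * (L * Y))) + 4 * ((L * X)\<^sup>2 + 4 * ((L * X) * (L * Y)))))"
  proof -
   have e: "4 * ((ennreal a)\<^sup>2 + 4 * (ennreal a * ennreal b)) = ennreal (4 * (a\<^sup>2 + 4 * (a * b)))" if "0 <= a" "0 <= b" for a b
    using that by (simp add: ennreal_mult ennreal_plus ennreal_power distrib_left)
   have e2: "ennreal c * (ennreal a + ennreal b) = ennreal (c * (a + b))" if "0 <= a" "0 <= b" "0 <= c" for a b c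
    using that by (simp add: ennreal_mult ennreal_plus)
   have "0 <= L * X" "0 <= L * Y" using L XY by auto
   then show ?thesis
    unfolding e[OF \<open>0 <= L * X\<close> \<open>0 <= L * Y\<close>] by (intro e2) auto
  qed
  also have "... <= ennreal (m * (C * (X * (X + Y))))"
  proof (rule ennreal_leI)
   have 1: "m * (C * (X * (X + Y))) = L\<^sup>2 * (L\<^sup>2 * (40 * (X * (X + Y))))"
    using m(2) by (simp add: C_def)
   have 2: "4 * ((L * X)\<^sup>2 + 4 * ((L * X) * (L * Y))) + 4 * ((L * X)\<^sup>2 + 4 * ((L * X) * (L * Y))) = L\<^sup>2 * (8 * X\<^sup>2 + 32 * (X * Y))"
    by (simp add: power2_eq_square algebra_simps)
   have "8 * X\<^sup>2 + 32 * (X * Y) <= 40 * (X * (X + Y))"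
    using XY by (simp add: power2_eq_square algebra_simps)
   then show "L\<^sup>2 * (4 * ((L * X)\<^sup>2 + 4 * ((L * X) * (L * Y))) + 4 * ((L * X)\<^sup>2 + 4 * ((L * X) * (L * Y)))) <= m * (C * (X * (X + Y)))"
    unfolding 1 2 by (intro mult_left_mono) auto
  qed
  also have "... = ennreal m * ennreal (C * (X * (X + Y)))"
   using m XY C0 by (intro ennreal_mult) auto
  finally show ?thesis
   using m(2) by (subst (asm) ennreal_mult_le_mult_iff) (auto simp: X_def Y_def)
 qed
 with C0 show ?thesis by blast
qed

section \<open>Littlewood--Paley blocks in the vertical variable\<close>

lemma integral_torus_cos:
 "(LINT z|torus. cos (of_int m * z + c)) = (if m = 0 then 2 * pi * cos c else (0::real))"
proof (cases "m = 0")
 case False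
 then show ?thesis
  using integral_atom_zero[of "of_int m :: real" c] by simp
qed (simp add: measure_torus_real)

lemma tp_cos_real: "tp (%z::real. cos (of_int m * z + c))"
 using tp_atom[of "of_int m :: real" 1 c] by simp

lemma tp_cos_half: "tp (%z::real. cos (of_int m * z + c) / 2)"
 using tp_scale[OF tp_cos_real, of "1/2" m c] by simp

lemma integral_cos_cos:
 "(LINT z|torus. cos (of_int k * z + c) * cos (of_int l * z + d)) =
  (if k = - l then pi * cos (c + d) else 0) + (if k = l then pi * cos (c - d) else (0::real))"
proof -
 have "(LINT z|torus. cos (of_int k * z + c) * cos (of_int l * z + d)) =
  (LINT z|torus. cos (of_int (k + l) * z + (c + d)) / 2 + cos (of_int (k - l) * z + (c - d)) / 2)"
 proof (rule LB_integral_cong)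
  fix z :: real
  have "of_int (k + l) * z + (c + d) = (of_int k * z + c) + (of_int l * z + d)"
   "of_int (k - l) * z + (c - d) = (of_int k * z + c) - (of_int l * z + d)"
   by (simp_all add: algebra_simps)
  then show "cos (of_int k * z + c) * cos (of_int l * z + d) =
   cos (of_int (k + l) * z + (c + d)) / 2 + cos (of_int (k - l) * z + (c - d)) / 2"
   by (simp only: cos_add[of "of_int k * z + c"] cos_diff[of "of_int k * z + c"]) (simp add: field_simps)
 qed simp
 also have "... = (LINT z|torus. cos (of_int (k + l) * z + (c + d))) / 2 + (LINT z|torus. cos (of_int (k - l) * z + (c - d))) / 2"
  by (subst LB_integral_add) (rule tp_integrable[OF tp_cos_half], rule tp_integrable[OF tp_cos_half], simp)
 also have "... = (if k = - l then pi * cos (c + d) else 0) + (if k = l then pi * cos (c - d) else (0::real))"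
  unfolding integral_torus_cos by (auto simp: eq_neg_iff_add_eq_0)
 finally show ?thesis .
qed

text \<open>Orthogonality of the cosines. In a symmetric index set each frequency meets itself and
  its negative, hence 2 pi instead of pi. The phase - pi / 2 gives sine sums, whose coefficients are
  odd; this is why only their moduli are assumed even.\<close>

lemma integral_cos_sum_square:
 fixes a :: "int => real"
 assumes "finite I" and sym: "!!k. k : I ==> - k : I" and a: "!!k. \<bar>a (- k)\<bar> = \<bar>a k\<bar>"
 shows "(LINT z|torus. (\<Sum>k\<in>I. a k * cos (of_int k * z + c))\<^sup>2) <= 2 * pi * (\<Sum>k\<in>I. (a k)\<^sup>2)"
proof -
 have int: "integrable torus (%z::real. cos (of_int k * z + c) * cos (of_int l * z + c))" for k l
  by (intro tp_integrable tp_mult tp_cos_real)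
 have "(LINT z|torus. (\<Sum>k\<in>I. a k * cos (of_int k * z + c))\<^sup>2) =
  (LINT z|torus. (\<Sum>k\<in>I. \<Sum>l\<in>I. (a k * a l) * (cos (of_int k * z + c) * cos (of_int l * z + c))))"
  by (simp add: power2_eq_square sum_product algebra_simps)
 also have "... = (\<Sum>k\<in>I. \<Sum>l\<in>I. (a k * a l) * (LINT z|torus. cos (of_int k * z + c) * cos (of_int l * z + c)))"
  by (subst LB_integral_sum, (intro LB_integrable_sum integrable_mult_right int))+
   (simp add: LB_integral_sum int)
 also have "... = (\<Sum>k\<in>I. \<Sum>l\<in>I. (if l = - k then pi * cos (2 * c) * (a k * a l) else 0) + (if l = k then pi * (a k * a l) else 0))"
  unfolding integral_cos_cos by (intro sum.cong refl) (auto simp: algebra_simps)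
 also have "... = (\<Sum>k\<in>I. pi * cos (2 * c) * (a k * a (- k)) + pi * (a k * a k))"
  using assms by (intro sum.cong refl) (simp add: sum.distrib)
 also have "... <= (\<Sum>k\<in>I. 2 * pi * (a k)\<^sup>2)"
 proof (rule sum_mono)
  fix k
  have "cos (2 * c) * (a k * a (- k)) <= \<bar>cos (2 * c)\<bar> * (\<bar>a k\<bar> * \<bar>a (- k)\<bar>)"
   by (metis abs_ge_self abs_mult)
  also have "... <= 1 * (\<bar>a k\<bar> * \<bar>a k\<bar>)"
   unfolding a by (intro mult_right_mono) auto
  finally have "cos (2 * c) * (a k * a (- k)) <= (a k)\<^sup>2" by (simp add: power2_eq_square)
  then have "pi * (cos (2 * c) * (a k * a (- k))) <= pi * (a k)\<^sup>2" by (intro mult_left_mono) auto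
  then show "pi * cos (2 * c) * (a k * a (- k)) + pi * (a k * a k) <= 2 * pi * (a k)\<^sup>2"
   by (simp add: power2_eq_square mult.assoc)
 qed
 finally show ?thesis by (simp add: sum_distrib_left)
qed

section \<open>Convolution in the vertical variable\<close>

lemma conv_z_borel:
 assumes [measurable]: "h : Borel" "f : Borel"
 shows "conv_z h f : Borel"
proof -
 interpret sigma_finite_measure "torus :: real measure" by (rule sigma_finite_torus)
 show ?thesis unfolding conv_z_def[abs_def] by measurable
qed

text \<open>Cauchy-Schwarz in the vertical variable: at every height the convolution is bounded by
  the column norm of \<open>f\<close> times the kernel norm. Asking the square of the kernel to be
  even admits both \<open>kappa\<close> and its odd primitive.\<close>

lemma conv_z_le:
 assumes h: "tp h" "!!u. (h (- u))\<^sup>2 = (h u)\<^sup>2" and [measurable]: "f : Borel"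
 shows "ennreal ((norm (conv_z h f (xH, z)))\<^sup>2) <= ennreal (LINT u|torus. (h u)\<^sup>2) * (\<oint>\<zeta>. ennreal ((norm (f (xH, \<zeta>)))\<^sup>2))"
proof -
 have [measurable]: "h : Borel" by (rule tp_borel[OF h(1)])
 have "ennreal (norm (conv_z h f (xH, z))) <= (\<oint>\<zeta>. ennreal (norm (h (z - \<zeta>) *R f (xH, \<zeta>))))"
 proof (cases "integrable torus (%\<zeta>. h (z - \<zeta>) *R f (xH, \<zeta>))")
  case True
  from integral_norm_bound_ennreal[OF this] show ?thesis by (simp only: conv_z_def fst_conv snd_conv)
 next
  case False
  then show ?thesis by (simp add: conv_z_def not_integrable_integral_eq)
 qed
 then have "(ennreal (norm (conv_z h f (xH, z))))\<^sup>2 <= (\<oint>\<zeta>. ennreal (norm (h (z - \<zeta>) *R f (xH, \<zeta>))))\<^sup>2"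
  by (rule power_mono) simp
 also have "... = (\<oint>\<zeta>. ennreal \<bar>h (z - \<zeta>)\<bar> * ennreal (norm (f (xH, \<zeta>))))\<^sup>2"
  by (simp add: ennreal_mult)
 also have "... <= (\<oint>\<zeta>. ennreal \<bar>h (z - \<zeta>)\<bar> ^ 2) * (\<oint>\<zeta>. ennreal (norm (f (xH, \<zeta>))) ^ 2)"
  by (rule Cauchy_Schwarz_nn_integral) measurable
 also have "(\<oint>\<zeta>. ennreal \<bar>h (z - \<zeta>)\<bar> ^ 2) = (\<oint>\<zeta>. ennreal ((h (\<zeta> + (- z)))\<^sup>2))"
  using h(2)[of "_ - z"] by (intro nn_integral_cong) (simp add: ennreal_power flip: h(2)[of "_ - z"])
 also have "... = (\<oint>\<zeta>. ennreal ((h \<zeta>)\<^sup>2))"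
  by (rule nn_integral_torus_translate[where f="%\<zeta>. ennreal ((h \<zeta>)\<^sup>2)"]) (auto intro: periodic_compose[OF tp_periodic[OF h(1)]])
 also have "... = ennreal (LINT u|torus. (h u)\<^sup>2)"
  using tp_integrable[OF tp_power[OF h(1), of 2]] by (intro nn_integral_eq_integral) auto
 finally show ?thesis by (simp add: ennreal_power)
qed

text \<open>Testing with products of a horizontal polynomial and \<open>\<eta>\<close> shows that
  the sum of the two vertical integrals is orthogonal to all horizontal polynomials. The exceptional
  null set may depend on \<open>\<eta>\<close>.\<close>

lemma weak_pd_slice:
 fixes f :: "R3 => R2"
 assumes f: "f : H1" and \<eta>: "tp \<eta>"
 shows "AE xH in torus. (LINT \<zeta>|torus. pd 1 \<eta> \<zeta> *R f (xH, \<zeta>)) = - (LINT \<zeta>|torus. \<eta> \<zeta> *R weak_pd (0, 1) f (xH, \<zeta>))"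
proof -
 let ?D = "weak_pd (0, 1) f"
 note fL = H1_L2[OF f]
 have D: "?D : Lp_torus 2" "is_weak_pd (0, 1) f ?D" using weak_pd_H1[OF f] by auto
 define F where "F x = pd 1 \<eta> (snd x) *R f x + \<eta> (snd x) *R ?D x" for x
 have F1: "(%x. pd 1 \<eta> (snd x) *R f x) : Lp_torus 2" and F2: "(%x. \<eta> (snd x) *R ?D x) : Lp_torus 2"
  by (intro Lp_torus_mult_tp tp_snd tp_pd \<eta> fL D)+
 then have F: "F : Lp_torus 2" unfolding F_def by (rule Lp_torus_add)
 have "AE xH in torus. (LINT z|torus. F (xH, z)) = 0"
 proof (rule L2_orthogonal_tp_zero)
  show "(%xH. LINT z|torus. F (xH, z)) : Lp_torus 2" by (rule z_integral_Lp_torus[OF F])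
  fix \<psi> :: "R2 => real" assume \<psi>: "tp \<psi>"
  let ?P = "%x::R3. \<psi> (fst x) * \<eta> (snd x)"
  have tpP: "tp ?P" by (intro tp_mult tp_fst tp_snd \<psi> \<eta>)
  have pdP: "pd (0, 1) ?P x = \<psi> (fst x) * pd 1 \<eta> (snd x)" for x
  proof -
   have "pd (0, 1) ?P x = pd 1 (%z. ?P (fst x, z)) (snd x)"
    using pd_slice_snd[of ?P "fst x" "snd x"] tp_differentiable[OF tpP] by simp
   also have "... = \<psi> (fst x) * pd 1 \<eta> (snd x)"
    using pd_scaleR_right[of \<eta> "snd x" 1 "\<psi> (fst x)"] tp_differentiable[OF \<eta>] by simp
   finally show ?thesis .
  qed
  have "(LINT xH|torus. \<psi> xH *R (LINT z|torus. F (xH, z))) = (LINT x|torus. \<psi> (fst x) *R F x)"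
   by (rule integral_tp_fst[OF F \<psi>, symmetric])
  also have "... = (LINT x|torus. pd (0, 1) ?P x *R f x + ?P x *R ?D x)"
   by (simp add: F_def pdP scaleR_add_right)
  also have "... = (LINT x|torus. pd (0, 1) ?P x *R f x) + (LINT x|torus. ?P x *R ?D x)"
   by (rule LB_integral_add)
    (rule integrable_torus_mult_tp[OF L2_integrable[OF fL] tp_pd[OF tpP]], rule integrable_torus_mult_tp[OF L2_integrable[OF D(1)] tpP])
  also have "... = 0" using is_weak_pd_tp[OF D(2) tpP] by simp
  finally show "(LINT xH|torus. \<psi> xH *R (LINT z|torus. F (xH, z))) = 0" .
 qed
 then show ?thesis
  using integral_torus_fst(2)[OF L2_integrable[OF F1]] integral_torus_fst(2)[OF L2_integrable[OF F2]]
 proof eventually_elim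
  case (elim xH)
  have "(LINT z|torus. F (xH, z)) = (LINT z|torus. pd 1 \<eta> z *R f (xH, z)) + (LINT z|torus. \<eta> z *R ?D (xH, z))"
   unfolding F_def using elim(2,3) by simp
  then show ?case using elim(1) by (simp add: eq_neg_iff_add_eq_0)
 qed
qed

locale LP =
 fixes chi :: "real => real"
 assumes cutoff: "LP_cutoff chi"
begin

lemma chi_even: "chi (- x) = chi x"
 and chi_1: "\<bar>x\<bar> <= 1/2 ==> chi x = 1"
 and chi_0: "1 <= \<bar>x\<bar> ==> chi x = 0"
 using cutoff by (auto simp: LP_cutoff_def)

lemma chi_bounded: "EX M. ALL x. \<bar>chi x\<bar> <= M"
proof -
 have "continuous_on {-1..1} chi" using cutoff by (auto simp: LP_cutoff_def intro: smooth_continuous)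
 then have "bounded (chi ` {-1..1})" by (intro compact_imp_bounded compact_continuous_image) auto
 then obtain M where M: "ALL x:{-1..1}. \<bar>chi x\<bar> <= M" by (auto simp: bounded_iff)
 have "\<bar>chi x\<bar> <= max M 0" for x
  using bspec[OF M, of x] chi_0[of x] by (cases "x : {-1..1}") (auto simp: max_def)
 then show ?thesis by blast
qed

definition M where "M = (SOME M. ALL x. \<bar>chi x\<bar> <= M)"

lemma chi_le: "\<bar>chi x\<bar> <= M"
 using someI_ex[OF chi_bounded] unfolding M_def by blast

lemma M_nonneg: "0 <= M"
 using chi_le[of 0] by linarith

text \<open>Indexed by natural numbers: at integer frequencies the multipliers with negative index
  vanish.\<close>

definition rho :: "nat => int => real" where
 "rho j k = chi (of_int k / 2 ^ Suc j) - chi (of_int k / 2 ^ j)"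

lemma LP_rho_eq: "LP_rho chi (int j) (of_int k) = rho j k"
 by (simp add: LP_rho_def rho_def Let_def power_int_minus field_simps)

lemma rho_even: "rho j (- k) = rho j k"
 using chi_even[of "of_int k / 2 ^ Suc j"] chi_even[of "of_int k / 2 ^ j"] by (simp add: rho_def)

lemma rho_le: "\<bar>rho j k\<bar> <= 2 * M"
 using chi_le[of "of_int k / 2 ^ Suc j"] chi_le[of "of_int k / 2 ^ j"] unfolding rho_def by linarith

lemma rho_small: "2 * \<bar>k\<bar> <= 2 ^ j ==> rho j k = 0"
proof -
 assume "2 * \<bar>k\<bar> <= 2 ^ j"
 then have "real_of_int (2 * \<bar>k\<bar>) <= real_of_int (2 ^ j)" by (simp only: of_int_le_iff)
 then have "\<bar>real_of_int k / 2 ^ j\<bar> <= 1/2" "\<bar>real_of_int k / 2 ^ Suc j\<bar> <= 1/2"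
  by (simp_all add: field_simps)
 then show ?thesis by (simp only: rho_def chi_1)
qed

lemma rho_large: "2 ^ Suc j <= \<bar>k\<bar> ==> rho j k = 0"
proof -
 assume "2 ^ Suc j <= \<bar>k\<bar>"
 then have "real_of_int (2 ^ Suc j) <= real_of_int \<bar>k\<bar>" by (simp only: of_int_le_iff)
 then have "1 <= \<bar>real_of_int k / 2 ^ j\<bar>" "1 <= \<bar>real_of_int k / 2 ^ Suc j\<bar>"
  by (simp_all add: field_simps)
 then show ?thesis by (simp only: rho_def chi_0)
qed

lemma rho_sum: "(\<Sum>j<J. rho j k) = chi (of_int k / 2 ^ J) - chi (of_int k)"
 unfolding rho_def by (induction J) simp_all

definition freqs :: "nat => int set" where
 "freqs j = {- (2 ^ Suc j)..2 ^ Suc j}"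

lemma finite_freqs [simp]: "finite (freqs j)"
 by (simp add: freqs_def)

lemma freqs_sym: "k : freqs j ==> - k : freqs j"
 by (auto simp: freqs_def)

lemma rho_outside: "k \<notin> freqs j ==> rho j k = 0"
 by (intro rho_large) (auto simp: freqs_def)

lemma card_freqs: "real (card (freqs j)) <= 5 * 2 ^ j"
proof -
 have "int (card (freqs j)) = 2 * 2 ^ Suc j + 1" by (simp add: freqs_def)
 then have "real (card (freqs j)) = real_of_int (2 * 2 ^ Suc j + 1)" by (metis of_int_of_nat_eq)
 then show ?thesis using one_le_power[of "2::real" j] by simp
qed

definition kappa :: "nat => real => real" where
 "kappa j z = (\<Sum>k\<in>freqs j. rho j k * cos (of_int k * z))"

text \<open>The primitive of \<open>kappa\<close>; the term of frequency zero is harmless because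
  \<open>rho j 0\<close> is 0.\<close>

definition psi :: "nat => real => real" where
 "psi j z = (\<Sum>k\<in>freqs j. (rho j k / of_int k) * sin (of_int k * z))"

lemma LP_kernel_eq: "LP_kernel chi (int j) = kappa j"
proof
 fix z
 let ?g = "%k::int. complex_of_real (LP_rho chi (int j) (of_int k)) * exp (\<i> * of_int k * of_real z)"
 have "(\<Sum>\<^sub>\<infinity>k\<in>UNIV. ?g k) = (\<Sum>\<^sub>\<infinity>k\<in>freqs j. ?g k)"
  by (rule infsum_cong_neutral) (auto simp: LP_rho_eq rho_outside)
 also have "... = (\<Sum>k\<in>freqs j. ?g k)" by simp
 finally have "LP_kernel chi (int j) z = Re (\<Sum>k\<in>freqs j. ?g k)"
  unfolding LP_kernel_def by simp
 also have "... = (\<Sum>k\<in>freqs j. rho j k * cos (of_int k * z))"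
  unfolding Re_sum
 proof (rule sum.cong)
  fix k
  show "Re (?g k) = rho j k * cos (of_int k * z)"
   by (simp add: LP_rho_eq Re_exp)
 qed simp
 finally show "LP_kernel chi (int j) z = kappa j z" by (simp add: kappa_def)
qed

lemma tp_kappa: "tp (kappa j)"
 unfolding kappa_def using tp_cos_real[of _ 0] by (intro tp_sum tp_scale) simp

lemma tp_sin_real: "tp (%z::real. sin (of_int k * z))"
 using tp_cos_real[of k "- (pi / 2)"] by (simp add: cos_diff)

lemma tp_psi: "tp (psi j)"
 unfolding psi_def by (intro tp_sum tp_scale tp_sin_real)

lemma kappa_even: "kappa j (- z) = kappa j z"
 by (simp add: kappa_def)

lemma psi_odd: "psi j (- z) = - psi j z"
 by (simp add: psi_def sum_negf)

lemma pd_psi: "pd 1 (psi j) z = kappa j z"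
proof -
 have "((%z. (rho j k / of_int k) * sin (of_int k * z)) has_real_derivative rho j k * cos (of_int k * z)) (at z)" for k
  using rho_small[of 0 j] by (cases "k = 0") (auto intro!: derivative_eq_intros)
 then have "(psi j has_real_derivative kappa j z) (at z)"
  unfolding psi_def[abs_def] kappa_def by (intro DERIV_sum)
 from pd_eqI[OF this[unfolded has_field_derivative_def], of 1] show ?thesis by simp
qed

text \<open>5 counts the frequencies, of which there are at most 5 * 2 ^ j; \<open>2 * M\<close>
  bounds the multipliers; 4 comes from |k| >= 2 ^ j / 2 on their support and serves the primitive
  kernel.\<close>

definition K0 where "K0 = 2 * pi * (5 * (4 * (2 * M)\<^sup>2))"

lemma K0_nonneg: "0 <= K0" by (simp add: K0_def)

lemma kappa_norm: "(LINT u|torus. (kappa j u)\<^sup>2) <= K0 * 2 ^ j"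
proof -
 have "(LINT u|torus. (kappa j u)\<^sup>2) <= 2 * pi * (\<Sum>k\<in>freqs j. (rho j k)\<^sup>2)"
  using integral_cos_sum_square[of "freqs j" "rho j" 0] freqs_sym rho_even by (simp add: kappa_def)
 also have "(\<Sum>k\<in>freqs j. (rho j k)\<^sup>2) <= (\<Sum>k\<in>freqs j. (2 * M)\<^sup>2)"
  by (intro sum_mono) (metis abs_le_square_iff abs_of_nonneg M_nonneg mult_nonneg_nonneg rho_le zero_le_numeral)
 also have "... = real (card (freqs j)) * (2 * M)\<^sup>2" by simp
 also have "... <= (5 * 2 ^ j) * (2 * M)\<^sup>2"
  by (intro mult_right_mono card_freqs) auto
 also have "... <= 5 * (4 * (2 * M)\<^sup>2) * 2 ^ j"
  by simp
 finally show ?thesis by (simp add: K0_def mult.assoc)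
qed

text \<open>On the support of the multiplier |k| exceeds 2 ^ j / 2, so the primitive gains a factor
  of order 4 ^ -j in the squared norm.\<close>

lemma psi_norm: "(LINT u|torus. (psi j u)\<^sup>2) <= K0 * 2 ^ j / 4 ^ j"
proof -
 have "(LINT u|torus. (psi j u)\<^sup>2) <= 2 * pi * (\<Sum>k\<in>freqs j. (rho j k / of_int k)\<^sup>2)"
  using integral_cos_sum_square[of "freqs j" "%k. rho j k / of_int k" "- (pi / 2)"] freqs_sym rho_even
  by (simp add: psi_def cos_diff)
 also have "(\<Sum>k\<in>freqs j. (rho j k / of_int k)\<^sup>2) <= (\<Sum>k\<in>freqs j. 4 * (2 * M)\<^sup>2 / 4 ^ j)"
 proof (rule sum_mono)
  fix k
  show "(rho j k / of_int k)\<^sup>2 <= 4 * (2 * M)\<^sup>2 / 4 ^ j"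
  proof (cases "2 * \<bar>k\<bar> <= 2 ^ j")
   case True
   then show ?thesis by (simp add: rho_small)
  next
   case False
   then have "real_of_int (2 ^ j) <= real_of_int (2 * \<bar>k\<bar>)" by (simp only: of_int_le_iff)
   then have "(2 ^ j)\<^sup>2 <= (2 * \<bar>real_of_int k\<bar>)\<^sup>2" by (intro power_mono) auto
   then have k: "4 ^ j <= 4 * (real_of_int k)\<^sup>2" by (simp add: power_mult_distrib power2_eq_square flip: power_mult_distrib)
   have k0: "0 < (real_of_int k)\<^sup>2" using False by auto
   have r: "(rho j k)\<^sup>2 <= (2 * M)\<^sup>2"
    by (metis abs_le_square_iff abs_of_nonneg M_nonneg mult_nonneg_nonneg rho_le zero_le_numeral)
   have "(rho j k / of_int k)\<^sup>2 <= (2 * M)\<^sup>2 / (real_of_int k)\<^sup>2"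
    using r by (simp add: power_divide divide_right_mono)
   also have "... <= (2 * M)\<^sup>2 / (4 ^ j / 4)"
    using k k0 by (intro divide_left_mono) auto
   finally show ?thesis by (simp add: mult.commute)
  qed
 qed
 also have "... = real (card (freqs j)) * (4 * (2 * M)\<^sup>2 / 4 ^ j)" by simp
 also have "... <= (5 * 2 ^ j) * (4 * (2 * M)\<^sup>2 / 4 ^ j)"
  by (intro mult_right_mono card_freqs) auto
 finally show ?thesis by (simp add: K0_def field_simps)
qed

definition block :: "nat => (R3 => R2) => R3 => R2" where
 "block j f = conv_z (kappa j) f"

lemma block_borel: "f : Borel ==> block j f : Borel"
 unfolding block_def by (intro conv_z_borel tp_borel tp_kappa)

text \<open>Integration by parts in z moves the derivative from \<open>psi\<close> to
  \<open>f\<close>; for each height the identity holds on almost every vertical line.\<close>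

lemma block_deriv:
 assumes f: "f : H1"
 shows "AE xH in torus. block j f (xH, z) = conv_z (psi j) (weak_pd (0, 1) f) (xH, z)"
proof -
 define \<eta> where "\<eta> \<zeta> = psi j (z - \<zeta>)" for \<zeta>
 have eq: "\<eta> \<zeta> = - psi j (\<zeta> + (- z))" for \<zeta> using psi_odd[of j "\<zeta> - z"] by (simp add: \<eta>_def)
 have tp: "tp \<eta>" unfolding eq[abs_def] by (intro tp_minus tp_translate tp_psi)
 have "pd 1 \<eta> \<zeta> = - kappa j (z - \<zeta>)" for \<zeta>
 proof -
  have "pd 1 \<eta> \<zeta> = - pd 1 (%\<zeta>. psi j (\<zeta> + (- z))) \<zeta>"
   unfolding eq[abs_def] using pd_scaleR_right[of "%\<zeta>. psi j (\<zeta> + (- z))" \<zeta> 1 "-1"] tp_differentiable[OF tp_translate[OF tp_psi], of j "-z" \<zeta>]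
   by simp
  also have "... = - kappa j (z - \<zeta>)"
   unfolding pd_translate pd_psi using kappa_even[of j "z - \<zeta>"] by simp
  finally show ?thesis .
 qed
 with weak_pd_slice[OF f tp] show ?thesis
  by (simp add: block_def conv_z_def \<eta>_def)
qed

text \<open>A Bernstein bound: 2 ^ j is the price of evaluating at a single height, and the minimum
  combines the plain estimate with the one after passing to the primitive kernel.\<close>

lemma block_slice_le:
 assumes f: "f : H1"
 shows "(\<oint>xH. ennreal ((norm (block j f (xH, z)))\<^sup>2)) <=
  ennreal (K0 * 2 ^ j * min (rmass 2 f) (rmass 2 (weak_pd (0, 1) f) / 4 ^ j))"
proof -
 note fL = H1_L2[OF f]
 have DL: "weak_pd (0, 1) f : Lp_torus 2" by (intro weak_pd_H1 f) simp
 have gen: "(\<oint>xH. ennreal ((norm (conv_z h g (xH, z)))\<^sup>2)) <= ennreal (c * rmass 2 g)"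
  if g: "g : Lp_torus 2" and h: "tp h" "!!u. (h (- u))\<^sup>2 = (h u)\<^sup>2" "(LINT u|torus. (h u)\<^sup>2) <= c" for g h c
 proof -
  note [measurable] = Lp_torusD(2)[OF g]
  have c: "0 <= c" using h(3) by (rule order_trans[rotated]) simp
  have "(\<oint>xH. ennreal ((norm (conv_z h g (xH, z)))\<^sup>2)) <= (\<oint>xH. ennreal c * (\<oint>\<zeta>. ennreal ((norm (g (xH, \<zeta>)))\<^sup>2)))"
  proof (rule nn_integral_mono)
   fix xH
   show "ennreal ((norm (conv_z h g (xH, z)))\<^sup>2) <= ennreal c * (\<oint>\<zeta>. ennreal ((norm (g (xH, \<zeta>)))\<^sup>2))"
    by (rule order_trans[OF conv_z_le[OF h(1,2)] mult_right_mono]) (use h(3) in \<open>auto intro: ennreal_leI\<close>)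
  qed
  also have "... = ennreal c * pmass 2 g"
   unfolding pmass_def nn_integral_torus_fst[of "%x. ennreal ((norm (g x))\<^sup>2)", simplified]
   by (rule nn_integral_cmult)
    (rule measurable_torus, rule sigma_finite_measure.borel_measurable_nn_integral[OF sigma_finite_torus], measurable)
  also have "... = ennreal (c * rmass 2 g)"
   using Lp_torusD(3)[OF g] c by (simp add: rmass_def ennreal_mult less_top)
  finally show ?thesis .
 qed
 have 1: "(\<oint>xH. ennreal ((norm (block j f (xH, z)))\<^sup>2)) <= ennreal (K0 * 2 ^ j * rmass 2 f)"
  unfolding block_def by (rule gen[OF fL tp_kappa _ kappa_norm]) (simp add: kappa_even)
 have "(\<oint>xH. ennreal ((norm (block j f (xH, z)))\<^sup>2)) =
  (\<oint>xH. ennreal ((norm (conv_z (psi j) (weak_pd (0, 1) f) (xH, z)))\<^sup>2))"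
  by (rule nn_integral_cong_AE) (use block_deriv[OF f, of j z] in eventually_elim, simp)
 also have "... <= ennreal (K0 * 2 ^ j / 4 ^ j * rmass 2 (weak_pd (0, 1) f))"
  by (rule gen[OF DL tp_psi _ psi_norm]) (simp add: psi_odd)
 finally have 2: "(\<oint>xH. ennreal ((norm (block j f (xH, z)))\<^sup>2)) <= ennreal (K0 * 2 ^ j * (rmass 2 (weak_pd (0, 1) f) / 4 ^ j))"
  by simp
 from 1 2 show ?thesis by (simp add: min_def)
qed

end

section \<open>Besov bounds for single blocks and their sum\<close>

lemma ennpowr_2: "ennpowr x 2 = x\<^sup>2"
 by (cases x) (auto simp: ennpowr_def ennreal_power)

lemma ennpowr_half_le:
 assumes "ennpowr x (1 / 2) <= ennreal b" "0 <= b"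
 shows "x <= ennreal (b\<^sup>2)"
proof (cases x)
 case (real r)
 then have "r powr (1/2) <= b" using assms by (simp add: ennpowr_def)
 then have "(r powr (1/2))\<^sup>2 <= b\<^sup>2" by (intro power_mono) auto
 moreover have "(r powr (1/2))\<^sup>2 = r" using real by (simp add: powr_half_sqrt)
 ultimately show ?thesis using real by simp
next
 case top
 then show ?thesis using assms by (simp add: ennpowr_def top_unique)
qed

lemma Lp_norm_2_le:
 assumes "Lp_norm 2 N E <= ennreal b" "0 <= b"
 shows "E : borel_measurable N" "(\<integral>\<^sup>+z. (E z)\<^sup>2 \<partial>N) <= ennreal (b\<^sup>2)"
proof -
 show m: "E : borel_measurable N"
  using assms by (auto simp: Lp_norm_def top_unique split: if_splits)
 have "ennpowr (\<integral>\<^sup>+z. ennpowr (E z) 2 \<partial>N) (1 / 2) <= ennreal b"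
  using assms(1) m by (simp add: Lp_norm_def)
 then show "(\<integral>\<^sup>+z. (E z)\<^sup>2 \<partial>N) <= ennreal (b\<^sup>2)"
  using ennpowr_half_le[OF _ assms(2)] by (simp add: ennpowr_2)
qed

lemma Lp_norm_inf_AE:
 assumes "\<phi> : borel_measurable N"
 shows "AE x in N. \<phi> x <= Lp_norm \<infinity> N \<phi>"
 using assms esssup_AE[of \<phi> N] by (simp add: Lp_norm_def)

lemma suminf_Cauchy_Schwarz:
 fixes a b :: "nat => ennreal"
 shows "(\<Sum>j. a j * b j)\<^sup>2 <= (\<Sum>j. (a j)\<^sup>2) * (\<Sum>j. (b j)\<^sup>2)"
 using Cauchy_Schwarz_nn_integral[of a "count_space UNIV" b] by (simp add: nn_integral_count_space_nat)

context LP
begin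

lemma besov_block:
 assumes "besov_norm chi s 2 \<infinity> f = ennreal B" "0 <= B"
 shows "Lpz_LinfH_norm 2 (block j f) <= ennreal (B / 2 powr (s * real j))"
proof -
 let ?\<phi> = "%j. ennreal (2 powr (s * of_int j)) * Lpz_LinfH_norm 2 (conv_z (LP_kernel chi j) f)"
 have "AE i in count_space UNIV. ?\<phi> i <= ennreal B"
  using Lp_norm_inf_AE[of ?\<phi> "count_space UNIV"] assms by (simp add: besov_norm_def)
 then have "ALL i. ?\<phi> i <= ennreal B" by (simp add: AE_count_space)
 from spec[OF this, of "int j"] have "?\<phi> (int j) <= ennreal B" .
 then have *: "ennreal (2 powr (s * real j)) * Lpz_LinfH_norm 2 (block j f) <= ennreal B"
  by (simp add: LP_kernel_eq block_def)
 show ?thesis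
 proof (cases "Lpz_LinfH_norm 2 (block j f)")
  case (real r)
  then have "2 powr (s * real j) * r <= B" using * assms(2) by (simp add: ennreal_mult[symmetric])
  then show ?thesis using real by (simp add: field_simps ennreal_leI)
 next
  case top
  then show ?thesis using * by (simp add: ennreal_mult_top top_unique)
 qed
qed

text \<open>Two of the four powers are estimated by the horizontal supremum, whose L2 norm in z is
  the Besov quantity, the other two by the slice bound, which is uniform in z.\<close>

lemma block_pmass_4:
 assumes f: "f : H1" and B: "besov_norm chi s 2 \<infinity> f = ennreal B" "0 <= B"
 shows "pmass 4 (block j f) <= ennreal ((K0 * 2 ^ j * min (rmass 2 f) (rmass 2 (weak_pd (0, 1) f) / 4 ^ j)) * (B / 2 powr (s * real j))\<^sup>2)"
proof -
 let ?b = "B / 2 powr (s * real j)" and ?A = "K0 * 2 ^ j * min (rmass 2 f) (rmass 2 (weak_pd (0, 1) f) / 4 ^ j)"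
 define E where "E z = Lp_norm \<infinity> torus (%xH. ennreal (norm (block j f (xH, z))))" for z
 have [measurable]: "block j f : Borel"
  by (intro block_borel Lp_torusD[OF H1_L2[OF f]])
 have b0: "0 <= ?b" using B by simp
 have "Lp_norm 2 torus E <= ennreal ?b"
  using besov_block[OF B, of j] by (simp add: Lpz_LinfH_norm_def E_def[abs_def])
 note E = Lp_norm_2_le[OF this b0]
 note [measurable] = E(1)
 have A0: "0 <= ?A" by (simp add: K0_nonneg rmass_nonneg)
 have "pmass 4 (block j f) = (\<oint>z. (\<oint>xH. ennreal (norm (block j f (xH, z)) ^ 4)))"
  unfolding pmass_def by (rule nn_integral_torus_snd) measurable
 also have "... <= (\<oint>z. (E z)\<^sup>2 * ennreal ?A)"
 proof (rule nn_integral_mono)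
  fix z :: real
  have ae: "AE xH in torus. ennreal (norm (block j f (xH, z))) <= E z"
   unfolding E_def by (rule Lp_norm_inf_AE) measurable
  have "(\<oint>xH. ennreal (norm (block j f (xH, z)) ^ 4)) <= (\<oint>xH. (E z)\<^sup>2 * ennreal ((norm (block j f (xH, z)))\<^sup>2))"
  proof (rule nn_integral_mono_AE)
   show "AE xH in torus. ennreal (norm (block j f (xH, z)) ^ 4) <= (E z)\<^sup>2 * ennreal ((norm (block j f (xH, z)))\<^sup>2)"
    using ae
   proof eventually_elim
    case (elim xH)
    have "ennreal (norm (block j f (xH, z)) ^ 4) = (ennreal (norm (block j f (xH, z))))\<^sup>2 * ennreal ((norm (block j f (xH, z)))\<^sup>2)"
     by (simp add: ennreal_power ennreal_mult[symmetric] flip: power_add)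
    also have "... <= (E z)\<^sup>2 * ennreal ((norm (block j f (xH, z)))\<^sup>2)"
     by (intro mult_right_mono power_mono elim) auto
    finally show ?case .
   qed
  qed
  also have "... = (E z)\<^sup>2 * (\<oint>xH. ennreal ((norm (block j f (xH, z)))\<^sup>2))"
   by (rule nn_integral_cmult) measurable
  also have "... <= (E z)\<^sup>2 * ennreal ?A"
   by (intro mult_left_mono block_slice_le f) simp
  finally show "(\<oint>xH. ennreal (norm (block j f (xH, z)) ^ 4)) <= (E z)\<^sup>2 * ennreal ?A" .
 qed
 also have "... = (\<oint>z. (E z)\<^sup>2) * ennreal ?A"
  by (rule nn_integral_multc) measurable
 also have "... <= ennreal (?b\<^sup>2) * ennreal ?A"
  by (intro mult_right_mono E) simp
 also have "... = ennreal (?A * ?b\<^sup>2)"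
  using A0 by (simp add: ennreal_mult mult.commute)
 finally show ?thesis .
qed

text \<open>The interpolation \<open>a powr s * min 1 b <= a + b\<close> replaces Young's inequality.\<close>

lemma block_coefficient_le:
 assumes \<gamma>: "2 < \<gamma>" and nonneg: "0 <= B" "0 <= X" "0 <= Y"
 shows "2 ^ j * min X (Y / 4 ^ j) * (B / 2 powr (2 / \<gamma> * real j))\<^sup>2 <= (1/2) ^ j * ((1 + X) * (B powr \<gamma> + Y))"
proof -
 define s where "s = 2 / \<gamma>"
 have s: "0 < s" "s <= 1" using \<gamma> by (auto simp: s_def)
 \<comment> \<open>Normalised so that \<open>a powr s\<close>, with \<open>s = 2 / \<gamma>\<close>,
   is the squared Besov factor.\<close>
 define a where "a = B powr \<gamma> / 4 ^ j"
 define b where "b = Y / 4 ^ j"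
 have ab: "0 <= a" "0 <= b" using nonneg by (auto simp: a_def b_def)
 have "(2::real) powr (s * real j) * 2 powr (s * real j) = (2 powr 2) powr (s * real j)"
  unfolding powr_powr powr_add[symmetric] by (simp add: algebra_simps)
 then have p: "(2 powr (s * real j))\<^sup>2 = (4 ^ j) powr s"
  by (simp add: power2_eq_square powr_realpow[symmetric] powr_powr mult.commute)
 have "a powr s = (B powr \<gamma>) powr s / (4 ^ j) powr s"
  unfolding a_def using nonneg by (simp add: powr_divide)
 also have "(B powr \<gamma>) powr s = B\<^sup>2"
  unfolding powr_powr s_def using \<gamma> nonneg by (cases "B = 0") (auto simp: powr_numeral)
 finally have as: "(B / 2 powr (s * real j))\<^sup>2 = a powr s"
  by (simp add: power_divide p)
 have key: "a powr s * min 1 b <= a + b"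
 proof (cases "1 <= a")
  case True
  then have "a powr s <= a powr 1" using s by (intro powr_mono) auto
  then have "a powr s <= a" using True by simp
  then have "a powr s * min 1 b <= a * 1" using ab by (intro mult_mono) auto
  then show ?thesis using ab by simp
 next
  case False
  then have "a powr s <= 1 powr s" using ab s by (intro powr_mono2) auto
  then have "a powr s * min 1 b <= 1 * b" using ab by (intro mult_mono) auto
  then show ?thesis using ab by simp
 qed
 have "min X b <= (1 + X) * min 1 b"
  using nonneg ab by (auto simp: min_def algebra_simps intro: add_increasing2)
 then have "min X b * a powr s <= ((1 + X) * min 1 b) * a powr s" by (intro mult_right_mono) auto
 also have "... = (1 + X) * (a powr s * min 1 b)" by simp
 also have "... <= (1 + X) * (a + b)" using nonneg by (intro mult_left_mono key) auto
 finally have "2 ^ j * (min X b * a powr s) <= 2 ^ j * ((1 + X) * (a + b))" by simp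
 also have "... = (1/2) ^ j * ((1 + X) * (B powr \<gamma> + Y))"
 proof -
  have "(4::real) ^ j = 2 ^ j * 2 ^ j" by (simp flip: power_mult_distrib)
  then show ?thesis by (simp add: a_def b_def power_divide field_simps)
 qed
 finally show ?thesis unfolding s_def[symmetric] as b_def[symmetric] by (simp add: mult.assoc)
qed

definition blocksum :: "(R3 => R2) => R3 => ennreal" where
 "blocksum f x = (\<Sum>j. ennreal (norm (block j f x)))"

text \<open>The ratio of the weights used to sum the blocks. Two uses of Cauchy-Schwarz cost q ^ -6
  per block against a decay of 1 / 2, so q ^ 6 must exceed 1 / 2.\<close>

definition q :: real where "q = 19 / 20"
definition cq :: real where "cq = 1 / (1 - q\<^sup>2)"

lemma geometric_cq: "(\<Sum>j. (ennreal (q ^ j))\<^sup>2) = ennreal cq"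
proof -
 have "(%j. (q\<^sup>2) ^ j) sums (1 / (1 - q\<^sup>2))"
  by (rule geometric_sums) (simp add: q_def power2_eq_square)
 then have "(\<Sum>j. ennreal ((q\<^sup>2) ^ j)) = ennreal cq"
  unfolding cq_def by (intro suminf_ennreal_eq) (auto simp: q_def)
 moreover have "(ennreal (q ^ j))\<^sup>2 = ennreal ((q\<^sup>2) ^ j)" for j
  by (simp add: ennreal_power q_def mult.commute flip: power_mult)
 ultimately show ?thesis by simp
qed

lemma cq_pos: "0 < cq" by (simp add: cq_def q_def power2_eq_square)

text \<open>Cauchy-Schwarz with weights q ^ j, twice: the first use leaves u^2 / q ^ (2 j), from
  which one more weight q ^ j is split off, and the second leaves u^4 / q ^ (6 j). The first
  constant is squared on the way, hence the cube of \<open>cq\<close>.\<close>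

lemma suminf_power4_le:
 fixes u :: "nat => real"
 assumes u: "!!j. 0 <= u j"
 shows "(\<Sum>j. ennreal (u j)) ^ 4 <= ennreal (cq ^ 3) * (\<Sum>j. ennreal ((1 / q ^ 6) ^ j * u j ^ 4))"
proof -
 have q0: "0 < q" by (simp add: q_def)
 have "(\<Sum>j. ennreal (u j)) = (\<Sum>j. ennreal (q ^ j) * ennreal (u j / q ^ j))"
  using q0 u by (intro suminf_cong) (simp add: ennreal_mult[symmetric])
 then have 1: "(\<Sum>j. ennreal (u j))\<^sup>2 <= ennreal cq * (\<Sum>j. (ennreal (u j / q ^ j))\<^sup>2)"
  using suminf_Cauchy_Schwarz[of "%j. ennreal (q ^ j)" "%j. ennreal (u j / q ^ j)"] by (simp add: geometric_cq)
 have "(\<Sum>j. (ennreal (u j / q ^ j))\<^sup>2) = (\<Sum>j. ennreal (q ^ j) * ennreal ((u j)\<^sup>2 / q ^ (3 * j)))"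
 proof (intro suminf_cong)
  fix j
  have "q ^ (3 * j) = q ^ (j + j * 2)" by (rule arg_cong[where f="power q"]) simp
  also have "... = q ^ j * (q ^ j)\<^sup>2" by (simp only: power_add power_mult)
  finally have "q ^ (3 * j) = q ^ j * (q ^ j)\<^sup>2" .
  then show "(ennreal (u j / q ^ j))\<^sup>2 = ennreal (q ^ j) * ennreal ((u j)\<^sup>2 / q ^ (3 * j))"
   using q0 u[of j] by (simp add: ennreal_power ennreal_mult[symmetric] power_divide)
 qed
 then have 2: "(\<Sum>j. (ennreal (u j / q ^ j))\<^sup>2)\<^sup>2 <= ennreal cq * (\<Sum>j. (ennreal ((u j)\<^sup>2 / q ^ (3 * j)))\<^sup>2)"
  using suminf_Cauchy_Schwarz[of "%j. ennreal (q ^ j)" "%j. ennreal ((u j)\<^sup>2 / q ^ (3 * j))"] by (simp add: geometric_cq)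
 have 3: "(ennreal ((u j)\<^sup>2 / q ^ (3 * j)))\<^sup>2 = ennreal ((1 / q ^ 6) ^ j * u j ^ 4)" for j
 proof -
  have "(q ^ (3 * j))\<^sup>2 = (q ^ 6) ^ j" by (simp add: mult.commute mult.left_commute flip: power_mult)
  then show ?thesis
   using q0 u[of j] by (simp add: ennreal_power power_divide flip: power_mult)
 qed
 have "(\<Sum>j. ennreal (u j)) ^ 4 = ((\<Sum>j. ennreal (u j))\<^sup>2)\<^sup>2" by (simp flip: power_mult)
 also have "... <= (ennreal cq * (\<Sum>j. (ennreal (u j / q ^ j))\<^sup>2))\<^sup>2"
  by (rule power_mono[OF 1]) simp
 also have "... = (ennreal cq)\<^sup>2 * (\<Sum>j. (ennreal (u j / q ^ j))\<^sup>2)\<^sup>2" by (simp add: power_mult_distrib)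
 also have "... <= (ennreal cq)\<^sup>2 * (ennreal cq * (\<Sum>j. (ennreal ((u j)\<^sup>2 / q ^ (3 * j)))\<^sup>2))"
  by (rule mult_left_mono[OF 2]) simp
 also have "... = ennreal (cq ^ 3) * (\<Sum>j. ennreal ((1 / q ^ 6) ^ j * u j ^ 4))"
  unfolding 3 using cq_pos by (simp add: ennreal_mult power2_eq_square power3_eq_cube mult.assoc)
 finally show ?thesis .
qed

definition K1 :: real where "K1 = cq ^ 3 * (K0 * (1 / (1 - (1 / q ^ 6) * (1 / 2))))"

text \<open>Besov bound and interpolation give the fourth power of each block a mass of order 2 ^
  -j; with the weights included the series is geometric with ratio \<open>t\<close>.\<close>

lemma blocksum_power4:
 assumes f: "f : H1" and \<gamma>: "2 < \<gamma>" and B: "besov_norm chi (2 / \<gamma>) 2 \<infinity> f = ennreal B" "0 <= B"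
 shows "(\<oint>x. blocksum f x ^ 4) <= ennreal (K1 * ((1 + rmass 2 f) * (B powr \<gamma> + (grad_L2_norm f)\<^sup>2)))"
proof -
 have [measurable]: "block j f : Borel" for j
  by (intro block_borel Lp_torusD[OF H1_L2[OF f]])
 let ?D = "weak_pd (0, 1) f"
 define Z where "Z = (1 + rmass 2 f) * (B powr \<gamma> + rmass 2 ?D)"
 have Z0: "0 <= Z" by (simp add: Z_def rmass_nonneg)
 define t where "t = (1 / q ^ 6) * (1 / 2 :: real)"
 have t: "0 < t" "t < 1" by (simp_all add: t_def q_def field_simps)
 have q0: "0 < q" by (simp add: q_def)
 have "(\<oint>x. blocksum f x ^ 4) <= (\<oint>x. ennreal (cq ^ 3) * (\<Sum>j. ennreal ((1 / q ^ 6) ^ j * norm (block j f x) ^ 4)))"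
  unfolding blocksum_def by (intro nn_integral_mono suminf_power4_le) simp
 also have "... = ennreal (cq ^ 3) * (\<Sum>j. \<integral>\<^sup>+x. ennreal ((1 / q ^ 6) ^ j * norm (block j f x) ^ 4) \<partial>torus)"
  by (subst nn_integral_cmult, measurable) (subst nn_integral_suminf, auto)
 also have "(\<Sum>j. \<integral>\<^sup>+x. ennreal ((1 / q ^ 6) ^ j * norm (block j f x) ^ 4) \<partial>torus) <= (\<Sum>j. ennreal (K0 * Z * t ^ j))"
 proof (intro suminf_le summableI)
  fix j
  have "(\<oint>x. ennreal ((1 / q ^ 6) ^ j * norm (block j f x) ^ 4)) = ennreal ((1 / q ^ 6) ^ j) * pmass 4 (block j f)"
   unfolding pmass_def using q0 by (subst nn_integral_cmult[symmetric]) (auto simp: ennreal_mult[symmetric])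
  also have "... <= ennreal ((1 / q ^ 6) ^ j) * ennreal ((K0 * 2 ^ j * min (rmass 2 f) (rmass 2 ?D / 4 ^ j)) * (B / 2 powr (2 / \<gamma> * real j))\<^sup>2)"
   by (intro mult_left_mono block_pmass_4 f B) simp
  also have "... = ennreal ((1 / q ^ 6) ^ j * ((K0 * 2 ^ j * min (rmass 2 f) (rmass 2 ?D / 4 ^ j)) * (B / 2 powr (2 / \<gamma> * real j))\<^sup>2))"
   using q0 by (intro ennreal_mult[symmetric]) (auto simp: K0_nonneg rmass_nonneg)
  also have "... <= ennreal (K0 * Z * t ^ j)"
  proof (rule ennreal_leI)
   have "K0 * (2 ^ j * min (rmass 2 f) (rmass 2 ?D / 4 ^ j) * (B / 2 powr (2 / \<gamma> * real j))\<^sup>2) <= K0 * ((1/2) ^ j * Z)"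
    unfolding Z_def by (intro mult_left_mono block_coefficient_le \<gamma> B rmass_nonneg K0_nonneg)
   then have "(1 / q ^ 6) ^ j * (K0 * (2 ^ j * min (rmass 2 f) (rmass 2 ?D / 4 ^ j) * (B / 2 powr (2 / \<gamma> * real j))\<^sup>2)) <=
    (1 / q ^ 6) ^ j * (K0 * ((1/2) ^ j * Z))"
    by (rule mult_left_mono) (use q0 in auto)
   then show "(1 / q ^ 6) ^ j * ((K0 * 2 ^ j * min (rmass 2 f) (rmass 2 ?D / 4 ^ j)) * (B / 2 powr (2 / \<gamma> * real j))\<^sup>2) <= K0 * Z * t ^ j"
    unfolding t_def power_mult_distrib by (simp only: ac_simps)
  qed
  finally show "(\<oint>x. ennreal ((1 / q ^ 6) ^ j * norm (block j f x) ^ 4)) <= ennreal (K0 * Z * t ^ j)" .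
 qed
 also have "(\<Sum>j. ennreal (K0 * Z * t ^ j)) = ennreal (K0 * Z * (1 / (1 - t)))"
  using t Z0 K0_nonneg by (intro suminf_ennreal_eq sums_mult geometric_sums) auto
 also have "ennreal (cq ^ 3) * ennreal (K0 * Z * (1 / (1 - t))) = ennreal (K1 * Z)"
  using t Z0 K0_nonneg cq_pos by (subst ennreal_mult[symmetric]) (auto simp: K1_def t_def)
 also have "... <= ennreal (K1 * ((1 + rmass 2 f) * (B powr \<gamma> + (grad_L2_norm f)\<^sup>2)))"
 proof (intro ennreal_leI mult_left_mono)
  show "0 <= K1" using t K0_nonneg cq_pos by (simp add: K1_def t_def)
  show "Z <= (1 + rmass 2 f) * (B powr \<gamma> + (grad_L2_norm f)\<^sup>2)"
   unfolding Z_def using rmass_weak_pd_le[OF f, of "(0, 1)"]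
   by (intro mult_left_mono add_left_mono) (auto simp: rmass_nonneg)
 qed
 finally show ?thesis by (simp add: mult_left_mono)
qed

definition blockvec :: "(R3 => R2) => R3 => R2" where
 "blockvec f x = (\<Sum>j. block j f x)"

lemma norm_blockvec_le: "ennreal (norm (blockvec f x)) <= blocksum f x"
proof (cases "blocksum f x = top")
 case False
 then have s: "summable (%j. norm (block j f x))"
  unfolding blocksum_def by (rule summable_suminf_not_top[rotated]) simp
 then have "norm (blockvec f x) <= (\<Sum>j. norm (block j f x))"
  unfolding blockvec_def by (rule summable_norm)
 then have "ennreal (norm (blockvec f x)) <= ennreal (\<Sum>j. norm (block j f x))" by (rule ennreal_leI)
 also have "... = blocksum f x" unfolding blocksum_def by (rule suminf_ennreal2[symmetric]) (use s in auto)
 finally show ?thesis .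
qed simp

section \<open>Recovering a function from its mean and its blocks\<close>

lemma conv_z_eq:
 "block j f (xH, z) = (LINT \<zeta>|torus. kappa j (z - \<zeta>) *R f (xH, \<zeta>))"
 by (simp add: block_def conv_z_def)

text \<open>Each cosine is an eigenfunction of convolution with \<open>kappa\<close>. The factor 2
  pi stays because the convolution is not divided by the period; it reappears in the reconstruction
  formula.\<close>

lemma integral_cos_kappa:
 "(LINT z|torus. cos (of_int k * z + c) * kappa j (z - \<zeta>)) = 2 * pi * rho j k * cos (of_int k * \<zeta> + c)"
proof -
 have "(LINT z|torus. cos (of_int k * z + c) * kappa j (z - \<zeta>)) =
  (LINT z|torus. (\<Sum>l\<in>freqs j. rho j l *R (cos (of_int k * z + c) * cos (of_int l * z + (- of_int l * \<zeta>)))))"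
  unfolding kappa_def by (simp add: sum_distrib_left algebra_simps)
 also have "... = (\<Sum>l\<in>freqs j. rho j l *R (LINT z|torus. cos (of_int k * z + c) * cos (of_int l * z + (- of_int l * \<zeta>))))"
  by (rule integral_sum_scaleR) (intro tp_integrable tp_mult tp_cos_real)
 also have "... = (\<Sum>l\<in>freqs j. (if l = - k then pi * rho j k * cos (of_int k * \<zeta> + c) else 0) + (if l = k then pi * rho j k * cos (of_int k * \<zeta> + c) else 0))"
  unfolding integral_cos_cos by (intro sum.cong refl) (auto simp: rho_even algebra_simps)
 also have "... = 2 * pi * rho j k * cos (of_int k * \<zeta> + c)"
 proof (cases "k : freqs j")
  case True
  then show ?thesis using freqs_sym[OF True] by (simp add: sum.distrib)
 next
  case False
  then show ?thesis by (simp add: rho_outside sum.distrib)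
 qed
 finally show ?thesis .
qed

end

context LP
begin

text \<open>The partial sums telescope to chi(k / 2 ^ J) - chi(k). For nonzero k the second term is
  0, as |k| >= 1, and the first is 1 for large J.\<close>

lemma sums_rho: "(%j. rho j k) sums (if k = 0 then 0 else 1)"
proof (cases "k = 0")
 case True
 then have "(%j. rho j k) = (%_. 0)" by (simp add: rho_small)
 then show ?thesis using True sums_zero by simp
next
 case False
 have "eventually (%J. (\<Sum>j<J. rho j k) = 1) sequentially"
  unfolding eventually_sequentially
 proof (intro exI allI impI)
  fix J assume J: "nat (2 * \<bar>k\<bar>) <= J"
  have "2 * \<bar>k\<bar> <= int J" using J by linarith
  also have "... <= 2 ^ J" using of_nat_mono[OF less_imp_le[OF less_exp[of J]], where 'a=int] by simp
  finally have "real_of_int (2 * \<bar>k\<bar>) <= real_of_int (2 ^ J)" by (simp only: of_int_le_iff)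
  then have "\<bar>real_of_int k / 2 ^ J\<bar> <= 1/2" by (simp add: field_simps)
  then show "(\<Sum>j<J. rho j k) = 1"
   using False chi_0[of "of_int k"] by (simp add: rho_sum chi_1)
 qed
 then show ?thesis unfolding sums_def using False by (auto intro: tendsto_eventually)
qed

lemma integral_cos_conv:
 fixes g :: "real => R2"
 assumes g: "integrable torus g" and [measurable]: "g : Borel"
 shows "(LINT z|torus. cos (of_int k * z + c) *R (LINT \<zeta>|torus. kappa j (z - \<zeta>) *R g \<zeta>)) =
  (2 * pi * rho j k) *R (LINT \<zeta>|torus. cos (of_int k * \<zeta> + c) *R g \<zeta>)"
proof -
 interpret pair_sigma_finite "torus :: real measure" "torus :: real measure" by (rule pair_torus_torus)
 have [measurable]: "kappa j : Borel" by (rule tp_borel[OF tp_kappa])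
 obtain C where C: "C >= 0" "!!x. \<bar>kappa j x\<bar> <= C" using tp_bounded[OF tp_kappa] by auto
 let ?F = "%x::real \<times> real. (cos (of_int k * fst x + c) * kappa j (fst x - snd x)) *R g (snd x)"
 have "integrable torus (%x::real \<times> real. g (snd x))"
 proof (rule integrableI_bounded)
  have "(\<integral>\<^sup>+x. ennreal (norm (g (snd x))) \<partial>(torus :: (real \<times> real) measure)) = (\<integral>\<^sup>+z. (\<oint>\<zeta>. ennreal (norm (g \<zeta>))) \<partial>(torus :: real measure))"
   by (subst nn_integral_torus_fst) auto
  also have "... < \<infinity>"
   using integrable_iff_bounded[THEN iffD1, OF g] by (auto simp: ennreal_mult_less_top emeasure_torus_real)
  finally show "(\<integral>\<^sup>+x. ennreal (norm (g (snd x))) \<partial>(torus :: (real \<times> real) measure)) < \<infinity>" .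
 qed auto
 from integrable_scaleR_right[OF this, of C] have "integrable torus ?F"
 proof (rule LB_integrable_bound)
  show "AE x in torus. norm (?F x) <= norm (C *R g (snd x))"
  proof (intro AE_I2)
   fix x :: "real \<times> real"
   have "\<bar>cos (of_int k * fst x + c)\<bar> * \<bar>kappa j (fst x - snd x)\<bar> <= 1 * C"
    by (intro mult_mono C) auto
   then have "\<bar>cos (of_int k * fst x + c)\<bar> * \<bar>kappa j (fst x - snd x)\<bar> * norm (g (snd x)) <= C * norm (g (snd x))"
    by (intro mult_right_mono) auto
   then show "norm (?F x) <= norm (C *R g (snd x))" using C(1) by (simp add: abs_mult)
  qed
 qed auto
 then have "integrable (torus \<Otimes>\<^sub>M torus) (%(z, \<zeta>). (cos (of_int k * z + c) * kappa j (z - \<zeta>)) *R g \<zeta>)"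
  by (simp add: torus_prod case_prod_beta')
 from Fubini_integral[OF this] have
  "(LINT z|torus. LINT \<zeta>|torus. (cos (of_int k * z + c) * kappa j (z - \<zeta>)) *R g \<zeta>) =
  (LINT \<zeta>|torus. LINT z|torus. (cos (of_int k * z + c) * kappa j (z - \<zeta>)) *R g \<zeta>)" by simp
 also have "... = (LINT \<zeta>|torus. (2 * pi * rho j k * cos (of_int k * \<zeta> + c)) *R g \<zeta>)"
  unfolding integral_cos_kappa[symmetric]
  by (intro LB_integral_cong refl integral_scaleR_left tp_integrable tp_mult tp_cos_real impI)
   (use tp_translate[OF tp_kappa[of j], of "- _"] in auto)
 finally show ?thesis by (simp flip: scaleR_scaleR)
qed

text \<open>The two sides differ by a square integrable function all of whose cosine coefficients
  vanish: the mean supplies frequency 0, and for nonzero k the multipliers sum to 1. The fourth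
  power bound makes the series absolutely convergent almost everywhere and in L1, so it may be
  integrated termwise.\<close>

lemma Littlewood_Paley_slice:
 fixes g :: "real => R2"
 assumes g: "g : Lp_torus 2"
  and S: "(\<oint>z. (\<Sum>j. ennreal (norm (LINT \<zeta>|torus. kappa j (z - \<zeta>) *R g \<zeta>))) ^ 4) < \<infinity>"
 shows "AE z in torus. (2 * pi) *R g z = (LINT \<zeta>|torus. g \<zeta>) + (\<Sum>j. LINT \<zeta>|torus. kappa j (z - \<zeta>) *R g \<zeta>)"
proof -
 note [measurable] = Lp_torusD(2)[OF g]
 have [measurable]: "kappa j : Borel" for j by (rule tp_borel[OF tp_kappa])
 define bl where "bl j z = (LINT \<zeta>|torus. kappa j (z - \<zeta>) *R g \<zeta>)" for j z
 define S where "S z = (\<Sum>j. ennreal (norm (bl j z)))" for z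
 interpret sigma_finite_measure "torus :: real measure" by (rule sigma_finite_torus)
 have [measurable]: "bl j : Borel" for j unfolding bl_def by measurable
 have [measurable]: "S : Borel" unfolding S_def by measurable
 have gi: "integrable torus g" by (rule L2_integrable[OF g])
 have S4: "(\<oint>z. S z ^ 4) < \<infinity>" using S by (simp add: S_def bl_def)
 \<comment> \<open>On a set of finite measure these turn the fourth power bound into bounds in L1
   and L2.\<close>
 have le: "x <= 1 + x ^ 4" "x\<^sup>2 <= 1 + x ^ 4" for x :: ennreal
 proof -
  have "x <= 1 + x ^ 4 & x\<^sup>2 <= 1 + x ^ 4"
  proof (cases "x <= 1")
   case True
   then have "x\<^sup>2 <= 1" by (simp add: power_le_one)
   then show ?thesis using True by (auto intro: add_increasing2)
  next
   case False
   then have "x <= x ^ 4" "x\<^sup>2 <= x ^ 4" using power_increasing[of 1 4 x] power_increasing[of 2 4 x] by auto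
   then show ?thesis by (auto intro: add_increasing)
  qed
  then show "x <= 1 + x ^ 4" "x\<^sup>2 <= 1 + x ^ 4" by auto
 qed
 have fin: "(\<oint>z. 1 + S z ^ 4) < \<infinity>"
  using S4 by (subst nn_integral_add) (auto simp: emeasure_torus_real)
 have S1: "(\<oint>z. S z) < \<infinity>"
  by (rule order.strict_trans1[OF nn_integral_mono fin]) (rule le)
 have S2: "(\<oint>z. (S z)\<^sup>2) < \<infinity>"
  by (rule order.strict_trans1[OF nn_integral_mono fin]) (rule le)
 have sw: "(\<Sum>j. \<integral>\<^sup>+z. ennreal (norm (bl j z)) \<partial>torus) = (\<oint>z. S z)"
  unfolding S_def by (rule nn_integral_suminf[symmetric]) measurable
 have bli: "integrable torus (bl j)" for j
 proof (rule integrableI_bounded)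
  have "(\<oint>z. ennreal (norm (bl j z))) <= (\<oint>z. S z)"
   unfolding sw[symmetric] using sum_le_suminf[of "%j. \<integral>\<^sup>+z. ennreal (norm (bl j z)) \<partial>torus" "{j}"] by simp
  then show "(\<oint>z. ennreal (norm (bl j z))) < \<infinity>" using S1 by order
 qed simp
 have sum: "summable (%j. LINT z|torus. norm (bl j z))"
 proof (rule summable_suminf_not_top)
  have "(\<Sum>j. ennreal (LINT z|torus. norm (bl j z))) = (\<oint>z. S z)"
   unfolding sw[symmetric] by (intro suminf_cong nn_integral_eq_integral[symmetric] integrable_norm bli) auto
  then show "(\<Sum>j. ennreal (LINT z|torus. norm (bl j z))) ~= top" using S1 by simp
 qed simp
 have AEsum: "AE z in torus. summable (%j. norm (bl j z))"
 proof -
  have "AE z in torus. S z ~= \<infinity>" by (rule nn_integral_PInf_AE) (use S1 in auto)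
  then show ?thesis by eventually_elim (auto simp: S_def intro: summable_suminf_not_top)
 qed
 define h where "h z = (2 * pi) *R g z - (LINT \<zeta>|torus. g \<zeta>) - (\<Sum>j. bl j z)" for z
 have "(%z. \<Sum>j. bl j z) : Lp_torus 2"
  unfolding Lp_torus_def
 proof (safe)
  have "bl j (z + (2 * pi) *R b) = bl j z" if "b : Basis" for b j z
   using periodicD[OF tp_periodic[OF tp_kappa[of j]] that, of "z - _"] by (simp add: bl_def algebra_simps)
  then show "periodic (%z. \<Sum>j. bl j z)" by (simp add: periodic_def)
  show "(%z. \<Sum>j. bl j z) : Borel" by measurable
  have "pmass 2 (%z. \<Sum>j. bl j z) <= (\<oint>z. (S z)\<^sup>2)"
   unfolding pmass_def
  proof (rule nn_integral_mono_AE)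
   show "AE z in torus. ennreal ((norm (\<Sum>j. bl j z))\<^sup>2) <= (S z)\<^sup>2"
    using AEsum
   proof eventually_elim
    case (elim z)
    have "ennreal (norm (\<Sum>j. bl j z)) <= ennreal (\<Sum>j. norm (bl j z))"
     by (intro ennreal_leI summable_norm elim)
    also have "... = S z" unfolding S_def by (rule suminf_ennreal2[symmetric]) (use elim in auto)
    finally have "ennreal (norm (\<Sum>j. bl j z)) ^ 2 <= S z ^ 2" by (intro power_mono) auto
    then show ?case by (simp add: ennreal_power)
   qed
  qed
  then show "pmass 2 (%z. \<Sum>j. bl j z) < \<infinity>" using S2 by order
 qed
 then have h: "h : Lp_torus 2"
  unfolding h_def by (intro Lp_torus_diff Lp_torus_scaleR g Lp_torus_const)
 have hi: "integrable torus h" by (rule L2_integrable[OF h])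
 have atom: "(LINT z|torus. cos (of_int k * z + c) *R h z) = 0" for k c
 proof -
  define e where "e z = cos (of_int k * z + c)" for z :: real
  have te: "tp e" unfolding e_def by (rule tp_cos_real)
  note [measurable] = tp_borel[OF te]
  have e1: "norm (e z *R u) <= norm u" for z and u :: R2
   using mult_right_mono[OF abs_cos_le_one[of "of_int k * z + c"] norm_ge_zero[of u]] by (simp add: e_def)
  have ei: "integrable torus (%z. e z *R bl j z)" for j by (rule integrable_torus_mult_tp[OF bli te])
  have s1: "AE z in torus. summable (%j. norm (e z *R bl j z))"
   using AEsum
  proof eventually_elim
   case (elim z)
   show ?case by (rule summable_comparison_test'[OF elim, where N=0]) (simp only: real_norm_def abs_norm_cancel e1)
  qed
  have s2: "summable (%j. LINT z|torus. norm (e z *R bl j z))"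
  proof (rule summable_comparison_test'[OF sum, where N=0])
   fix j
   have "(LINT z|torus. norm (e z *R bl j z)) <= (LINT z|torus. norm (bl j z))"
    by (intro integral_mono integrable_norm ei bli e1)
   then show "norm (LINT z|torus. norm (e z *R bl j z)) <= (LINT z|torus. norm (bl j z))" by simp
  qed
  have "(LINT z|torus. e z *R (\<Sum>j. bl j z)) = (LINT z|torus. (\<Sum>j. e z *R bl j z))"
  proof (rule integral_cong_AE)
   show "AE z in torus. e z *R (\<Sum>j. bl j z) = (\<Sum>j. e z *R bl j z)"
    using AEsum by eventually_elim (rule suminf_scaleR_right[OF summable_norm_cancel])
  qed measurable
  also have "... = (\<Sum>j. LINT z|torus. e z *R bl j z)" by (rule integral_suminf[OF ei s1 s2])
  also have "... = (\<Sum>j. rho j k *R ((2 * pi) *R (LINT \<zeta>|torus. e \<zeta> *R g \<zeta>)))"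
   using integral_cos_conv[OF gi, of k c] by (simp add: e_def bl_def mult.commute)
  also have "... = (if k = 0 then 0 else (2 * pi) *R (LINT \<zeta>|torus. e \<zeta> *R g \<zeta>))"
   using sums_scaleR_left[OF sums_rho[of k], of "(2 * pi) *R (LINT \<zeta>|torus. e \<zeta> *R g \<zeta>)", THEN sums_unique, symmetric] by (rule trans) simp
  finally have A: "(LINT z|torus. e z *R (\<Sum>j. bl j z)) = (if k = 0 then 0 else (2 * pi) *R (LINT \<zeta>|torus. e \<zeta> *R g \<zeta>))" .
  have i1: "integrable torus (%z. e z *R ((2 * pi) *R g z))"
   and i2: "integrable torus (%z. e z *R (LINT \<zeta>|torus. g \<zeta>))"
   by (rule integrable_torus_mult_tp[OF _ te]; simp add: gi integrable_torus_const)+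
  have i3: "integrable torus (%z. e z *R (\<Sum>j. bl j z))"
   by (rule integrable_torus_mult_tp[OF L2_integrable te]) fact
  have "(LINT z|torus. e z *R h z) = (LINT z|torus. e z *R ((2 * pi) *R g z)) - (LINT z|torus. e z *R (LINT \<zeta>|torus. g \<zeta>)) - (LINT z|torus. e z *R (\<Sum>j. bl j z))"
   unfolding h_def scaleR_diff_right using i1 i2 i3 by (simp del: scaleR_scaleR)
  also have "(LINT z|torus. e z *R ((2 * pi) *R g z)) = (2 * pi) *R (LINT z|torus. e z *R g z)"
   by (subst integral_scaleR_right[symmetric]) (simp add: mult.commute)
  also have "(LINT z|torus. e z *R (LINT \<zeta>|torus. g \<zeta>)) = (if k = 0 then 2 * pi * cos c else 0) *R (LINT \<zeta>|torus. g \<zeta>)"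
   using integral_torus_cos[of k c, folded e_def]
   by (subst integral_scaleR_left[where f=e, OF tp_integrable[OF te]]) simp
  also have "(2 * pi) *R (LINT z|torus. e z *R g z) - (if k = 0 then 2 * pi * cos c else 0) *R (LINT \<zeta>|torus. g \<zeta>) - (LINT z|torus. e z *R (\<Sum>j. bl j z)) = 0"
   unfolding A by (auto simp: e_def)
  finally show ?thesis unfolding e_def .
 qed
 have "AE z in torus. h z = 0"
 proof (rule L2_orthogonal_tp_zero[OF h])
  fix \<psi> :: "real => real" assume "tp \<psi>"
  then show "(LINT x|torus. \<psi> x *R h x) = 0"
  proof (induction rule: tp.induct)
   case (tp_atom l a c)
   then obtain k where "l = of_int k" by (auto elim!: Ints_cases)
   then show ?case using atom[of k c] by (simp flip: scaleR_scaleR)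
  next
   case (tp_add f1 f2)
   then show ?case
    using integrable_torus_mult_tp[OF hi tp_add(1)] integrable_torus_mult_tp[OF hi tp_add(2)]
    by (simp add: scaleR_add_left)
  qed
 qed
 then show ?thesis
  by eventually_elim (simp add: h_def bl_def algebra_simps)
qed

text \<open>On almost every vertical line the field is, up to the factor 2 pi >= 1, the mean plus
  the blocks, and the fourth power of a sum of two terms costs 16. The mean is constant along the
  line, whose length turns 16 into 32 pi.\<close>

lemma pmass_4_le_blocksum:
 assumes f: "f : H1" and S4: "(\<oint>x. blocksum f x ^ 4) < \<infinity>"
 shows "pmass 4 f <= ennreal (32 * pi) * pmass 4 (%xH. LINT z|torus. f (xH, z)) + 16 * (\<oint>x. blocksum f x ^ 4)"
proof -
 note fL = H1_L2[OF f]
 note fb [measurable] = Lp_torusD(2)[OF fL]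
 have [measurable]: "block j f : Borel" for j by (intro block_borel fb)
 have bs [measurable]: "blocksum f : Borel" unfolding blocksum_def by measurable
 define m where "m xH = (LINT z|torus. f (xH, z))" for xH
 interpret sigma_finite_measure "torus :: real measure" by (rule sigma_finite_torus)
 have [measurable]: "m : Borel" unfolding m_def by measurable
 have A1: "AE xH in torus. (\<oint>z. ennreal ((norm (f (xH, z)))\<^sup>2)) ~= \<infinity>"
 proof (rule nn_integral_PInf_AE)
  show "(\<oint>xH. (\<oint>z. ennreal ((norm (f (xH, z)))\<^sup>2))) ~= \<infinity>"
   using Lp_torusD(3)[OF fL] by (subst nn_integral_torus_fst[symmetric]) (auto simp: pmass_def)
 qed (rule measurable_torus, measurable)
 have A2: "AE xH in torus. (\<oint>z. blocksum f (xH, z) ^ 4) ~= \<infinity>"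
 proof (rule nn_integral_PInf_AE)
  show "(\<oint>xH. (\<oint>z. blocksum f (xH, z) ^ 4)) ~= \<infinity>"
   using S4 by (subst nn_integral_torus_fst[symmetric]) auto
 qed (rule measurable_torus, measurable)
 have "pmass 4 f = (\<oint>xH. (\<oint>z. ennreal (norm (f (xH, z)) ^ 4)))"
  unfolding pmass_def by (rule nn_integral_torus_fst) measurable
 also have "... <= (\<oint>xH. ennreal (32 * pi) * ennreal (norm (m xH) ^ 4) + 16 * (\<oint>z. blocksum f (xH, z) ^ 4))"
 proof (rule nn_integral_mono_AE)
  show "AE xH in torus. (\<oint>z. ennreal (norm (f (xH, z)) ^ 4)) <=
   ennreal (32 * pi) * ennreal (norm (m xH) ^ 4) + 16 * (\<oint>z. blocksum f (xH, z) ^ 4)"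
   using A1 A2
  proof eventually_elim
   case (elim xH)
   have g: "(%z. f (xH, z)) : Lp_torus 2"
    using elim(1) periodic_slice_snd[OF Lp_torusD(1)[OF fL]] by (auto simp: Lp_torus_def pmass_def less_top)
   have S: "(\<oint>z. (\<Sum>j. ennreal (norm (LINT \<zeta>|torus. kappa j (z - \<zeta>) *R f (xH, \<zeta>)))) ^ 4) < \<infinity>"
    using elim(2) by (simp add: blocksum_def conv_z_eq less_top)
   have "AE z in torus. ennreal (norm (f (xH, z)) ^ 4) <= 16 * (ennreal (norm (m xH) ^ 4) + blocksum f (xH, z) ^ 4)"
    using Littlewood_Paley_slice[OF g S]
   proof eventually_elim
    case (elim z)
    have eq: "(2 * pi) *R f (xH, z) = m xH + blockvec f (xH, z)"
     using elim by (simp add: m_def blockvec_def conv_z_eq)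
    have "norm (f (xH, z)) <= norm ((2 * pi) *R f (xH, z))"
     using pi_ge_two mult_right_mono[of 1 "2 * pi" "norm (f (xH, z))"] by simp
    also have "... <= norm (m xH) + norm (blockvec f (xH, z))" unfolding eq by (rule norm_triangle_ineq)
    finally have "norm (f (xH, z)) <= norm (m xH) + norm (blockvec f (xH, z))" .
    then have "norm (f (xH, z)) ^ 4 <= (norm (m xH) + norm (blockvec f (xH, z))) ^ 4" by (intro power_mono) auto
    also have "... <= 2 ^ 4 * (norm (m xH) ^ 4 + norm (blockvec f (xH, z)) ^ 4)"
     using norm_add_power[of "norm (m xH)" "norm (blockvec f (xH, z))" 4] by simp
    finally have "ennreal (norm (f (xH, z)) ^ 4) <= ennreal (2 ^ 4 * (norm (m xH) ^ 4 + norm (blockvec f (xH, z)) ^ 4))"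
     by (rule ennreal_leI)
    also have "... = 16 * (ennreal (norm (m xH) ^ 4) + ennreal (norm (blockvec f (xH, z))) ^ 4)"
     by (simp add: ennreal_mult ennreal_power)
    also have "... <= 16 * (ennreal (norm (m xH) ^ 4) + blocksum f (xH, z) ^ 4)"
     by (intro mult_left_mono add_left_mono power_mono norm_blockvec_le) auto
    finally show ?case .
   qed
   then have "(\<oint>z. ennreal (norm (f (xH, z)) ^ 4)) <= (\<oint>z. 16 * (ennreal (norm (m xH) ^ 4) + blocksum f (xH, z) ^ 4))"
    by (rule nn_integral_mono_AE)
   also have "... = 16 * ((\<integral>\<^sup>+z. ennreal (norm (m xH) ^ 4) \<partial>(torus :: real measure)) + (\<oint>z. blocksum f (xH, z) ^ 4))"
    by (subst nn_integral_cmult, measurable) (subst nn_integral_add, auto)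
   also have "... = ennreal (32 * pi) * ennreal (norm (m xH) ^ 4) + 16 * (\<oint>z. blocksum f (xH, z) ^ 4)"
    by (simp add: emeasure_torus_real distrib_left ennreal_mult[symmetric] mult_ac flip: ennreal_numeral)
   finally show ?case .
  qed
 qed
 also have "... = ennreal (32 * pi) * pmass 4 m + 16 * (\<oint>xH. (\<oint>z. blocksum f (xH, z) ^ 4))"
  unfolding pmass_def
  by (subst nn_integral_add; (subst nn_integral_cmult)?; (subst nn_integral_cmult)?; (rule refl | (rule measurable_torus, measurable)))
 also have "(\<oint>xH. (\<oint>z. blocksum f (xH, z) ^ 4)) = (\<oint>x. blocksum f x ^ 4)"
  by (rule nn_integral_torus_fst[symmetric]) measurable
 finally show ?thesis by (simp add: m_def[abs_def])
qed

text \<open>The shape matters: the bound is linear in the squared gradient and in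
  \<open>B powr \<gamma>\<close>, which are integrable in time, and only the energy occurs in a
  higher power.\<close>

lemma pmass_4_le_besov:
 "EX C>=0. ALL f:H1. ALL \<gamma> B. 2 < \<gamma> --> 0 <= B --> besov_norm chi (2 / \<gamma>) 2 \<infinity> f = ennreal B -->
  pmass 4 f <= ennreal (C * ((1 + rmass 2 f)\<^sup>2 * (1 + (grad_L2_norm f)\<^sup>2 + B powr \<gamma>)))"
proof -
 obtain C where C: "C >= 0" "!!f. f : (H1 :: (R3 => R2) set) ==> pmass 4 (%xH. LINT z|torus. f (xH, z)) <= ennreal (C * (rmass 2 f * (rmass 2 f + (grad_L2_norm f)\<^sup>2)))"
  using pmass_4_z_mean_le by auto
 have K1: "0 <= K1" using K0_nonneg cq_pos by (simp add: K1_def q_def field_simps)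
 show ?thesis
 proof (intro exI[of _ "32 * pi * C + 16 * K1"] conjI ballI allI impI)
  fix f \<gamma> B assume f: "f : (H1 :: (R3 => R2) set)" and a: "2 < \<gamma>" "0 <= B" "besov_norm chi (2 / \<gamma>) 2 \<infinity> f = ennreal B"
  define G where "G = (1 + rmass 2 f)\<^sup>2 * (1 + (grad_L2_norm f)\<^sup>2 + B powr \<gamma>)"
  let ?r = "rmass 2 f"
  have r: "0 <= ?r" by (rule rmass_nonneg)
  note b4 = blocksum_power4[OF f a(1,3,2)]
  have S4: "(\<oint>x. blocksum f x ^ 4) < \<infinity>" by (rule order.strict_trans1[OF b4]) simp
  have "?r * (?r + (grad_L2_norm f)\<^sup>2) <= (1 + ?r) * ((1 + ?r) * (1 + (grad_L2_norm f)\<^sup>2 + B powr \<gamma>))"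
   using r by (intro mult_mono) (auto simp: algebra_simps intro!: add_nonneg_nonneg)
  then have g1: "?r * (?r + (grad_L2_norm f)\<^sup>2) <= G" by (simp add: G_def power2_eq_square mult.assoc)
  have "(1 + ?r) * (B powr \<gamma> + (grad_L2_norm f)\<^sup>2) <= (1 + ?r) * ((1 + ?r) * (1 + (grad_L2_norm f)\<^sup>2 + B powr \<gamma>))"
   using r by (intro mult_mono) (auto simp: algebra_simps intro!: add_nonneg_nonneg)
  then have g2: "(1 + ?r) * (B powr \<gamma> + (grad_L2_norm f)\<^sup>2) <= G" by (simp add: G_def power2_eq_square mult.assoc)
  have G0: "0 <= G" unfolding G_def by (intro mult_nonneg_nonneg add_nonneg_nonneg) auto
  have "pmass 4 f <= ennreal (32 * pi) * ennreal (C * G) + 16 * ennreal (K1 * G)"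
   using pmass_4_le_blocksum[OF f S4]
   by (rule order_trans, intro add_mono mult_left_mono order_trans[OF b4] order_trans[OF C(2)[OF f]] ennreal_leI g1 g2 K1 C(1)) auto
  also have "... = ennreal ((32 * pi * C + 16 * K1) * G)"
   using C(1) K1 G0 by (simp add: ennreal_mult[symmetric] ennreal_plus[symmetric] algebra_simps del: ennreal_plus flip: ennreal_numeral)
  finally show "pmass 4 f <= ennreal ((32 * pi * C + 16 * K1) * ((1 + rmass 2 f)\<^sup>2 * (1 + (grad_L2_norm f)\<^sup>2 + B powr \<gamma>)))"
   unfolding G_def .
 qed (use C K1 in auto)
qed

end

section \<open>Hydrostatic solenoidal fields\<close>

text \<open>A horizontal gradient, extended constantly in z. Orthogonality to all such fields is the
  divergence constraint of \<open>hydro_sol\<close>.\<close>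

definition gradH :: "(R2 => real) => R3 => R2" where
 "gradH \<psi> x = (\<Sum>b\<in>Basis. pd b \<psi> (fst x) *R b)"

lemma gradH_props:
 assumes "smooth \<psi>" "periodic \<psi>"
 shows "gradH \<psi> : Lp_torus 2" "EX C. ALL x:cell. norm (gradH \<psi> x) <= C"
proof -
 have cont: "continuous_on UNIV (gradH \<psi>)"
  unfolding gradH_def
  by (intro continuous_intros continuous_on_compose2[OF smooth_pd_continuous[OF assms(1), of _ UNIV]]) auto
 have per: "periodic (gradH \<psi>)"
  unfolding gradH_def by (intro periodic_fst[of "%x. \<Sum>b\<in>Basis. pd b \<psi> x *R b"]) (use periodic_pd[OF assms(2)] in \<open>simp add: periodic_def\<close>)
 have "compact (gradH \<psi> ` cell)"
  unfolding cell_def by (intro compact_continuous_image continuous_on_subset[OF cont]) auto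
 then have "bounded (gradH \<psi> ` cell)" by (rule compact_imp_bounded)
 then show C: "EX C. ALL x:cell. norm (gradH \<psi> x) <= C" by (auto simp: bounded_iff)
 then obtain C where C: "!!x. x : cell ==> norm (gradH \<psi> x) <= C" by blast
 have "pmass 2 (gradH \<psi>) <= pmass 2 (%_::R3. C)"
  by (intro pmass_mono_AE AE_I2) (use C in \<open>force intro: order_trans\<close>)
 also have "... < \<infinity>" using Lp_torusD(3)[OF Lp_torus_const] .
 finally show "gradH \<psi> : Lp_torus 2"
  unfolding Lp_torus_def using per borel_measurable_continuous_onI[OF cont] by auto
qed

lemma weak_div_free_iff:
 fixes f :: "R3 => R2"
 assumes f: "f : Lp_torus 2"
 shows "weak_div_free (%xH. LINT z|torus. f (xH, z)) \<longleftrightarrow>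
  (ALL \<psi>. smooth \<psi> & periodic \<psi> --> (LINT x|torus. f x \<bullet> gradH \<psi> x) = 0)"
proof -
 note [measurable] = Lp_torusD(2)[OF f]
 interpret sigma_finite_measure "torus :: real measure" by (rule sigma_finite_torus)
 have eq: "(LINT xH|torus. (\<Sum>b\<in>Basis. ((LINT z|torus. f (xH, z)) \<bullet> b) * pd b \<psi> xH)) = (LINT x|torus. f x \<bullet> gradH \<psi> x)"
  if \<psi>: "smooth \<psi>" "periodic \<psi>" for \<psi>
 proof -
  have i: "integrable torus (%x. f x \<bullet> gradH \<psi> x)" by (intro integrable_inner_L2 f gradH_props \<psi>)
  have [measurable]: "pd b \<psi> : Borel" if "b : Basis" for b
   by (rule borel_measurable_continuous_onI) (rule smooth_pd_continuous[OF \<psi>(1) that])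
  have [measurable]: "gradH \<psi> : Borel" by (rule Lp_torusD(2)[OF gradH_props(1)[OF \<psi>]])
  have "(LINT xH|torus. (\<Sum>b\<in>Basis. ((LINT z|torus. f (xH, z)) \<bullet> b) * pd b \<psi> xH)) = (LINT xH|torus. LINT z|torus. f (xH, z) \<bullet> gradH \<psi> (xH, z))"
  proof (rule integral_cong_AE)
   show "AE xH in torus. (\<Sum>b\<in>Basis. ((LINT z|torus. f (xH, z)) \<bullet> b) * pd b \<psi> xH) = (LINT z|torus. f (xH, z) \<bullet> gradH \<psi> (xH, z))"
    using integral_torus_fst(2)[OF L2_integrable[OF f]]
   proof eventually_elim
    case (elim xH)
    have "(LINT z|torus. f (xH, z) \<bullet> gradH \<psi> (xH, z)) = (LINT z|torus. f (xH, z)) \<bullet> (\<Sum>b\<in>Basis. pd b \<psi> xH *R b)"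
     unfolding gradH_def fst_conv by (rule integral_inner_left) (use elim in auto)
    then show ?case by (simp add: inner_sum_right mult.commute)
   qed
  qed (rule measurable_torus, measurable)+
  also have "... = (LINT x|torus. f x \<bullet> gradH \<psi> x)" by (rule integral_torus_fst(1)[OF i])
  finally show ?thesis .
 qed
 then show ?thesis by (auto simp: weak_div_free_def)
qed

text \<open>Evenness almost everywhere and orthogonality to horizontal gradients are closed linear
  conditions; in this form they pass to multiples, series and averages.\<close>

lemma hydro_sol_iff:
 "f : hydro_sol \<longleftrightarrow> f : Lp_torus 2 & (AE x in torus. f (fst x, - snd x) = f x) &
  (ALL \<psi>. smooth \<psi> & periodic \<psi> --> (LINT x|torus. f x \<bullet> gradH \<psi> x) = 0)"
 using weak_div_free_iff[of f] by (auto simp: hydro_sol_def L2_eq_Lp_torus)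

section \<open>Geometric series in the solenoidal space\<close>

lemma suminf_weighted_square_le:
 fixes c :: "nat => ennreal"
 assumes s: "!!k. 0 <= s k"
 shows "(\<Sum>k. ennreal (s k) * c k)\<^sup>2 <= (\<Sum>k. ennreal (s k)) * (\<Sum>k. ennreal (s k) * (c k)\<^sup>2)"
proof -
 have *: "ennreal (sqrt (s k)) * ennreal (sqrt (s k)) = ennreal (s k)" for k
  using s[of k] by (simp add: ennreal_mult[symmetric])
 have "(\<Sum>k. ennreal (sqrt (s k)) * (ennreal (sqrt (s k)) * c k))\<^sup>2 <= (\<Sum>k. (ennreal (sqrt (s k)))\<^sup>2) * (\<Sum>k. (ennreal (sqrt (s k)) * c k)\<^sup>2)"
  by (rule suminf_Cauchy_Schwarz)
 then show ?thesis unfolding power2_eq_square[of "ennreal _"] power_mult_distrib mult.assoc[symmetric] * by simp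
qed

text \<open>The weighted sum \<open>S\<close> of the pointwise norms is square integrable, which
  gives absolute convergence almost everywhere and the norm bound at once. The sum is formed
  pointwise, so it is a periodic Borel representative.\<close>

lemma L2_series:
 fixes u :: "nat => 'a::euclidean_space => 'b::euclidean_space"
 assumes u: "!!k. u k : Lp_torus 2" "!!k. pmass 2 (u k) <= 1" and a: "!!k. \<bar>a k\<bar> <= s k" "s sums \<sigma>"
 shows "(%x. \<Sum>k. a k *R u k x) : Lp_torus 2" "pmass 2 (%x. \<Sum>k. a k *R u k x) <= ennreal (\<sigma>\<^sup>2)"
  "AE x in torus. summable (%k. a k *R u k x)"
proof -
 note [measurable] = Lp_torusD(2)[OF u(1)]
 have s0: "0 <= s k" for k using a(1)[of k] by linarith
 have \<sigma>0: "0 <= \<sigma>" using sums_le[OF _ sums_zero a(2)] s0 by auto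
 have sig: "(\<Sum>k. ennreal (s k)) = ennreal \<sigma>" by (rule suminf_ennreal_eq[OF s0 a(2)])
 define S where "S x = (\<Sum>k. ennreal (s k) * ennreal (norm (u k x)))" for x
 have [measurable]: "S : Borel" unfolding S_def by measurable
 have "(\<oint>x. (S x)\<^sup>2) <= (\<oint>x. ennreal \<sigma> * (\<Sum>k. ennreal (s k) * (ennreal (norm (u k x)))\<^sup>2))"
  unfolding S_def sig[symmetric] by (intro nn_integral_mono suminf_weighted_square_le s0)
 also have "... = ennreal \<sigma> * (\<Sum>k. \<integral>\<^sup>+x. ennreal (s k) * (ennreal (norm (u k x)))\<^sup>2 \<partial>torus)"
  by (subst nn_integral_cmult, measurable) (subst nn_integral_suminf, auto)
 also have "(\<Sum>k. \<integral>\<^sup>+x. ennreal (s k) * (ennreal (norm (u k x)))\<^sup>2 \<partial>torus) <= (\<Sum>k. ennreal (s k))"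
 proof (intro suminf_le summableI)
  fix k
  have "(\<oint>x. ennreal (s k) * (ennreal (norm (u k x)))\<^sup>2) = ennreal (s k) * pmass 2 (u k)"
   unfolding pmass_def by (subst nn_integral_cmult) (auto simp: ennreal_power)
  also have "... <= ennreal (s k) * 1" by (intro mult_left_mono u) simp
  finally show "(\<oint>x. ennreal (s k) * (ennreal (norm (u k x)))\<^sup>2) <= ennreal (s k)" by simp
 qed
 finally have S2: "(\<oint>x. (S x)\<^sup>2) <= ennreal (\<sigma>\<^sup>2)"
  unfolding sig using \<sigma>0 by (simp add: ennreal_mult[symmetric] power2_eq_square mult_left_mono)
 have "AE x in torus. (S x)\<^sup>2 ~= \<infinity>"
  by (rule nn_integral_PInf_AE) (use S2 in \<open>auto simp: top_unique\<close>)
 then have ae: "AE x in torus. summable (%k. norm (a k *R u k x)) & ennreal (norm (\<Sum>k. a k *R u k x)) <= S x"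
 proof eventually_elim
  case (elim x)
  have le: "norm (a k *R u k x) <= s k * norm (u k x)" for k
   using mult_right_mono[OF a(1)[of k] norm_ge_zero[of "u k x"]] by simp
  have "S x ~= top" using elim by (auto simp: power2_eq_square)
  then have sm: "summable (%k. s k * norm (u k x))"
   using s0 by (intro summable_suminf_not_top) (auto simp: S_def ennreal_mult)
  have sn: "summable (%k. norm (a k *R u k x))"
   by (rule summable_comparison_test'[OF sm, where N=0]) (simp only: real_norm_def abs_norm_cancel le)
  have "norm (\<Sum>k. a k *R u k x) <= (\<Sum>k. norm (a k *R u k x))" by (rule summable_norm[OF sn])
  also have "... <= (\<Sum>k. s k * norm (u k x))" by (rule suminf_le[OF le sn sm])
  finally have "ennreal (norm (\<Sum>k. a k *R u k x)) <= ennreal (\<Sum>k. s k * norm (u k x))" by (rule ennreal_leI)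
  also have "... = S x" unfolding S_def using s0 sm by (simp add: suminf_ennreal2 ennreal_mult[symmetric])
  finally show ?case using sn by blast
 qed
 then show "AE x in torus. summable (%k. a k *R u k x)" by eventually_elim (auto intro: summable_norm_cancel)
 have "pmass 2 (%x. \<Sum>k. a k *R u k x) <= (\<oint>x. (S x)\<^sup>2)"
  unfolding pmass_def
 proof (rule nn_integral_mono_AE)
  show "AE x in torus. ennreal ((norm (\<Sum>k. a k *R u k x))\<^sup>2) <= (S x)\<^sup>2"
   using ae by eventually_elim (simp add: ennreal_power[symmetric] power_mono)
 qed
 with S2 show le: "pmass 2 (%x. \<Sum>k. a k *R u k x) <= ennreal (\<sigma>\<^sup>2)" by simp
 have "periodic (%x. \<Sum>k. a k *R u k x)" using Lp_torusD(1)[OF u(1)] by (simp add: periodic_def)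
 then show "(%x. \<Sum>k. a k *R u k x) : Lp_torus 2"
  unfolding Lp_torus_def using le_less_trans[OF le, of \<infinity>] by simp
qed

lemma L2_series_tail:
 fixes u :: "nat => 'a::euclidean_space => 'b::euclidean_space"
 assumes u: "!!k. u k : Lp_torus 2" "!!k. pmass 2 (u k) <= 1" and a: "!!k. \<bar>a k\<bar> <= (1/3) ^ k"
 shows "L2_norm (%x. (\<Sum>k. a k *R u k x) - (\<Sum>k<n. a k *R u k x)) <= 3/2 * (1/3) ^ n"
  "(%x. (\<Sum>k. a k *R u k x) - (\<Sum>k<n. a k *R u k x)) : Lp_torus 2"
proof -
 have "(%k. (1/3::real) ^ k) sums (1 / (1 - 1/3))" by (rule geometric_sums) simp
 then have s0: "(%k. (1/3::real) ^ k) sums (3/2)" by simp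
 from sums_mult[OF this, of "(1/3) ^ n"] have s: "(%k. (1/3::real) ^ (k + n)) sums (3/2 * (1/3) ^ n)"
  by (simp add: power_add mult.commute)
 let ?T = "%x. \<Sum>k. a (k + n) *R u (k + n) x" and ?D = "%x. (\<Sum>k. a k *R u k x) - (\<Sum>k<n. a k *R u k x)"
 note T = L2_series[of "%k. u (k + n)" "%k. a (k + n)", OF u a s]
 note A = L2_series[of u a, OF u a s0]
 have eq: "AE x in torus. ?D x = ?T x"
  using A(3)
 proof eventually_elim
  case (elim x)
  show ?case using suminf_minus_initial_segment[OF elim, of n] by simp
 qed
 show D: "?D : Lp_torus 2"
  by (intro Lp_torus_diff A Lp_torus_sum Lp_torus_scaleR u) simp
 have "ennreal ((L2_norm ?D)\<^sup>2) <= ennreal ((3/2 * (1/3) ^ n)\<^sup>2)"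
  using T(2) unfolding pmass_2_eq[OF D, symmetric] pmass_cong_AE[OF eq] .
 then have "(L2_norm ?D)\<^sup>2 <= (3/2 * (1/3) ^ n)\<^sup>2" by simp
 then show "L2_norm ?D <= 3/2 * (1/3) ^ n" by (rule power2_le_imp_le) simp
qed

text \<open>Evenness survives because countably many null sets form a null set, orthogonality
  because the tails tend to 0 in norm.\<close>

lemma hydro_sol_series:
 assumes u: "!!k. u k : hydro_sol" "!!k. pmass 2 (u k) <= 1" and a: "!!k. \<bar>a k\<bar> <= (1/3) ^ k"
 shows "(%x. \<Sum>k. a k *R u k x) : hydro_sol"
 unfolding hydro_sol_iff
proof (intro conjI allI impI)
 have uL: "u k : Lp_torus 2" for k using u(1)[of k] by (simp add: hydro_sol_iff)
 let ?g = "%x. \<Sum>k. a k *R u k x"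
 show g: "?g : Lp_torus 2"
  using L2_series(1)[OF uL u(2) a] geometric_sums[of "1/3 :: real"] by simp
 have "AE x in torus. ALL k. u k (fst x, - snd x) = u k x"
  unfolding AE_all_countable using u(1) by (simp add: hydro_sol_iff)
 then show "AE x in torus. (\<Sum>k. a k *R u k (fst x, - snd x)) = (\<Sum>k. a k *R u k x)"
  by eventually_elim simp
 fix \<psi> :: "R2 => real" assume \<psi>: "smooth \<psi> & periodic \<psi>"
 then have G: "gradH \<psi> : Lp_torus 2" by (intro gradH_props) auto
 have "\<bar>LINT x|torus. ?g x \<bullet> gradH \<psi> x\<bar> <= 3/2 * (1/3) ^ n * L2_norm (gradH \<psi>)" for n
 proof -
  let ?p = "%x. \<Sum>k<n. a k *R u k x"
  have p: "?p : Lp_torus 2" by (intro Lp_torus_sum Lp_torus_scaleR uL) simp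
  have "(LINT x|torus. ?p x \<bullet> gradH \<psi> x) = (\<Sum>k<n. a k * (LINT x|torus. u k x \<bullet> gradH \<psi> x))"
   unfolding inner_sum_left inner_scaleR_left
   by (subst LB_integral_sum) (auto intro: integrable_inner_L2 uL G)
  also have "... = 0" using u(1) \<psi> by (simp add: hydro_sol_iff)
  finally have "(LINT x|torus. ?g x \<bullet> gradH \<psi> x) = (LINT x|torus. (?g x - ?p x) \<bullet> gradH \<psi> x)"
   unfolding inner_diff_left
   by (subst LB_integral_diff) (auto intro: integrable_inner_L2 g p G)
  also have "\<bar>...\<bar> <= L2_norm (%x. ?g x - ?p x) * L2_norm (gradH \<psi>)"
   by (rule integral_inner_le[OF L2_series_tail(2)[OF uL u(2) a] G])
  also have "... <= 3/2 * (1/3) ^ n * L2_norm (gradH \<psi>)"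
   by (rule mult_right_mono[OF L2_series_tail(1)[OF uL u(2) a] L2_norm_nonneg])
  finally show ?thesis .
 qed
 moreover
 have "(%n. 3/2 * (1/3) ^ n * L2_norm (gradH \<psi>)) ----> 3/2 * 0 * L2_norm (gradH \<psi>)"
  by (intro tendsto_intros LIMSEQ_power_zero) simp
 then have "(%n. 3/2 * (1/3) ^ n * L2_norm (gradH \<psi>)) ----> 0" by simp
 ultimately have "\<bar>LINT x|torus. ?g x \<bullet> gradH \<psi> x\<bar> <= 0"
  by (intro LIMSEQ_le_const[of "%n. 3/2 * (1/3) ^ n * L2_norm (gradH \<psi>)" 0]) blast+
 then show "(LINT x|torus. ?g x \<bullet> gradH \<psi> x) = 0" by simp
qed

section \<open>A uniform boundedness principle\<close>

text \<open>The sign of each coefficient is chosen after the earlier ones, so that the diagonal term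
  does not cancel against the partial sum before it.\<close>

lemma alternating_choice:
 fixes m :: "nat => nat => real" and r :: "nat => real"
 assumes "!!n. 0 <= m n n" "!!n. 0 <= r n"
 obtains a where "!!n. \<bar>a n\<bar> = r n" "!!n. r n * m n n <= \<bar>\<Sum>k<Suc n. a k * m n k\<bar>"
proof -
 let ?P = "%f n x. \<bar>x\<bar> = r n & r n * m n n <= \<bar>(\<Sum>k<n. f k * m n k) + x * m n n\<bar>"
 have "EX f. ALL n. ?P f n (f n)"
 proof (rule dependent_wf_choice[of less_than])
  fix f g n x assume "!!z. (z, n) : less_than ==> f z = (g z :: real)"
  then have "(\<Sum>k<n. f k * m n k) = (\<Sum>k<n. g k * m n k)" by (intro sum.cong) auto
  then show "?P f n x = ?P g n x" by simp
 next
  fix n and f :: "nat => real"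
  let ?s = "\<Sum>k<n. f k * m n k"
  have "0 <= r n * m n n" using assms by simp
  then have "?P f n (if 0 <= ?s then r n else - r n)" using assms(2)[of n] by (auto simp: abs_if)
  then show "EX x. ?P f n x" by blast
 qed simp
 then show ?thesis using that by auto
qed

text \<open>Gliding hump; the series of humps stays in the solenoidal space, on which alone
 the functionals are bounded.\<close>

lemma hydro_sol_uniform_bound:
 fixes w :: "'t => R3 => R2"
 assumes w: "!!t. t : A ==> w t : hydro_sol"
  and bdd: "!!g. g : hydro_sol ==> EX C. ALL t:A. \<bar>L2_inner (w t) g\<bar> <= C"
 shows "EX C. ALL t:A. L2_norm (w t) <= C"
proof (rule ccontr)
 assume "\<not> ?thesis"
 \<comment> \<open>With coefficients 3 ^ -n and norms above 4 * 6 ^ n the diagonal terms exceed 4 *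
   2 ^ n, and the tail beyond n destroys at most half of them.\<close>
 then have "ALL n. EX t. t : A & 4 * 6 ^ n < L2_norm (w t)" by (meson not_le)
 then obtain t where t: "!!n. t n : A" "!!n. 4 * 6 ^ n < L2_norm (w (t n))" by metis
 define N where "N n = L2_norm (w (t n))" for n
 have N: "4 * 6 ^ n < N n" for n using t(2) by (simp add: N_def)
 have N0: "0 < N n" for n using N[of n] zero_less_power[of "6::real" n] by linarith
 have wL: "w (t n) : Lp_torus 2" for n using w[OF t(1)] by (simp add: hydro_sol_iff)
 define u where "u n x = (1 / N n) *R w (t n) x" for n x
 have uL: "u n : Lp_torus 2" for n unfolding u_def by (intro Lp_torus_scaleR wL)
 have u: "u n : hydro_sol" for n
  using w[OF t(1), of n] uL[of n] by (auto simp: hydro_sol_iff u_def)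
 have u1: "pmass 2 (u n) <= 1" for n
  unfolding u_def using N0[of n]
  by (subst pmass_scaleR[OF Lp_torusD(2)[OF wL]]) (simp add: pmass_2_eq[OF wL] N_def[symmetric] ennreal_mult[symmetric] power_divide)
 define m where "m n k = L2_inner (w (t n)) (u k)" for n k
 have mm: "m n n = N n" for n
 proof -
  have "m n n = (1 / N n) * (N n)\<^sup>2" by (simp add: m_def L2_inner_def u_def N_def L2_norm_sq)
  then show ?thesis using N0[of n] by (simp add: power2_eq_square)
 qed
 obtain a where a: "!!n. \<bar>a n\<bar> = (1/3) ^ n" "!!n. (1/3) ^ n * m n n <= \<bar>\<Sum>k<Suc n. a k * m n k\<bar>"
  using alternating_choice[of m "%n. (1/3) ^ n"] N0 mm by (metis less_imp_le zero_le_power zero_le_divide_1_iff zero_le_numeral)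
 have a': "\<bar>a n\<bar> <= (1/3) ^ n" for n by (simp add: a)
 let ?g = "%x. \<Sum>k. a k *R u k x"
 have g: "?g : hydro_sol" by (rule hydro_sol_series[OF u u1 a'])
 then have gL: "?g : Lp_torus 2" by (simp add: hydro_sol_iff)
 obtain C where C: "!!s. s : A ==> \<bar>L2_inner (w s) ?g\<bar> <= C" using bdd[OF g] by blast
 have big: "2 * 2 ^ n <= C" for n
 proof -
  let ?p = "%x. \<Sum>k<Suc n. a k *R u k x"
  have p: "?p : Lp_torus 2" by (intro Lp_torus_sum Lp_torus_scaleR uL) simp
  have P: "L2_inner (w (t n)) ?p = (\<Sum>k<Suc n. a k * m n k)"
   unfolding L2_inner_def m_def inner_sum_right inner_scaleR_right
   by (subst LB_integral_sum) (auto intro: integrable_inner_L2 uL wL)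
  have "\<bar>LINT x|torus. w (t n) x \<bullet> (?g x - ?p x)\<bar> <= N n * L2_norm (%x. ?g x - ?p x)"
   unfolding N_def by (rule integral_inner_le[OF wL L2_series_tail(2)[OF uL u1 a']])
  also have "... <= N n * (3/2 * (1/3) ^ Suc n)"
   by (rule mult_left_mono[OF L2_series_tail(1)[OF uL u1 a']]) (use N0[of n] in simp)
  also have "(LINT x|torus. w (t n) x \<bullet> (?g x - ?p x)) = L2_inner (w (t n)) ?g - L2_inner (w (t n)) ?p"
   unfolding L2_inner_def inner_diff_right
   by (rule LB_integral_diff) (intro integrable_inner_L2 wL gL p)+
  finally have "\<bar>L2_inner (w (t n)) ?g - (\<Sum>k<Suc n. a k * m n k)\<bar> <= (1/3) ^ n * N n / 2"
   unfolding P by (simp add: mult.commute)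
  then have "(1/3) ^ n * N n / 2 <= \<bar>L2_inner (w (t n)) ?g\<bar>"
   using a(2)[of n] unfolding mm by linarith
  moreover have "(1/3) ^ n * (4 * 6 ^ n) <= (1/3) ^ n * N n"
   using N[of n] by (intro mult_left_mono) auto
  moreover have "(1/3::real) ^ n * (4 * 6 ^ n) = 4 * 2 ^ n"
   by (simp flip: power_mult_distrib)
  ultimately show ?thesis using C[OF t(1)[of n]] by linarith
 qed
 obtain n where "C < real n" using reals_Archimedean2 by blast
 also have "real n < 2 ^ n" by simp
 also have "... <= 2 * 2 ^ n" by simp
 also have "... <= C" by (rule big)
 finally show False by simp
qed

text \<open>Weak continuity bounds each pairing on [0, T] by compactness, for test fields in
  \<open>hydro_sol\<close>; uniform boundedness then controls the norm at every time.\<close>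

lemma hydro_sol_curve_bound:
 fixes w :: "real => R3 => R2"
 assumes w: "!!t. 0 <= t ==> w t : hydro_sol"
  and cont: "!!g. g : hydro_sol ==> continuous_on {0..} (%t. L2_inner (w t) g)"
 shows "EX C>=0. ALL t:{0..T}. L2_norm (w t) <= C"
proof -
 have "EX C. ALL t:{0..T}. L2_norm (w t) <= C"
 proof (rule hydro_sol_uniform_bound)
  fix g assume "g : hydro_sol"
  then have "continuous_on {0..T} (%t. L2_inner (w t) g)"
   by (rule continuous_on_subset[OF cont]) auto
  then have "bounded ((%t. L2_inner (w t) g) ` {0..T})"
   by (intro compact_imp_bounded compact_continuous_image compact_Icc)
  then show "EX C. ALL t:{0..T}. \<bar>L2_inner (w t) g\<bar> <= C" by (auto simp: bounded_iff)
 qed (use w in auto)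
 then obtain C where "ALL t:{0..T}. L2_norm (w t) <= C" by blast
 then show ?thesis by (intro exI[of _ "max 0 C"]) auto
qed


section \<open>Averages of solenoidal fields\<close>

definition zflip :: "R3 => R3" where "zflip x = (fst x, - snd x)"

lemma zflip_borel [measurable]: "zflip : Borel"
 unfolding zflip_def[abs_def] by measurable

lemma distr_lborel_zflip: "distr lborel borel zflip = lborel"
proof -
 define c where "c j = (if j = (0, 1) then - 1 else 1 :: real)" for j :: R3
 have "(%x::R3. 0 + (\<Sum>j\<in>Basis. (c j * (x \<bullet> j)) *R j)) = zflip"
  unfolding sum_Basis_R3 by (auto simp: fun_eq_iff zflip_def c_def inner_prod_def vec_eq_iff sum_2 forall_2 inner_axis_R2) (auto simp: axis_def)
 moreover have "c j ~= 0" for j by (simp add: c_def)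
 moreover have "(\<Prod>j\<in>Basis. \<bar>c j\<bar>) = 1" by (rule prod.neutral) (simp add: c_def)
 ultimately show ?thesis
  using lborel_affine_euclidean[of c "0 :: R3"] by (simp add: density_1)
qed

definition zflip_invariant :: "R3 measure => bool" where
 "zflip_invariant \<mu> \<longleftrightarrow> (ALL F::R3 => R2. F : Borel --> (LINT y|\<mu>. F (zflip y)) = (LINT y|\<mu>. F y))"

lemma inner_zflip: "b : Basis ==> zflip y \<bullet> b = y \<bullet> b \<or> zflip y \<bullet> b = - (y \<bullet> b)"
 by (auto simp: zflip_def Basis_prod_def inner_prod_def)

lemma zflip_invariant_kernm: "zflip_invariant (kernm n)"
 unfolding zflip_invariant_def
proof (intro allI impI)
 fix F :: "R3 => R2" assume [measurable]: "F : Borel"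
 have "bump (zflip y) = bump y" for y
  unfolding bump_def
 proof (intro sum.cong refl)
  fix b :: R3 assume "b : Basis"
  from inner_zflip[OF this, of y] show "(1 + cos (zflip y \<bullet> b)) / (2 * real DIM(R3)) = (1 + cos (y \<bullet> b)) / (2 * real DIM(R3))"
   by auto
 qed
 then have k: "kern n (zflip y) = kern n y" for y by (simp add: kern_def)
 have c: "zflip y : cell \<longleftrightarrow> y : cell" for y
  by (cases y) (auto simp: zflip_def cell_Times mem_cell_real)
 have i: "indicator cell (zflip y) = (indicator cell y :: real)" for y by (simp add: indicator_def c)
 have "(LINT y|kernm n. G y) = (LINT y|lborel. (kern n y * indicator cell y) *R G y)"
  if [measurable]: "G : Borel" for G :: "R3 => R2"
  unfolding kernm_def by (subst integral_density) (auto simp: kern_nonneg)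
 then have "(LINT y|kernm n. F (zflip y)) = (LINT y|lborel. (kern n (zflip y) * indicator cell (zflip y)) *R F (zflip y))"
  and e: "(LINT y|kernm n. F y) = (LINT y|lborel. (kern n y * indicator cell y) *R F y)"
  by (simp_all add: k i)
 note this(1)
 also have "(LINT y|lborel. (kern n (zflip y) * indicator cell (zflip y)) *R F (zflip y)) =
  (LINT y|distr lborel borel zflip. (kern n y * indicator cell y) *R F y)"
  by (rule integral_distr[symmetric]) measurable
 finally show "(LINT y|kernm n. F (zflip y)) = (LINT y|kernm n. F y)"
  by (simp add: distr_lborel_zflip e)
qed

lemma zflip_invariant_smear: "zflip_invariant (segm (-1) 1 h (0, 1))"
 unfolding zflip_invariant_def
proof (intro allI impI)
 fix F :: "R3 => R2" assume [measurable]: "F : Borel"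
 let ?I = "%G :: R3 => R2. (LINT s:{-1..1}|lborel. G ((h * s) *R (0, 1))) /\<^sub>R 2"
 have *: "(LINT y|segm (-1) 1 h (0, 1). G y) = ?I G" if "G : Borel" for G :: "R3 => R2"
  using avg_segm[OF that, of "-1" 1 h "(0, 1)" 0] by (simp add: avg_def)
 have "?I (%y. F (zflip y)) = (LINT s:{s. - s : {-1..1}}|lborel. F (zflip ((h * - s) *R (0, 1)))) /\<^sub>R 2"
  by (subst set_integral_reflect) simp
 also have "{s. - s : {-1..1::real}} = {-1..1}" by auto
 also have "(LINT s:{-1..1}|lborel. F (zflip ((h * - s) *R (0, 1)))) /\<^sub>R 2 = ?I F" by (simp add: zflip_def)
 finally show "(LINT y|segm (-1) 1 h (0, 1). F (zflip y)) = (LINT y|segm (-1) 1 h (0, 1). F y)"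
  by (subst (1 2) *) auto
qed

context shift_measure
begin

lemma integral_avg_inner:
 fixes f G :: "'a => 'b::euclidean_space"
 assumes f: "f : Lp_torus 2" and G: "G : Lp_torus 2" "!!x. x : cell ==> norm (G x) <= C"
 shows "(LINT x|torus. avg \<mu> f x \<bullet> G x) = (LINT y|\<mu>. LINT x|torus. f (x + y) \<bullet> G x)"
proof -
 note [measurable] = Lp_torusD(2)[OF f] Lp_torusD(2)[OF G(1)]
 interpret P: pair_sigma_finite torus \<mu> by (rule pair_torus)
 have m: "(%z. f (fst z + snd z) \<bullet> G (fst z)) : borel_measurable (torus \<Otimes>\<^sub>M \<mu>)"
  by measurable
 have "integrable (torus \<Otimes>\<^sub>M \<mu>) (%(x, y). f (x + y) \<bullet> G x)"
 proof (rule integrableI_bounded)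
  have "(\<integral>\<^sup>+z. ennreal (norm (case z of (x, y) => f (x + y) \<bullet> G x)) \<partial>(torus \<Otimes>\<^sub>M \<mu>)) = (\<oint>x. (\<integral>\<^sup>+y. ennreal \<bar>f (x + y) \<bullet> G x\<bar> \<partial>\<mu>))"
   by (subst nn_integral_fst[symmetric]) (use m in \<open>auto simp: case_prod_beta'\<close>)
  also have "... <= (\<oint>x. (\<integral>\<^sup>+y. ennreal (norm (f (x + y))) * ennreal (max 0 C) \<partial>\<mu>))"
  proof (intro nn_integral_mono)
   fix x y assume "x : space (torus :: 'a measure)"
   then have "norm (G x) <= max 0 C" using G(2)[of x] by auto
   then have "\<bar>f (x + y) \<bullet> G x\<bar> <= norm (f (x + y)) * max 0 C"
    by (intro order_trans[OF Cauchy_Schwarz_ineq2] mult_left_mono) auto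
   then show "ennreal \<bar>f (x + y) \<bullet> G x\<bar> <= ennreal (norm (f (x + y))) * ennreal (max 0 C)"
    by (subst ennreal_mult[symmetric]) (auto intro: ennreal_leI)
  qed
  also have "... = (\<integral>\<^sup>+y. (\<oint>x. ennreal (norm (f (x + y))) * ennreal (max 0 C)) \<partial>\<mu>)"
   by (rule nn_integral_torus_swap) measurable
  also have "... = (\<integral>\<^sup>+y. (\<oint>x. ennreal (norm (f x))) * ennreal (max 0 C) \<partial>\<mu>)"
   by (intro nn_integral_cong, subst nn_integral_multc, measurable)
    (subst nn_integral_torus_translate[of "%x. ennreal (norm (f x))"], measurable, rule periodic_compose[OF Lp_torusD(1)[OF f]], rule refl)
  also have "... = (\<oint>x. ennreal (norm (f x))) * ennreal (max 0 C)"
   using emeasure_space_1 by simp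
  also have "... < \<infinity>"
   using L2_integrable[OF f] by (auto simp: integrable_iff_bounded ennreal_mult_less_top)
  finally show "(\<integral>\<^sup>+z. ennreal (norm (case z of (x, y) => f (x + y) \<bullet> G x)) \<partial>(torus \<Otimes>\<^sub>M \<mu>)) < \<infinity>" .
 qed (use m in \<open>simp add: case_prod_beta'\<close>)
 from P.Fubini_integral[OF this]
 have F: "(LINT y|\<mu>. LINT x|torus. f (x + y) \<bullet> G x) = (LINT x|torus. LINT y|\<mu>. f (x + y) \<bullet> G x)" .
 also have "... = (LINT x|torus. avg \<mu> f x \<bullet> G x)"
 proof (rule integral_cong_AE)
  show "AE x in torus. (LINT y|\<mu>. f (x + y) \<bullet> G x) = avg \<mu> f x \<bullet> G x"
   using AE_integrable_avg[of f, OF Lp_torusD(2,1,3)[OF f]] by eventually_elim (simp add: avg_def integral_inner_left)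
  have [measurable]: "avg \<mu> f : Borel" using avg_Lp_torus[OF f] Lp_torusD(2) by auto
  show "(%x. avg \<mu> f x \<bullet> G x) : borel_measurable torus" by measurable
  show "(%x. LINT y|\<mu>. f (x + y) \<bullet> G x) : borel_measurable torus" by measurable
 qed
 finally show ?thesis by simp
qed

end

text \<open>A shifted even field is in general not even, but the flip in z exchanges opposite
  vertical shifts, and an invariant law weighs them equally. The divergence constraint survives each
  single shift: its horizontal part moves onto the test function, its vertical part leaves the test
  function unchanged.\<close>

lemma avg_hydro_sol:
 assumes \<mu>: "shift_measure \<mu>" "zflip_invariant \<mu>" and f: "f : hydro_sol"
 shows "avg \<mu> f : hydro_sol"
 unfolding hydro_sol_iff
proof (intro conjI allI impI)
 interpret shift_measure \<mu> by (rule \<mu>(1))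
 have fL: "f : Lp_torus 2" and ev: "AE x in torus. f (zflip x) = f x"
  and dv: "!!\<psi>. smooth \<psi> ==> periodic \<psi> ==> (LINT x|torus. f x \<bullet> gradH \<psi> x) = 0"
  using f by (auto simp: hydro_sol_iff zflip_def)
 note fm [measurable] = Lp_torusD(2)[OF fL]
 show a: "avg \<mu> f : Lp_torus 2" by (rule avg_Lp_torus[OF fL]) simp
 note [measurable] = Lp_torusD(2)[OF a]
 let ?f = "%x. f (zflip x)"
 have "pmass 2 ?f = pmass 2 f" by (rule pmass_cong_AE[OF ev])
 moreover have "periodic ?f"
  using periodicD[OF Lp_torusD(1)[OF fL]]
  unfolding periodic_def
 proof (intro allI ballI)
  fix x b :: R3 assume p: "!!b x. b : Basis ==> f (x + (2 * pi) *R b) = f x" and b: "b : Basis"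
  consider "zflip b = b" | "b = (0, 1)" using b by (auto simp: Basis_prod_def zflip_def)
  then show "f (zflip (x + (2 * pi) *R b)) = f (zflip x)"
  proof cases
   case 1
   have "zflip (x + (2 * pi) *R b) = zflip x + (2 * pi) *R zflip b" by (simp add: zflip_def)
   then show ?thesis using p[OF b, of "zflip x"] 1 by simp
  next
   case 2
   have "zflip (x + (2 * pi) *R b) + (2 * pi) *R b = zflip x" by (simp add: zflip_def 2 prod_eq_iff)
   then show ?thesis using p[OF b, of "zflip (x + (2 * pi) *R b)"] by simp
  qed
 qed
 ultimately have f': "?f : Lp_torus 2" using Lp_torusD(3)[OF fL] by (simp add: Lp_torus_def)
 note [measurable] = Lp_torusD(2)[OF avg_Lp_torus[OF f'], simplified]
 have R: "avg \<mu> f (zflip x) = avg \<mu> ?f x" for x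
 proof -
  have "avg \<mu> f (zflip x) = (LINT y|\<mu>. f (zflip x + zflip y))"
   unfolding avg_def using \<mu>(2)[unfolded zflip_invariant_def, rule_format, of "%y. f (zflip x + y)"] by simp
  then show ?thesis by (simp add: avg_def zflip_def)
 qed
 \<comment> \<open>\<open>f\<close> and its reflection agree only almost everywhere, while the
   average looks at shifted points; contraction in L2 bridges the gap.\<close>
 have "pmass 2 (%x. avg \<mu> ?f x - avg \<mu> f x) <= pmass 2 (%x. ?f x - f x)" by (rule pmass_avg_diff2[OF f' fL])
 also have "... = pmass 2 (%x::R3. 0 :: R2)" by (rule pmass_cong_AE) (use ev in auto)
 finally have "pmass 2 (%x. avg \<mu> ?f x - avg \<mu> f x) = 0" by (simp add: pmass_zero)
 then have "AE x in torus. avg \<mu> ?f x - avg \<mu> f x = 0" by (intro pmass_zero_AE) auto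
 then show "AE x in torus. avg \<mu> f (fst x, - snd x) = avg \<mu> f x"
  by eventually_elim (simp add: R[unfolded zflip_def] zflip_def)
 fix \<psi> :: "R2 => real" assume "smooth \<psi> & periodic \<psi>"
 then have \<psi>: "smooth \<psi>" "periodic \<psi>" by auto
 obtain C where C: "!!x. x : cell ==> norm (gradH \<psi> x) <= C" using gradH_props(2)[OF \<psi>] by blast
 note G = gradH_props(1)[OF \<psi>]
 have "(LINT x|torus. f (x + y) \<bullet> gradH \<psi> x) = 0" for y
 proof -
  define \<psi>' where "\<psi>' x = \<psi> (x + (- fst y))" for x
  have \<psi>': "smooth \<psi>'" "periodic \<psi>'" unfolding \<psi>'_def by (intro smooth_translate periodic_translate \<psi>)+
  have *: "gradH \<psi>' (x + y) = gradH \<psi> x" for x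
   unfolding gradH_def \<psi>'_def pd_translate by simp
  have "(LINT x|torus. f (x + y) \<bullet> gradH \<psi>' (x + y)) = (LINT x|torus. f x \<bullet> gradH \<psi>' x)"
  proof (rule integral_torus_translate_real)
   note [measurable] = Lp_torusD(2)[OF gradH_props(1)[OF \<psi>']]
   show "(%x. f x \<bullet> gradH \<psi>' x) : Borel" by measurable
   show "periodic (%x. f x \<bullet> gradH \<psi>' x)"
    by (rule periodic_compose2[OF Lp_torusD(1)[OF fL] Lp_torusD(1)[OF gradH_props(1)[OF \<psi>']]])
   show "integrable torus (%x. f x \<bullet> gradH \<psi>' x)" by (intro integrable_inner_L2 fL gradH_props \<psi>')
  qed
  then show ?thesis using dv[OF \<psi>'] by (simp add: *)
 qed
 then show "(LINT x|torus. avg \<mu> f x \<bullet> gradH \<psi> x) = 0"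
  using integral_avg_inner[OF fL G C] by simp
qed

lemma moll_hydro_sol: "f : hydro_sol ==> moll n f : hydro_sol"
 unfolding moll_def by (rule avg_hydro_sol[OF shift_measure_kernm zflip_invariant_kernm])

lemma smear_hydro_sol: "f : hydro_sol ==> smear h f : hydro_sol"
 by (rule avg_hydro_sol[OF shift_smear zflip_invariant_smear])

section \<open>Viscous term and flux of a Sobolev field\<close>

lemma integral_mult_young:
 fixes a b :: "'a::euclidean_space => real"
 assumes "a : Lmeas 2" "b : Lmeas 2"
 shows "\<bar>LINT x|torus. a x * b x\<bar> <= rmass 2 a + rmass 2 b"
proof -
 have "\<bar>LINT x|torus. a x * b x\<bar> <= (LINT x|torus. (norm (a x))\<^sup>2 + (norm (b x))\<^sup>2)"
 proof (rule order_trans[OF integral_abs_bound integral_mono])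
  show "integrable torus (%x. \<bar>a x * b x\<bar>)" using integrable_abs[OF integrable_mult_Lmeas[OF assms]] .
  show "integrable torus (%x. (norm (a x))\<^sup>2 + (norm (b x))\<^sup>2)"
   by (intro LB_integrable_add integrable_rmass assms)
  fix x
  have "0 <= (\<bar>a x\<bar> - \<bar>b x\<bar>)\<^sup>2 + \<bar>a x * b x\<bar> * 1" by (simp add: add_nonneg_nonneg)
  then show "\<bar>a x * b x\<bar> <= (norm (a x))\<^sup>2 + (norm (b x))\<^sup>2"
   by (simp add: power2_diff abs_mult)
 qed
 also have "... = rmass 2 a + rmass 2 b"
  unfolding rmass_eq[OF assms(1)] rmass_eq[OF assms(2)] by (intro LB_integral_add integrable_rmass assms)
 finally show ?thesis .
qed

lemma integral_mult_tendsto: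
 fixes a b :: "'a::euclidean_space => real"
 assumes L: "a : Lmeas 2" "b : Lmeas 2" "!!n. a' n : Lmeas 2"
  and lim: "(%n. pmass 2 (%x. a' n x - a x)) ----> 0"
 shows "(%n. LINT x|torus. a' n x * b x) ----> (LINT x|torus. a x * b x)"
proof (rule tendsto_L1_int)
 note [measurable] = LmeasD(1)[OF L(1)] LmeasD(1)[OF L(2)] LmeasD(1)[OF L(3)]
 have "(%n. (\<oint>x. ennreal (norm (a' n x * b x - a x * b x)))\<^sup>2) ----> 0"
 proof (rule ennreal_tendsto_0_le)
  show "(%n. pmass 2 b * pmass 2 (%x. a' n x - a x)) ----> 0"
   by (rule ennreal_tendsto_0_cmult[OF lim LmeasD(2)[OF L(2)]])
  fix n
  have "(\<oint>x. ennreal (norm (a' n x * b x - a x * b x))) = (\<oint>x. ennreal (norm (a' n x - a x) * norm (b x)))"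
   by (simp add: abs_mult left_diff_distrib[symmetric])
  then show "(\<oint>x. ennreal (norm (a' n x * b x - a x * b x)))\<^sup>2 <= pmass 2 b * pmass 2 (%x. a' n x - a x)"
   using nn_integral_norm_mult_le[of "%x. a' n x - a x" b] by (simp add: mult.commute)
 qed
 then show "(%n. \<integral>\<^sup>+x. ennreal (norm (a' n x * b x - a x * b x)) \<partial>torus) ----> 0"
  by (rule ennreal_tendsto_0_power) simp
qed (intro integrable_mult_Lmeas L)+

lemma rmass_inner_le:
 fixes f :: "'a::euclidean_space => 'b::euclidean_space"
 assumes f: "f : Lp_torus 2" and d: "!!x. norm (d x) <= K"
 shows "rmass 2 (%x. f x \<bullet> d x) <= K\<^sup>2 * rmass 2 f"
proof -
 have K: "0 <= K" using d[of 0] norm_ge_zero order_trans by blast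
 note s = Lp_torus_scaleR[OF f, of K]
 have "rmass 2 (%x. f x \<bullet> d x) <= rmass 2 (%x. K *R f x)"
 proof (intro rmass_mono pmass_mono_AE AE_I2 Lp_torusD(3)[OF s])
  fix x
  have "\<bar>f x \<bullet> d x\<bar> <= norm (f x) * norm (d x)" by (rule Cauchy_Schwarz_ineq2)
  also have "... <= norm (f x) * K" by (intro mult_left_mono d) simp
  finally show "norm (f x \<bullet> d x) <= norm (K *R f x)" using K by (simp add: mult.commute)
 qed
 also have "... = K\<^sup>2 * rmass 2 f"
  unfolding rmass_def pmass_scaleR[OF Lp_torusD(2)[OF f]] by (simp add: enn2real_mult)
 finally show ?thesis .
qed

lemma rmass_2_nonneg_H1: "f : H1 ==> rmass 2 f + (grad_L2_norm f)\<^sup>2 = (H1_norm f)\<^sup>2"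
 by (simp add: H1_norm_def rmass_2_eq[OF H1_L2])

definition visc :: "(R3 => R2) => (R3 => R2) => real" where
 "visc f g = (\<Sum>b\<in>Basis. LINT x|torus. weak_pd b f x \<bullet> pd b g x)"

lemma weak_pd_inner_tpv:
 fixes f :: "'a::euclidean_space => 'b::euclidean_space"
 assumes f: "f : Lp_torus 2" "D : Lp_torus 2" "is_weak_pd b f D" and g: "tpv g"
 shows "(LINT x|torus. D x \<bullet> g x) = - (LINT x|torus. f x \<bullet> pd b g x)"
proof -
 have gen: "(LINT x|torus. F x \<bullet> d x) = (\<Sum>c\<in>Basis. (LINT x|torus. (d x \<bullet> c) *R F x) \<bullet> c)"
  if F: "F : Lp_torus 2" and d: "tpv d" for F d :: "'a => 'b"
 proof -
  have i: "integrable torus (%x. (d x \<bullet> c) *R F x)" if "c : Basis" for c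
   by (rule integrable_torus_mult_tp[OF L2_integrable[OF F] tpvD[OF d that]])
  have "(LINT x|torus. F x \<bullet> d x) = (LINT x|torus. (\<Sum>c\<in>Basis. ((d x \<bullet> c) *R F x) \<bullet> c))"
   by (subst euclidean_inner) (simp add: mult.commute)
  also have "... = (\<Sum>c\<in>Basis. LINT x|torus. ((d x \<bullet> c) *R F x) \<bullet> c)"
   by (intro LB_integral_sum integrable_inner_left i)
  also have "... = (\<Sum>c\<in>Basis. (LINT x|torus. (d x \<bullet> c) *R F x) \<bullet> c)"
   by (intro sum.cong refl integral_inner_left i)
  finally show ?thesis .
 qed
 have "(LINT x|torus. (g x \<bullet> c) *R D x) = - (LINT x|torus. (pd b g x \<bullet> c) *R f x)" if "c : Basis" for c
  using is_weak_pd_tp[OF f(3) tpvD[OF g that]] by (simp add: pd_inner[OF tpv_differentiable[OF g]])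
 then show ?thesis by (simp add: gen[OF f(2) g] gen[OF f(1) tpv_pd[OF g]] sum_negf)
qed

text \<open>With both derivatives on the trigonometric field no weak derivative is left. This
  matters for measurability in time, since \<open>weak_pd\<close> is an arbitrary choice of
  representative at each time.\<close>

lemma visc_eq:
 assumes f: "f : H1" and g: "tpv g"
 shows "visc f g = - (\<Sum>b\<in>Basis. LINT x|torus. f x \<bullet> pd b (pd b g) x)"
 unfolding visc_def sum_negf[symmetric]
 by (intro sum.cong refl weak_pd_inner_tpv H1_L2 weak_pd_H1 f tpv_pd g)

lemma visc_cong_integral:
 assumes f: "f : H1" and g: "tpv g"
 shows "(LINT x|torus. (\<Sum>b\<in>Basis. weak_pd b f x \<bullet> pd b g x)) = visc f g"
 unfolding visc_def
 by (intro LB_integral_sum integrable_inner_L2 weak_pd_H1 f tpv_Lp_torus tpv_pd g)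

lemma visc_bound:
 assumes g: "tpv g"
 shows "EX C>=0. ALL f:H1. \<bar>visc f g\<bar> <= C * (1 + (H1_norm f)\<^sup>2)"
proof (intro exI conjI ballI)
 define S where "S = (\<Sum>b\<in>(Basis :: R3 set). \<Sum>c\<in>(Basis :: R2 set). rmass 2 (%x. pd b g x \<bullet> c))"
 have S0: "0 <= S" unfolding S_def by (intro sum_nonneg rmass_nonneg)
 show "0 <= S + 6" using S0 by simp
 fix f :: "R3 => R2" assume f: "f : H1"
 have D: "weak_pd b f : Lp_torus 2" if "b : Basis" for b by (rule weak_pd_H1[OF f that])
 have 1: "\<bar>LINT x|torus. weak_pd b f x \<bullet> pd b g x\<bar> <= 2 * (grad_L2_norm f)\<^sup>2 + (\<Sum>c\<in>(Basis :: R2 set). rmass 2 (%x. pd b g x \<bullet> c))"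
  if b: "b : Basis" for b
 proof -
  have L: "(%x. weak_pd b f x \<bullet> c) : Lp_torus 2" "(%x. pd b g x \<bullet> c) : Lp_torus 2" if "c : (Basis :: R2 set)" for c
   by (intro Lp_torus_inner D b tpv_Lp_torus[OF tpv_pd[OF g]]; use that in simp)+
  have "(LINT x|torus. weak_pd b f x \<bullet> pd b g x) = (\<Sum>c\<in>Basis. LINT x|torus. (weak_pd b f x \<bullet> c) * (pd b g x \<bullet> c))"
   by (subst euclidean_inner, intro LB_integral_sum integrable_mult_Lmeas Lp_torus_Lmeas L)
  also have "\<bar>...\<bar> <= (\<Sum>c\<in>(Basis :: R2 set). (grad_L2_norm f)\<^sup>2 + rmass 2 (%x. pd b g x \<bullet> c))"
  proof (rule order_trans[OF sum_abs sum_mono])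
   fix c :: R2 assume c: "c : Basis"
   have "rmass 2 (%x. weak_pd b f x \<bullet> c) <= 1\<^sup>2 * rmass 2 (weak_pd b f)"
    by (rule rmass_inner_le[OF D[OF b]]) (use c in simp)
   also have "... <= (grad_L2_norm f)\<^sup>2" using rmass_weak_pd_le[OF f b] by simp
   finally show "\<bar>LINT x|torus. (weak_pd b f x \<bullet> c) * (pd b g x \<bullet> c)\<bar> <= (grad_L2_norm f)\<^sup>2 + rmass 2 (%x. pd b g x \<bullet> c)"
    using integral_mult_young[OF Lp_torus_Lmeas[OF L(1)[OF c]] Lp_torus_Lmeas[OF L(2)[OF c]]] by linarith
  qed
  finally show ?thesis by (simp add: sum.distrib)
 qed
 have "\<bar>visc f g\<bar> <= (\<Sum>b\<in>(Basis :: R3 set). 2 * (grad_L2_norm f)\<^sup>2 + (\<Sum>c\<in>(Basis :: R2 set). rmass 2 (%x. pd b g x \<bullet> c)))"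
  unfolding visc_def by (rule order_trans[OF sum_abs sum_mono]) (rule 1)
 also have "... = 6 * (grad_L2_norm f)\<^sup>2 + S" by (simp add: sum.distrib S_def)
 also have "... <= 6 * (H1_norm f)\<^sup>2 + S"
  using rmass_nonneg[of 2 f] rmass_2_nonneg_H1[OF f] by simp
 also have "... <= (S + 6) * (1 + (H1_norm f)\<^sup>2)"
  using mult_nonneg_nonneg[OF S0, of "(H1_norm f)\<^sup>2"] by (simp add: algebra_simps)
 finally show "\<bar>visc f g\<bar> <= (S + 6) * (1 + (H1_norm f)\<^sup>2)" .
qed

lemma pd_lincomb:
 "(!!j. j : J ==> tpv (g j)) ==> pd b (%x. \<Sum>j\<in>J. a j *R g j x) x = (\<Sum>j\<in>J. a j *R pd b (g j) x)"
 by (subst pd_sum)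
  (auto intro: differentiable_scaleR[OF differentiable_const tpv_differentiable] sum.cong pd_scaleR_right tpv_differentiable)

lemma visc_lincomb:
 assumes f: "f : H1" and g: "!!j. j : J ==> tpv (g j)"
 shows "visc f (%x. \<Sum>j\<in>J. a j *R g j x) = (\<Sum>j\<in>J. a j * visc f (g j))"
proof -
 have pdl: "pd b (%x. \<Sum>j\<in>J. a j *R g j x) x = (\<Sum>j\<in>J. a j *R pd b (g j) x)" for b x
  by (rule pd_lincomb[OF g])
 have "(LINT x|torus. weak_pd b f x \<bullet> pd b (%x. \<Sum>j\<in>J. a j *R g j x) x) = (\<Sum>j\<in>J. a j * (LINT x|torus. weak_pd b f x \<bullet> pd b (g j) x))"
  if "b : Basis" for b
  unfolding pdl inner_sum_right inner_scaleR_right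
  by (subst LB_integral_sum)
   (intro integrable_mult_right integrable_inner_L2 weak_pd_H1 f that tpv_Lp_torus tpv_pd g, simp_all)
 then show ?thesis unfolding visc_def by (simp add: sum_distrib_left sum.swap[of _ J])
qed

lemma flux_lincomb:
 assumes f: "f : H1" and g: "!!j. j : J ==> tpv (g j)"
 shows "flux f (%x. \<Sum>j\<in>J. a j *R g j x) = (\<Sum>j\<in>J. a j * flux f (g j))"
proof -
 have i: "integrable torus (%x. \<Sum>b\<in>Basis. (velocity f x \<bullet> b) * (f x \<bullet> pd b (g j) x))" if "j : J" for j
  unfolding flux_integrand
  by (intro LB_integrable_add LB_integrable_sum flux_terms_integrable f tpv_pd g that)
 have pdl: "pd b (%x. \<Sum>j\<in>J. a j *R g j x) x = (\<Sum>j\<in>J. a j *R pd b (g j) x)" for b x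
  by (rule pd_lincomb[OF g])
 have "flux f (%x. \<Sum>j\<in>J. a j *R g j x) = (LINT x|torus. (\<Sum>j\<in>J. a j * (\<Sum>b\<in>Basis. (velocity f x \<bullet> b) * (f x \<bullet> pd b (g j) x))))"
  unfolding flux_def pdl inner_sum_right inner_scaleR_right sum_distrib_left
  by (subst sum.swap) (simp add: mult.left_commute)
 also have "... = (\<Sum>j\<in>J. LINT x|torus. a j * (\<Sum>b\<in>Basis. (velocity f x \<bullet> b) * (f x \<bullet> pd b (g j) x)))"
  by (intro LB_integral_sum integrable_mult_right i)
 finally show ?thesis by (simp add: flux_def)
qed

text \<open>A fixed trigonometric field has bounded gradient, so products of two square integrable
  factors remain and the bound is quadratic in the H1 norm, whose square is integrable in time for
  every weak solution.\<close>

lemma flux_H1_bound: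
 assumes g: "tpv g"
 shows "EX C>=0. ALL f:H1. \<bar>flux f g\<bar> <= C * (1 + (H1_norm f)\<^sup>2)"
proof -
 have "EX K. ALL x. norm (pd b g x) <= K" for b using tpv_bounded[OF tpv_pd[OF g, of b]] by blast
 then obtain K where K: "!!b x. norm (pd b g x) <= K b" by metis
 define M where "M = (\<Sum>k\<in>UNIV. (K (axis k 1, 0))\<^sup>2) + (K (0, 1))\<^sup>2"
 have M0: "0 <= M" unfolding M_def by (intro add_nonneg_nonneg sum_nonneg) auto
 show ?thesis
 proof (intro exI conjI ballI)
  show "0 <= M + 514" using M0 by simp
  fix f :: "R3 => R2" assume f: "f : H1"
  note fL = H1_L2[OF f]
  have d: "(%x. f x \<bullet> pd b g x) : Lp_torus 2" for b by (rule Lp_torus_inner_tpv[OF fL _ tpv_pd[OF g]]) simp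
  have h: "\<bar>hor k f (pd (axis k 1, 0) g)\<bar> <= rmass 2 f + (K (axis k 1, 0))\<^sup>2 * rmass 2 f" for k
  proof -
   have "\<bar>hor k f (pd (axis k 1, 0) g)\<bar> <= rmass 2 (%x. f x $ k) + rmass 2 (%x. f x \<bullet> pd (axis k 1, 0) g x)"
    unfolding hor_def by (intro integral_mult_young Lp_torus_Lmeas Lp_torus_nth fL d)
   also have "... <= rmass 2 f + (K (axis k 1, 0))\<^sup>2 * rmass 2 f"
    by (intro add_mono rmass_nth_le rmass_inner_le fL K)
   finally show ?thesis .
  qed
  have w: "\<bar>LINT x|torus. vert (div_H f) x * (f x \<bullet> pd (0, 1) g x)\<bar> <= 512 * (grad_L2_norm f)\<^sup>2 + (K (0, 1))\<^sup>2 * rmass 2 f"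
  proof -
   have "\<bar>LINT x|torus. vert (div_H f) x * (f x \<bullet> pd (0, 1) g x)\<bar> <= rmass 2 (vert (div_H f)) + rmass 2 (%x. f x \<bullet> pd (0, 1) g x)"
    by (intro integral_mult_young vert_Lmeas div_H_Lp_torus Lp_torus_Lmeas f d)
   also have "... <= 512 * (grad_L2_norm f)\<^sup>2 + (K (0, 1))\<^sup>2 * rmass 2 f"
    by (intro add_mono rmass_vert_le rmass_inner_le fL K f)
   finally show ?thesis .
  qed
  have "\<bar>flux f g\<bar> <= (2 + M) * rmass 2 f + 512 * (grad_L2_norm f)\<^sup>2"
   using h[of 1] h[of 2] w unfolding flux_eq[OF f g] M_def sum_2 distrib_right by linarith
  also have "... <= (M + 514) * (rmass 2 f + (grad_L2_norm f)\<^sup>2)"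
   using M0 rmass_nonneg[of 2 f] mult_nonneg_nonneg[OF M0, of "(grad_L2_norm f)\<^sup>2"] by (simp add: algebra_simps)
  also have "... <= (M + 514) * (1 + (H1_norm f)\<^sup>2)"
   unfolding rmass_2_nonneg_H1[OF f] using M0 by (intro mult_left_mono) auto
  finally show "\<bar>flux f g\<bar> <= (M + 514) * (1 + (H1_norm f)\<^sup>2)" .
 qed
qed

lemma vert_sum:
 assumes "!!i. i : I ==> tp (P i)"
 shows "vert (%x. \<Sum>i\<in>I. P i x * c i) x = (\<Sum>i\<in>I. vert (P i) x * c i)"
proof -
 have i: "integrable lborel (%\<zeta>. indicator {snd x..pi} \<zeta> *R (P i (fst x, \<zeta>) * c i))" if "i : I" for i
  using borel_integrable_atLeastAtMost'[of "snd x" pi "%\<zeta>. P i (fst x, \<zeta>) * c i"]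
   tp_continuous[OF tp_slice_snd[OF assms[OF that], of "fst x"], of "{snd x..pi}"]
  by (simp add: set_integrable_def continuous_on_mult_right)
 have "vert (%x. \<Sum>i\<in>I. P i x * c i) x = (\<Sum>i\<in>I. LINT \<zeta>|lborel. indicator {snd x..pi} \<zeta> *R (P i (fst x, \<zeta>) * c i))"
  unfolding vert_def set_lebesgue_integral_def scaleR_sum_right
  by (rule LB_integral_sum[OF i])
 also have "... = (\<Sum>i\<in>I. vert (P i) x * c i)"
  unfolding vert_def set_lebesgue_integral_def by (simp flip: mult.assoc)
 finally show ?thesis .
qed

section \<open>Measurability in time\<close>

lemma time_measurable:
 fixes H :: "real => R3 => 'b::euclidean_space"
 assumes "(%z. H (fst z) (snd z)) : Borel"
 shows "(%ta. LINT x|torus. H ta x) : Borel"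
proof -
 interpret sigma_finite_measure "torus :: R3 measure" by (rule sigma_finite_torus)
 have "(%z. (fst z, snd z)) : measurable (borel \<Otimes>\<^sub>M (torus :: R3 measure)) (borel \<Otimes>\<^sub>M borel)"
  by (intro measurable_Pair) measurable
 then have "(%z. H (fst (fst z, snd z)) (snd (fst z, snd z))) : borel_measurable (borel \<Otimes>\<^sub>M (torus :: R3 measure))"
  by (rule measurable_compose) (use assms in \<open>simp add: borel_prod\<close>)
 then have [measurable]: "(%(t, x). H t x) : borel_measurable (borel \<Otimes>\<^sub>M (torus :: R3 measure))"
  by (simp add: case_prod_beta')
 show ?thesis by measurable
qed

lemma visc_measurable:
 fixes V :: "real => R3 => R2"
 assumes [measurable]: "(%z. V (fst z) (snd z)) : Borel" and g: "tpv g"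
 shows "EX A:borel_measurable borel. ALL ta. V ta : H1 --> visc (V ta) g = A ta"
proof (intro bexI allI impI)
 show "visc (V ta) g = - (\<Sum>b\<in>Basis. LINT x|torus. V ta x \<bullet> pd b (pd b g) x)" if "V ta : H1" for ta
  by (rule visc_eq[OF that g])
 note [measurable] = tpv_borel[OF tpv_pd[OF tpv_pd[OF g]]]
 show "(%ta. - (\<Sum>b\<in>Basis. LINT x|torus. V ta x \<bullet> pd b (pd b g) x)) : Borel"
  by (intro borel_measurable_uminus borel_measurable_sum time_measurable) measurable
qed

text \<open>The vertical velocity involves chosen weak derivatives, so it is approached through
  mollified divergences. These are finite sums of fixed profiles whose coefficients are integrals of
  \<open>V ta\<close> itself, hence Borel in time, and so is the limit.\<close>

lemma flux_measurable:
 fixes V :: "real => R3 => R2"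
 assumes m [measurable]: "(%z. V (fst z) (snd z)) : Borel" and g: "tpv g"
 shows "EX A:borel_measurable borel. ALL ta. V ta : H1 --> flux (V ta) g = A ta"
proof -
 note [measurable] = tpv_borel[OF tpv_pd[OF g]]
 have "EX p :: nat \<times> (nat => R3 => real). (ALL i<fst p. tp (snd p i :: R3 => real)) & (ALL x y. kern n (y - x) = (\<Sum>i<fst p. snd p i x * snd p i y))" for n
 proof -
  obtain m and F :: "nat => R3 => real" where "!!i. i < m ==> tp (F i)" "!!x y. kern n (y - x :: R3) = (\<Sum>i<m. F i x * F i y)"
   using kern_expand by blast
  then have "(ALL i<fst (m, F). tp (snd (m, F) i)) & (ALL x y. kern n (y - x :: R3) = (\<Sum>i<fst (m, F). snd (m, F) i x * snd (m, F) i y))"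
   unfolding fst_conv snd_conv by blast
  then show ?thesis by (rule exI)
 qed
 then have "ALL n. EX p :: nat \<times> (nat => R3 => real). (ALL i<fst p. tp (snd p i :: R3 => real)) & (ALL x y. kern n (y - x) = (\<Sum>i<fst p. snd p i x * snd p i y))" by blast
 from choice[OF this] obtain p :: "nat => nat \<times> (nat => R3 => real)" where p: "ALL n. (ALL i<fst (p n). tp (snd (p n) i :: R3 => real)) & (ALL x y. kern n (y - x) = (\<Sum>i<fst (p n). snd (p n) i x * snd (p n) i y))" ..
 define N where "N n = fst (p n)" for n
 define F where "F n = snd (p n)" for n
 have F: "!!n i. i < N n ==> tp (F n i)" "!!n x y. kern n (y - x) = (\<Sum>i<N n. F n i x * F n i y)"
  using p unfolding N_def F_def by blast+
 let ?d = "pd (0, 1) g"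
 let ?P = "%n k i. pd (axis k 1, 0) (F n i)"
 define W where "W n ta = (\<Sum>i<N n. \<Sum>k\<in>UNIV. (LINT y|torus. F n i y *R V ta y) $ k * (LINT x|torus. vert (?P n k i) x * (V ta x \<bullet> ?d x)))" for n ta
 have [measurable]: "W n : Borel" for n
 proof -
  have [measurable]: "F n i : Borel" "vert (?P n k i) : Borel" if "i < N n" for i k
   by (intro tp_borel vert_borel tp_pd F(1) that)+
  show ?thesis unfolding W_def
   by (intro borel_measurable_sum borel_measurable_times measurable_compose[OF time_measurable borel_measurable_nth_R2] time_measurable; measurable)
 qed
 define A where "A ta = (\<Sum>k\<in>UNIV. LINT x|torus. V ta x $ k * (V ta x \<bullet> pd (axis k 1, 0) g x)) + lim (%n. W n ta)" for ta
 have "A : Borel"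
  unfolding A_def
  by (intro borel_measurable_add borel_measurable_sum time_measurable borel_measurable_lim_metric; measurable)
 moreover have "flux (V ta) g = A ta" if f: "V ta : H1" for ta
 proof -
  let ?f = "V ta"
  note fL = H1_L2[OF f]
  have D: "div_H ?f : Lp_torus 2" by (rule div_H_Lp_torus[OF f])
  have d: "(%x. ?f x \<bullet> ?d x) : Lmeas 2" by (intro Lp_torus_Lmeas Lp_torus_inner_tpv fL tpv_pd g) simp
  have M: "moll n (div_H ?f) x = (\<Sum>j\<in>{..<N n} \<times> UNIV. ?P n (snd j) (fst j) x * ((LINT y|torus. F n (fst j) y *R ?f y) $ snd j))" for n x
  proof -
   have wk: "weak_pd (axis k 1, 0) ?f : Lp_torus 2" for k using weak_pd_H1[OF f] by auto
   have "moll n (div_H ?f) x = (\<Sum>k\<in>UNIV. moll n (weak_pd (axis k 1, 0) ?f) x $ k)"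
   proof -
    have i: "integrable torus (%y. kern n (y - x) *R weak_pd (axis k 1, 0) ?f y)" for k
     using integrable_torus_mult_tp[OF L2_integrable[OF wk] tp_translate[OF tp_kern, of n "- x"]] by simp
    have "moll n (div_H ?f) x = (LINT y|torus. (\<Sum>k\<in>UNIV. (kern n (y - x) *R weak_pd (axis k 1, 0) ?f y) \<bullet> axis k 1))"
     by (subst moll_eq[OF Lp_torusD(2,1)[OF D] L2_integrable[OF D]]) (simp add: div_H_def sum_distrib_left inner_axis_R2)
    also have "... = (\<Sum>k\<in>UNIV. (LINT y|torus. kern n (y - x) *R weak_pd (axis k 1, 0) ?f y) \<bullet> axis k 1)"
     by (subst LB_integral_sum, intro integrable_inner_left i) (intro sum.cong refl integral_inner_left i)
    also have "... = (\<Sum>k\<in>UNIV. moll n (weak_pd (axis k 1, 0) ?f) x $ k)"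
     by (simp add: moll_eq[OF Lp_torusD(2,1)[OF wk] L2_integrable[OF wk]] inner_axis_R2)
    finally show ?thesis .
   qed
   also have "... = (\<Sum>k\<in>UNIV. \<Sum>i<N n. ?P n k i x * ((LINT y|torus. F n i y *R ?f y) $ k))"
   proof (intro sum.cong refl)
    fix k :: 2
    have "moll n (weak_pd (axis k 1, 0) ?f) x = pd (axis k 1, 0) (moll n ?f) x"
     by (rule moll_weak_pd[OF fL wk weak_pd_H1(2)[OF f]]) simp
    also have "... = (\<Sum>i<N n. ?P n k i x *R (LINT y|torus. F n i y *R ?f y))"
     by (rule pd_moll[OF F(1) F(2) fL])
    finally show "moll n (weak_pd (axis k 1, 0) ?f) x $ k = (\<Sum>i<N n. ?P n k i x * ((LINT y|torus. F n i y *R ?f y) $ k))"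
     by simp
   qed
   also have "... = (\<Sum>j\<in>{..<N n} \<times> UNIV. ?P n (snd j) (fst j) x * ((LINT y|torus. F n (fst j) y *R ?f y) $ snd j))"
    by (subst sum.swap) (simp add: sum.cartesian_product case_prod_beta')
   finally show ?thesis .
  qed
  have tpP: "tp (?P n (snd j) (fst j))" if "j : {..<N n} \<times> UNIV" for n j using that by (intro tp_pd F(1)) auto
  have "(LINT x|torus. vert (moll n (div_H ?f)) x * (?f x \<bullet> ?d x)) = W n ta" for n
  proof -
   have vl: "vert (?P n (snd j) (fst j)) : Lmeas 2" if "j : {..<N n} \<times> UNIV" for j
    by (intro vert_Lmeas tp_Lp_torus tpP that)
   have "vert (moll n (div_H ?f)) x = (\<Sum>j\<in>{..<N n} \<times> UNIV. vert (?P n (snd j) (fst j)) x * ((LINT y|torus. F n (fst j) y *R ?f y) $ snd j))" for x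
    unfolding M[abs_def] by (rule vert_sum) (rule tpP)
   then have "(LINT x|torus. vert (moll n (div_H ?f)) x * (?f x \<bullet> ?d x)) =
    (LINT x|torus. (\<Sum>j\<in>{..<N n} \<times> UNIV. ((LINT y|torus. F n (fst j) y *R ?f y) $ snd j) * (vert (?P n (snd j) (fst j)) x * (?f x \<bullet> ?d x))))"
    by (simp add: sum_distrib_left sum_distrib_right mult_ac)
   also have "... = (\<Sum>j\<in>{..<N n} \<times> UNIV. ((LINT y|torus. F n (fst j) y *R ?f y) $ snd j) * (LINT x|torus. vert (?P n (snd j) (fst j)) x * (?f x \<bullet> ?d x)))"
    by (subst LB_integral_sum) (auto intro!: integrable_mult_right integrable_mult_Lmeas vl d simp del: mem_Times_iff)
   also have "... = W n ta" unfolding W_def by (simp add: sum.cartesian_product case_prod_beta')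
   finally show ?thesis .
  qed
  moreover have "(%n. LINT x|torus. vert (moll n (div_H ?f)) x * (?f x \<bullet> ?d x)) ----> (LINT x|torus. vert (div_H ?f) x * (?f x \<bullet> ?d x))"
  proof (rule integral_mult_tendsto[OF vert_Lmeas[OF D] d])
   have mD: "moll n (div_H ?f) : Lp_torus 2" for n by (rule moll_Lp_torus[OF D]) simp
   show "vert (moll n (div_H ?f)) : Lmeas 2" for n by (rule vert_Lmeas[OF mD])
   show "(%n. pmass 2 (%x. vert (moll n (div_H ?f)) x - vert (div_H ?f) x)) ----> 0"
    by (rule ennreal_tendsto_0_le[OF ennreal_tendsto_0_cmult[OF ennreal_tendsto_0_cmult[OF pmass_moll_tendsto[OF D]]] pmass_vert_diff[OF mD D]]) auto
  qed
  ultimately have "lim (%n. W n ta) = (LINT x|torus. vert (div_H ?f) x * (?f x \<bullet> ?d x))"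
   by (intro limI) simp
  then show ?thesis unfolding A_def flux_eq[OF f g] by (simp add: hor_def)
 qed
 ultimately show ?thesis by blast
qed

section \<open>The weak formulation with separated variables\<close>

text \<open>Completeness of the measure: functionals of the solution are identified with Borel
  functions of time only outside a null set.\<close>

lemma borel_measurable_lebesgue_AE:
 fixes f g :: "real => real"
 assumes g: "g : borel_measurable lebesgue" and eq: "AE x in lebesgue. f x = g x"
 shows "f : borel_measurable lebesgue"
proof (rule measurableI)
 fix S :: "real set" assume S: "S : sets borel"
 obtain N where N: "{x. f x ~= g x} \<subseteq> N" "N : null_sets lebesgue"
  using eq by (auto elim!: AE_E simp: null_setsI)
 have "f -` S \<inter> N : null_sets lebesgue" by (rule null_sets_completion_subset[OF _ N(2)]) auto
 then have "((g -` S \<inter> space lebesgue) - N) \<union> (f -` S \<inter> N) : sets lebesgue"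
  using N(2) measurable_sets[OF g S] by (intro sets.Un sets.Diff) auto
 also have "((g -` S \<inter> space lebesgue) - N) \<union> (f -` S \<inter> N) = f -` S \<inter> space lebesgue" using N(1) by force
 finally show "f -` S \<inter> space lebesgue : sets lebesgue" .
qed simp

lemma integral_lebesgue_cong_AE:
 fixes f g :: "real => real"
 assumes g: "g : borel_measurable lebesgue" and eq: "AE x in lebesgue. f x = g x"
 shows "integral\<^sup>L lebesgue f = integral\<^sup>L lebesgue g"
 by (rule integral_cong_AE[OF borel_measurable_lebesgue_AE[OF g eq] g eq])

section \<open>Test functions with separated variables and cut-offs in time\<close>

lemma sup_continuous_curve_scaleR:
 assumes a: "continuous_on UNIV a" and G: "continuous_on UNIV G" "!!x. norm (G x) <= K"
 shows "sup_continuous_curve (%t x. a t *R G x)"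
 unfolding sup_continuous_curve_def
proof (intro allI impI conjI)
 fix t :: real
 show "continuous_on UNIV (%x. a t *R G x)" by (intro continuous_intros G)
 show "uniform_limit UNIV (%t x. a t *R G x) (%x. a t *R G x) (at t within {0..})"
 proof (rule uniform_limitI)
  fix e :: real assume e: "0 < e"
  have K: "0 <= K" using G(2) norm_ge_zero order_trans by blast
  have "(a \<longlongrightarrow> a t) (at t within {0..})"
   using continuous_on_subset[OF a, of "{0..} \<union> {t}"] by (auto simp: continuous_on_def intro: tendsto_within_subset[of _ _ t "{0..} \<union> {t}"])
  then have "\<forall>\<^sub>F s in at t within {0..}. dist (a s) (a t) < e / (K + 1)"
   using e K by (intro tendstoD) auto
  then show "\<forall>\<^sub>F s in at t within {0..}. ALL x:UNIV. dist (a s *R G x) (a t *R G x) < e"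
  proof eventually_elim
   case (elim s)
   show ?case
   proof
    fix x
    have "dist (a s *R G x) (a t *R G x) = \<bar>a s - a t\<bar> * norm (G x)"
     by (simp add: dist_norm flip: scaleR_diff_left)
    also have "... <= \<bar>a s - a t\<bar> * (K + 1)" using G(2)[of x] by (intro mult_left_mono) auto
    also have "... < e" using elim K by (simp add: dist_real_def field_simps)
    finally show "dist (a s *R G x) (a t *R G x) < e" .
   qed
  qed
 qed
qed

lemma sup_continuous_curve_cong:
 assumes "!!t x. 0 <= t ==> \<phi> t x = \<phi>' t x" "sup_continuous_curve \<phi>'"
 shows "sup_continuous_curve \<phi>"
 unfolding sup_continuous_curve_def
proof (intro allI impI conjI)
 fix t :: real assume t: "0 <= t"
 have eq: "\<phi> t = \<phi>' t" using assms(1)[OF t] by auto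
 show "continuous_on UNIV (\<phi> t)" using assms(2) t unfolding eq sup_continuous_curve_def by blast
 have "\<forall>\<^sub>F s in at t within {0..}. ALL x:UNIV. \<phi> s x = \<phi>' s x"
  unfolding eventually_at_filter using assms(1) by (auto intro: always_eventually)
 then have "uniform_limit UNIV \<phi> (\<phi> t) (at t within {0..}) \<longleftrightarrow> uniform_limit UNIV \<phi>' (\<phi>' t) (at t within {0..})"
  by (rule uniform_limit_cong) (simp add: eq)
 then show "uniform_limit UNIV \<phi> (\<phi> t) (at t within {0..})"
  using assms(2) t unfolding sup_continuous_curve_def by blast
qed

lemma time_deriv_scaleR:
 assumes "0 <= t" "(\<theta> has_real_derivative d) (at t)"
 shows "time_deriv (%ta x. \<theta> ta *R G x) t x = d *R G x"
 unfolding time_deriv_def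
proof (rule vector_derivative_within)
 have "at_right t <= at t within {0..}" using assms(1) by (intro at_le) auto
 then show "at t within {0..} ~= bot" using trivial_limit_at_right_real[of t] by (auto simp: trivial_limit_def dest: filter_leD)
 have "(\<theta> has_vector_derivative d) (at t)" using assms(2) by (simp add: has_real_derivative_iff_has_vector_derivative)
 then show "((%s. \<theta> s *R G x) has_vector_derivative d *R G x) (at t within {0..})"
  using has_vector_derivative_scaleR[OF has_field_derivative_at_within[OF assms(2), of "{0..}"] has_vector_derivative_const[of "G x"]] by simp
qed

lemma test_function_scaleR:
 assumes g: "tpv g" "g : hydro_sol" and \<theta>: "!!t. (\<theta> has_real_derivative \<theta>' t) (at t)" "continuous_on UNIV \<theta>'"
  and R: "!!t. R <= t ==> \<theta> t = 0"
 shows "test_function (%t x. \<theta> t *R g x)"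
proof -
 have \<theta>c: "continuous_on UNIV \<theta>" using \<theta>(1) by (intro DERIV_continuous_on) (auto intro: has_field_derivative_at_within)
 have pd: "pd b (%x. r *R g x) = (%x. r *R pd b g x)" for b r
  by (rule ext) (rule pd_scaleR_right[OF tpv_differentiable[OF g(1)]])
 obtain K where K: "!!x. norm (g x) <= K" using tpv_bounded[OF g(1)] by auto
 have Kb: "EX K. ALL x. norm (pd b g x) <= K" for b using tpv_bounded[OF tpv_pd[OF g(1), of b]] by auto
 have C1: "(%x. r *R g x) : C1_torus \<inter> hydro_sol" for r
 proof
  have "periodic (%x. r *R g x)" by (rule periodic_compose[OF tpv_periodic[OF g(1)]])
  moreover have "(%x. r *R g x) differentiable (at x)" for x
   by (rule differentiable_scaleR[OF differentiable_const tpv_differentiable[OF g(1)]])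
  moreover have "continuous_on UNIV (%x. r *R pd b g x)" for b
   by (rule continuous_on_scaleR[OF continuous_on_const tpv_continuous[OF tpv_pd[OF g(1)]]])
  ultimately show "(%x. r *R g x) : C1_torus" by (simp add: C1_torus_def pd)
  show "(%x. r *R g x) : hydro_sol"
   using g(2) Lp_torus_scaleR[of g 2 r] by (auto simp: hydro_sol_iff)
 qed
 show ?thesis
  unfolding test_function_def pd
 proof (intro conjI allI impI ballI)
  show "sup_continuous_curve (%t x. \<theta> t *R g x)"
   by (rule sup_continuous_curve_scaleR[OF \<theta>c tpv_continuous[OF g(1)] K])
  show "sup_continuous_curve (%t x. \<theta> t *R pd b g x)" for b
   using Kb[of b] sup_continuous_curve_scaleR[OF \<theta>c tpv_continuous[OF tpv_pd[OF g(1), of b]]] by blast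
  show "sup_continuous_curve (time_deriv (%t x. \<theta> t *R g x))"
   by (rule sup_continuous_curve_cong[OF time_deriv_scaleR[OF _ \<theta>(1)]])
    (auto intro: sup_continuous_curve_scaleR[OF \<theta>(2) tpv_continuous[OF g(1)] K])
  show "EX R. ALL t>=R. ALL x. \<theta> t *R g x = 0" using R by auto
  fix t :: real assume t: "0 <= t"
  show "(%x. \<theta> t *R g x) : C1_torus \<inter> hydro_sol" by (rule C1)
  have td: "time_deriv (%t x. \<theta> t *R g x) t = (%x. \<theta>' t *R g x)"
   by (rule ext) (rule time_deriv_scaleR[OF t \<theta>(1)])
  show "uniform_limit UNIV (%s x. (\<theta> s *R g x - \<theta> t *R g x) /\<^sub>R (s - t)) (time_deriv (%t x. \<theta> t *R g x) t) (at t within {0..})"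
   unfolding td
  proof (rule uniform_limitI)
   fix e :: real assume e: "0 < e"
   have K0: "0 <= K" using K norm_ge_zero order_trans by blast
   have "((%s. (\<theta> s - \<theta> t) / (s - t)) \<longlongrightarrow> \<theta>' t) (at t within {0..})"
    using has_field_derivative_at_within[OF \<theta>(1)[of t], of "{0..}"] by (simp add: has_field_derivative_iff)
   then have "\<forall>\<^sub>F s in at t within {0..}. dist ((\<theta> s - \<theta> t) / (s - t)) (\<theta>' t) < e / (K + 1)"
    using e K0 by (intro tendstoD) auto
   then show "\<forall>\<^sub>F s in at t within {0..}. ALL x:UNIV. dist ((\<theta> s *R g x - \<theta> t *R g x) /\<^sub>R (s - t)) (\<theta>' t *R g x) < e"
   proof eventually_elim
    case (elim s)
    show ?case
    proof
     fix x
     have "(\<theta> s *R g x - \<theta> t *R g x) /\<^sub>R (s - t) - \<theta>' t *R g x = ((\<theta> s - \<theta> t) / (s - t) - \<theta>' t) *R g x"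
      by (simp add: divide_inverse algebra_simps)
     then have "dist ((\<theta> s *R g x - \<theta> t *R g x) /\<^sub>R (s - t)) (\<theta>' t *R g x) = \<bar>(\<theta> s - \<theta> t) / (s - t) - \<theta>' t\<bar> * norm (g x)"
      by (simp add: dist_norm)
     also have "... <= \<bar>(\<theta> s - \<theta> t) / (s - t) - \<theta>' t\<bar> * (K + 1)" using K[of x] by (intro mult_left_mono) auto
     also have "... < e" using elim K0 by (simp add: dist_real_def pos_less_divide_eq)
     finally show "dist ((\<theta> s *R g x - \<theta> t *R g x) /\<^sub>R (s - t)) (\<theta>' t *R g x) < e" .
    qed
   qed
  qed
 qed
qed

text \<open>The square of the positive part is continuously differentiable; composed with itself it
  yields a cut-off with the regularity in time that test functions require.\<close>

lemma DERIV_max_square: "((%s::real. (max 0 s)\<^sup>2) has_real_derivative 2 * max 0 s) (at s)"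
proof -
 consider "0 < s" | "s < 0" | "s = 0" by linarith
 then show ?thesis
 proof cases
  case 1
  have "((%s::real. s\<^sup>2) has_real_derivative 2 * max 0 s) (at s)" using 1 by (auto intro!: derivative_eq_intros)
  then show ?thesis
   by (rule has_field_derivative_transform_within_open[where S="{0<..}"]) (use 1 in auto)
 next
  case 2
  have "((%s::real. 0) has_real_derivative 2 * max 0 s) (at s)" using 2 by (auto intro!: derivative_eq_intros)
  then show ?thesis
   by (rule has_field_derivative_transform_within_open[where S="{..<0}"]) (use 2 in auto)
 next
  case 3
  have "((%y::real. max 0 y) \<longlongrightarrow> max 0 0) (at 0)" by (intro tendsto_intros)
  moreover have "((max 0 y)\<^sup>2 - (max 0 0)\<^sup>2) / (y - 0) = max 0 y" for y :: real by (simp add: max_def power2_eq_square)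
  ultimately show ?thesis unfolding 3 has_field_derivative_iff by simp
 qed
qed

text \<open>A continuously differentiable cut-off that is 1 up to t and 0 from t + 1 / (n + 1) on.
  It varies only to the right of t, so that t = 0 is admissible.\<close>

definition ramp :: "real => nat => real => real" where
 "ramp t n ta = (max 0 (1 - (max 0 ((ta - t) * real (Suc n)))\<^sup>2))\<^sup>2"

definition hump :: "real => nat => real => real" where
 "hump t n ta = 4 * real (Suc n) * max 0 (1 - (max 0 ((ta - t) * real (Suc n)))\<^sup>2) * max 0 ((ta - t) * real (Suc n))"

lemma DERIV_ramp: "(ramp t n has_real_derivative - hump t n ta) (at ta)"
proof -
 have 1: "((%ta. (ta - t) * real (Suc n)) has_real_derivative real (Suc n)) (at ta)"
  by (auto intro!: derivative_eq_intros)
 have "((%ta. 1 - (max 0 ((ta - t) * real (Suc n)))\<^sup>2) has_real_derivative 0 - 2 * max 0 ((ta - t) * real (Suc n)) * real (Suc n)) (at ta)"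
  by (intro DERIV_diff DERIV_const DERIV_chain2[OF DERIV_max_square 1])
 from DERIV_chain2[OF DERIV_max_square this] show ?thesis
  unfolding ramp_def[abs_def] hump_def by (simp add: mult_ac del: of_nat_Suc)
qed

lemma hump_continuous: "continuous_on A (hump t n)"
 unfolding hump_def by (intro continuous_intros)

lemma hump_nonneg: "0 <= hump t n ta"
 by (simp add: hump_def)

lemma ramp_right: "t + 1 / real (Suc n) <= ta ==> ramp t n ta = 0"
 and hump_right: "t + 1 / real (Suc n) <= ta ==> hump t n ta = 0"
proof -
 assume "t + 1 / real (Suc n) <= ta"
 then have u: "1 <= (ta - t) * real (Suc n)" by (simp add: field_simps)
 then have "1 <= ((ta - t) * real (Suc n))\<^sup>2" using power_mono[OF u, of 2] by simp
 moreover have "max 0 ((ta - t) * real (Suc n)) = (ta - t) * real (Suc n)" using u by linarith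
 ultimately have "max 0 (1 - (max 0 ((ta - t) * real (Suc n)))\<^sup>2) = 0" by (simp del: of_nat_Suc)
 then show "ramp t n ta = 0" "hump t n ta = 0" by (simp_all only: ramp_def hump_def) simp_all
qed

lemma ramp_left: "ta <= t ==> ramp t n ta = 1"
 and hump_left: "ta <= t ==> hump t n ta = 0"
proof -
 assume "ta <= t"
 then have "(ta - t) * real (Suc n) <= 0" by (intro mult_nonpos_nonneg) auto
 then have "max 0 ((ta - t) * real (Suc n)) = 0" by linarith
 then show "ramp t n ta = 1" "hump t n ta = 0" by (simp_all only: ramp_def hump_def) simp_all
qed

lemma ramp_bounded: "\<bar>ramp t n ta\<bar> <= 1"
proof -
 have "(max 0 (1 - (max 0 ((ta - t) * real (Suc n)))\<^sup>2))\<^sup>2 <= 1"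
  by (rule power_le_one) auto
 then show ?thesis by (simp add: ramp_def)
qed

lemma ramp_mult_le: "\<bar>ramp t n ta * a\<bar> <= \<bar>a\<bar>"
 using mult_right_mono[OF ramp_bounded abs_ge_zero, of t n ta a] by (simp add: abs_mult)

lemma ramp_continuous: "continuous_on A (ramp t n)"
 unfolding ramp_def by (intro continuous_intros)

lemma ramp_tendsto: "(%n. ramp t n ta) ----> indicator {..t} ta"
proof (cases "ta <= t")
 case True
 then show ?thesis by (simp add: ramp_left)
next
 case False
 then obtain N where N: "1 / real (Suc N) < ta - t" using nat_approx_posE[of "ta - t"] by auto
 have "\<forall>\<^sub>F n in sequentially. ramp t n ta = 0"
  unfolding eventually_sequentially
 proof (intro exI allI impI)
  fix n assume "N <= n"
  then have "1 / real (Suc n) <= 1 / real (Suc N)" by (intro divide_left_mono) auto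
  then show "ramp t n ta = 0" using N by (intro ramp_right) linarith
 qed
 then show ?thesis using False by (auto intro: tendsto_eventually)
qed

text \<open>By the fundamental theorem \<open>hump\<close> has integral 1, the drop of
  \<open>ramp\<close>. It is nonnegative and concentrated on [t, t + 1 / (n + 1)], hence an
  approximate identity at t from the right.\<close>

lemma hump_tendsto:
 assumes t: "0 <= t" and y: "continuous_on {0..} y"
 shows "(%n. LINT ta:{0..}|lebesgue. hump t n ta * y ta) ----> y t"
proof (rule tendstoI)
 fix e :: real assume e: "0 < e"
 have "EX d>0. ALL x:{0..}. dist x t < d --> dist (y x) (y t) < e / 2"
 proof -
  have "ALL e>0. EX d>0. ALL x:{0..}. dist x t < d --> dist (y x) (y t) < e"
   using bspec[OF y[unfolded continuous_on_iff], of t] t by simp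
  then show ?thesis using half_gt_zero[OF e] by blast
 qed
 then obtain d where d: "0 < d" "!!x. 0 <= x ==> dist x t < d ==> dist (y x) (y t) < e / 2" by auto
 obtain N where N: "1 / real (Suc N) < d" using nat_approx_posE[OF d(1)] by auto
 show "\<forall>\<^sub>F n in sequentially. dist (LINT ta:{0..}|lebesgue. hump t n ta * y ta) (y t) < e"
  unfolding eventually_sequentially
 proof (intro exI allI impI)
  fix n assume "N <= n"
  then have "1 / real (Suc n) <= 1 / real (Suc N)" by (intro divide_left_mono) auto
  then have nd: "1 / real (Suc n) < d" using N by linarith
  define J where "J = {t..t + 1 / real (Suc n)}"
  let ?h = "%ta. indicator J ta *R hump t n ta"
  have cy: "continuous_on J y" using t by (intro continuous_on_subset[OF y]) (auto simp: J_def)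
  have ih: "integrable lborel ?h"
   using borel_integrable_atLeastAtMost'[OF hump_continuous] by (simp add: set_integrable_def J_def)
  have "continuous_on J (%ta. hump t n ta * y ta)" by (intro continuous_intros hump_continuous cy)
  then have iy: "integrable lborel (%ta. indicator J ta *R (hump t n ta * y ta))"
   unfolding J_def by (rule borel_integrable_atLeastAtMost'[unfolded set_integrable_def])
  have h1: "integral\<^sup>L lborel ?h = 1"
  proof -
   have "integral\<^sup>L lborel (%ta. indicator J ta *R - hump t n ta) = ramp t n (t + 1 / real (Suc n)) - ramp t n t"
    unfolding J_def
    by (rule integral_FTC_atLeastAtMost)
     (auto intro!: continuous_intros hump_continuous has_field_derivative_at_within[OF DERIV_ramp] simp flip: has_real_derivative_iff_has_vector_derivative)
   then show ?thesis by (simp add: ramp_right ramp_left)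
  qed
  have "(LINT ta:{0..}|lebesgue. hump t n ta * y ta) = integral\<^sup>L lebesgue (%ta. indicator J ta *R (hump t n ta * y ta))"
   unfolding set_lebesgue_integral_def
  proof (rule LB_integral_cong[OF refl])
   fix ta
   show "indicator {0..} ta *R (hump t n ta * y ta) = indicator J ta *R (hump t n ta * y ta)"
    using t hump_left[of ta t n] hump_right[of t n ta] by (cases "ta <= t"; cases "t + 1 / real (Suc n) <= ta") (auto simp: J_def indicator_def)
  qed
  also have "... = integral\<^sup>L lborel (%ta. indicator J ta *R (hump t n ta * y ta))"
   by (rule integral_completion) (use iy in auto)
  finally have "(LINT ta:{0..}|lebesgue. hump t n ta * y ta) - y t = integral\<^sup>L lborel (%ta. indicator J ta *R (hump t n ta * y ta)) - integral\<^sup>L lborel (%ta. ?h ta * y t)"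
   using h1 by simp
  also have "... = integral\<^sup>L lborel (%ta. indicator J ta *R (hump t n ta * y ta) - ?h ta * y t)"
   by (rule LB_integral_diff[symmetric]) (intro iy integrable_mult_left ih)+
  also have "\<bar>...\<bar> <= integral\<^sup>L lborel (%ta. ?h ta * (e / 2))"
  proof (rule order_trans[OF integral_abs_bound integral_mono])
   show "integrable lborel (%ta. \<bar>indicator J ta *R (hump t n ta * y ta) - ?h ta * y t\<bar>)"
    by (intro integrable_abs LB_integrable_diff iy integrable_mult_left ih)
   show "integrable lborel (%ta. ?h ta * (e / 2))" by (intro integrable_mult_left ih)
   fix ta
   show "\<bar>indicator J ta *R (hump t n ta * y ta) - ?h ta * y t\<bar> <= ?h ta * (e / 2)"
   proof (cases "ta : J")
    case True
    then have "dist (y ta) (y t) < e / 2" using t nd by (intro d) (auto simp: J_def dist_real_def)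
    then have "hump t n ta * \<bar>y ta - y t\<bar> <= hump t n ta * (e / 2)"
     by (intro mult_left_mono hump_nonneg) (simp add: dist_real_def)
    then show ?thesis using True hump_nonneg[of t n ta] by (simp add: abs_mult flip: right_diff_distrib)
   qed simp
  qed
  also have "... = e / 2" using h1 by simp
  finally show "dist (LINT ta:{0..}|lebesgue. hump t n ta * y ta) (y t) < e"
   using e by (simp add: dist_real_def)
 qed
qed

section \<open>The equation tested with a fixed solenoidal field\<close>

locale weak_sol =
 fixes v :: "real => R3 => R2" and v0 :: "R3 => R2"
 assumes sol: "weak_solution v v0" and v0: "v0 : hydro_sol"
begin

lemma v_hydro: "0 <= t ==> v t : hydro_sol"
 and v_cont: "g : hydro_sol ==> continuous_on {0..} (%t. L2_inner (v t) g)"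
 and v_H1: "AE t in lebesgue. 0 <= t --> v t : H1"
 and v_int: "set_integrable lebesgue {0..T} (%t. (H1_norm (v t))\<^sup>2)"
 and v_init: "AE x in torus. v 0 x = v0 x"
 using sol by (auto simp: weak_solution_def AE_restrict_space_iff)

lemma v_L2: "0 <= t ==> v t : Lp_torus 2"
 using v_hydro[of t] by (simp add: hydro_sol_iff)

text \<open>Extension by zero to negative times turns joint measurability on a half space into Borel
  measurability on the whole space.\<close>

definition V :: "real => R3 => R2" where
 "V ta = (if 0 <= ta then v ta else (%x. 0))"

lemma V_measurable [measurable]: "(%z. V (fst z) (snd z)) : Borel"
proof -
 have "(%(t, x). v t x) : borel_measurable (restrict_space borel ({0..} \<times> UNIV))"
  using sol by (simp add: weak_solution_def)
 then have "(%z. indicator ({0..} \<times> UNIV) z *R (case z of (t, x) => v t x)) : Borel"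
  by (subst (asm) borel_measurable_restrict_space_iff) (auto simp: space_borel intro: borel_closed closed_Times)
 then show ?thesis
  by (rule measurable_cong[THEN iffD1, rotated]) (auto simp: V_def indicator_def)
qed

text \<open>A Borel function that agrees with the functional whenever the field lies in
  \<open>H1\<close> gives measurability, the quadratic bound gives integrability; viscosity and flux
  are the two instances.\<close>

lemma functional_integrable:
 fixes \<Phi> :: "(R3 => R2) => real"
 assumes A: "EX A:borel_measurable borel. ALL ta. V ta : H1 --> \<Phi> (V ta) = A ta"
  and C: "EX C>=0. ALL f:H1. \<bar>\<Phi> f\<bar> <= C * (1 + (H1_norm f)\<^sup>2)"
 shows "set_integrable lebesgue {0..T} (%ta. \<Phi> (v ta))"
proof -
 obtain A where A: "A : Borel" "!!ta. V ta : H1 ==> \<Phi> (V ta) = A ta" using A by blast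
 obtain C where C: "0 <= C" "!!f. f : H1 ==> \<bar>\<Phi> f\<bar> <= C * (1 + (H1_norm f)\<^sup>2)" using C by blast
 have eq: "AE ta in lebesgue. indicator {0..T} ta *R \<Phi> (v ta) = indicator {0..T} ta * A ta"
  using v_H1
 proof eventually_elim
  case (elim ta)
  then show ?case using A(2)[of ta] by (auto simp: V_def indicator_def)
 qed
 have "(%ta. indicator {0..T} ta * A ta) : borel_measurable lborel" using A(1) by measurable
 then have m: "(%ta. indicator {0..T} ta *R \<Phi> (v ta)) : borel_measurable lebesgue"
  by (rule borel_measurable_lebesgue_AE[OF measurable_completion eq])
 have "integrable lebesgue (indicator {0..T} :: real => real)"
  by (rule integrable_completion[THEN iffD2]) (auto intro!: integrable_real_indicator simp: emeasure_lborel_Icc_eq)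
 then have "integrable lebesgue (%ta. C * (indicator {0..T} ta + indicator {0..T} ta *R (H1_norm (v ta))\<^sup>2))"
  using v_int[of T] unfolding set_integrable_def by (intro integrable_mult_right LB_integrable_add)
 then show ?thesis
  unfolding set_integrable_def
 proof (rule LB_integrable_bound[OF _ m])
  show "AE ta in lebesgue. norm (indicator {0..T} ta *R \<Phi> (v ta)) <= norm (C * (indicator {0..T} ta + indicator {0..T} ta *R (H1_norm (v ta))\<^sup>2))"
   using v_H1
  proof eventually_elim
   case (elim ta)
   show ?case
   proof (cases "ta : {0..T}")
    case True
    then have "\<bar>\<Phi> (v ta)\<bar> <= C * (1 + (H1_norm (v ta))\<^sup>2)" using elim C(2)[of "v ta"] by auto
    then show ?thesis using True C(1) by (simp add: abs_mult)
   qed simp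
  qed
 qed
qed

lemma visc_integrable: "tpv g ==> set_integrable lebesgue {0..T} (%ta. visc (v ta) g)"
 by (rule functional_integrable[OF visc_measurable[OF V_measurable] visc_bound])

lemma flux_integrable: "tpv g ==> set_integrable lebesgue {0..T} (%ta. flux (v ta) g)"
 by (rule functional_integrable[OF flux_measurable[OF V_measurable] flux_H1_bound])

text \<open>Testing with \<open>ramp t n\<close> times \<open>g\<close> and letting n grow. Weak
  continuity makes the term with \<open>hump\<close> converge at each t, so the identity holds at
  every time and not merely at almost every one.\<close>

lemma weak_increment:
 assumes g: "tpv g" "g : hydro_sol" and t: "0 <= t"
 shows "L2_inner (v t) g = L2_inner (v 0) g + (LINT ta:{0..t}|lebesgue. flux (v ta) g - visc (v ta) g)"
proof -
 let ?y = "%ta. L2_inner (v ta) g"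
 have vis: "set_integrable lebesgue {0..t + 1} (%ta. visc (v ta) g)" and flu: "set_integrable lebesgue {0..t + 1} (%ta. flux (v ta) g)"
  using visc_integrable[OF g(1)] flux_integrable[OF g(1)] by auto
 have ramp1: "ramp t n ta = 0" if "t + 1 <= ta" for n ta
 proof (rule ramp_right)
  have "1 / real (Suc n) <= 1" by simp
  then show "t + 1 / real (Suc n) <= ta" using that by linarith
 qed
 have [measurable]: "ramp t n : borel_measurable lebesgue" for n
  by (rule measurable_completion) (simp add: borel_measurable_continuous_onI[OF ramp_continuous])
 \<comment> \<open>The ramp vanishes after t + 1, so integrals over the half line reduce to
   [0, t + 1], where integrability is known.\<close>
 have cut: "indicator {0..} ta * (ramp t n ta * a) = ramp t n ta * (indicator {0..t + 1} ta * a)" for ta n and a :: real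
  using ramp1[of ta n] by (auto simp: indicator_def)
 have int: "integrable lebesgue (%ta. indicator {0..} ta * (ramp t n ta * a ta))"
  if "set_integrable lebesgue {0..t + 1} a" for a :: "real => real" and n
  unfolding cut
 proof (rule LB_integrable_bound[OF that[unfolded set_integrable_def]])
  have [measurable]: "(%ta. indicator {0..t + 1} ta * a ta) : borel_measurable lebesgue"
   using borel_measurable_integrable[OF that[unfolded set_integrable_def]] by simp
  show "(%ta. ramp t n ta * (indicator {0..t + 1} ta * a ta)) : borel_measurable lebesgue" by measurable
  show "AE ta in lebesgue. norm (ramp t n ta * (indicator {0..t + 1} ta * a ta)) <= norm (indicator {0..t + 1} ta *R a ta)"
   by (intro AE_I2) (simp only: real_norm_def real_scaleR_def ramp_mult_le)
 qed
 have key: "(LINT ta:{0..}|lebesgue. hump t n ta * ?y ta) = ?y 0 + (LINT ta|lebesgue. indicator {0..} ta * (ramp t n ta * (flux (v ta) g - visc (v ta) g)))" for n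
 proof -
  let ?\<phi> = "%ta x. ramp t n ta *R g x"
  have tf: "test_function ?\<phi>"
   by (rule test_function_scaleR[OF g DERIV_ramp _ ramp1]) (auto intro!: continuous_intros hump_continuous)
  have td: "time_deriv ?\<phi> ta x = - hump t n ta *R g x" if "0 <= ta" for ta x
   by (rule time_deriv_scaleR[OF that DERIV_ramp])
  have pd: "pd b (?\<phi> ta) x = ramp t n ta *R pd b g x" for b ta x
   by (rule pd_scaleR_right[OF tpv_differentiable[OF g(1)]])
  have W: "- (LINT ta:{0..}|lebesgue. LINT x|torus. v ta x \<bullet> time_deriv ?\<phi> ta x)
    + (LINT ta:{0..}|lebesgue. LINT x|torus. (\<Sum>b\<in>Basis. weak_pd b (v ta) x \<bullet> pd b (?\<phi> ta) x))
    - (LINT ta:{0..}|lebesgue. LINT x|torus.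
      (\<Sum>b\<in>Basis. \<Sum>k\<in>UNIV. (velocity (v ta) x \<bullet> b) * v ta x $ k * pd b (?\<phi> ta) x $ k))
    = L2_inner v0 (?\<phi> 0)"
   using sol tf unfolding weak_solution_def by blast
  have 1: "(LINT ta:{0..}|lebesgue. LINT x|torus. v ta x \<bullet> time_deriv ?\<phi> ta x) = - (LINT ta:{0..}|lebesgue. hump t n ta * ?y ta)"
  proof -
   have "(LINT ta:{0..}|lebesgue. LINT x|torus. v ta x \<bullet> time_deriv ?\<phi> ta x) = (LINT ta:{0..}|lebesgue. - (hump t n ta * ?y ta))"
    by (rule set_lebesgue_integral_cong) (auto simp: td L2_inner_def)
   then show ?thesis by (simp add: set_lebesgue_integral_def)
  qed
  have 2: "(LINT ta:{0..}|lebesgue. LINT x|torus. (\<Sum>b\<in>Basis. weak_pd b (v ta) x \<bullet> pd b (?\<phi> ta) x)) = (LINT ta|lebesgue. indicator {0..} ta * (ramp t n ta * visc (v ta) g))"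
   unfolding set_lebesgue_integral_def
  proof (rule integral_lebesgue_cong_AE[OF borel_measurable_integrable[OF int[OF vis]]])
   show "AE ta in lebesgue. indicator {0..} ta *R (LINT x|torus. (\<Sum>b\<in>Basis. weak_pd b (v ta) x \<bullet> pd b (?\<phi> ta) x)) = indicator {0..} ta * (ramp t n ta * visc (v ta) g)"
    using v_H1
   proof eventually_elim
    case (elim ta)
    show ?case
    proof (cases "0 <= ta")
     case True
     then show ?thesis using visc_cong_integral[OF _ g(1), of "v ta"] elim by (simp add: pd sum_distrib_left[symmetric])
    qed simp
   qed
  qed
  have 3: "(LINT ta:{0..}|lebesgue. LINT x|torus. (\<Sum>b\<in>Basis. \<Sum>k\<in>UNIV. (velocity (v ta) x \<bullet> b) * v ta x $ k * pd b (?\<phi> ta) x $ k)) = (LINT ta|lebesgue. indicator {0..} ta * (ramp t n ta * flux (v ta) g))"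
  proof -
   have "(\<Sum>k\<in>UNIV. (velocity (v ta) x \<bullet> b) * v ta x $ k * pd b (?\<phi> ta) x $ k) = ramp t n ta * ((velocity (v ta) x \<bullet> b) * (v ta x \<bullet> pd b g x))" for ta b x
    by (simp add: pd inner_R2 sum_distrib_left mult_ac)
   then have "(LINT x|torus. (\<Sum>b\<in>Basis. \<Sum>k\<in>UNIV. (velocity (v ta) x \<bullet> b) * v ta x $ k * pd b (?\<phi> ta) x $ k)) = ramp t n ta * flux (v ta) g" for ta
    by (simp add: flux_def sum_distrib_left[symmetric])
   then show ?thesis by (simp add: set_lebesgue_integral_def)
  qed
  have 4: "L2_inner v0 (?\<phi> 0) = ?y 0"
  proof -
   have "L2_inner v0 (?\<phi> 0) = (LINT x|torus. v0 x \<bullet> g x)" using t by (simp add: L2_inner_def ramp_left)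
   also have "... = ?y 0"
    unfolding L2_inner_def using v_init
    by (intro integral_cong_AE borel_measurable_integrable integrable_inner_L2 hydro_sol_L2[OF v0] v_L2 order_refl tpv_Lp_torus g) (auto elim!: eventually_mono)
   finally show ?thesis .
  qed
  have "(LINT ta|lebesgue. indicator {0..} ta * (ramp t n ta * (flux (v ta) g - visc (v ta) g))) =
   (LINT ta|lebesgue. indicator {0..} ta * (ramp t n ta * flux (v ta) g)) - (LINT ta|lebesgue. indicator {0..} ta * (ramp t n ta * visc (v ta) g))"
   unfolding right_diff_distrib by (rule LB_integral_diff[OF int[OF flu] int[OF vis]])
  then show ?thesis using W unfolding 1 2 3 4 by linarith
 qed
 have "(%n. LINT ta|lebesgue. indicator {0..} ta * (ramp t n ta * (flux (v ta) g - visc (v ta) g))) ---->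
  (LINT ta|lebesgue. indicator {0..t} ta *R (flux (v ta) g - visc (v ta) g))"
 proof (rule integral_dominated_convergence)
  have fv: "set_integrable lebesgue {0..T} (%ta. flux (v ta) g - visc (v ta) g)" for T
   by (intro set_integral_diff visc_integrable flux_integrable g)
  show "(%ta. indicator {0..t} ta *R (flux (v ta) g - visc (v ta) g)) : borel_measurable lebesgue"
   using fv[of t] unfolding set_integrable_def by (rule borel_measurable_integrable)
  show "(%ta. indicator {0..} ta * (ramp t n ta * (flux (v ta) g - visc (v ta) g))) : borel_measurable lebesgue" for n
   using int[OF fv] by (rule borel_measurable_integrable)
  show "integrable lebesgue (%ta. \<bar>indicator {0..t + 1} ta *R (flux (v ta) g - visc (v ta) g)\<bar>)"
   using fv[of "t + 1"] unfolding set_integrable_def by (rule integrable_abs)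
  show "AE ta in lebesgue. norm (indicator {0..} ta * (ramp t n ta * (flux (v ta) g - visc (v ta) g))) <= \<bar>indicator {0..t + 1} ta *R (flux (v ta) g - visc (v ta) g)\<bar>" for n
   unfolding cut by (intro AE_I2) (simp only: real_norm_def real_scaleR_def ramp_mult_le)
  show "AE ta in lebesgue. (%n. indicator {0..} ta * (ramp t n ta * (flux (v ta) g - visc (v ta) g))) ----> indicator {0..t} ta *R (flux (v ta) g - visc (v ta) g)"
  proof (intro AE_I2)
   fix ta
   have "(%n. indicator {0..} ta * (ramp t n ta * (flux (v ta) g - visc (v ta) g))) ----> indicator {0..} ta * (indicator {..t} ta * (flux (v ta) g - visc (v ta) g))"
    by (intro tendsto_intros ramp_tendsto)
   also have "indicator {0..} ta * (indicator {..t} ta * (flux (v ta) g - visc (v ta) g)) = indicator {0..t} ta *R (flux (v ta) g - visc (v ta) g)"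
    by (auto simp: indicator_def)
   finally show "(%n. indicator {0..} ta * (ramp t n ta * (flux (v ta) g - visc (v ta) g))) ----> indicator {0..t} ta *R (flux (v ta) g - visc (v ta) g)" .
  qed
 qed
 then have "(%n. LINT ta:{0..}|lebesgue. hump t n ta * ?y ta) ----> ?y 0 + (LINT ta:{0..t}|lebesgue. flux (v ta) g - visc (v ta) g)"
  unfolding key unfolding set_lebesgue_integral_def by (intro tendsto_add tendsto_const)
 from LIMSEQ_unique[OF hump_tendsto[OF t v_cont[OF g(2)]] this] show ?thesis .
qed

end

section \<open>The energy balance of the mollified solution\<close>

lemma set_integral_Icc_diff:
 fixes f :: "real => real"
 assumes f: "set_integrable lebesgue {0..t} f" and s: "0 <= s" "s <= t"
 shows "(LINT ta:{0..t}|lebesgue. f ta) - (LINT ta:{0..s}|lebesgue. f ta) = (LINT ta:{s..t}|lebesgue. f ta)"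
proof -
 have i: "set_integrable lebesgue {0..s} f" "set_integrable lebesgue {s..t} f"
  by (rule set_integrable_subset[OF f]; use s in auto)+
 show ?thesis
  using Henstock_Kurzweil_Integration.integral_combine[OF s set_lebesgue_integral_eq_integral(1)[OF f]]
  by (simp add: set_lebesgue_integral_eq_integral(2)[OF f] set_lebesgue_integral_eq_integral(2)[OF i(1)] set_lebesgue_integral_eq_integral(2)[OF i(2)])
qed

lemma set_integral_Icc_continuous:
 fixes f :: "real => real"
 assumes f: "set_integrable lebesgue {0..t} f"
 shows "continuous_on {0..t} (%s. LINT ta:{0..s}|lebesgue. f ta)"
proof -
 have "continuous_on {0..t} (%s. integral {0..s} f)"
  by (rule indefinite_integral_continuous_1[OF set_lebesgue_integral_eq_integral(1)[OF f]])
 then show ?thesis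
  by (rule continuous_on_eq)
   (auto intro!: set_lebesgue_integral_eq_integral(2)[symmetric] set_integrable_subset[OF f])
qed

text \<open>Summation over a uniform partition of mesh below d. A local estimate with a small factor
  in \<open>H\<close> thus becomes a global one with the same factor.\<close>

lemma telescope_le:
 fixes G H :: "real => real"
 assumes d: "0 < d" and t: "0 <= t"
  and le: "!!s s'. 0 <= s ==> s <= s' ==> s' <= t ==> s' - s < d ==> \<bar>G s' - G s\<bar> <= H s' - H s"
 shows "\<bar>G t - G 0\<bar> <= H t - H 0"
proof -
 obtain m where m: "t / d < real m" using reals_Archimedean2 by blast
 have m0: "0 < real m" using t d by (intro le_less_trans[OF _ m]) simp
 define u where "u = t / real m"
 have u: "0 <= u" "u < d" "real m * u = t" using m m0 d t by (simp_all add: u_def field_simps)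
 have "k <= m ==> \<bar>G (real k * u) - G 0\<bar> <= H (real k * u) - H 0" for k
 proof (induction k)
  case (Suc k)
  have "real (Suc k) * u <= real m * u" using Suc.prems u by (intro mult_right_mono) auto
  then have "\<bar>G (real (Suc k) * u) - G (real k * u)\<bar> <= H (real (Suc k) * u) - H (real k * u)"
   using u by (intro le) (auto simp: distrib_right)
  then show ?case using Suc by linarith
 qed simp
 from this[of m] show ?thesis using u by simp
qed

text \<open>The segment average may act on either factor of the separated kernel, because the kernel
  is even and the segment symmetric. Comparing the two forms shows that pairing v(s) with the
  smoothed v(t) is symmetric in s and t.\<close>

lemma smear_moll_expand:
 assumes F: "!!i. i < N ==> tp (F i)" "!!x y. kern n (y - x :: R3) = (\<Sum>i<N. F i x * F i y)" and f: "f : Lp_torus 2"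
 shows "smear h (moll n f) x = (\<Sum>i<N. smear h (F i) x *R (LINT y|torus. F i y *R f y))" (is ?A)
  and "smear h (moll n f) x = (\<Sum>i<N. F i x *R (LINT y|torus. smear h (F i) y *R f y))" (is ?B)
proof -
 let ?\<mu> = "segm (-1) 1 h ((0, 1) :: R3)"
 have iF: "integrable ?\<mu> (%y. F i (x + y))" if "i < N" for i x
 proof -
  note Fi = F(1)[OF that]
  obtain C where "!!x. norm (F i x) <= C" using tp_bounded[OF Fi] by auto
  then show ?thesis by (intro integrable_segm_bounded tp_borel Fi) auto
 qed
 have "smear h (moll n f) x = (LINT y|?\<mu>. (\<Sum>i<N. F i (x + y) *R (LINT y|torus. F i y *R f y)))"
  unfolding avg_def using moll_expand[OF F f] by simp
 also have "... = (\<Sum>i<N. smear h (F i) x *R (LINT y|torus. F i y *R f y))"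
  unfolding avg_def by (subst LB_integral_sum) (auto intro!: integrable_scaleR_left iF sum.cong integral_scaleR_left)
 finally show ?A .
 have lin: "(\<Sum>i<N. smear h (F i) x * c i) = smear h (%x. \<Sum>i<N. F i x * c i) x" for c x
  unfolding avg_def by (subst LB_integral_sum) (auto intro!: integrable_mult_left iF)
 have [measurable]: "kern n : borel_measurable (borel :: R3 measure)" by (rule kern_borel)
 have kern: "(\<Sum>i<N. smear h (F i) x * F i y) = (\<Sum>i<N. F i x * smear h (F i) y)" for x y
 proof -
  have "(\<Sum>i<N. smear h (F i) x * F i y) = smear h (%x. kern n (y - x)) x" unfolding lin F(2) ..
  also have "... = (LINT s:{-1..1}|lborel. kern n (y - (x + (h * s) *R (0, 1)))) /\<^sub>R (1 - (-1))"
   by (rule avg_segm) auto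
  also have "(LINT s:{-1..1}|lborel. kern n (y - (x + (h * s) *R (0, 1)))) = (LINT s:{s. - s : {-1..1}}|lborel. kern n (y - (x + (h * - s) *R (0, 1))))"
   by (rule set_integral_reflect)
  also have "{s. - s : {-1..1::real}} = {-1..1}" by auto
  also have "(LINT s:{-1..1}|lborel. kern n (y - (x + (h * - s) *R (0, 1)))) = (LINT s:{-1..1}|lborel. kern n (y + (h * s) *R (0, 1) - x))"
   by (intro arg_cong2[where f="set_lebesgue_integral lborel"] refl ext arg_cong[where f="kern n"]) (simp add: algebra_simps zero_prod_def)
  also have "... /\<^sub>R (1 - (-1)) = smear h (%y. kern n (y - x)) y"
   by (rule avg_segm[symmetric]) auto
  also have "... = (\<Sum>i<N. F i x * smear h (F i) y)" unfolding F(2) using lin[of y "%i. F i x"] by (simp add: mult.commute)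
  finally show ?thesis .
 qed
 have i1: "integrable torus (%y. F i y *R f y)" "integrable torus (%y. smear h (F i) y *R f y)" if "i < N" for i
  by (intro integrable_torus_mult_tp[OF L2_integrable[OF f]] F(1) that conjunct1[OF tp_avg_segm])+
 have "(\<Sum>i<N. smear h (F i) x *R (LINT y|torus. F i y *R f y)) = (LINT y|torus. (\<Sum>i<N. smear h (F i) x *R (F i y *R f y)))"
  by (rule integral_sum_scaleR[symmetric]) (use i1 in auto)
 also have "... = (LINT y|torus. (\<Sum>i<N. F i x *R (smear h (F i) y *R f y)))"
  using kern[of x] by (simp flip: scaleR_sum_left)
 also have "... = (\<Sum>i<N. F i x *R (LINT y|torus. smear h (F i) y *R f y))"
  by (rule integral_sum_scaleR) (use i1 in auto)
 finally show ?B using \<open>?A\<close> by simp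
qed

lemma L2_inner_lincomb:
 assumes f: "f : Lp_torus 2" and g: "!!j. j : J ==> tpv (g j)"
 shows "L2_inner f (%x. \<Sum>j\<in>J. a j *R g j x) = (\<Sum>j\<in>J. a j * L2_inner f (g j))"
 unfolding L2_inner_def inner_sum_right inner_scaleR_right
 by (subst LB_integral_sum)
  (auto intro!: integrable_mult_right integrable_inner_L2 f tpv_Lp_torus g)

lemma tpv_scaleR_const: "tp F ==> tpv (%x. F x *R c)"
 using tpv_scaleR_sum[of "{()}" "%_. F" "%_. c"] by simp

lemma scaleR_axis_expand: "F *R (u :: R2) = (\<Sum>k\<in>UNIV. (u $ k) *R (F *R axis k 1))"
 by (simp add: vec_eq_iff sum_2 axis_def forall_2)

lemma sum_axis_expand:
 "(\<Sum>i<N. G i *R (u i :: R2)) = (\<Sum>j\<in>{..<N} \<times> UNIV. (u (fst j) $ snd j) *R (G (fst j) *R axis (snd j) 1))"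
proof -
 have "(\<Sum>i<N. G i *R u i) = (\<Sum>i<N. \<Sum>k\<in>UNIV. (u i $ k) *R (G i *R axis k 1))"
  by (rule sum.cong[OF refl scaleR_axis_expand])
 also have "... = (\<Sum>j\<in>{..<N} \<times> UNIV. (u (fst j) $ snd j) *R (G (fst j) *R axis (snd j) 1))"
  unfolding sum.cartesian_product by (simp only: case_prod_beta')
 finally show ?thesis .
qed

lemma L2_inner_axis:
 assumes f: "f : Lp_torus 2" and F: "tp F"
 shows "L2_inner f (%x. F x *R axis k 1) = (LINT y|torus. F y *R f y) $ k"
proof -
 have "(LINT y|torus. (F y *R f y) \<bullet> axis k 1) = (LINT y|torus. F y *R f y) \<bullet> axis k 1"
  by (rule integral_inner_left) (rule integrable_torus_mult_tp[OF L2_integrable[OF f] F])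
 then show ?thesis by (simp add: L2_inner_def inner_axis)
qed

section \<open>The energy identity of the smoothed solution\<close>

context weak_sol
begin

text \<open>The rate of change of the pairing of v with g, as prescribed by the equation.\<close>

definition act :: "(R3 => R2) => real => real" where
 "act g ta = flux (v ta) g - visc (v ta) g"

lemma act_integrable: "tpv g ==> 0 <= s ==> set_integrable lebesgue {s..t} (act g)"
 unfolding act_def
 by (rule set_integrable_subset[where A="{0..t}"]) (auto intro: set_integral_diff flux_integrable visc_integrable)

lemma increment:
 assumes g: "tpv g" "g : hydro_sol" and s: "0 <= s" "s <= t"
 shows "L2_inner (v t) g - L2_inner (v s) g = (LINT ta:{s..t}|lebesgue. act g ta)"
 using weak_increment[OF g, of t] weak_increment[OF g, of s] s
  set_integral_Icc_diff[OF act_integrable[OF g(1), of 0 t] s] by (simp add: act_def)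

lemma integral_act_lincomb:
 assumes J: "finite J" and g: "!!j. j : J ==> tpv (g j)" and s: "0 <= s"
 shows "(LINT ta:{s..t}|lebesgue. act (%x. \<Sum>j\<in>J. a j *R g j x) ta) = (\<Sum>j\<in>J. a j * (LINT ta:{s..t}|lebesgue. act (g j) ta))"
proof -
 have i: "integrable lebesgue (%ta. indicator {s..t} ta * (a j * act (g j) ta))" if "j : J" for j
  using integrable_mult_right[OF act_integrable[OF g[OF that] s, of t, unfolded set_integrable_def], of "a j"]
  by (simp add: mult.left_commute)
 have "(LINT ta:{s..t}|lebesgue. act (%x. \<Sum>j\<in>J. a j *R g j x) ta) = (LINT ta|lebesgue. (\<Sum>j\<in>J. indicator {s..t} ta * (a j * act (g j) ta)))"
  unfolding set_lebesgue_integral_def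
 proof (rule integral_lebesgue_cong_AE)
  show "(%ta. \<Sum>j\<in>J. indicator {s..t} ta * (a j * act (g j) ta)) : borel_measurable lebesgue"
   by (intro borel_measurable_integrable LB_integrable_sum i)
  show "AE ta in lebesgue. indicator {s..t} ta *R act (%x. \<Sum>j\<in>J. a j *R g j x) ta = (\<Sum>j\<in>J. indicator {s..t} ta * (a j * act (g j) ta))"
   using v_H1
  proof eventually_elim
   case (elim ta)
   show ?case
   proof (cases "ta : {s..t}")
    case True
    then have f: "v ta : H1" using elim s by auto
    have "act (%x. \<Sum>j\<in>J. a j *R g j x) ta = (\<Sum>j\<in>J. a j * act (g j) ta)"
     using flux_lincomb[OF f, of J g a] visc_lincomb[OF f, of J g a] g by (simp add: act_def sum_subtractf right_diff_distrib)
    then show ?thesis using True by simp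
   qed simp
  qed
 qed
 also have "... = (\<Sum>j\<in>J. LINT ta|lebesgue. indicator {s..t} ta * (a j * act (g j) ta))"
  by (rule LB_integral_sum) (rule i)
 also have "... = (\<Sum>j\<in>J. a j * (LINT ta:{s..t}|lebesgue. act (g j) ta))"
  by (simp add: set_lebesgue_integral_def mult.left_commute[of "indicator _ _"])
 finally show ?thesis .
qed

text \<open>The smoothed energy is a quadratic form in finitely many coefficients, whose product
  rule is carried out by hand: on short intervals the coefficients are almost constant, and the
  errors add up to an arbitrarily small multiple of a fixed integral. The single fields
  \<open>e j\<close> need not belong to \<open>hydro_sol\<close>; the equation is applied only to
  the combinations \<open>moll n (v r)\<close> and \<open>S r\<close>.\<close>

lemma energy_level:
 assumes T: "0 <= T"
 shows "set_integrable lebesgue {0..T} (%ta. act (smear h (moll n (v ta))) ta)"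
  and "L2_inner (v T) (smear h (moll n (v T))) - L2_inner (v 0) (smear h (moll n (v 0))) =
   2 * (LINT ta:{0..T}|lebesgue. act (smear h (moll n (v ta))) ta)"
proof -
 obtain N and F :: "nat => R3 => real" where F: "!!i. i < N ==> tp (F i)" "!!x y. kern n (y - x :: R3) = (\<Sum>i<N. F i x * F i y)"
  using kern_expand by blast
 define J where "J = {..<N} \<times> (UNIV :: 2 set)"
 have fJ: "finite J" by (simp add: J_def)
 define e0 where "e0 j x = F (fst j) x *R (axis (snd j) 1 :: R2)" for j :: "nat \<times> 2" and x
 define e where "e j x = smear h (F (fst j)) x *R (axis (snd j) 1 :: R2)" for j :: "nat \<times> 2" and x
 define c where "c j t = (LINT y|torus. F (fst j) y *R v t y) $ snd j" for j :: "nat \<times> 2" and t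
 define S where "S t = smear h (moll n (v t))" for t
 have tF: "tp (F (fst j))" if "j : J" for j using that F(1) by (auto simp: J_def)
 have te0: "tpv (e0 j)" and te: "tpv (e j)" if "j : J" for j
  using tF[OF that] tp_avg_segm[OF tF[OF that]] unfolding e0_def e_def by (auto intro: tpv_scaleR_const)
 have ce0: "L2_inner (v t) (e0 j) = c j t" if "j : J" "0 <= t" for j t
  unfolding e0_def c_def by (rule L2_inner_axis[OF v_L2[OF that(2)] tF[OF that(1)]])
 have m: "moll n (v t) = (%x. \<Sum>j\<in>J. c j t *R e0 j x)" if "0 <= t" for t
  unfolding fun_eq_iff J_def c_def e0_def
  by (intro allI trans[OF moll_expand[OF F v_L2[OF that]] sum_axis_expand])
 have Se: "S t = (%x. \<Sum>j\<in>J. c j t *R e j x)" if "0 <= t" for t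
  unfolding S_def fun_eq_iff J_def c_def e_def
  by (intro allI trans[OF smear_moll_expand(1)[OF F v_L2[OF that]] sum_axis_expand])
 have mh: "moll n (v t) : hydro_sol" "S t : hydro_sol" if "0 <= t" for t
  unfolding S_def by (intro smear_hydro_sol moll_hydro_sol v_hydro that)+
 have tS: "tpv (S t)" and tm: "tpv (moll n (v t))" if "0 <= t" for t
  unfolding S_def by (intro tpv_avg_segm tpv_moll v_L2 that)+
 have sym: "L2_inner (v s) (S t) = L2_inner (v t) (S s)" if "0 <= s" "0 <= t" for s t
 proof -
  let ?C = "%i t. LINT y|torus. F i y *R v t y" and ?D = "%i t. LINT y|torus. smear h (F i) y *R v t y"
  have gen: "L2_inner (v s) (%x. \<Sum>i<N. G i x *R u i) = (\<Sum>i<N. (LINT y|torus. G i y *R v s y) \<bullet> u i)"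
   if G: "!!i. i < N ==> tp (G i)" and s: "0 <= s" for G u s
  proof -
   have i: "integrable torus (%y. G i y *R v s y)" if "i < N" for i
    by (rule integrable_torus_mult_tp[OF L2_integrable[OF v_L2[OF s]] G[OF that]])
   have "L2_inner (v s) (%x. \<Sum>i<N. G i x *R u i) = (LINT x|torus. (\<Sum>i<N. (G i x *R v s x) \<bullet> u i))"
    by (simp add: L2_inner_def inner_sum_right)
   also have "... = (\<Sum>i<N. LINT x|torus. (G i x *R v s x) \<bullet> u i)"
    by (rule LB_integral_sum) (auto intro!: integrable_inner_left i simp del: inner_scaleR_left)
   also have "... = (\<Sum>i<N. (LINT y|torus. G i y *R v s y) \<bullet> u i)"
    by (intro sum.cong refl integral_inner_left i) simp
   finally show ?thesis .
  qed
  have S2: "S t = (%x. \<Sum>i<N. F i x *R ?D i t)"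
   unfolding S_def by (rule ext) (rule smear_moll_expand(2)[OF F v_L2[OF that(2)]])
  have S1: "S s = (%x. \<Sum>i<N. smear h (F i) x *R ?C i s)"
   unfolding S_def by (rule ext) (rule smear_moll_expand(1)[OF F v_L2[OF that(1)]])
  have "L2_inner (v s) (S t) = (\<Sum>i<N. ?C i s \<bullet> ?D i t)"
   unfolding S2 by (rule gen[OF F(1) that(1)])
  also have "... = (\<Sum>i<N. ?D i t \<bullet> ?C i s)" by (simp add: inner_commute)
  also have "... = L2_inner (v t) (S s)"
   unfolding S1
   by (rule gen[symmetric, OF _ that(2)]) (use tp_avg_segm[OF F(1)] in blast)
  finally show ?thesis .
 qed
 obtain Cv where Cv: "0 <= Cv" "!!t. t : {0..T} ==> L2_norm (v t) <= Cv"
  using hydro_sol_curve_bound[of v T] v_hydro v_cont by blast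
 define M where "M = (\<Sum>j\<in>J. Cv * L2_norm (e0 j))"
 have cM: "\<bar>c j t\<bar> <= M" if j: "j : J" and t: "t : {0..T}" for j t
 proof -
  have "\<bar>c j t\<bar> <= L2_norm (v t) * L2_norm (e0 j)"
   using integral_inner_le[OF v_L2 tpv_Lp_torus[OF te0[OF j]], of t] ce0[OF j, of t] t by (simp add: L2_inner_def)
  also have "... <= Cv * L2_norm (e0 j)" using Cv(2)[OF t] by (rule mult_right_mono) (rule L2_norm_nonneg)
  also have "... <= M" unfolding M_def by (rule member_le_sum[OF j _ fJ]) (auto intro!: mult_nonneg_nonneg Cv L2_norm_nonneg)
  finally show ?thesis .
 qed
 define I0 where "I0 j t = (LINT ta:{0..t}|lebesgue. \<bar>act (e0 j) ta\<bar>)" for j t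
 define I where "I j t = (LINT ta:{0..t}|lebesgue. \<bar>act (e j) ta\<bar>)" for j t
 define \<Omega> where "\<Omega> t = (\<Sum>j\<in>J. 2 * M * I0 j t)" for t
 have abs_int: "set_integrable lebesgue {s..t} (%ta. \<bar>act g ta\<bar>)" if "tpv g" "0 <= s" for g s t
  by (rule set_integrable_abs[OF act_integrable[OF that]])
 have abs_diff: "\<bar>LINT ta:{s..t}|lebesgue. act g ta\<bar> <= (LINT ta:{0..t}|lebesgue. \<bar>act g ta\<bar>) - (LINT ta:{0..s}|lebesgue. \<bar>act g ta\<bar>)"
  if "tpv g" "0 <= s" "s <= t" for g s t
  unfolding set_integral_Icc_diff[OF abs_int[OF that(1) order_refl] that(2,3)]
  using set_integral_norm_bound[OF act_integrable[OF that(1,2)], of t] by simp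
 \<comment> \<open>Single coefficients are reached through a sum of squares: the increment of v
   tested with \<open>moll n (v t)\<close>, minus the same increment tested with
   \<open>moll n (v s)\<close>, is the sum of all squared coefficient increments.\<close>
 have inc: "(c j t - c j s)\<^sup>2 <= \<Omega> t - \<Omega> s" if j: "j : J" and st: "0 <= s" "s <= t" "t <= T" for j s t
 proof -
  have t0: "0 <= t" using st by simp
  have A: "(\<Sum>j\<in>J. c j r * (c j t - c j s)) = (\<Sum>j\<in>J. c j r * (LINT ta:{s..t}|lebesgue. act (e0 j) ta))" if r: "0 <= r" for r
  proof -
   have "L2_inner (v t) (moll n (v r)) - L2_inner (v s) (moll n (v r)) = (\<Sum>j\<in>J. c j r * (c j t - c j s))"
    unfolding m[OF r] using ce0 t0 st(1)
    by (simp add: L2_inner_lincomb v_L2 te0 right_diff_distrib sum_subtractf)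
   moreover have "L2_inner (v t) (moll n (v r)) - L2_inner (v s) (moll n (v r)) = (\<Sum>j\<in>J. c j r * (LINT ta:{s..t}|lebesgue. act (e0 j) ta))"
    unfolding increment[OF tm[OF r] mh(1)[OF r] st(1,2)] unfolding m[OF r] by (rule integral_act_lincomb[OF fJ te0 st(1)])
   ultimately show ?thesis by simp
  qed
  have "(c j t - c j s)\<^sup>2 <= (\<Sum>j\<in>J. (c j t - c j s)\<^sup>2)" by (rule member_le_sum[OF j _ fJ]) simp
  also have "... = (\<Sum>j\<in>J. c j t * (c j t - c j s)) - (\<Sum>j\<in>J. c j s * (c j t - c j s))"
   by (simp add: power2_eq_square left_diff_distrib sum_subtractf)
  also have "... = (\<Sum>j\<in>J. (c j t - c j s) * (LINT ta:{s..t}|lebesgue. act (e0 j) ta))"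
   unfolding A[OF t0] A[OF st(1)] by (simp add: left_diff_distrib sum_subtractf)
  also have "... <= (\<Sum>j\<in>J. (2 * M) * (I0 j t - I0 j s))"
  proof (rule sum_mono)
   fix j assume j: "j : J"
   have "\<bar>c j t - c j s\<bar> <= 2 * M" using cM[OF j, of t] cM[OF j, of s] st by auto
   then have "\<bar>(c j t - c j s) * (LINT ta:{s..t}|lebesgue. act (e0 j) ta)\<bar> <= (2 * M) * (I0 j t - I0 j s)"
    unfolding abs_mult I0_def using abs_diff[OF te0[OF j] st(1,2)] by (intro mult_mono) auto
   then show "(c j t - c j s) * (LINT ta:{s..t}|lebesgue. act (e0 j) ta) <= (2 * M) * (I0 j t - I0 j s)" by linarith
  qed
  also have "... = \<Omega> t - \<Omega> s" by (simp add: \<Omega>_def right_diff_distrib sum_subtractf)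
  finally show ?thesis .
 qed
 have "continuous_on {0..T} \<Omega>"
  unfolding \<Omega>_def I0_def by (intro continuous_intros set_integral_Icc_continuous abs_int te0) auto
 then have \<Omega>u: "uniformly_continuous_on {0..T} \<Omega>" by (rule compact_uniformly_continuous) auto
 \<comment> \<open>One modulus of continuity for all coefficients, from the uniform continuity of
   \<open>\<Omega>\<close>.\<close>
 have cu: "EX d>0. ALL j:J. ALL s t. 0 <= s & s <= t & t <= T & t - s < d --> \<bar>c j t - c j s\<bar> <= r" if r: "0 < r" for r
 proof -
  have "0 < r\<^sup>2" using r by simp
  then obtain d where d: "0 < d" "!!s t. s : {0..T} ==> t : {0..T} ==> dist t s < d ==> dist (\<Omega> t) (\<Omega> s) < r\<^sup>2"
   using \<Omega>u unfolding uniformly_continuous_on_def by metis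
  show ?thesis
  proof (intro exI[of _ d] conjI d ballI allI impI)
   fix j s t assume j: "j : J" and st: "0 <= s & s <= t & t <= T & t - s < d"
   then have "dist (\<Omega> t) (\<Omega> s) < r\<^sup>2" by (intro d) (auto simp: dist_real_def)
   then have "(c j t - c j s)\<^sup>2 <= r\<^sup>2" using inc[OF j, of s t] st by (simp add: dist_real_def)
   then show "\<bar>c j t - c j s\<bar> <= r" using r by (simp add: abs_le_square_iff[symmetric])
  qed
 qed
 have cc: "continuous_on {0..T} (c j)" if j: "j : J" for j
  unfolding continuous_on_iff
 proof (intro ballI allI impI)
  fix x r :: real assume x: "x : {0..T}" and r: "0 < r"
  obtain d where d: "0 < d" "!!s t. 0 <= s ==> s <= t ==> t <= T ==> t - s < d ==> \<bar>c j t - c j s\<bar> <= r / 2"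
   using cu[OF half_gt_zero[OF r]] j by blast
  have "dist (c j y) (c j x) < r" if y: "y : {0..T}" "dist y x < d" for y
  proof -
   have "\<bar>c j y - c j x\<bar> <= r / 2"
    using d(2)[of x y] d(2)[of y x] x y by (cases "x <= y") (auto simp: dist_real_def abs_minus_commute)
   then show ?thesis using r by (simp add: dist_real_def)
  qed
  then show "EX d>0. ALL y:{0..T}. dist y x < d --> dist (c j y) (c j x) < r" using d(1) by blast
 qed
 \<comment> \<open>Half the time derivative of the smoothed energy, with the coefficients taken at
   the current time.\<close>
 define P where "P ta = (\<Sum>j\<in>J. c j ta * act (e j) ta)" for ta
 have cact: "set_integrable lebesgue {s..t} (%ta. c j ta * act (e j) ta)" if j: "j : J" and s: "0 <= s" "t <= T" for j s t
 proof -
  have "integrable lebesgue (%ta. indicator {0..T} ta *R (c j ta * act (e j) ta))"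
  proof (rule LB_integrable_bound)
   show "integrable lebesgue (%ta. M * (indicator {0..T} ta *R act (e j) ta))"
    using act_integrable[OF te[OF j], of 0 T] by (intro integrable_mult_right) (simp add: set_integrable_def)
   have "(%ta. indicator {0..T} ta *R c j ta) : Borel"
    by (rule borel_measurable_continuous_on_indicator[OF _ cc[OF j]]) simp
   then have "(%ta. indicator {0..T} ta *R c j ta) : borel_measurable lebesgue" by (intro measurable_completion) simp
   moreover have "(%ta. indicator {0..T} ta *R act (e j) ta) : borel_measurable lebesgue"
    using act_integrable[OF te[OF j], of 0 T] by (intro borel_measurable_integrable) (simp add: set_integrable_def)
   ultimately have "(%ta. (indicator {0..T} ta *R c j ta) * (indicator {0..T} ta *R act (e j) ta)) : borel_measurable lebesgue"
    by (rule borel_measurable_times)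
   also have "(%ta. (indicator {0..T} ta *R c j ta) * (indicator {0..T} ta *R act (e j) ta)) = (%ta. indicator {0..T} ta *R (c j ta * act (e j) ta))"
    by (auto simp: fun_eq_iff indicator_def)
   finally show "(%ta. indicator {0..T} ta *R (c j ta * act (e j) ta)) : borel_measurable lebesgue" .
   show "AE ta in lebesgue. norm (indicator {0..T} ta *R (c j ta * act (e j) ta)) <= norm (M * (indicator {0..T} ta *R act (e j) ta))"
   proof (intro AE_I2)
    fix ta
    show "norm (indicator {0..T} ta *R (c j ta * act (e j) ta)) <= norm (M * (indicator {0..T} ta *R act (e j) ta))"
    proof (cases "ta : {0..T}")
     case True
     then have "\<bar>c j ta\<bar> <= \<bar>M\<bar>" using cM[OF j True] by simp
     then show ?thesis using True by (simp add: abs_mult mult_right_mono)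
    qed simp
   qed
  qed
  then have "set_integrable lebesgue {0..T} (%ta. c j ta * act (e j) ta)" by (simp add: set_integrable_def)
  then show ?thesis by (rule set_integrable_subset) (use s in auto)
 qed
 have Pi: "set_integrable lebesgue {s..t} P" if "0 <= s" "t <= T" for s t
  unfolding P_def using cact[OF _ that] by (simp add: set_integrable_def sum_distrib_left LB_integrable_sum)
 define H where "H t = (\<Sum>j\<in>J. I j t)" for t
 define G where "G t = L2_inner (v t) (S t) - 2 * (LINT ta:{0..t}|lebesgue. P ta)" for t
 have GH: "\<bar>G T - G 0\<bar> <= 2 * r * (H T - H 0)" if r: "0 < r" for r
 proof -
  obtain d where d: "0 < d" "!!j s t. j : J ==> 0 <= s ==> s <= t ==> t <= T ==> t - s < d ==> \<bar>c j t - c j s\<bar> <= r"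
   using cu[OF r] by blast
  have "\<bar>G T - G 0\<bar> <= 2 * r * H T - 2 * r * H 0"
  proof (rule telescope_le[OF d(1) T])
   fix s t assume st: "0 <= s" "s <= t" "t <= T" "t - s < d"
   have t0: "0 <= t" using st by simp
   have E: "L2_inner (v t) (S q) - L2_inner (v s) (S q) = (\<Sum>j\<in>J. c j q * (LINT ta:{s..t}|lebesgue. act (e j) ta))" if q: "0 <= q" for q
    unfolding increment[OF tS[OF q] mh(2)[OF q] st(1,2)] unfolding Se[OF q] by (rule integral_act_lincomb[OF fJ te st(1)])
   have sp: "(LINT ta:{s..t}|lebesgue. P ta) = (\<Sum>j\<in>J. LINT ta:{s..t}|lebesgue. c j ta * act (e j) ta)"
    unfolding P_def using cact[OF _ st(1,3)]
    by (simp add: set_lebesgue_integral_def set_integrable_def sum_distrib_left LB_integral_sum)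
   \<comment> \<open>By \<open>sym\<close> the increment of the quadratic form is the sum of two
     increments of linear functionals, one against \<open>S t\<close> and one against
     \<open>S s\<close>.\<close>
   have "G t - G s = (L2_inner (v t) (S t) - L2_inner (v s) (S t)) + (L2_inner (v t) (S s) - L2_inner (v s) (S s)) - 2 * (LINT ta:{s..t}|lebesgue. P ta)"
    using sym[OF st(1) t0] set_integral_Icc_diff[OF Pi[OF order_refl st(3)] st(1,2)] by (simp add: G_def)
   also have "... = (\<Sum>j\<in>J. (c j t + c j s) * (LINT ta:{s..t}|lebesgue. act (e j) ta) - 2 * (LINT ta:{s..t}|lebesgue. c j ta * act (e j) ta))"
    unfolding E[OF t0] E[OF st(1)] sp by (simp add: sum_subtractf sum.distrib distrib_right sum_distrib_left)
   finally have Y: "G t - G s = (\<Sum>j\<in>J. (c j t + c j s) * (LINT ta:{s..t}|lebesgue. act (e j) ta) - 2 * (LINT ta:{s..t}|lebesgue. c j ta * act (e j) ta))" .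
   have "\<bar>G t - G s\<bar> <= (\<Sum>j\<in>J. 2 * r * (I j t - I j s))"
    unfolding Y
   proof (rule order_trans[OF sum_abs sum_mono])
    fix j assume j: "j : J"
    let ?a = "act (e j)"
    note ia = act_integrable[OF te[OF j] st(1), of t] and ic = cact[OF j st(1,3)]
    have ii: "set_integrable lebesgue {s..t} (%ta. (c j t + c j s) * ?a ta - 2 * (c j ta * ?a ta))"
     by (intro set_integral_diff set_integrable_mult_right ia ic)
    have X: "(c j t + c j s) * (LINT ta:{s..t}|lebesgue. ?a ta) - 2 * (LINT ta:{s..t}|lebesgue. c j ta * ?a ta) =
     (LINT ta:{s..t}|lebesgue. (c j t + c j s) * ?a ta - 2 * (c j ta * ?a ta))"
     by (subst set_integral_diff(2)) (auto intro!: set_integrable_mult_right ia ic)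
    have "\<bar>LINT ta:{s..t}|lebesgue. (c j t + c j s) * ?a ta - 2 * (c j ta * ?a ta)\<bar> <= (LINT ta:{s..t}|lebesgue. \<bar>(c j t + c j s) * ?a ta - 2 * (c j ta * ?a ta)\<bar>)"
     using set_integral_norm_bound[OF ii] unfolding real_norm_def .
    also have "... <= (LINT ta:{s..t}|lebesgue. (2 * r) * \<bar>?a ta\<bar>)"
    proof (rule set_integral_mono[OF set_integrable_abs[OF ii]])
     show "set_integrable lebesgue {s..t} (%ta. (2 * r) * \<bar>?a ta\<bar>)"
      by (intro set_integrable_mult_right abs_int te j st)
     fix ta assume ta: "ta : {s..t}"
     have "\<bar>c j t - c j ta\<bar> <= r" "\<bar>c j ta - c j s\<bar> <= r" using ta st by (auto intro!: d j)
     then have "\<bar>(c j t - c j ta) + (c j s - c j ta)\<bar> <= 2 * r" by linarith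
     then have "\<bar>(c j t - c j ta) + (c j s - c j ta)\<bar> * \<bar>?a ta\<bar> <= (2 * r) * \<bar>?a ta\<bar>" by (rule mult_right_mono) simp
     moreover have "(c j t + c j s) * ?a ta - 2 * (c j ta * ?a ta) = ((c j t - c j ta) + (c j s - c j ta)) * ?a ta"
      by (simp add: algebra_simps)
     ultimately show "\<bar>(c j t + c j s) * ?a ta - 2 * (c j ta * ?a ta)\<bar> <= (2 * r) * \<bar>?a ta\<bar>" by (simp only: abs_mult)
    qed
    also have "... = 2 * r * (I j t - I j s)"
     unfolding I_def set_integral_Icc_diff[OF abs_int[OF te[OF j] order_refl] st(1,2)] by simp
    finally show "\<bar>(c j t + c j s) * (LINT ta:{s..t}|lebesgue. ?a ta) - 2 * (LINT ta:{s..t}|lebesgue. c j ta * ?a ta)\<bar> <= 2 * r * (I j t - I j s)" unfolding X .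
   qed
   also have "... = 2 * r * H t - 2 * r * H s"
    by (simp add: H_def right_diff_distrib sum_subtractf sum_distrib_left)
   finally show "\<bar>G t - G s\<bar> <= 2 * r * H t - 2 * r * H s" .
  qed
  then show ?thesis by (simp add: right_diff_distrib)
 qed
 have G0: "G T - G 0 = 0"
 proof (rule ccontr)
  assume ne: "G T - G 0 ~= 0"
  define K where "K = \<bar>H T - H 0\<bar> + 1"
  \<comment> \<open>Chosen so that the error bound \<open>2 * r * K\<close> is half of the alleged
    defect; the summand 1 in \<open>K\<close> keeps the quotient meaningful.\<close>
  define r where "r = \<bar>G T - G 0\<bar> / (4 * K)"
  have K: "0 < K" "H T - H 0 <= K" unfolding K_def by linarith+
  have r: "0 < r" unfolding r_def using ne K by (intro divide_pos_pos) auto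
  have "\<bar>G T - G 0\<bar> <= 2 * r * (H T - H 0)" by (rule GH[OF r])
  also have "... <= 2 * r * K" using r K by (intro mult_left_mono) auto
  also have "... = \<bar>G T - G 0\<bar> / 2" using K by (simp add: r_def)
  finally show False using ne by simp
 qed
 have z: "(LINT ta:{0..0}|lebesgue. P ta) = 0"
  using set_integral_Icc_diff[OF Pi[OF order_refl T] order_refl order_refl] by simp
 have eq: "AE ta in lebesgue. indicator {0..T} ta *R act (S ta) ta = indicator {0..T} ta *R P ta"
  using v_H1
 proof eventually_elim
  case (elim ta)
  show ?case
  proof (cases "ta : {0..T}")
   case True
   then have f: "v ta : H1" and ta: "0 <= ta" using elim by auto
   have "act (S ta) ta = P ta"
    using flux_lincomb[OF f, of J e "%j. c j ta"] visc_lincomb[OF f, of J e "%j. c j ta"] te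
    unfolding Se[OF ta] by (simp add: P_def act_def sum_subtractf right_diff_distrib)
   then show ?thesis by simp
  qed simp
 qed
 note PT = Pi[OF order_refl order_refl, unfolded set_integrable_def]
 note mm = borel_measurable_lebesgue_AE[OF borel_measurable_integrable[OF PT] eq]
 show "set_integrable lebesgue {0..T} (%ta. act (smear h (moll n (v ta))) ta)"
  unfolding set_integrable_def S_def[symmetric]
  by (rule integrable_cong_AE_imp[OF PT mm]) (use eq in auto)
 have "(LINT ta:{0..T}|lebesgue. act (S ta) ta) = (LINT ta:{0..T}|lebesgue. P ta)"
  unfolding set_lebesgue_integral_def by (rule integral_lebesgue_cong_AE[OF borel_measurable_integrable[OF PT] eq])
 then show "L2_inner (v T) (smear h (moll n (v T))) - L2_inner (v 0) (smear h (moll n (v 0))) =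
   2 * (LINT ta:{0..T}|lebesgue. act (smear h (moll n (v ta))) ta)"
  using G0 z by (simp add: G_def S_def)
qed

end

section \<open>Passage to the limit\<close>

text \<open>Dominated convergence for integrands that are controlled at almost every time; the limit
  inherits measurability from the sequence by completeness.\<close>

lemma time_limit:
 fixes a :: "nat => real => real"
 assumes a: "!!n. set_integrable lebesgue {0..t} (a n)" and D: "integrable lebesgue D"
  and bound: "!!n. AE ta in lebesgue. ta : {0..t} --> \<bar>a n ta\<bar> <= D ta"
  and lim: "AE ta in lebesgue. ta : {0..t} --> (%n. a n ta) ----> l ta"
 shows "set_integrable lebesgue {0..t} l" "(%n. LINT ta:{0..t}|lebesgue. a n ta) ----> (LINT ta:{0..t}|lebesgue. l ta)"
proof -
 let ?s = "%n ta. indicator {0..t} ta *R a n ta" and ?l = "%ta. indicator {0..t} ta *R l ta"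
 have m [measurable]: "?s n : borel_measurable lebesgue" for n
  using a[of n] unfolding set_integrable_def by (rule borel_measurable_integrable)
 have AE_lim: "AE ta in lebesgue. (%n. ?s n ta) ----> ?l ta"
  using lim by eventually_elim (auto simp: indicator_def)
 have ml: "?l : borel_measurable lebesgue"
 proof (rule borel_measurable_lebesgue_AE)
  show "(%ta. lim (%n. ?s n ta)) : borel_measurable lebesgue" by (rule borel_measurable_lim_metric) (rule m)
  show "AE ta in lebesgue. ?l ta = lim (%n. ?s n ta)" using AE_lim by eventually_elim (rule limI[symmetric])
 qed
 have b: "AE ta in lebesgue. norm (?s n ta) <= \<bar>D ta\<bar>" for n
  using bound[of n] by eventually_elim (auto simp: indicator_def)
 show "set_integrable lebesgue {0..t} l"
  unfolding set_integrable_def by (rule integrable_dominated_convergence[OF ml m integrable_abs[OF D] AE_lim b])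
 show "(%n. LINT ta:{0..t}|lebesgue. a n ta) ----> (LINT ta:{0..t}|lebesgue. l ta)"
  unfolding set_lebesgue_integral_def by (rule integral_dominated_convergence[OF ml m integrable_abs[OF D] AE_lim b])
qed

definition viscS :: "real => (R3 => R2) => real" where
 "viscS h f = (\<Sum>b\<in>Basis. LINT x|torus. weak_pd b f x \<bullet> smear h (weak_pd b f) x)"

lemma L2_norm_avg_le:
 assumes "shift_measure \<mu>" "f : Lp_torus 2"
 shows "L2_norm (avg \<mu> f) <= L2_norm f"
proof -
 have "avg \<mu> f : Lp_torus 2" by (rule shift_measure.avg_Lp_torus[OF assms]) simp
 then have "(L2_norm (avg \<mu> f))\<^sup>2 <= (L2_norm f)\<^sup>2"
  using rmass_avg_le[OF assms] by (simp add: rmass_2_eq[symmetric] assms)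
 then show ?thesis by (rule power2_le_imp_le) (rule L2_norm_nonneg)
qed

lemma visc_smear_moll:
 assumes f: "f : H1"
 shows "visc f (smear h (moll n f)) = (\<Sum>b\<in>Basis. LINT x|torus. weak_pd b f x \<bullet> smear h (moll n (weak_pd b f)) x)"
 unfolding visc_def
proof (intro sum.cong refl)
 fix b :: R3 assume b: "b : Basis"
 have "moll n (weak_pd b f) = pd b (moll n f)"
  by (rule ext) (rule moll_weak_pd[OF H1_L2[OF f] weak_pd_H1[OF f b]])
 then show "(LINT x|torus. weak_pd b f x \<bullet> pd b (smear h (moll n f)) x) = (LINT x|torus. weak_pd b f x \<bullet> smear h (moll n (weak_pd b f)) x)"
  by (simp add: tpv_avg_segm(2)[OF tpv_moll[OF H1_L2[OF f]]])
qed

lemma sum_inner_avg_le: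
 assumes f: "f : H1" and W: "!!b. b : Basis ==> W b : Lp_torus 2" "!!b. b : Basis ==> L2_norm (W b) <= L2_norm (weak_pd b f)"
 shows "\<bar>\<Sum>b\<in>(Basis :: R3 set). LINT x|torus. weak_pd b f x \<bullet> W b x\<bar> <= (grad_L2_norm f)\<^sup>2"
 unfolding grad_L2_norm_sq
proof (rule order_trans[OF sum_abs sum_mono])
 fix b :: R3 assume b: "b : Basis"
 have "\<bar>LINT x|torus. weak_pd b f x \<bullet> W b x\<bar> <= L2_norm (weak_pd b f) * L2_norm (W b)"
  by (rule integral_inner_le[OF weak_pd_H1(1)[OF f b] W(1)[OF b]])
 also have "... <= L2_norm (weak_pd b f) * L2_norm (weak_pd b f)"
  by (rule mult_left_mono[OF W(2)[OF b] L2_norm_nonneg])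
 finally show "\<bar>LINT x|torus. weak_pd b f x \<bullet> W b x\<bar> <= (L2_norm (weak_pd b f))\<^sup>2" by (simp add: power2_eq_square)
qed

lemma smear_Lp2: "f : Lp_torus 2 ==> smear h f : Lp_torus 2"
 by (rule shift_measure.avg_Lp_torus[OF shift_smear]) simp_all

lemma moll_Lp2: "f : Lp_torus 2 ==> moll n f : Lp_torus 2"
 by (rule moll_Lp_torus) simp_all

lemma smear_moll_tendsto:
 assumes f: "f : Lp_torus 2"
 shows "(%n. pmass 2 (%x. smear h (moll n f) x - smear h f x)) ----> 0"
 by (rule ennreal_tendsto_0_le[OF pmass_moll_tendsto[OF f]])
  (auto intro: shift_measure.pmass_avg_diff2[OF shift_smear] moll_Lp2 f)

lemma smear_tendsto:
 assumes f: "f : Lp_torus 2"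
 shows "(%m. pmass 2 (%x. smear (1 / real (Suc m)) f x - f x)) ----> 0"
proof (rule pmass_avg_tendsto[OF f _ shift_smear segm_tendsto])
 show "(%m. 1 / real (Suc m)) ----> 0" using LIMSEQ_inverse_real_of_nat by (simp add: inverse_eq_divide)
qed auto

lemma inner_tendsto_right:
 fixes b c :: "'a::euclidean_space => 'b::euclidean_space"
 assumes "b : Lp_torus 2" "c : Lp_torus 2" "!!n. c' n : Lp_torus 2" "(%n. pmass 2 (%x. c' n x - c x)) ----> 0"
 shows "(%n. LINT x|torus. b x \<bullet> c' n x) ----> (LINT x|torus. b x \<bullet> c x)"
 by (rule integral_inner_tendsto[OF assms(1,2) _ assms(3) _ assms(4)]) (auto simp: assms pmass_zero)

locale regular_weak_sol = weak_sol + LP chi for chi +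
 fixes T \<gamma> :: real
 assumes T: "0 < T" and \<gamma>: "2 < \<gamma>" and besov: "in_L_besov chi \<gamma> T (2 / \<gamma>) 2 \<infinity> v"
begin

text \<open>On [0, T] the energy is bounded by a constant, so \<open>bulk\<close> is at most a
  multiple of 1 plus the squared H1 norm plus the Besov norm to the power \<open>\<gamma>\<close>,
  each of them integrable in time.\<close>

lemma bulk_dominated:
 obtains D where "integrable lebesgue D"
  "AE ta in lebesgue. ta : {0..T} --> v ta : H1 & v ta : Lp_torus 4 & bulk (v ta) <= D ta & (grad_L2_norm (v ta))\<^sup>2 <= D ta"
proof -
 let ?M = "lebesgue_on {0<..<T}"
 define b where "b t = besov_norm chi (2 / \<gamma>) 2 \<infinity> (v t)" for t
 have "Lp_norm (ennreal \<gamma>) ?M b < \<infinity>" using besov by (simp add: in_L_besov_def b_def[abs_def])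
 then have bm [measurable]: "b : borel_measurable ?M" and "ennpowr (\<integral>\<^sup>+t. ennpowr (b t) \<gamma> \<partial>?M) (1 / \<gamma>) < \<infinity>"
  using \<gamma> by (auto simp: Lp_norm_def split: if_splits)
 then have fin: "(\<integral>\<^sup>+t. ennpowr (b t) \<gamma> \<partial>?M) < \<infinity>"
  by (auto simp: ennpowr_def less_top split: if_splits)
 have [measurable]: "(%t. ennpowr (b t) \<gamma>) : borel_measurable ?M" unfolding ennpowr_def by measurable
 define W where "W t = enn2real (b t) powr \<gamma>" for t
 have Wi: "integrable ?M W"
 proof (rule integrableI_bounded)
  show "W : borel_measurable ?M" unfolding W_def by measurable
  have "(\<integral>\<^sup>+t. ennreal (norm (W t)) \<partial>?M) <= (\<integral>\<^sup>+t. ennpowr (b t) \<gamma> \<partial>?M)"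
   by (intro nn_integral_mono) (auto simp: W_def ennpowr_def)
  then show "(\<integral>\<^sup>+t. ennreal (norm (W t)) \<partial>?M) < \<infinity>" using fin by order
 qed
 then have Wl: "integrable lebesgue (%t. indicator {0<..<T} t *R W t)"
  by (subst (asm) integrable_restrict_space) auto
 have "AE t in ?M. ennpowr (b t) \<gamma> ~= \<infinity>" by (rule nn_integral_PInf_AE) (use fin in auto)
 then have bfin: "AE t in lebesgue. t : {0<..<T} --> b t ~= \<infinity>"
  by (subst (asm) AE_restrict_space_iff) (auto simp: ennpowr_def)
 obtain Cv where Cv: "0 <= Cv" "!!t. t : {0..T} ==> L2_norm (v t) <= Cv"
  using hydro_sol_curve_bound[of v T] v_hydro v_cont by blast
 obtain C where C: "0 <= C" "!!f \<gamma> B. f : H1 ==> 2 < \<gamma> ==> 0 <= B ==> besov_norm chi (2 / \<gamma>) 2 \<infinity> f = ennreal B ==>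
  pmass 4 f <= ennreal (C * ((1 + rmass 2 f)\<^sup>2 * (1 + (grad_L2_norm f)\<^sup>2 + B powr \<gamma>)))"
  using pmass_4_le_besov by blast
 \<comment> \<open>The summand 1 makes \<open>D\<close> dominate the squared gradient in addition to
   the fourth power mass.\<close>
 define K where "K = C * (1 + Cv\<^sup>2)\<^sup>2 + 1"
 have K: "1 <= K" unfolding K_def using C(1) by simp
 define D where "D t = K * (indicator {0..T} t + indicator {0..T} t *R (H1_norm (v t))\<^sup>2 + indicator {0<..<T} t *R W t)" for t
 show ?thesis
 proof (rule that[of D])
  have "integrable lebesgue (indicator {0..T} :: real => real)"
   by (rule integrable_completion[THEN iffD2]) (auto intro!: integrable_real_indicator simp: emeasure_lborel_Icc_eq)
  then show "integrable lebesgue D"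
   unfolding D_def using v_int[of T, unfolded set_integrable_def] Wl
   by (intro integrable_mult_right LB_integrable_add)
  \<comment> \<open>The Besov norm is controlled on the open interval; its end points form a null
    set.\<close>
  have ne: "AE ta in lebesgue. ta ~= 0" "AE ta in lebesgue. ta ~= T"
   by (rule AE_completion[OF AE_lborel_singleton])+
  show "AE ta in lebesgue. ta : {0..T} --> v ta : H1 & v ta : Lp_torus 4 & bulk (v ta) <= D ta & (grad_L2_norm (v ta))\<^sup>2 <= D ta"
   using v_H1 bfin ne
  proof eventually_elim
   case (elim ta)
   show ?case
   proof
    assume ta: "ta : {0..T}"
    then have ta': "ta : {0<..<T}" and f: "v ta : H1" using elim by auto
    define B where "B = enn2real (b ta)"
    have B: "0 <= B" "besov_norm chi (2 / \<gamma>) 2 \<infinity> (v ta) = ennreal B"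
     using elim(2) ta' by (auto simp: B_def b_def less_top)
    define X where "X = (1 + rmass 2 (v ta))\<^sup>2 * (1 + (grad_L2_norm (v ta))\<^sup>2 + B powr \<gamma>)"
    have p: "pmass 4 (v ta) <= ennreal (C * X)" unfolding X_def by (rule C(2)[OF f \<gamma> B])
    have X0: "0 <= X" unfolding X_def by (intro mult_nonneg_nonneg add_nonneg_nonneg) auto
    have L4: "v ta : Lp_torus 4"
     using H1_L2[OF f] le_less_trans[OF p, of \<infinity>] by (simp add: Lp_torus_def)
    have r4: "rmass 4 (v ta) <= C * X"
     unfolding rmass_def by (rule enn2real_leI) (use p C(1) X0 in auto)
    have r2: "rmass 2 (v ta) <= Cv\<^sup>2"
     unfolding rmass_2_eq[OF H1_L2[OF f]] by (rule power_mono[OF Cv(2)[OF ta] L2_norm_nonneg])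
    have g: "(grad_L2_norm (v ta))\<^sup>2 <= (H1_norm (v ta))\<^sup>2"
     using rmass_2_nonneg_H1[OF f] rmass_nonneg[of 2 "v ta"] by linarith
    have "X <= (1 + Cv\<^sup>2)\<^sup>2 * (1 + (H1_norm (v ta))\<^sup>2 + B powr \<gamma>)"
     unfolding X_def
    proof (rule mult_mono)
     show "(1 + rmass 2 (v ta))\<^sup>2 <= (1 + Cv\<^sup>2)\<^sup>2"
      using r2 rmass_nonneg[of 2 "v ta"] by (intro power_mono) auto
     show "1 + (grad_L2_norm (v ta))\<^sup>2 + B powr \<gamma> <= 1 + (H1_norm (v ta))\<^sup>2 + B powr \<gamma>" using g by simp
    qed (auto intro: add_nonneg_nonneg)
    then have "C * X <= C * ((1 + Cv\<^sup>2)\<^sup>2 * (1 + (H1_norm (v ta))\<^sup>2 + B powr \<gamma>))"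
     by (rule mult_left_mono[OF _ C(1)])
    moreover have "D ta = C * ((1 + Cv\<^sup>2)\<^sup>2 * (1 + (H1_norm (v ta))\<^sup>2 + B powr \<gamma>)) + (1 + (H1_norm (v ta))\<^sup>2 + B powr \<gamma>)"
     using ta ta' by (simp add: D_def K_def W_def B_def distrib_right mult.assoc)
    moreover have "0 <= C * X" using C(1) X0 by simp
    moreover have "0 <= B powr \<gamma>" by simp
    ultimately have "bulk (v ta) <= D ta" "(grad_L2_norm (v ta))\<^sup>2 <= D ta"
     using r4 g unfolding bulk_def by linarith+
    with f L4 show "v ta : H1 & v ta : Lp_torus 4 & bulk (v ta) <= D ta & (grad_L2_norm (v ta))\<^sup>2 <= D ta" by blast
   qed
  qed
 qed
qed

text \<open>The mollifier is removed at fixed h. In the majorant, 8 + 512 / h belongs to the flux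
  and 1 to the viscous term.\<close>

lemma energy_smear:
 assumes t: "0 <= t" "t <= T" and h: "0 < h"
 shows "set_integrable lebesgue {0..t} (%ta. rflux h (v ta) - viscS h (v ta))"
  and "L2_inner (v t) (smear h (v t)) - L2_inner (v 0) (smear h (v 0)) = 2 * (LINT ta:{0..t}|lebesgue. rflux h (v ta) - viscS h (v ta))"
proof -
 obtain D where D: "integrable lebesgue D" "AE ta in lebesgue. ta : {0..T} --> v ta : H1 & v ta : Lp_torus 4 & bulk (v ta) <= D ta & (grad_L2_norm (v ta))\<^sup>2 <= D ta"
  by (rule bulk_dominated)
 let ?a = "%n ta. act (smear h (moll n (v ta))) ta"
 have wL: "weak_pd b f : Lp_torus 2" if "f : H1" "b : Basis" for b :: R3 and f :: "R3 => R2" by (rule weak_pd_H1[OF that])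
 have bound: "AE ta in lebesgue. ta : {0..t} --> \<bar>?a n ta\<bar> <= (9 + 512 / h) * D ta" for n
  using D(2)
 proof eventually_elim
  case (elim ta)
  show ?case
  proof
   assume "ta : {0..t}"
   then have f: "v ta : H1" "v ta : Lp_torus 4" and le: "bulk (v ta) <= D ta" "(grad_L2_norm (v ta))\<^sup>2 <= D ta"
    using elim t by auto
   have "\<bar>visc (v ta) (smear h (moll n (v ta)))\<bar> <= (grad_L2_norm (v ta))\<^sup>2"
    unfolding visc_smear_moll[OF f(1)]
   proof (rule sum_inner_avg_le[OF f(1)])
    fix b :: R3 assume b: "b : Basis"
    note w = wL[OF f(1) b]
    show "smear h (moll n (weak_pd b (v ta))) : Lp_torus 2" by (intro smear_Lp2 moll_Lp2 w)
    show "L2_norm (smear h (moll n (weak_pd b (v ta)))) <= L2_norm (weak_pd b (v ta))"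
     by (rule order_trans[OF L2_norm_avg_le[OF shift_smear moll_Lp2[OF w]] L2_norm_avg_le[OF shift_measure_kernm w, folded moll_def]])
   qed
   moreover have "\<bar>flux (v ta) (smear h (moll n (v ta)))\<bar> <= (8 + 512 / h) * D ta"
    by (rule order_trans[OF flux_bound[OF f h] mult_left_mono[OF le(1)]]) (use h in simp)
   ultimately show "\<bar>?a n ta\<bar> <= (9 + 512 / h) * D ta"
    using le(2) unfolding act_def distrib_right by linarith
  qed
 qed
 have lim: "AE ta in lebesgue. ta : {0..t} --> (%n. ?a n ta) ----> rflux h (v ta) - viscS h (v ta)"
  using D(2)
 proof eventually_elim
  case (elim ta)
  show ?case
  proof
   assume "ta : {0..t}"
   then have f: "v ta : H1" "v ta : Lp_torus 4" using elim t by auto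
   have "(%n. visc (v ta) (smear h (moll n (v ta)))) ----> viscS h (v ta)"
    unfolding visc_smear_moll[OF f(1)] viscS_def
    by (intro tendsto_sum inner_tendsto_right wL f smear_Lp2 moll_Lp2 smear_moll_tendsto)
   moreover have "(%n. flux (v ta) (smear h (moll n (v ta)))) ----> rflux h (v ta)"
    by (rule flux_tendsto[OF f]) (use h in simp)
   ultimately show "(%n. ?a n ta) ----> rflux h (v ta) - viscS h (v ta)"
    unfolding act_def by (intro tendsto_diff)
  qed
 qed
 note L = time_limit[OF energy_level(1)[OF t(1)] integrable_mult_right[OF D(1)] bound lim]
 show "set_integrable lebesgue {0..t} (%ta. rflux h (v ta) - viscS h (v ta))" by (rule L(1))
 have E: "(%n. L2_inner (v s) (smear h (moll n (v s)))) ----> L2_inner (v s) (smear h (v s))" if s: "0 <= s" for s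
  unfolding L2_inner_def by (intro inner_tendsto_right v_L2 s smear_Lp2 moll_Lp2 smear_moll_tendsto)
 have "(%n. L2_inner (v t) (smear h (moll n (v t))) - L2_inner (v 0) (smear h (moll n (v 0)))) ---->
   2 * (LINT ta:{0..t}|lebesgue. rflux h (v ta) - viscS h (v ta))"
  unfolding energy_level(2)[OF t(1)] by (intro tendsto_mult tendsto_const L(2))
 from LIMSEQ_unique[OF tendsto_diff[OF E[OF t(1)] E[OF order_refl]] this]
 show "L2_inner (v t) (smear h (v t)) - L2_inner (v 0) (smear h (v 0)) = 2 * (LINT ta:{0..t}|lebesgue. rflux h (v ta) - viscS h (v ta))" .
qed

text \<open>Now h tends to 0 with a majorant free of h, where 17 is 16 for the flux plus 1 for the
  viscous term. The flux disappears and the averaged dissipation becomes the full one.\<close>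

lemma energy_equality:
 assumes t: "0 <= t" "t <= T"
 shows "1/2 * (L2_norm (v t))\<^sup>2 + (LINT ta:{0..t}|lebesgue. (grad_L2_norm (v ta))\<^sup>2) = 1/2 * (L2_norm v0)\<^sup>2"
proof -
 obtain D where D: "integrable lebesgue D" "AE ta in lebesgue. ta : {0..T} --> v ta : H1 & v ta : Lp_torus 4 & bulk (v ta) <= D ta & (grad_L2_norm (v ta))\<^sup>2 <= D ta"
  by (rule bulk_dominated)
 define h where "h m = 1 / real (Suc m)" for m
 have h0: "0 < h m" for m by (simp add: h_def)
 have hl: "h ----> 0" using LIMSEQ_inverse_real_of_nat by (simp add: h_def[abs_def] inverse_eq_divide)
 let ?a = "%m ta. rflux (h m) (v ta) - viscS (h m) (v ta)"
 have bound: "AE ta in lebesgue. ta : {0..t} --> \<bar>?a m ta\<bar> <= 17 * D ta" for m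
  using D(2)
 proof eventually_elim
  case (elim ta)
  show ?case
  proof
   assume "ta : {0..t}"
   then have f: "v ta : H1" "v ta : Lp_torus 4" and le: "bulk (v ta) <= D ta" "(grad_L2_norm (v ta))\<^sup>2 <= D ta" and ta: "0 <= ta"
    using elim t by auto
   have "\<bar>viscS (h m) (v ta)\<bar> <= (grad_L2_norm (v ta))\<^sup>2"
    unfolding viscS_def
    by (rule sum_inner_avg_le[OF f(1)]; intro smear_Lp2 L2_norm_avg_le[OF shift_smear] weak_pd_H1 f)
   moreover have "\<bar>rflux (h m) (v ta)\<bar> <= 16 * bulk (v ta)"
    by (rule rflux_bound[OF f(1) v_hydro[OF ta] f(2)]) (use h0[of m] in simp)
   ultimately show "\<bar>?a m ta\<bar> <= 17 * D ta" using le by linarith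
  qed
 qed
 have lim: "AE ta in lebesgue. ta : {0..t} --> (%m. ?a m ta) ----> - (grad_L2_norm (v ta))\<^sup>2"
  using D(2)
 proof eventually_elim
  case (elim ta)
  show ?case
  proof
   assume "ta : {0..t}"
   then have f: "v ta : H1" "v ta : Lp_torus 4" and ta: "0 <= ta" using elim t by auto
   have "(%m. viscS (h m) (v ta)) ----> (\<Sum>b\<in>Basis. LINT x|torus. weak_pd b (v ta) x \<bullet> weak_pd b (v ta) x)"
    unfolding viscS_def h_def
    by (intro tendsto_sum inner_tendsto_right weak_pd_H1 f smear_Lp2 smear_tendsto)
   then have "(%m. viscS (h m) (v ta)) ----> (grad_L2_norm (v ta))\<^sup>2" by (simp add: grad_L2_norm_sq L2_norm_sq)
   from tendsto_diff[OF rflux_tendsto[OF f(1) v_hydro[OF ta] f(2) hl h0] this]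
   show "(%m. ?a m ta) ----> - (grad_L2_norm (v ta))\<^sup>2" by simp
  qed
 qed
 note L = time_limit[OF energy_smear(1)[OF t h0] integrable_mult_right[OF D(1)] bound lim]
 have E: "(%m. L2_inner (v s) (smear (h m) (v s))) ----> (L2_norm (v s))\<^sup>2" if s: "0 <= s" for s
  unfolding L2_inner_def L2_norm_sq h_def by (intro inner_tendsto_right v_L2 s smear_Lp2 smear_tendsto)
 have "(%m. L2_inner (v t) (smear (h m) (v t)) - L2_inner (v 0) (smear (h m) (v 0))) ----> 2 * (LINT ta:{0..t}|lebesgue. - (grad_L2_norm (v ta))\<^sup>2)"
  unfolding energy_smear(2)[OF t h0] by (intro tendsto_mult tendsto_const L(2))
 from LIMSEQ_unique[OF tendsto_diff[OF E[OF t(1)] E[OF order_refl]] this]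
 have "(L2_norm (v t))\<^sup>2 - (L2_norm (v 0))\<^sup>2 = - 2 * (LINT ta:{0..t}|lebesgue. (grad_L2_norm (v ta))\<^sup>2)"
  by (simp add: set_lebesgue_integral_def)
 moreover have "(L2_norm (v 0))\<^sup>2 = (L2_norm v0)\<^sup>2"
  unfolding L2_norm_sq using v_init
  by (intro integral_cong_AE borel_measurable_integrable integrable_inner_L2 hydro_sol_L2[OF v0] v_L2 order_refl) (auto elim!: eventually_mono)
 ultimately show ?thesis by simp
qed

end

theorem theorem1p3:
  fixes v :: "real \<Rightarrow> R3 \<Rightarrow> R2" and v0 :: "R3 \<Rightarrow> R2"
    and chi :: "real \<Rightarrow> real" and T \<beta> p \<gamma> :: real
  assumes "LP_cutoff chi"
    and "v0 \<in> hydro_sol"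
    and "weak_solution v v0"
    and "T > 0"
    and "2 < p" and "2 < \<beta>" and "2 / \<beta> + 2 / p = 1"
    and "2 < \<gamma>"
    and "in_L_besov chi \<beta> T (- 1 / p) (ennreal p) \<infinity> v"
    and "in_L_besov chi \<gamma> T (2 / \<gamma>) 2 \<infinity> v"
  shows "\<forall>t\<in>{0<..T}.
    1/2 * (L2_norm (v t))\<^sup>2 + (LINT \<tau>:{0..t}|lebesgue. (grad_L2_norm (v \<tau>))\<^sup>2)
      = 1/2 * (L2_norm v0)\<^sup>2"
proof -
  interpret regular_weak_sol v v0 chi T \<gamma>
    by unfold_locales (use assms in auto)
  show ?thesis using energy_equality by auto
qed

end
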